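(* Let $n\ge4$ be even and let $(M,[g])$ be a conformal manifold of dimension $n$ with ambient metric $\widetilde g$ on $\widetilde{\mathcal G}$. For a representative $g\in[g]$, take a positive $t\in\widetilde{\mathcal E}(1)$ with $t(u^2g)=u$ on $\mathcal G$ (for $u>0$) and set $\rho=\widetilde\rho/(2t^2)$. Then there is a formal solution to $\widetilde\Delta F=0$ of the form $$F=\log t+\varphi+\eta\,\widetilde\rho^{\,n/2}\log\rho$$ with $\varphi\in\widetilde{\mathcal E}(0)$ such that $\varphi=O(\rho)$, and $\eta\in\widetilde{\mathcal E}(-n)$. Here $\varphi$ modulo $O(\rho^{n/2})$ and $\eta$ modulo $O(\rho^\infty)$ are determined by $g$ and, moreover, $\eta\circ g$ is a constant multiple of the $Q$-curvature $Q_g=-(\widetilde\Delta^{n/2}\log t)\circ g$ of $P_{n/2}$.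
   Context: For a conformal manifold $(M,[g])$ of dimension $n$, the metric bundle $\mathcal G\subset S^2T^*M$ is the ray bundle of metrics in $[g]$, with dilations $\delta_s(g)=s^2g$, $s>0$; a representative $g$ is regarded as a section $g:M\to\mathcal G$. $\mathcal E(w)$ is the space of smooth functions on $\mathcal G$ homogeneous of degree $w$ under $\delta_s$. The ambient space is $\widetilde{\mathcal G}=\mathcal G\times(-1,1)\supset\mathcal G=\mathcal G\times\{0\}$, and $\widetilde{\mathcal E}(w)$ denotes smooth functions on $\widetilde{\mathcal G}$ (near $\mathcal G$) homogeneous of degree $w$. The ambient metric $\widetilde g$ is a metric near $\mathcal G$ with (1) $\iota^*\widetilde g=g_0$, the tautological symmetric 2-tensor on $\mathcal G$ ($\iota$ the inclusion); (2) $\delta_s^*\widetilde g=s^2\widetilde g$; (3) $\operatorname{Ric}(\widetilde g)=0$ asymptotically along $\mathcal G$, which for $n$ even means $\operatorname{Ric}(\widetilde g)=O(\widetilde\rho^{\,n/2-1})$ and that the pullback to $\mathcal G$ of $\widetilde\rho^{\,1-n/2}\operatorname{Ric}(\widetilde g)$ is, at each point, the pullback of a $g$-trace-free symmetric tensor on $M$. Here $T=\frac{d}{ds}\delta_s|_{s=1}$ and $\widetilde\rho=\|T\|^2_{\widetilde g}\in\widetilde{\mathcal E}(2)$, which is a defining function of $\mathcal G$; $\widetilde g$ is normalized so that $\widetilde\nabla_IT_J=\widetilde g_{IJ}$. One such $\widetilde g$ is fixed. $\widetilde\Delta=-\widetilde\nabla_I\widetilde\nabla^I$ is its Laplacian.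 $P_{n/2}:\mathcal E(0)\to\mathcal E(-n)$ is the operator induced by $\widetilde\Delta^{n/2}:\widetilde{\mathcal E}(0)\to\widetilde{\mathcal E}(-n)$, i.e. $P_{n/2}f=(\widetilde\Delta^{n/2}\widetilde f)|_{\mathcal G}$ for any extension $\widetilde f\in\widetilde{\mathcal E}(0)$ of $f$. Its $Q$-curvature in the metric $g$ is $Q_g=-(\widetilde\Delta^{n/2}\log t)\circ g$, which does not depend on the extension of $t$ off $\mathcal G$. "Formal solution" means that $\varphi,\eta$ are regarded as formal power series along $\mathcal G$ and $\widetilde\Delta F$ vanishes to infinite order along $\mathcal G$ (both the smooth part and the coefficient of $\log\rho$). *)

theory Defs
  imports "HOL-Analysis.Analysis"
begin

section \<open>Smooth manifolds\<close>

text \<open>On an open set of a Euclidean space, \<^term>\<open>Ck_on k S f\<close> is \<open>C\<^sup>k\<close>-differentiability: all iterated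
  directional derivatives of order up to \<open>k\<close> exist, and those of order \<open>k\<close> are continuous.\<close>

definition dird :: "('e::real_normed_vector \<Rightarrow> 'f::real_normed_vector) \<Rightarrow> 'e \<Rightarrow> 'e \<Rightarrow> 'f" where
  "dird f x v = frechet_derivative f (at x) v"

primrec Ck_on ::
    "nat \<Rightarrow> 'e::euclidean_space set \<Rightarrow> ('e \<Rightarrow> 'f::real_normed_vector) \<Rightarrow> bool" where
  "Ck_on 0 S f \<longleftrightarrow> continuous_on S f"
| "Ck_on (Suc k) S f \<longleftrightarrow>
     (\<forall>x\<in>S. f differentiable (at x)) \<and> (\<forall>v. Ck_on k S (\<lambda>x. dird f x v))"

definition smooth_on :: "'e::euclidean_space set \<Rightarrow> ('e \<Rightarrow> 'f::real_normed_vector) \<Rightarrow> bool" where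
  "smooth_on S f \<longleftrightarrow> (\<forall>k. Ck_on k S f)"

text \<open>A chart is a domain together with a coordinate map into the model space. The points of a
  manifold are those covered by its atlas, and its topology is the one induced by the atlas.\<close>

type_synonym ('a, 'e) chart = "'a set \<times> ('a \<Rightarrow> 'e)"

definition chart_inv :: "('a, 'e) chart \<Rightarrow> 'e \<Rightarrow> 'a" where
  "chart_inv C = inv_into (fst C) (snd C)"

definition chart_image :: "('a, 'e) chart \<Rightarrow> 'a set \<Rightarrow> 'e set" where
  "chart_image C W = {x \<in> snd C ` fst C. chart_inv C x \<in> W}"

definition points :: "('a, 'e) chart set \<Rightarrow> 'a set" where
  "points A = (\<Union>C\<in>A. fst C)"

definition smooth_atlas :: "('a, 'e::euclidean_space) chart set \<Rightarrow> bool" where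
  "smooth_atlas A \<longleftrightarrow>
     (\<forall>C\<in>A. inj_on (snd C) (fst C) \<and> open (snd C ` fst C)) \<and>
     (\<forall>C\<in>A. \<forall>D\<in>A. open (chart_image C (fst D)) \<and>
        smooth_on (chart_image C (fst D)) (snd D \<circ> chart_inv C))"

definition atlas_topology :: "('a, 'e::euclidean_space) chart set \<Rightarrow> 'a topology" where
  "atlas_topology A = topology (\<lambda>W. W \<subseteq> points A \<and> (\<forall>C\<in>A. open (snd C ` fst C) \<longrightarrow> open (chart_image C W)))"

lemma openin_atlas_topology:
  "openin (atlas_topology A) W \<longleftrightarrow>
     W \<subseteq> points A \<and> (\<forall>C\<in>A. open (snd C ` fst C) \<longrightarrow> open (chart_image C W))"
proof -
  have Int: "chart_image C (S \<inter> T) = chart_image C S \<inter> chart_image C T" for C :: "('a, 'b) chart" and S T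
    by (auto simp: chart_image_def)
  have Un: "chart_image C (\<Union>K) = (\<Union>S\<in>K. chart_image C S)" for C :: "('a, 'b) chart" and K
    by (auto simp: chart_image_def)
  have "istopology (\<lambda>W. W \<subseteq> points A \<and> (\<forall>C\<in>A. open (snd C ` fst C) \<longrightarrow> open (chart_image C W)))"
    unfolding istopology_def by (auto simp: Int Un intro!: open_Int open_UN)
  then show ?thesis
    by (simp add: atlas_topology_def topology_inverse')
qed

definition smooth_manifold :: "('a, 'e::euclidean_space) chart set \<Rightarrow> bool" where
  "smooth_manifold A \<longleftrightarrow>
     smooth_atlas A \<and> Hausdorff_space (atlas_topology A) \<and> second_countable (atlas_topology A)"

definition smooth_fun :: "('a, 'e::euclidean_space) chart set \<Rightarrow> 'a set \<Rightarrow> ('a \<Rightarrow> real) \<Rightarrow> bool" where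
  "smooth_fun A W f \<longleftrightarrow> (\<forall>C\<in>A. smooth_on (chart_image C W) (f \<circ> chart_inv C))"

text \<open>The choice of the chart does not matter wherever \<open>chart_at\<close> is used: all quantities computed
  with it are invariant under changes of charts.\<close>

definition chart_at :: "('a, 'e) chart set \<Rightarrow> 'a \<Rightarrow> ('a, 'e) chart" where
  "chart_at A p = (SOME C. C \<in> A \<and> p \<in> fst C)"

section \<open>Covariant 2-tensors\<close>

text \<open>A covariant 2-tensor at a point \<open>p\<close> is the family of its coordinate expressions in the charts
  around \<open>p\<close>, related by the tensor transformation law. The family is zero on all other charts, so
  that equality of families is equality of tensors. A tensor field assigns to each point a tensor
  at this point.\<close>

type_synonym ('a, 'e) tens2 = "('a, 'e) chart \<Rightarrow> 'e \<Rightarrow> 'e \<Rightarrow> real"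

definition tens2_at :: "('a, 'e::euclidean_space) chart set \<Rightarrow> 'a \<Rightarrow> ('a, 'e) tens2 \<Rightarrow> bool" where
  "tens2_at A p b \<longleftrightarrow>
     (\<forall>C. \<not> (C \<in> A \<and> p \<in> fst C) \<longrightarrow> b C = (\<lambda>u v. 0)) \<and>
     (\<forall>C\<in>A. p \<in> fst C \<longrightarrow> bilinear (b C)) \<and>
     (\<forall>C\<in>A. \<forall>D\<in>A. p \<in> fst C \<inter> fst D \<longrightarrow>
        (\<forall>u v. b C u v = b D (dird (snd D \<circ> chart_inv C) (snd C p) u)
                             (dird (snd D \<circ> chart_inv C) (snd C p) v)))"

definition tens2_sym :: "('a, 'e) tens2 \<Rightarrow> bool" where
  "tens2_sym b \<longleftrightarrow> (\<forall>C u v. b C u v = b C v u)"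

definition tens2_scale :: "real \<Rightarrow> ('a, 'e) tens2 \<Rightarrow> ('a, 'e) tens2" where
  "tens2_scale a b = (\<lambda>C u v. a * b C u v)"

definition in_chart ::
    "('a \<Rightarrow> ('a, 'e) tens2) \<Rightarrow> ('a, 'e) chart \<Rightarrow> 'e \<Rightarrow> 'e \<Rightarrow> 'e \<Rightarrow> real" where
  "in_chart b C x u v = b (chart_inv C x) C u v"

definition sym_tensor_field ::
    "('a, 'e::euclidean_space) chart set \<Rightarrow> 'a set \<Rightarrow> ('a \<Rightarrow> ('a, 'e) tens2) \<Rightarrow> bool" where
  "sym_tensor_field A W b \<longleftrightarrow>
     (\<forall>p\<in>W. tens2_at A p (b p) \<and> tens2_sym (b p)) \<and>
     (\<forall>C\<in>A. \<forall>u v. smooth_on (chart_image C W) (\<lambda>x. in_chart b C x u v))"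

text \<open>Metrics are nondegenerate but may have any signature.\<close>

definition pseudo_metric ::
    "('a, 'e::euclidean_space) chart set \<Rightarrow> 'a set \<Rightarrow> ('a \<Rightarrow> ('a, 'e) tens2) \<Rightarrow> bool" where
  "pseudo_metric A W g \<longleftrightarrow> sym_tensor_field A W g \<and>
     (\<forall>C\<in>A. \<forall>p\<in>W \<inter> fst C. \<forall>u. (\<forall>v. g p C u v = 0) \<longrightarrow> u = 0)"

text \<open>\<^term>\<open>pullback B f b q\<close> is \<open>f\<^sup>*b\<close> at the point \<open>q\<close>; \<open>B\<close> is the atlas of the target of \<open>f\<close>.\<close>

definition pullback ::
    "('b, 'd::euclidean_space) chart set \<Rightarrow> ('a \<Rightarrow> 'b) \<Rightarrow> ('b \<Rightarrow> ('b, 'd) tens2) \<Rightarrow>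
     'a \<Rightarrow> ('a, 'e::euclidean_space) tens2" where
  "pullback B f b q C u v =
     (let D = chart_at B (f q) in
       b (f q) D (dird (snd D \<circ> f \<circ> chart_inv C) (snd C q) u)
                 (dird (snd D \<circ> f \<circ> chart_inv C) (snd C q) v))"

section \<open>Metrics on open subsets of a Euclidean space\<close>

text \<open>Here \<open>\<gamma> x u v\<close> is the value of the metric at \<open>x\<close> on the vectors \<open>u\<close> and \<open>v\<close>, and the indices
  \<open>i\<close>, \<open>j\<close>, \<open>k\<close>, \<open>l\<close>, \<open>p\<close> are vectors of the standard basis. \<^term>\<open>sharp b w\<close> is the vector \<open>v\<close> with
  \<open>b v k = w \<bullet> k\<close> for all \<open>k\<close>; hence \<^term>\<open>inv_metric b i j\<close> is the inverse of the matrix \<open>b i j\<close>.\<close>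

definition sharp :: "('e::euclidean_space \<Rightarrow> 'e \<Rightarrow> real) \<Rightarrow> 'e \<Rightarrow> 'e" where
  "sharp b = inv (\<lambda>v. \<Sum>k\<in>Basis. b v k *\<^sub>R k)"

definition inv_metric :: "('e::euclidean_space \<Rightarrow> 'e \<Rightarrow> real) \<Rightarrow> 'e \<Rightarrow> 'e \<Rightarrow> real" where
  "inv_metric b i j = sharp b i \<bullet> j"

definition bilinear_trace ::
    "('e::euclidean_space \<Rightarrow> 'e \<Rightarrow> real) \<Rightarrow> ('e \<Rightarrow> 'e \<Rightarrow> real) \<Rightarrow> real" where
  "bilinear_trace b s = (\<Sum>i\<in>Basis. \<Sum>j\<in>Basis. inv_metric b i j * s i j)"

text \<open>\<^term>\<open>christoffel \<gamma> x k i j\<close> is \<open>\<Gamma>\<^sup>k\<^sub>i\<^sub>j\<close> at \<open>x\<close>.\<close>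

definition christoffel ::
    "('e::euclidean_space \<Rightarrow> 'e \<Rightarrow> 'e \<Rightarrow> real) \<Rightarrow> 'e \<Rightarrow> 'e \<Rightarrow> 'e \<Rightarrow> 'e \<Rightarrow> real" where
  "christoffel \<gamma> x k i j =
     (\<Sum>l\<in>Basis. inv_metric (\<gamma> x) k l *
        (dird (\<lambda>y. \<gamma> y j l) x i + dird (\<lambda>y. \<gamma> y i l) x j - dird (\<lambda>y. \<gamma> y i j) x l)) / 2"

text \<open>The component \<open>\<nabla>\<^sub>i\<alpha>\<^sub>j\<close> of the covariant derivative of a covector field \<open>\<alpha>\<close>.\<close>

definition cov_deriv ::
    "('e::euclidean_space \<Rightarrow> 'e \<Rightarrow> 'e \<Rightarrow> real) \<Rightarrow> ('e \<Rightarrow> 'e \<Rightarrow> real) \<Rightarrow> 'e \<Rightarrow> 'e \<Rightarrow> 'e \<Rightarrow> real" where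
  "cov_deriv \<gamma> \<alpha> x i j =
     dird (\<lambda>y. \<alpha> y j) x i - (\<Sum>k\<in>Basis. christoffel \<gamma> x k i j * \<alpha> x k)"

definition local_laplacian ::
    "('e::euclidean_space \<Rightarrow> 'e \<Rightarrow> 'e \<Rightarrow> real) \<Rightarrow> ('e \<Rightarrow> real) \<Rightarrow> 'e \<Rightarrow> real" where
  "local_laplacian \<gamma> f x = - bilinear_trace (\<gamma> x) (cov_deriv \<gamma> (dird f) x)"

text \<open>\<open>R\<^sub>j\<^sub>k = \<partial>\<^sub>i\<Gamma>\<^sup>i\<^sub>j\<^sub>k - \<partial>\<^sub>j\<Gamma>\<^sup>i\<^sub>i\<^sub>k + \<Gamma>\<^sup>i\<^sub>i\<^sub>p\<Gamma>\<^sup>p\<^sub>j\<^sub>k - \<Gamma>\<^sup>i\<^sub>j\<^sub>p\<Gamma>\<^sup>p\<^sub>i\<^sub>k\<close>\<close>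

definition ricci_comp ::
    "('e::euclidean_space \<Rightarrow> 'e \<Rightarrow> 'e \<Rightarrow> real) \<Rightarrow> 'e \<Rightarrow> 'e \<Rightarrow> 'e \<Rightarrow> real" where
  "ricci_comp \<gamma> x j k =
     (\<Sum>i\<in>Basis. dird (\<lambda>y. christoffel \<gamma> y i j k) x i - dird (\<lambda>y. christoffel \<gamma> y i i k) x j
        + (\<Sum>p\<in>Basis. christoffel \<gamma> x i i p * christoffel \<gamma> x p j k
                      - christoffel \<gamma> x i j p * christoffel \<gamma> x p i k))"

text \<open>The Ricci tensor (as a bilinear form) and the Laplacian \<open>- \<nabla>\<^sub>I\<nabla>\<^sup>I\<close> of a metric on a manifold.\<close>

definition ricci ::
    "('a \<Rightarrow> ('a, 'e::euclidean_space) tens2) \<Rightarrow> 'a \<Rightarrow> ('a, 'e) tens2" where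
  "ricci g p C u v =
     (\<Sum>j\<in>Basis. \<Sum>k\<in>Basis. (u \<bullet> j) * (v \<bullet> k) * ricci_comp (in_chart g C) (snd C p) j k)"

definition laplacian ::
    "('a, 'e::euclidean_space) chart set \<Rightarrow> ('a \<Rightarrow> ('a, 'e) tens2) \<Rightarrow> ('a \<Rightarrow> real) \<Rightarrow> 'a \<Rightarrow> real" where
  "laplacian A g f p =
     (let C = chart_at A p in local_laplacian (in_chart g C) (f \<circ> chart_inv C) (snd C p))"

section \<open>Conformal manifolds and the metric bundle\<close>

text \<open>In \<open>conformal_manifold A cf\<close>, the set \<open>cf\<close> is the conformal class \<open>[g]\<close> of metrics.
  Metrics are required to be \<open>0\<close> off the manifold so that they are determined as functions.\<close>

definition conformal_manifold ::
    "('a, 'e::euclidean_space) chart set \<Rightarrow> ('a \<Rightarrow> ('a, 'e) tens2) set \<Rightarrow> bool" where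
  "conformal_manifold A cf \<longleftrightarrow> smooth_manifold A \<and>
     (\<exists>g. pseudo_metric A (points A) g \<and> (\<forall>p. p \<notin> points A \<longrightarrow> g p = (\<lambda>C u v. 0)) \<and>
        cf = {(\<lambda>p. tens2_scale (exp (2 * \<upsilon> p)) (g p)) |\<upsilon>. smooth_fun A (points A) \<upsilon>})"

type_synonym ('a, 'e) bpoint = "'a \<times> ('a, 'e) tens2"
type_synonym ('a, 'e) apoint = "('a, 'e) bpoint \<times> real"
type_synonym ('a, 'e) bchart = "(('a, 'e) bpoint, 'e \<times> real) chart"
type_synonym ('a, 'e) achart = "(('a, 'e) apoint, ('e \<times> real) \<times> real) chart"

definition metric_bundle ::
    "('a, 'e::euclidean_space) chart set \<Rightarrow> ('a \<Rightarrow> ('a, 'e) tens2) set \<Rightarrow> ('a, 'e) bpoint set" where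
  "metric_bundle A cf = {(p, g p) |p g. p \<in> points A \<and> g \<in> cf}"

text \<open>A chart \<open>C\<close> of the base and a representative \<open>g\<close> of the conformal class yield the chart
  \<open>(p, s\<^sup>2 g\<^sub>p) \<mapsto> (C p, s)\<close> of the metric bundle.\<close>

definition fibre_coord :: "('a \<Rightarrow> ('a, 'e) tens2) \<Rightarrow> ('a, 'e) bpoint \<Rightarrow> real" where
  "fibre_coord g y = (THE s. s > 0 \<and> snd y = tens2_scale (s\<^sup>2) (g (fst y)))"

definition bundle_chart ::
    "('a, 'e::euclidean_space) chart set \<Rightarrow> ('a \<Rightarrow> ('a, 'e) tens2) set \<Rightarrow>
     ('a, 'e) chart \<Rightarrow> ('a \<Rightarrow> ('a, 'e) tens2) \<Rightarrow> ('a, 'e) bchart" where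
  "bundle_chart A cf C g =
     ({y \<in> metric_bundle A cf. fst y \<in> fst C}, \<lambda>y. (snd C (fst y), fibre_coord g y))"

definition bundle_atlas ::
    "('a, 'e::euclidean_space) chart set \<Rightarrow> ('a \<Rightarrow> ('a, 'e) tens2) set \<Rightarrow> ('a, 'e) bchart set" where
  "bundle_atlas A cf = {bundle_chart A cf C g |C g. C \<in> A \<and> g \<in> cf}"

definition dilation :: "real \<Rightarrow> ('a, 'e) bpoint \<Rightarrow> ('a, 'e) bpoint" where
  "dilation s y = (fst y, tens2_scale (s\<^sup>2) (snd y))"

definition tautological ::
    "('a, 'e::euclidean_space) chart set \<Rightarrow> ('a, 'e) bpoint \<Rightarrow> (('a, 'e) bpoint, 'e \<times> real) tens2" where
  "tautological A y = pullback A fst (\<lambda>p. snd y) y"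

definition density ::
    "('a, 'e::euclidean_space) chart set \<Rightarrow> ('a \<Rightarrow> ('a, 'e) tens2) set \<Rightarrow> int \<Rightarrow>
     (('a, 'e) bpoint \<Rightarrow> real) \<Rightarrow> bool" where
  "density A cf w f \<longleftrightarrow> smooth_fun (bundle_atlas A cf) (metric_bundle A cf) f \<and>
     (\<forall>y\<in>metric_bundle A cf. \<forall>s>0. f (dilation s y) = s powi w * f y)"

section \<open>The ambient space\<close>

definition ambient_atlas ::
    "('a, 'e::euclidean_space) chart set \<Rightarrow> ('a \<Rightarrow> ('a, 'e) tens2) set \<Rightarrow> ('a, 'e) achart set" where
  "ambient_atlas A cf =
     {(fst B \<times> {-1<..<1}, \<lambda>q. (snd B (fst q), snd q)) |B. B \<in> bundle_atlas A cf}"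

definition bundle_incl :: "('a, 'e) bpoint \<Rightarrow> ('a, 'e) apoint" where
  "bundle_incl y = (y, 0)"

definition ambient_dilation :: "real \<Rightarrow> ('a, 'e) apoint \<Rightarrow> ('a, 'e) apoint" where
  "ambient_dilation s q = (dilation s (fst q), snd q)"

text \<open>Objects near \<open>\<G>\<close> live on dilation-invariant open neighbourhoods of \<open>\<G>\<close> in the ambient space.\<close>

definition ambient_nbhd ::
    "('a, 'e::euclidean_space) chart set \<Rightarrow> ('a \<Rightarrow> ('a, 'e) tens2) set \<Rightarrow> ('a, 'e) apoint set \<Rightarrow> bool" where
  "ambient_nbhd A cf W \<longleftrightarrow> openin (atlas_topology (ambient_atlas A cf)) W \<and>
     bundle_incl ` metric_bundle A cf \<subseteq> W \<and> (\<forall>s>0. ambient_dilation s ` W \<subseteq> W)"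

definition near_bundle ::
    "('a, 'e::euclidean_space) chart set \<Rightarrow> ('a \<Rightarrow> ('a, 'e) tens2) set \<Rightarrow> (('a, 'e) apoint \<Rightarrow> bool) \<Rightarrow> bool" where
  "near_bundle A cf P \<longleftrightarrow> (\<exists>W. ambient_nbhd A cf W \<and> (\<forall>q\<in>W. P q))"

definition smooth_near_bundle ::
    "('a, 'e::euclidean_space) chart set \<Rightarrow> ('a \<Rightarrow> ('a, 'e) tens2) set \<Rightarrow> (('a, 'e) apoint \<Rightarrow> real) \<Rightarrow> bool" where
  "smooth_near_bundle A cf f \<longleftrightarrow> (\<exists>W. ambient_nbhd A cf W \<and> smooth_fun (ambient_atlas A cf) W f)"

definition ambient_density ::
    "('a, 'e::euclidean_space) chart set \<Rightarrow> ('a \<Rightarrow> ('a, 'e) tens2) set \<Rightarrow> int \<Rightarrow>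
     (('a, 'e) apoint \<Rightarrow> real) \<Rightarrow> bool" where
  "ambient_density A cf w f \<longleftrightarrow> smooth_near_bundle A cf f \<and>
     near_bundle A cf (\<lambda>q. \<forall>s>0. f (ambient_dilation s q) = s powi w * f q)"

text \<open>The coordinate expression of the vector field \<open>T\<close> in an ambient chart.\<close>

definition euler_field ::
    "('a, 'e::euclidean_space) achart \<Rightarrow> ('a, 'e) apoint \<Rightarrow> ('e \<times> real) \<times> real" where
  "euler_field C q = vector_derivative (\<lambda>s. snd C (ambient_dilation s q)) (at 1)"

type_synonym ('a, 'e) afield = "('a, 'e) apoint \<Rightarrow> (('a, 'e) apoint, ('e \<times> real) \<times> real) tens2"

definition rho_tilde ::
    "('a, 'e::euclidean_space) chart set \<Rightarrow> ('a \<Rightarrow> ('a, 'e) tens2) set \<Rightarrow> ('a, 'e) afield \<Rightarrow>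
     ('a, 'e) apoint \<Rightarrow> real" where
  "rho_tilde A cf gt q =
     (let C = chart_at (ambient_atlas A cf) q in gt q C (euler_field C q) (euler_field C q))"

definition euler_normalized_at ::
    "('a, 'e::euclidean_space) afield \<Rightarrow> ('a, 'e) achart \<Rightarrow> ('a, 'e) apoint \<Rightarrow> bool" where
  "euler_normalized_at gt C q \<longleftrightarrow>
     (\<forall>i\<in>Basis. \<forall>j\<in>Basis.
        cov_deriv (in_chart gt C) (\<lambda>x. in_chart gt C x (euler_field C (chart_inv C x))) (snd C q) i j
          = gt q C i j)"

text \<open>The condition \<open>Ric = O(\<rho>\<^sup>m\<^sup>-\<^sup>1)\<close> for \<open>m = n/2\<close>, where \<open>S\<close> is the smooth tensor \<open>\<rho>\<^sup>1\<^sup>-\<^sup>m Ric\<close>, whose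
  pullback to \<open>\<G>\<close> has to be the pullback of a trace-free tensor \<open>\<sigma>\<close> at each point. The trace-free
  condition is conformally invariant, hence it may be stated for the metric \<open>snd y\<close> at the point
  \<open>fst y\<close> of the base.\<close>

definition ricci_condition ::
    "('a, 'e::euclidean_space) chart set \<Rightarrow> ('a \<Rightarrow> ('a, 'e) tens2) set \<Rightarrow> ('a, 'e) apoint set \<Rightarrow>
     ('a, 'e) afield \<Rightarrow> bool" where
  "ricci_condition A cf W gt \<longleftrightarrow>
     (\<exists>S. sym_tensor_field (ambient_atlas A cf) W S \<and>
        (\<forall>C\<in>ambient_atlas A cf. \<forall>q\<in>W \<inter> fst C. \<forall>u v.
           ricci gt q C u v = rho_tilde A cf gt q ^ (DIM('e) div 2 - 1) * S q C u v) \<and>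
        (\<forall>y\<in>metric_bundle A cf. \<exists>\<sigma>. tens2_at A (fst y) \<sigma> \<and> tens2_sym \<sigma> \<and>
           (\<forall>C\<in>A. fst y \<in> fst C \<longrightarrow> bilinear_trace (snd y C) (\<sigma> C) = 0) \<and>
           (\<forall>C\<in>bundle_atlas A cf. y \<in> fst C \<longrightarrow>
              pullback (ambient_atlas A cf) bundle_incl S y C = pullback A fst (\<lambda>p. \<sigma>) y C)))"

definition ambient_metric ::
    "('a, 'e::euclidean_space) chart set \<Rightarrow> ('a \<Rightarrow> ('a, 'e) tens2) set \<Rightarrow> ('a, 'e) afield \<Rightarrow> bool" where
  "ambient_metric A cf gt \<longleftrightarrow> (\<exists>W. ambient_nbhd A cf W \<and>
     pseudo_metric (ambient_atlas A cf) W gt \<and>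
     (\<forall>C\<in>bundle_atlas A cf. \<forall>y\<in>fst C.
        pullback (ambient_atlas A cf) bundle_incl gt y C = tautological A y C) \<and>
     (\<forall>s>0. \<forall>C\<in>ambient_atlas A cf. \<forall>q\<in>W \<inter> fst C.
        pullback (ambient_atlas A cf) (ambient_dilation s) gt q C = tens2_scale (s\<^sup>2) (gt q) C) \<and>
     ricci_condition A cf W gt \<and>
     (\<forall>C\<in>ambient_atlas A cf. \<forall>q\<in>W \<inter> fst C. euler_normalized_at gt C q))"

abbreviation ambient_laplacian ::
    "('a, 'e::euclidean_space) chart set \<Rightarrow> ('a \<Rightarrow> ('a, 'e) tens2) set \<Rightarrow> ('a, 'e) afield \<Rightarrow>
     (('a, 'e) apoint \<Rightarrow> real) \<Rightarrow> ('a, 'e) apoint \<Rightarrow> real" where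
  "ambient_laplacian A cf gt \<equiv> laplacian (ambient_atlas A cf) gt"

definition O_rho ::
    "('a, 'e::euclidean_space) chart set \<Rightarrow> ('a \<Rightarrow> ('a, 'e) tens2) set \<Rightarrow> ('a, 'e) afield \<Rightarrow>
     nat \<Rightarrow> (('a, 'e) apoint \<Rightarrow> real) \<Rightarrow> bool" where
  "O_rho A cf gt k f \<longleftrightarrow>
     (\<exists>h. smooth_near_bundle A cf h \<and> near_bundle A cf (\<lambda>q. f q = rho_tilde A cf gt q ^ k * h q))"

section \<open>Scales, Q-curvature and formal solutions\<close>

text \<open>\<^term>\<open>scale_function A cf g t\<close>: \<open>t\<close> is positive, homogeneous of degree \<open>1\<close>, and \<open>t (u\<^sup>2 g) = u\<close> on \<open>\<G>\<close>.\<close>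

definition scale_function ::
    "('a, 'e::euclidean_space) chart set \<Rightarrow> ('a \<Rightarrow> ('a, 'e) tens2) set \<Rightarrow> ('a \<Rightarrow> ('a, 'e) tens2) \<Rightarrow>
     (('a, 'e) apoint \<Rightarrow> real) \<Rightarrow> bool" where
  "scale_function A cf g t \<longleftrightarrow> ambient_density A cf 1 t \<and> near_bundle A cf (\<lambda>q. t q > 0) \<and>
     (\<forall>p\<in>points A. \<forall>u>0. t (bundle_incl (p, tens2_scale (u\<^sup>2) (g p))) = u)"

definition Q_curvature ::
    "('a, 'e::euclidean_space) chart set \<Rightarrow> ('a \<Rightarrow> ('a, 'e) tens2) set \<Rightarrow> ('a, 'e) afield \<Rightarrow>
     ('a \<Rightarrow> ('a, 'e) tens2) \<Rightarrow> (('a, 'e) apoint \<Rightarrow> real) \<Rightarrow> 'a \<Rightarrow> real" where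
  "Q_curvature A cf gt g t p =
     - (ambient_laplacian A cf gt ^^ (DIM('e) div 2)) (\<lambda>q. ln (t q)) (bundle_incl (p, g p))"

text \<open>Formal power series along \<open>\<G>\<close>: since the ambient space is \<open>\<G> \<times> (-1, 1)\<close>, a formal power series
  is \<open>\<Sum>\<^sub>k a\<^sub>k r\<^sup>k\<close> with smooth functions \<open>a\<^sub>k\<close> on \<open>\<G>\<close>, where \<open>r\<close> is the coordinate of \<open>(-1, 1)\<close>. Dilations
  fix \<open>r\<close>, hence the series is homogeneous of degree \<open>w\<close> if all coefficients are. Since both \<open>r\<close> and
  \<open>\<rho>\<close> are defining functions of \<open>\<G>\<close>, a series is \<open>O(\<rho>\<^sup>K)\<close> if \<open>a\<^sub>k = 0\<close> for \<open>k < K\<close>. By Borel's lemma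
  these series are the elements of the space of ambient densities modulo \<open>O(\<rho>\<^sup>\<infinity>)\<close>.\<close>

type_synonym ('a, 'e) formal = "nat \<Rightarrow> ('a, 'e) bpoint \<Rightarrow> real"

definition formal_density ::
    "('a, 'e::euclidean_space) chart set \<Rightarrow> ('a \<Rightarrow> ('a, 'e) tens2) set \<Rightarrow> int \<Rightarrow> ('a, 'e) formal \<Rightarrow> bool" where
  "formal_density A cf w a \<longleftrightarrow> (\<forall>k. density A cf w (a k))"

definition formal_O ::
    "('a, 'e::euclidean_space) chart set \<Rightarrow> ('a \<Rightarrow> ('a, 'e) tens2) set \<Rightarrow> nat \<Rightarrow> ('a, 'e) formal \<Rightarrow> bool" where
  "formal_O A cf K a \<longleftrightarrow> (\<forall>k<K. \<forall>y\<in>metric_bundle A cf. a k y = 0)"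

definition truncation :: "('a, 'e) formal \<Rightarrow> nat \<Rightarrow> ('a, 'e) apoint \<Rightarrow> real" where
  "truncation a N q = (\<Sum>k\<le>N. a k (fst q) * snd q ^ k)"

text \<open>\<^term>\<open>log_ansatz A cf gt t \<phi> \<eta> q\<close> is \<open>log t + \<phi> + \<eta> \<rho>\<^sub>~\<^sup>n\<^sup>/\<^sup>2 log \<rho>\<close>, where \<open>\<rho>\<^sub>~\<close> is \<^const>\<open>rho_tilde\<close>.\<close>

definition rho ::
    "('a, 'e::euclidean_space) chart set \<Rightarrow> ('a \<Rightarrow> ('a, 'e) tens2) set \<Rightarrow> ('a, 'e) afield \<Rightarrow>
     (('a, 'e) apoint \<Rightarrow> real) \<Rightarrow> ('a, 'e) apoint \<Rightarrow> real" where
  "rho A cf gt t q = rho_tilde A cf gt q / (2 * (t q)\<^sup>2)"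

definition log_ansatz ::
    "('a, 'e::euclidean_space) chart set \<Rightarrow> ('a \<Rightarrow> ('a, 'e) tens2) set \<Rightarrow> ('a, 'e) afield \<Rightarrow>
     (('a, 'e) apoint \<Rightarrow> real) \<Rightarrow> (('a, 'e) apoint \<Rightarrow> real) \<Rightarrow> (('a, 'e) apoint \<Rightarrow> real) \<Rightarrow>
     ('a, 'e) apoint \<Rightarrow> real" where
  "log_ansatz A cf gt t \<phi> \<eta> q =
     ln (t q) + \<phi> q + \<eta> q * rho_tilde A cf gt q ^ (DIM('e) div 2) * ln (rho A cf gt t q)"

text \<open>The Laplacian of \<open>F\<close> vanishes to infinite order along \<open>\<G>\<close>: for every order \<open>K\<close>, the Laplacian of all
  sufficiently long truncations of \<open>F\<close> is \<open>a + b log \<rho>\<close>, on the side \<open>\<rho> > 0\<close> of \<open>\<G>\<close>, with a smooth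
  part \<open>a\<close> and a coefficient \<open>b\<close> of \<open>log \<rho>\<close> that both vanish to order \<open>K\<close>.\<close>

definition formally_harmonic ::
    "('a, 'e::euclidean_space) chart set \<Rightarrow> ('a \<Rightarrow> ('a, 'e) tens2) set \<Rightarrow> ('a, 'e) afield \<Rightarrow>
     (('a, 'e) apoint \<Rightarrow> real) \<Rightarrow> ('a, 'e) formal \<Rightarrow> ('a, 'e) formal \<Rightarrow> bool" where
  "formally_harmonic A cf gt t \<phi> \<eta> \<longleftrightarrow>
     (\<forall>K. \<exists>N0. \<forall>N\<ge>N0. \<exists>a b. O_rho A cf gt K a \<and> O_rho A cf gt K b \<and>
        near_bundle A cf (\<lambda>q. rho A cf gt t q > 0 \<longrightarrow>
          ambient_laplacian A cf gt (log_ansatz A cf gt t (truncation \<phi> N) (truncation \<eta> N)) q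
            = a q + b q * ln (rho A cf gt t q)))"

definition formal_log_solution ::
    "('a, 'e::euclidean_space) chart set \<Rightarrow> ('a \<Rightarrow> ('a, 'e) tens2) set \<Rightarrow> ('a, 'e) afield \<Rightarrow>
     (('a, 'e) apoint \<Rightarrow> real) \<Rightarrow> ('a, 'e) formal \<Rightarrow> ('a, 'e) formal \<Rightarrow> bool" where
  "formal_log_solution A cf gt t \<phi> \<eta> \<longleftrightarrow>
     formal_density A cf 0 \<phi> \<and> formal_O A cf 1 \<phi> \<and>
     formal_density A cf (- int DIM('e)) \<eta> \<and>
     formally_harmonic A cf gt t \<phi> \<eta>"

end

theory Submission
  imports Defs
begin

text \<open>The normalization \<open>\<nabla>\<^sub>I T\<^sub>J = g\<^sub>I\<^sub>J\<close> of the ambient metric gives \<open>d\<rho>\<^sub>~ = 2 T\<close>, hence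
  \<open>\<Delta>\<rho>\<^sub>~ = - 2 (n + 2)\<close> and \<open>\<Delta> (\<rho>\<^sub>~\<^sup>k f) = \<rho>\<^sub>~\<^sup>k \<Delta>f - 2 k (2 k + n + 2 w) \<rho>\<^sub>~\<^sup>k\<^sup>-\<^sup>1 f\<close> for a density \<open>f\<close> of weight \<open>w\<close>.
  So \<open>\<phi>\<close> can be corrected order by order until the coefficient vanishes at \<open>k = n / 2\<close>, where the
  logarithmic term contributes \<open>2 n \<eta> \<rho>\<^sub>~\<^sup>n\<^sup>/\<^sup>2\<^sup>-\<^sup>1\<close> and so determines \<open>\<eta>\<close> on \<open>\<G>\<close>; off \<open>\<G>\<close>, \<open>\<eta>\<close> is determined by
  \<open>\<Delta>\<eta> = 0\<close>, for which no coefficient vanishes. The same obstruction is read off from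
  \<open>\<Delta>\<^sup>n\<^sup>/\<^sup>2 log t\<close>, since \<open>\<Delta>\<^sup>n\<^sup>/\<^sup>2 \<phi>\<close> vanishes on \<open>\<G>\<close> and \<open>\<Delta>\<^sup>n\<^sup>/\<^sup>2\<^sup>-\<^sup>1 (\<rho>\<^sub>~\<^sup>n\<^sup>/\<^sup>2\<^sup>-\<^sup>1 f)\<close> restricts to a nonzero multiple of \<open>f\<close>.\<close>

section \<open>Smooth functions on open sets\<close>

text \<open>Three points shape the argument. First, the formula for the Laplacian of a power of
  \<open>rt\<close> applies to densities only, since the weight enters as derivative along the Euler
  field. So quotients by \<open>rt\<close> have to be taken among densities, and log t, which is not
  a density, enters only through its Laplacian, which has weight -2. Secondly, formal series are
  expansions in the coordinate r of (-1, 1), while that formula is in powers of \<open>rt\<close>.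
  Near the bundle the two differ by a nowhere vanishing factor of weight 2, which comes from
  Hadamard's lemma and the nondegeneracy of the metric; each step converts between them. Thirdly,
  harmonicity is required only on the side rho > 0 and with unspecified a and b. Comparing growth as
  rho tends to 0 shows that a + b log rho determines a and b to infinite order, so the condition
  splits into two equations. The one for the logarithmic coefficient does not involve \<phi>; hence
  \<eta> is completed first and then acts as a source for \<phi>, whose coefficient of order n/2
  remains free. This is why \<phi> is determined only modulo O(rho^(n/2)).\<close>

lemma has_derivative_dird: "f differentiable (at x) \<Longrightarrow> (f has_derivative dird f x) (at x)"
  unfolding dird_def by (metis eta_contract_eq frechet_derivative_works)

lemma dird_eqI: "(f has_derivative f') (at x) \<Longrightarrow> dird f x = f'"
  unfolding dird_def using frechet_derivative_at by fastforce

lemma linear_dird: "f differentiable (at x) \<Longrightarrow> linear (dird f x)"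
  using has_derivative_dird has_derivative_linear by blast

lemma has_derivative_cong_open:
  assumes "open S" "x \<in> S" "\<And>y. y \<in> S \<Longrightarrow> f y = g y"
  shows "(f has_derivative D) (at x) \<longleftrightarrow> (g has_derivative D) (at x)"
  using assms has_derivative_transform_within_open[of f D x UNIV S g]
    has_derivative_transform_within_open[of g D x UNIV S f] by auto

lemma differentiable_cong_open:
  assumes "open S" "x \<in> S" "\<And>y. y \<in> S \<Longrightarrow> f y = g y"
  shows "f differentiable (at x) \<longleftrightarrow> g differentiable (at x)"
  unfolding differentiable_def using has_derivative_cong_open[OF assms] by simp

lemma dird_cong_open:
  assumes "open S" "x \<in> S" "\<And>y. y \<in> S \<Longrightarrow> f y = g y"
  shows "dird f x = dird g x"
  unfolding dird_def frechet_derivative_def using has_derivative_cong_open[OF assms] by simp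

section \<open>Closure properties of finite differentiability\<close>

lemma Ck_on_cong:
  assumes "open S" "\<And>y. y \<in> S \<Longrightarrow> f y = g y"
  shows "Ck_on k S f \<longleftrightarrow> Ck_on k S g"
  using assms(2)
proof (induction k arbitrary: f g)
  case 0
  then show ?case by (simp cong: continuous_on_cong)
next
  case (Suc k)
  have "Ck_on k S (\<lambda>x. dird f x v) \<longleftrightarrow> Ck_on k S (\<lambda>x. dird g x v)" for v
    by (rule Suc.IH) (simp add: dird_cong_open[OF assms(1) _ Suc.prems])
  then show ?case
    using differentiable_cong_open[OF assms(1) _ Suc.prems] by auto
qed

lemma Ck_on_subset: "Ck_on k S f \<Longrightarrow> T \<subseteq> S \<Longrightarrow> Ck_on k T f"
  by (induction k arbitrary: f) (auto intro: continuous_on_subset)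

lemma Ck_on_Suc_imp: "Ck_on (Suc k) S f \<Longrightarrow> Ck_on k S f"
proof (induction k arbitrary: f)
  case 0
  then show ?case
    by (simp add: continuous_at_imp_continuous_on differentiable_imp_continuous_within)
next
  case (Suc k)
  then show ?case by (metis Ck_on.simps(2))
qed

lemma Ck_on_continuous: "Ck_on k S f \<Longrightarrow> continuous_on S f"
proof (induction k)
  case (Suc k)
  then show ?case using Ck_on_Suc_imp by blast
qed simp

text \<open>Any explicit formula \<open>D\<close> for the derivative may replace
  \<open>dird\<close>. The closure properties then follow by induction on the order, because such a
  formula is built from functions of the same kind.\<close>

lemma Ck_on_SucI:
  assumes "\<And>x. x \<in> S \<Longrightarrow> (f has_derivative D x) (at x)"
    and "open S" and "\<And>v. Ck_on k S (\<lambda>x. D x v)"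
  shows "Ck_on (Suc k) S f"
proof -
  have "Ck_on k S (\<lambda>x. dird f x v)" for v
    using Ck_on_cong[OF assms(2), of "\<lambda>x. dird f x v" "\<lambda>x. D x v" k] assms(3)
      dird_eqI[OF assms(1)] by simp
  then show ?thesis using assms(1) by (auto simp: differentiable_def)
qed

lemma Ck_on_const: "open S \<Longrightarrow> Ck_on k S (\<lambda>x. c)"
proof (induction k arbitrary: c)
  case (Suc k)
  show ?case
    by (rule Ck_on_SucI[where D = "\<lambda>x v. 0"]) (use Suc.IH Suc.prems in \<open>simp_all\<close>)
qed auto

lemma Ck_on_bounded_linear:
  assumes "open S" "bounded_linear L"
  shows "Ck_on k S L"
proof (cases k)
  case 0
  then show ?thesis using assms(2) by (simp add: linear_continuous_on)
next
  case (Suc j)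
  show ?thesis unfolding Suc
    by (rule Ck_on_SucI[where D = "\<lambda>x. L"])
      (use assms in \<open>auto intro: bounded_linear_imp_has_derivative Ck_on_const\<close>)
qed

lemma Ck_on_add: "open S \<Longrightarrow> Ck_on k S f \<Longrightarrow> Ck_on k S g \<Longrightarrow> Ck_on k S (\<lambda>x. f x + g x)"
proof (induction k arbitrary: f g)
  case (Suc k)
  show ?case
  proof (rule Ck_on_SucI[where D = "\<lambda>x v. dird f x v + dird g x v"])
    fix v show "Ck_on k S (\<lambda>x. dird f x v + dird g x v)"
      using Suc.prems by (intro Suc.IH) auto
  qed (use Suc.prems in \<open>auto intro!: has_derivative_add has_derivative_dird\<close>)
qed (auto intro: continuous_on_add)

lemma Ck_on_linear_compose:
  "open S \<Longrightarrow> bounded_linear L \<Longrightarrow> Ck_on k S f \<Longrightarrow> Ck_on k S (\<lambda>x. L (f x))"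
proof (induction k arbitrary: f)
  case 0
  then show ?case using bounded_linear.continuous_on[OF 0(2), of S f] by simp
next
  case (Suc k)
  show ?case
  proof (rule Ck_on_SucI[where D = "\<lambda>x v. L (dird f x v)"])
    fix v show "Ck_on k S (\<lambda>x. L (dird f x v))"
      using Suc.prems by (intro Suc.IH) auto
  next
    fix x assume "x \<in> S"
    then show "((\<lambda>x. L (f x)) has_derivative (\<lambda>v. L (dird f x v))) (at x)"
      using Suc.prems bounded_linear.has_derivative[OF Suc.prems(2) has_derivative_dird, of f x] by simp
  qed (fact Suc.prems(1))
qed

text \<open>Products and scalar multiples are treated at once. The product rule contains the
  undifferentiated factors, so the induction step needs that \<open>Ck_on (Suc k)\<close> implies
  \<open>Ck_on k\<close>.\<close>

lemma Ck_on_bilinear: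
  assumes "bounded_bilinear p"
  shows "open S \<Longrightarrow> Ck_on k S f \<Longrightarrow> Ck_on k S g \<Longrightarrow> Ck_on k S (\<lambda>x. p (f x) (g x))"
proof (induction k arbitrary: f g)
  case 0
  then show ?case using bounded_bilinear.continuous_on[OF assms, of S f g] by simp
next
  case (Suc k)
  show ?case
  proof (rule Ck_on_SucI[where D = "\<lambda>x v. p (f x) (dird g x v) + p (dird f x v) (g x)"])
    fix x assume "x \<in> S"
    then show "((\<lambda>x. p (f x) (g x)) has_derivative
        (\<lambda>v. p (f x) (dird g x v) + p (dird f x v) (g x))) (at x)"
      using Suc.prems
        bounded_bilinear.FDERIV[OF assms has_derivative_dird[of f x] has_derivative_dird[of g x]] by simp
  next
    fix v
    have "Ck_on k S f" "Ck_on k S g" using Suc.prems Ck_on_Suc_imp by blast+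
    moreover have "Ck_on k S (\<lambda>x. dird f x v)" "Ck_on k S (\<lambda>x. dird g x v)"
      using Suc.prems by simp_all
    ultimately show "Ck_on k S (\<lambda>x. p (f x) (dird g x v) + p (dird f x v) (g x))"
      by (intro Ck_on_add Suc.IH Suc.prems(1))
  qed (fact Suc.prems(1))
qed

lemma Ck_on_sum:
  assumes "open S" "finite I" "\<And>i. i \<in> I \<Longrightarrow> Ck_on k S (f i)"
  shows "Ck_on k S (\<lambda>x. \<Sum>i\<in>I. f i x)"
  using assms(2,3)
  by (induction I rule: finite_induct) (auto intro!: Ck_on_const Ck_on_add assms(1))

lemma linear_Basis_sum:
  fixes L :: "'a::euclidean_space \<Rightarrow> 'b::real_vector"
  assumes "linear L"
  shows "L v = (\<Sum>b\<in>Basis. (v \<bullet> b) *\<^sub>R L b)"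
  using linear_sum[OF assms, of "\<lambda>b. (v \<bullet> b) *\<^sub>R b" Basis]
  by (simp add: euclidean_representation linear_scale[OF assms])

text \<open>In the chain rule the inner function occurs both as base point and as direction.
  Expanding the direction in the standard basis separates the two: only derivatives of
  \<open>g\<close> in fixed directions are composed with \<open>f\<close>, and the induction
  hypothesis applies to them.\<close>

lemma Ck_on_compose:
  fixes f :: "'a::euclidean_space \<Rightarrow> 'b::euclidean_space" and g :: "'b \<Rightarrow> 'c::real_normed_vector"
  assumes "open S" "open T" "\<And>x. x \<in> S \<Longrightarrow> f x \<in> T"
  shows "Ck_on k S f \<Longrightarrow> Ck_on k T g \<Longrightarrow> Ck_on k S (\<lambda>x. g (f x))"
proof (induction k arbitrary: g)
  case 0
  then show ?case using assms(3) by (auto intro: continuous_on_compose2[of T g S f])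
next
  case (Suc k)
  show ?case
  proof (rule Ck_on_SucI[where D = "\<lambda>x v. \<Sum>b\<in>Basis. (dird f x v \<bullet> b) *\<^sub>R dird g (f x) b"])
    fix x assume x: "x \<in> S"
    have g: "g differentiable (at (f x))" using Suc.prems(2) assms(3) x by auto
    have "(f has_derivative dird f x) (at x)" using Suc.prems(1) x by (simp add: has_derivative_dird)
    then have "((\<lambda>x. g (f x)) has_derivative (\<lambda>v. dird g (f x) (dird f x v))) (at x)"
      by (rule has_derivative_compose) (rule has_derivative_dird[OF g])
    moreover have "(\<lambda>v. dird g (f x) (dird f x v))
        = (\<lambda>v. \<Sum>b\<in>Basis. (dird f x v \<bullet> b) *\<^sub>R dird g (f x) b)"
      by (intro ext linear_Basis_sum[OF linear_dird[OF g]])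
    ultimately show "((\<lambda>x. g (f x)) has_derivative
        (\<lambda>v. \<Sum>b\<in>Basis. (dird f x v \<bullet> b) *\<^sub>R dird g (f x) b)) (at x)"
      by (simp only:)
  next
    fix v
    have "Ck_on k S f" using Suc.prems(1) Ck_on_Suc_imp by blast
    then have "Ck_on k S (\<lambda>x. dird g (f x) b)" for b
      using Suc.IH[of "\<lambda>y. dird g y b"] Suc.prems(2) by simp
    moreover have "Ck_on k S (\<lambda>x. dird f x v \<bullet> b)" for b
      using Suc.prems(1) Ck_on_linear_compose[OF assms(1) bounded_linear_inner_left[of b], of k "\<lambda>x. dird f x v"]
      by simp
    ultimately show "Ck_on k S (\<lambda>x. \<Sum>b\<in>Basis. (dird f x v \<bullet> b) *\<^sub>R dird g (f x) b)"
      by (intro Ck_on_sum Ck_on_bilinear[OF bounded_bilinear_scaleR] assms) auto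
  qed (fact assms)
qed

section \<open>Calculus of smooth functions\<close>

lemma smooth_on_cong:
  "open S \<Longrightarrow> (\<And>y. y \<in> S \<Longrightarrow> f y = g y) \<Longrightarrow> smooth_on S f \<longleftrightarrow> smooth_on S g"
  unfolding smooth_on_def using Ck_on_cong by blast

lemma smooth_on_transform:
  "smooth_on S f \<Longrightarrow> open S \<Longrightarrow> (\<And>y. y \<in> S \<Longrightarrow> f y = g y) \<Longrightarrow> smooth_on S g"
  by (rule smooth_on_cong[THEN iffD1])

lemma smooth_on_subset: "smooth_on S f \<Longrightarrow> T \<subseteq> S \<Longrightarrow> smooth_on T f"
  unfolding smooth_on_def using Ck_on_subset by blast

lemma smooth_on_continuous: "smooth_on S f \<Longrightarrow> continuous_on S f"
  unfolding smooth_on_def using Ck_on_continuous by blast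

lemma smooth_on_differentiable: "smooth_on S f \<Longrightarrow> x \<in> S \<Longrightarrow> f differentiable (at x)"
  unfolding smooth_on_def by (metis Ck_on.simps(2))

lemma smooth_on_has_derivative: "smooth_on S f \<Longrightarrow> x \<in> S \<Longrightarrow> (f has_derivative dird f x) (at x)"
  using smooth_on_differentiable has_derivative_dird by blast

lemma smooth_on_isCont: "smooth_on S f \<Longrightarrow> x \<in> S \<Longrightarrow> isCont f x"
  using differentiable_imp_continuous_within smooth_on_differentiable by blast

lemma smooth_on_dird: "smooth_on S f \<Longrightarrow> smooth_on S (\<lambda>x. dird f x v)"
  unfolding smooth_on_def by (metis Ck_on.simps(2))

lemma smooth_on_const: "open S \<Longrightarrow> smooth_on S (\<lambda>x. c)"
  unfolding smooth_on_def using Ck_on_const by blast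

lemma smooth_on_bounded_linear: "open S \<Longrightarrow> bounded_linear L \<Longrightarrow> smooth_on S L"
  unfolding smooth_on_def using Ck_on_bounded_linear by blast

lemma smooth_on_add: "open S \<Longrightarrow> smooth_on S f \<Longrightarrow> smooth_on S g \<Longrightarrow> smooth_on S (\<lambda>x. f x + g x)"
  unfolding smooth_on_def using Ck_on_add by blast

lemma smooth_on_linear_compose:
  "open S \<Longrightarrow> bounded_linear L \<Longrightarrow> smooth_on S f \<Longrightarrow> smooth_on S (\<lambda>x. L (f x))"
  unfolding smooth_on_def using Ck_on_linear_compose by blast

lemma smooth_on_mult:
  "open S \<Longrightarrow> smooth_on S f \<Longrightarrow> smooth_on S g \<Longrightarrow> smooth_on S (\<lambda>x. f x * g x :: real)"
  unfolding smooth_on_def using Ck_on_bilinear[OF bounded_bilinear_mult] by blast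

lemma smooth_on_scaleR:
  "open S \<Longrightarrow> smooth_on S f \<Longrightarrow> smooth_on S g \<Longrightarrow> smooth_on S (\<lambda>x. f x *\<^sub>R g x)"
  unfolding smooth_on_def using Ck_on_bilinear[OF bounded_bilinear_scaleR] by blast

lemma smooth_on_sum:
  "open S \<Longrightarrow> finite I \<Longrightarrow> (\<And>i. i \<in> I \<Longrightarrow> smooth_on S (f i)) \<Longrightarrow> smooth_on S (\<lambda>x. \<Sum>i\<in>I. f i x)"
  unfolding smooth_on_def using Ck_on_sum by blast

lemma smooth_on_minus: "open S \<Longrightarrow> smooth_on S f \<Longrightarrow> smooth_on S (\<lambda>x. - f x)"
  using smooth_on_linear_compose[OF _ bounded_linear_minus[OF bounded_linear_ident]] .

lemma smooth_on_diff:
  "open S \<Longrightarrow> smooth_on S f \<Longrightarrow> smooth_on S g \<Longrightarrow> smooth_on S (\<lambda>x. f x - g x)"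
  using smooth_on_add[of S f "\<lambda>x. - g x"] smooth_on_minus by auto

lemma smooth_on_power: "open S \<Longrightarrow> smooth_on S f \<Longrightarrow> smooth_on S (\<lambda>x. f x ^ k :: real)"
  by (induction k) (auto simp: smooth_on_const smooth_on_mult)

lemma smooth_on_compose:
  fixes f :: "'a::euclidean_space \<Rightarrow> 'b::euclidean_space"
  assumes "open S" "open T" "\<And>x. x \<in> S \<Longrightarrow> f x \<in> T" "smooth_on S f" "smooth_on T g"
  shows "smooth_on S (\<lambda>x. g (f x))"
  using assms(4,5) Ck_on_compose[of S T f, OF assms(1-3)] unfolding smooth_on_def by metis

lemma smooth_on_Pair:
  assumes "open S" "smooth_on S f" "smooth_on S g"
  shows "smooth_on S (\<lambda>x. (f x, g x))"
proof -
  have "smooth_on S (\<lambda>x. (f x, 0) + (0, g x))"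
    using smooth_on_linear_compose[OF assms(1) bounded_linear_Pair[OF bounded_linear_ident bounded_linear_zero] assms(2)]
      smooth_on_linear_compose[OF assms(1) bounded_linear_Pair[OF bounded_linear_zero bounded_linear_ident] assms(3)]
    by (rule smooth_on_add[OF assms(1)])
  then show ?thesis by simp
qed

lemma smooth_on_fst: "open S \<Longrightarrow> smooth_on S f \<Longrightarrow> smooth_on S (\<lambda>x. fst (f x))"
  by (rule smooth_on_linear_compose[OF _ bounded_linear_fst])

lemma smooth_on_snd: "open S \<Longrightarrow> smooth_on S f \<Longrightarrow> smooth_on S (\<lambda>x. snd (f x))"
  by (rule smooth_on_linear_compose[OF _ bounded_linear_snd])

lemma smooth_on_ident: "open S \<Longrightarrow> smooth_on S (\<lambda>x. x)"
  by (simp add: bounded_linear_ident smooth_on_bounded_linear)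

lemma smooth_on_exp_real: "smooth_on UNIV (exp :: real \<Rightarrow> real)"
proof -
  have "Ck_on k UNIV (exp :: real \<Rightarrow> real)" for k
  proof (induction k)
    case 0
    show ?case by (auto intro: continuous_intros)
  next
    case (Suc k)
    show ?case
      by (rule Ck_on_SucI[where D = "\<lambda>x v. exp x * v"])
        (use Suc in \<open>auto intro!: derivative_eq_intros Ck_on_bilinear[OF bounded_bilinear_mult]
          Ck_on_const\<close>)
  qed
  then show ?thesis by (auto simp: smooth_on_def)
qed

lemma smooth_on_inverse_real: "smooth_on (- {0}) (inverse :: real \<Rightarrow> real)"
proof -
  have op: "open (- {0::real})" by auto
  have "Ck_on k (- {0}) (inverse :: real \<Rightarrow> real)" for k
  proof (induction k)
    case 0
    show ?case by (auto intro: continuous_intros)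
  next
    case (Suc k)
    show ?case
    proof (rule Ck_on_SucI[where D = "\<lambda>x v. (- v) * (inverse x * inverse x)"])
      fix v show "Ck_on k (- {0}) (\<lambda>x. (- v) * (inverse x * inverse x :: real))"
        by (intro Ck_on_bilinear[OF bounded_bilinear_mult] Ck_on_const op Suc.IH)
    qed (use op in \<open>auto intro!: derivative_eq_intros\<close>)
  qed
  then show ?thesis by (auto simp: smooth_on_def)
qed

lemma smooth_on_ln_real: "smooth_on {0<..} (ln :: real \<Rightarrow> real)"
proof -
  have op: "open {0::real<..}" by auto
  have "Ck_on k {0<..} (ln :: real \<Rightarrow> real)" for k
  proof (cases k)
    case 0
    then show ?thesis by (auto intro!: continuous_intros)
  next
    case (Suc j)
    have "Ck_on j {0<..} (inverse :: real \<Rightarrow> real)"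
      by (rule Ck_on_subset[of _ "- {0}"]) (use smooth_on_inverse_real in \<open>auto simp: smooth_on_def\<close>)
    then have "Ck_on j {0<..} (\<lambda>x. v * inverse x :: real)" for v
      by (intro Ck_on_bilinear[OF bounded_bilinear_mult] Ck_on_const op)
    then show ?thesis unfolding Suc
      by (intro Ck_on_SucI[where D = "\<lambda>x v. v * inverse x"] op)
        (auto intro!: derivative_eq_intros simp: field_simps)
  qed
  then show ?thesis by (auto simp: smooth_on_def)
qed

lemma smooth_on_exp: "open S \<Longrightarrow> smooth_on S f \<Longrightarrow> smooth_on S (\<lambda>x. exp (f x :: real))"
  by (rule smooth_on_compose[of S UNIV f exp]) (auto simp: smooth_on_exp_real)

lemma smooth_on_inverse:
  "open S \<Longrightarrow> smooth_on S f \<Longrightarrow> (\<And>x. x \<in> S \<Longrightarrow> f x \<noteq> 0) \<Longrightarrow> smooth_on S (\<lambda>x. inverse (f x :: real))"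
  by (rule smooth_on_compose[of S "- {0}" f inverse]) (auto simp: smooth_on_inverse_real)

lemma smooth_on_ln:
  "open S \<Longrightarrow> smooth_on S f \<Longrightarrow> (\<And>x. x \<in> S \<Longrightarrow> f x > 0) \<Longrightarrow> smooth_on S (\<lambda>x. ln (f x :: real))"
  by (rule smooth_on_compose[of S "{0<..}" f ln]) (auto simp: smooth_on_ln_real)

lemma smooth_on_inner:
  "open S \<Longrightarrow> smooth_on S f \<Longrightarrow> smooth_on S (\<lambda>x. f x \<bullet> b)"
  by (rule smooth_on_linear_compose[OF _ bounded_linear_inner_left])

lemmas smooth_on_intros =
  smooth_on_const smooth_on_ident smooth_on_add smooth_on_mult smooth_on_scaleR smooth_on_sum
  smooth_on_minus smooth_on_diff smooth_on_power smooth_on_Pair smooth_on_fst smooth_on_snd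
  smooth_on_exp smooth_on_inverse smooth_on_ln smooth_on_inner

section \<open>Symmetry of second derivatives\<close>

lemma has_derivative_along_line:
  assumes "f differentiable (at (x + s *\<^sub>R u))"
  shows "((\<lambda>s. f (x + s *\<^sub>R u)) has_vector_derivative dird f (x + s *\<^sub>R u) u) (at s)"
proof -
  have "((\<lambda>s. x + s *\<^sub>R u) has_derivative (\<lambda>h. h *\<^sub>R u)) (at s)"
    by (auto intro!: derivative_eq_intros)
  from has_derivative_compose[OF this has_derivative_dird[OF assms]]
  show ?thesis
    by (simp add: has_vector_derivative_def linear_scale[OF linear_dird[OF assms]])
qed

text \<open>The mean value theorem, applied in the direction \<open>u\<close> to a first difference
  and then in the direction \<open>v\<close> to the derivative along \<open>u\<close>, turns the
  second difference into one second derivative at a nearby point.\<close>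

lemma dird_sym_aux:
  fixes f :: "'a::euclidean_space \<Rightarrow> real"
  assumes "open S" "smooth_on S f" "ball x r \<subseteq> S" "h > 0" "h * (norm u + norm v) < r"
  shows "\<exists>y. dist x y \<le> h * (norm u + norm v) \<and>
    f (x + h *\<^sub>R u + h *\<^sub>R v) - f (x + h *\<^sub>R u) - f (x + h *\<^sub>R v) + f x
      = h * h * dird (\<lambda>y. dird f y u) y v"
proof -
  have bound: "x + s *\<^sub>R u + t *\<^sub>R v \<in> S \<and> dist x (x + s *\<^sub>R u + t *\<^sub>R v) \<le> h * (norm u + norm v)"
    if "0 \<le> s" "s \<le> h" "0 \<le> t" "t \<le> h" for s t
  proof -
    have "dist x (x + s *\<^sub>R u + t *\<^sub>R v) = norm (s *\<^sub>R u + t *\<^sub>R v)"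
      unfolding dist_norm by (metis add.assoc add_diff_cancel_left' norm_minus_commute)
    also have "\<dots> \<le> s * norm u + t * norm v"
      using that norm_triangle_ineq[of "s *\<^sub>R u" "t *\<^sub>R v"] by simp
    also have "\<dots> \<le> h * (norm u + norm v)"
      using that by (simp add: distrib_left add_mono mult_right_mono)
    finally show ?thesis using assms(3,5) by (auto simp: subset_iff)
  qed
  define \<phi> where "\<phi> s = f (x + h *\<^sub>R v + s *\<^sub>R u) - f (x + s *\<^sub>R u)" for s
  have "(\<phi> has_real_derivative dird f (x + h *\<^sub>R v + s *\<^sub>R u) u - dird f (x + s *\<^sub>R u) u) (at s)"
    if "0 \<le> s" "s \<le> h" for s
    unfolding \<phi>_def has_real_derivative_iff_has_vector_derivative
    using bound[OF that, of h] bound[OF that, of 0] assms(2,4)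
    by (intro has_vector_derivative_diff has_derivative_along_line smooth_on_differentiable[OF assms(2)])
      (auto simp: algebra_simps)
  from MVT2[OF assms(4), of \<phi>, OF this] obtain s where s: "0 < s" "s < h"
    "\<phi> h - \<phi> 0 = h * (dird f (x + h *\<^sub>R v + s *\<^sub>R u) u - dird f (x + s *\<^sub>R u) u)" by auto
  define \<psi> where "\<psi> t = dird f (x + s *\<^sub>R u + t *\<^sub>R v) u" for t
  have "(\<psi> has_real_derivative dird (\<lambda>y. dird f y u) (x + s *\<^sub>R u + t *\<^sub>R v) v) (at t)"
    if "0 \<le> t" "t \<le> h" for t
    unfolding \<psi>_def has_real_derivative_iff_has_vector_derivative
    using bound[of s t] that s assms(2)
    by (intro has_derivative_along_line smooth_on_differentiable[OF smooth_on_dird[OF assms(2)]]) auto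
  from MVT2[OF assms(4), of \<psi>, OF this] obtain t where t: "0 < t" "t < h"
    "\<psi> h - \<psi> 0 = h * dird (\<lambda>y. dird f y u) (x + s *\<^sub>R u + t *\<^sub>R v) v" by auto
  show ?thesis
    by (rule exI[of _ "x + s *\<^sub>R u + t *\<^sub>R v"])
      (use bound[of s t] s t in \<open>simp add: \<phi>_def \<psi>_def algebra_simps\<close>)
qed

text \<open>The second difference is symmetric in \<open>u\<close> and \<open>v\<close>, hence the
  two mixed derivatives agree when taken at two suitable points close to \<open>x\<close>.
  Continuity then excludes different values at \<open>x\<close>.\<close>

lemma dird_sym:
  fixes f :: "'a::euclidean_space \<Rightarrow> real"
  assumes "open S" "smooth_on S f" "x \<in> S"
  shows "dird (\<lambda>y. dird f y u) x v = dird (\<lambda>y. dird f y v) x u"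
proof (rule ccontr)
  let ?A = "\<lambda>y. dird (\<lambda>y. dird f y u) y v" and ?B = "\<lambda>y. dird (\<lambda>y. dird f y v) y u"
  assume "?A x \<noteq> ?B x"
  define e where "e = \<bar>?A x - ?B x\<bar> / 2"
  have "e > 0" using \<open>?A x \<noteq> ?B x\<close> by (simp add: e_def)
  have "isCont ?A x" "isCont ?B x"
    by (rule smooth_on_isCont[of S], intro smooth_on_dird assms, fact)+
  then obtain d1 d2 where d: "d1 > 0" "d2 > 0"
    "\<And>y. dist y x < d1 \<Longrightarrow> dist (?A y) (?A x) < e" "\<And>y. dist y x < d2 \<Longrightarrow> dist (?B y) (?B x) < e"
    using \<open>e > 0\<close> unfolding continuous_at_eps_delta dist_norm by metis
  obtain r where r: "r > 0" "ball x r \<subseteq> S" using assms(1,3) openE by blast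
  define m where "m = min r (min d1 d2)"
  have m: "m > 0" "m \<le> r" "m \<le> d1" "m \<le> d2" using d r by (auto simp: m_def)
  \<comment> \<open>The step keeps both intermediate points within distance \<open>m\<close> of
    \<open>x\<close>; the summand 1 covers the case that \<open>u\<close> and \<open>v\<close> both
    vanish.\<close>
  define h where "h = m / (norm u + norm v + 1)"
  have "norm u + norm v + 1 > 0" by (simp add: add_nonneg_pos)
  then have h: "h > 0" "h * (norm u + norm v) < m" "h * (norm v + norm u) < m"
    using m(1) by (auto simp: h_def field_simps intro: add_nonneg_nonneg)
  obtain y where y: "dist x y \<le> h * (norm u + norm v)"
    "f (x + h *\<^sub>R u + h *\<^sub>R v) - f (x + h *\<^sub>R u) - f (x + h *\<^sub>R v) + f x = h * h * ?A y"
    using dird_sym_aux[OF assms(1,2) r(2) h(1), of u v] h m by auto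
  obtain z where z: "dist x z \<le> h * (norm v + norm u)"
    "f (x + h *\<^sub>R v + h *\<^sub>R u) - f (x + h *\<^sub>R v) - f (x + h *\<^sub>R u) + f x = h * h * ?B z"
    using dird_sym_aux[OF assms(1,2) r(2) h(1), of v u] h m by auto
  have comm: "x + h *\<^sub>R v + h *\<^sub>R u = x + h *\<^sub>R u + h *\<^sub>R v" by simp
  have "h * h * ?A y = h * h * ?B z" using y(2) z(2)[unfolded comm] by linarith
  then have "?A y = ?B z" using h(1) by simp
  moreover have "dist (?A y) (?A x) < e" "dist (?B z) (?B x) < e"
    using d(3)[of y] d(4)[of z] y(1) z(1) h m by (auto simp: dist_commute)
  ultimately show False
    using abs_triangle_ineq4[of "?B z - ?B x" "?B z - ?A x"] unfolding e_def dist_real_def by simp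
qed

text \<open>By the Leibniz rule a derivative in \<open>x\<close> passes under the integral, and the
  new integrand is the derivative of \<open>F\<close> in a horizontal direction. So the induction
  has to run over all integrands of the respective order.\<close>

lemma Ck_on_integral:
  fixes F :: "'a::euclidean_space \<times> real \<Rightarrow> real"
  assumes "open S" "open T" "\<And>x t. x \<in> S \<Longrightarrow> t \<in> {0..1} \<Longrightarrow> (x, t) \<in> T"
  shows "Ck_on k T F \<Longrightarrow> Ck_on k S (\<lambda>x. integral {0..1} (\<lambda>t. F (x, t)))"
proof (induction k arbitrary: F)
  case 0
  then have "continuous_on (S \<times> cbox 0 1) F"
    using assms(3) by (auto intro: continuous_on_subset)
  then show ?case
    using integral_continuous_on_param[of S 0 1 "\<lambda>x t. F (x, t)"]
    by (simp add: case_prod_unfold cbox_interval)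
next
  case (Suc k)
  let ?D = "\<lambda>x v. integral {0..1} (\<lambda>t. dird F (x, t) (v, 0))"
  show ?case
  proof (rule Ck_on_SucI[where D = ?D])
    fix x assume x: "x \<in> S"
    then obtain e where e: "e > 0" "ball x e \<subseteq> S" using assms(1) openE by blast
    let ?U = "ball x e"
    \<comment> \<open>The Leibniz rule asks for a continuous family of bounded linear operators;
      continuity is verified on each basis vector.\<close>
    define fx where "fx y t = Blinfun (\<lambda>v. dird F (y, t) (v, 0))" for y t
    have lin: "bounded_linear (\<lambda>v. dird F (y, t) (v, 0))"
      and der: "((\<lambda>y. F (y, t)) has_derivative (\<lambda>v. dird F (y, t) (v, 0))) (at y)"
      if "y \<in> ?U" "t \<in> {0..1}" for y t
    proof -
      have d: "F differentiable (at (y, t))" using Suc.prems assms(3) that e by auto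
      have P: "((\<lambda>y. (y, t)) has_derivative (\<lambda>v. (v, 0))) (at y)"
        by (auto intro!: derivative_eq_intros)
      show "((\<lambda>y. F (y, t)) has_derivative (\<lambda>v. dird F (y, t) (v, 0))) (at y)"
        by (rule has_derivative_compose[OF P has_derivative_dird[OF d]])
      then show "bounded_linear (\<lambda>v. dird F (y, t) (v, 0))"
        by (rule has_derivative_bounded_linear)
    qed
    have fx: "blinfun_apply (fx y t) = (\<lambda>v. dird F (y, t) (v, 0))" if "y \<in> ?U" "t \<in> {0..1}" for y t
      unfolding fx_def using lin[OF that] by (simp add: bounded_linear_Blinfun_apply)
    have contF: "continuous_on T F" using Suc.prems Ck_on_continuous by blast
    have contD: "continuous_on (?U \<times> {0..1}) (\<lambda>z. dird F z w)" for w
    proof (rule continuous_on_subset[of T])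
      have "Ck_on k T (\<lambda>z. dird F z w)" using Suc.prems by (cases w) simp
      then show "continuous_on T (\<lambda>z. dird F z w)" by (rule Ck_on_continuous)
    qed (use assms(3) e in auto)
    have contfx: "continuous_on (?U \<times> cbox 0 1) (\<lambda>(y, t). fx y t)"
    proof (rule continuous_on_blinfun_componentwise)
      fix i :: 'a
      show "continuous_on (?U \<times> cbox 0 1) (\<lambda>z. blinfun_apply (case z of (y, t) \<Rightarrow> fx y t) i)"
        by (rule continuous_on_eq[OF contD[of "(i, 0)", folded cbox_interval]]) (auto simp: fx)
    qed
    have "((\<lambda>y. integral (cbox 0 1) (\<lambda>t. F (y, t))) has_derivative integral (cbox 0 1) (fx x)) (at x within ?U)"
    proof (rule leibniz_rule[OF _ _ contfx])
      fix y :: 'a assume "y \<in> ?U"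
      then have "continuous_on (cbox 0 1) (\<lambda>t. F (y, t))"
        using e assms(3) by (auto intro!: continuous_on_compose2[OF contF] continuous_intros)
      then show "(\<lambda>t. F (y, t)) integrable_on cbox 0 1" by (rule integrable_continuous)
    next
      fix y t assume "y \<in> ?U" "t \<in> cbox (0::real) 1"
      then show "((\<lambda>y. F (y, t)) has_derivative blinfun_apply (fx y t)) (at y within ?U)"
        using der[of y t] fx[of y t] by (simp add: has_derivative_at_withinI cbox_interval)
    qed (use e in auto)
    moreover have "blinfun_apply (integral (cbox 0 1) (fx x)) = ?D x"
    proof
      fix v
      have "continuous_on (cbox 0 1) (\<lambda>t. (\<lambda>(y, t). fx y t) (x, t))"
        by (rule continuous_on_compose2[OF contfx]) (use e in \<open>auto intro!: continuous_intros\<close>)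
      then have "fx x integrable_on cbox 0 1" by (intro integrable_continuous) simp
      from blinfun_apply_integral[OF this, of v]
      have "blinfun_apply (integral (cbox 0 1) (fx x)) v = integral (cbox 0 1) (\<lambda>t. fx x t v)" .
      also have "\<dots> = ?D x v"
        unfolding cbox_interval by (rule Henstock_Kurzweil_Integration.integral_cong) (use e in \<open>simp add: fx\<close>)
      finally show "blinfun_apply (integral (cbox 0 1) (fx x)) v = ?D x v" .
    qed
    ultimately show "((\<lambda>y. integral {0..1} (\<lambda>t. F (y, t))) has_derivative ?D x) (at x)"
      using e by (simp add: at_within_open[of _ "ball x e"])
  next
    fix v show "Ck_on k S (\<lambda>x. ?D x v)"
      using Suc.IH[of "\<lambda>z. dird F z (v, 0)"] Suc.prems by simp
  qed (fact assms)
qed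

text \<open>The complement is the projection of a closed set along the compact interval, hence
  closed.\<close>

lemma open_star_core:
  fixes U :: "('a::euclidean_space \<times> real) set"
  assumes "open U"
  shows "open {z. \<forall>t\<in>{0..1}. (fst z, t * snd z) \<in> U}"
proof -
  let ?\<psi> = "\<lambda>w :: real \<times> 'a \<times> real. (fst (snd w), fst w * snd (snd w))"
  have "closed (?\<psi> -` (- U))"
    by (intro continuous_closed_vimage) (use assms in \<open>auto intro!: continuous_intros\<close>)
  from closed_compact_projection[OF compact_Icc[of 0 1] this]
  have "closed {z. \<exists>t. t \<in> {0..1} \<and> (t, z) \<in> ?\<psi> -` (- U)}" .
  moreover have "{z. \<exists>t. t \<in> {0..1} \<and> (t, z) \<in> ?\<psi> -` (- U)}
      = - {z. \<forall>t\<in>{0..1}. (fst z, t * snd z) \<in> U}" by auto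
  ultimately show ?thesis by (simp add: closed_def)
qed

text \<open>Hadamard's lemma: the quotient is \<open>\<integral>\<^sub>0\<^sup>1 \<partial>\<^sub>r f (z, \<theta> r) d\<theta>\<close>.\<close>

lemma smooth_on_divide_snd:
  fixes f :: "'a::euclidean_space \<times> real \<Rightarrow> real"
  assumes "open U" "smooth_on U f" "\<And>z. (z, 0) \<in> U \<Longrightarrow> f (z, 0) = 0"
    and star: "\<And>z r t. (z, r) \<in> U \<Longrightarrow> t \<in> {0..1} \<Longrightarrow> (z, t * r) \<in> U"
  shows "smooth_on U (\<lambda>(z, r). if r = 0 then dird f (z, 0) (0, 1) else f (z, r) / r)"
proof -
  let ?\<psi> = "\<lambda>w :: ('a \<times> real) \<times> real. (fst (fst w), snd w * snd (fst w))"
  \<comment> \<open>On this open set the integrand is smooth jointly in the point and \<theta>; it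
    contains the product of \<open>U\<close> with [0, 1] because \<open>U\<close> is star-shaped
    along the fibres.\<close>
  define T where "T = ?\<psi> -` U"
  have opT: "open T" unfolding T_def
    by (intro open_vimage assms) (auto intro!: continuous_intros)
  define F where "F w = dird f (?\<psi> w) (0, 1)" for w
  have "smooth_on T F" unfolding F_def
  proof (rule smooth_on_compose[OF opT assms(1)])
    show "smooth_on T ?\<psi>" by (intro smooth_on_intros opT)
  qed (auto simp: T_def smooth_on_dird assms)
  then have sm: "smooth_on U (\<lambda>x. integral {0..1} (\<lambda>t. F (x, t)))"
    using Ck_on_integral[OF assms(1) opT, of _ F] star
    by (force simp: smooth_on_def T_def)
  have eq: "integral {0..1} (\<lambda>t. F ((z, r), t)) = (if r = 0 then dird f (z, 0) (0, 1) else f (z, r) / r)"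
    if "(z, r) \<in> U" for z r
  proof (cases "r = 0")
    case True
    then show ?thesis by (simp add: F_def)
  next
    case False
    have "((\<lambda>t. f (z, t * r) / r) has_vector_derivative dird f (z, t * r) (0, 1)) (at t within {0..1})"
      if "t \<in> {0..1}" for t
    proof -
      have d: "f differentiable (at (z, t * r))"
        using star[OF \<open>(z, r) \<in> U\<close> that] assms(2) smooth_on_differentiable by blast
      have "((\<lambda>t. f ((z, 0) + t *\<^sub>R (0, r))) has_vector_derivative dird f ((z, 0) + t *\<^sub>R (0, r)) (0, r)) (at t)"
        by (rule has_derivative_along_line) (use d in simp)
      then have "((\<lambda>t. f (z, t * r)) has_vector_derivative dird f (z, t * r) (0, r)) (at t)" by simp
      moreover have "dird f (z, t * r) (0, r) = r * dird f (z, t * r) (0, 1)"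
        using linear_scale[OF linear_dird[OF d], of r "(0, 1)"] by simp
      ultimately have "((\<lambda>t. f (z, t * r)) has_vector_derivative r * dird f (z, t * r) (0, 1)) (at t)"
        by simp
      from has_vector_derivative_divide[OF this, of r]
      show ?thesis using False by (auto intro: has_vector_derivative_at_within)
    qed
    then have "((\<lambda>t. dird f (z, t * r) (0, 1)) has_integral f (z, 1 * r) / r - f (z, 0 * r) / r) {0..1}"
      by (intro fundamental_theorem_of_calculus) auto
    moreover have "f (z, 0) = 0" using assms(3) star[OF that, of 0] by simp
    ultimately show ?thesis using False by (auto simp: F_def integral_unique)
  qed
  have "smooth_on U (\<lambda>x. integral {0..1} (\<lambda>t. F (x, t))) \<longleftrightarrow>
      smooth_on U (\<lambda>(z, r). if r = 0 then dird f (z, 0) (0, 1) else f (z, r) / r)"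
    by (rule smooth_on_cong[OF assms(1)]) (use eq in auto)
  then show ?thesis using sm by blast
qed

section \<open>Metrics at a point\<close>

definition metric_form :: "('e::euclidean_space \<Rightarrow> 'e \<Rightarrow> real) \<Rightarrow> bool" where
  "metric_form b \<longleftrightarrow> bilinear b \<and> (\<forall>u v. b u v = b v u) \<and> (\<forall>u. (\<forall>v. b u v = 0) \<longrightarrow> u = 0)"

lemma metric_form_linear:
  assumes "metric_form b"
  shows "linear (b u)" "linear (\<lambda>u. b u v)"
  using assms unfolding metric_form_def bilinear_def by (metis eta_contract_eq)+

lemma metric_form_sym: "metric_form b \<Longrightarrow> b u v = b v u"
  unfolding metric_form_def by blast

text \<open>Nondegeneracy as an extensionality rule: identities between vectors are verified below
  by pairing both sides with an arbitrary vector.\<close>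

lemma metric_form_cancel:
  assumes "metric_form b" "\<And>v. b x v = b y v"
  shows "x = y"
proof -
  have "b (x - y) v = 0" for v
    using assms(2) linear_diff[OF metric_form_linear(2)[OF assms(1)]] by simp
  then show ?thesis using assms(1) unfolding metric_form_def by (metis eq_iff_diff_eq_0)
qed

lemma linear_real_Basis_sum:
  fixes L :: "'a::euclidean_space \<Rightarrow> real"
  assumes "linear L"
  shows "L v = (\<Sum>b\<in>Basis. (v \<bullet> b) * L b)"
  using linear_Basis_sum[OF assms, of v] by simp

lemma inner_sum_linear:
  fixes L :: "'a::euclidean_space \<Rightarrow> real"
  assumes "linear L"
  shows "(\<Sum>k\<in>Basis. L k *\<^sub>R k) \<bullet> v = L v"
  unfolding linear_real_Basis_sum[OF assms, of v] inner_sum_left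
  by (intro sum.cong refl) (simp add: inner_commute[of v])

text \<open>\<open>sharp\<close> inverts the map that lowers an index. That map is injective by
  nondegeneracy and then surjective by equality of dimensions, so the \<open>inv\<close> in the
  definition is a genuine two-sided inverse.\<close>

lemma
  assumes "metric_form b"
  shows linear_sharp: "linear (sharp b)"
    and sharp_left: "b (sharp b w) v = w \<bullet> v"
    and sharp_flat: "sharp b (\<Sum>k\<in>Basis. b v k *\<^sub>R k) = v"
proof -
  let ?f = "\<lambda>v. \<Sum>k\<in>Basis. b v k *\<^sub>R k"
  have f: "?f v \<bullet> w = b v w" for v w
    by (rule inner_sum_linear[OF metric_form_linear(1)[OF assms]])
  have lin: "linear ?f"
    by (rule linearI) (simp_all add: linear_add[OF metric_form_linear(2)[OF assms]]
        linear_scale[OF metric_form_linear(2)[OF assms]] scaleR_left_distrib sum.distrib scaleR_sum_right)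
  have inj: "inj ?f"
  proof (rule injI)
    fix x y assume "?f x = ?f y"
    then have "b x v = b y v" for v using f by metis
    then show "x = y" by (rule metric_form_cancel[OF assms])
  qed
  have surj: "surj ?f" using lin inj linear_injective_imp_surjective by blast
  have sh: "sharp b = inv ?f" by (simp add: sharp_def)
  show "linear (sharp b)"
  proof (rule linearI)
    fix x y :: 'a and r :: real
    have "?f (sharp b (x + y)) = ?f (sharp b x + sharp b y)"
      unfolding linear_add[OF lin] sh surj_f_inv_f[OF surj] ..
    then show "sharp b (x + y) = sharp b x + sharp b y" by (rule injD[OF inj])
    have "?f (sharp b (r *\<^sub>R x)) = ?f (r *\<^sub>R sharp b x)"
      unfolding linear_scale[OF lin] sh surj_f_inv_f[OF surj] ..
    then show "sharp b (r *\<^sub>R x) = r *\<^sub>R sharp b x" by (rule injD[OF inj])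
  qed
  show "b (sharp b w) v = w \<bullet> v"
    using f[of "sharp b w" v] surj_f_inv_f[OF surj, of w] unfolding sh by simp
  show "sharp b (?f v) = v" unfolding sh by (rule inv_f_f[OF inj])
qed

lemma sharp_right: "metric_form b \<Longrightarrow> b v (sharp b w) = w \<bullet> v"
  using sharp_left metric_form_sym by metis

lemma inv_metric_sym: "metric_form b \<Longrightarrow> inv_metric b i j = inv_metric b j i"
  unfolding inv_metric_def using sharp_left sharp_right by (metis inner_commute)

lemma inv_metric_sum:
  fixes L :: "'a::euclidean_space \<Rightarrow> real"
  assumes "linear L"
  shows "(\<Sum>j\<in>Basis. inv_metric b i j * L j) = L (sharp b i)"
  by (simp add: linear_real_Basis_sum[OF assms, of "sharp b i"] inv_metric_def)

section \<open>Traces with respect to a metric form\<close>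

lemma bilinear_trace_sharp:
  assumes "\<And>i. linear (s i)"
  shows "bilinear_trace b s = (\<Sum>i\<in>Basis. s i (sharp b i))"
  unfolding bilinear_trace_def using inv_metric_sum[OF assms] by simp

lemma bilinear_trace_add:
  "bilinear_trace b (\<lambda>u v. s u v + s' u v) = bilinear_trace b s + bilinear_trace b s'"
  unfolding bilinear_trace_def by (simp add: distrib_left sum.distrib)

lemma bilinear_trace_cmult:
  "bilinear_trace b (\<lambda>u v. c * s u v) = c * bilinear_trace b s"
  unfolding bilinear_trace_def sum_distrib_left by (simp add: algebra_simps)

lemma bilinear_trace_cong:
  assumes "\<And>i j. i \<in> Basis \<Longrightarrow> j \<in> Basis \<Longrightarrow> s i j = s' i j"
  shows "bilinear_trace b s = bilinear_trace b s'"
  unfolding bilinear_trace_def using assms by simp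

lemma bilinear_trace_flip:
  "metric_form b \<Longrightarrow> bilinear_trace b (\<lambda>u v. s v u) = bilinear_trace b s"
  unfolding bilinear_trace_def by (subst sum.swap) (simp add: inv_metric_sym[of b])

lemma bilinear_trace_self:
  assumes "metric_form (b :: 'a::euclidean_space \<Rightarrow> 'a \<Rightarrow> real)"
  shows "bilinear_trace b b = DIM('a)"
  using bilinear_trace_sharp[of b b] metric_form_linear(1)[OF assms] sharp_right[OF assms]
  by simp

text \<open>Contraction with the inverse metric undoes the lowering of the index of
  \<open>w\<close>. With the Euler field for \<open>w\<close>, this evaluates the pairing of its
  norm's differential with any other one.\<close>

lemma bilinear_trace_flat:
  assumes "metric_form b" "linear \<beta>"
  shows "bilinear_trace b (\<lambda>u v. b w u * \<beta> v) = \<beta> w"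
proof -
  have "bilinear_trace b (\<lambda>u v. b w u * \<beta> v) = (\<Sum>i\<in>Basis. b w i * \<beta> (sharp b i))"
    by (rule bilinear_trace_sharp) (auto intro!: linear_compose_scale_right[OF assms(2), unfolded real_scaleR_def])
  also have "\<dots> = \<beta> (sharp b (\<Sum>i\<in>Basis. b w i *\<^sub>R i))"
    by (simp add: linear_sum[OF linear_sharp[OF assms(1)]] linear_sum[OF assms(2)]
        linear_scale[OF linear_sharp[OF assms(1)]] linear_scale[OF assms(2)])
  finally show ?thesis by (simp add: sharp_flat[OF assms(1)])
qed

text \<open>A trace may be computed in any pair of dual frames; the assumption \<open>dual\<close>
  says that the vectors \<open>L i\<close> and \<open>M i\<close> form such a pair.\<close>

lemma sum_bilinear_dual:
  fixes L M :: "'a::euclidean_space \<Rightarrow> 'a"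
  assumes "bilinear K" "linear L" "linear M"
    and dual: "\<And>k l. (\<Sum>i\<in>Basis. (L i \<bullet> k) * (M i \<bullet> l)) = k \<bullet> l"
  shows "(\<Sum>i\<in>Basis. K (L i) (M i)) = (\<Sum>i\<in>Basis. K i i :: real)"
proof -
  have K: "K u v = (\<Sum>k\<in>Basis. \<Sum>l\<in>Basis. (u \<bullet> k) * (v \<bullet> l) * K k l)" for u v
    using bilinear_sum[OF assms(1), of "\<lambda>k. (u \<bullet> k) *\<^sub>R k" Basis "\<lambda>k. (v \<bullet> k) *\<^sub>R k" Basis]
    by (simp add: euclidean_representation sum.cartesian_product bilinear_lmul[OF assms(1)]
        bilinear_rmul[OF assms(1)] mult_ac)
  have "(\<Sum>i\<in>Basis. K (L i) (M i))
      = (\<Sum>k\<in>Basis. \<Sum>l\<in>Basis. \<Sum>i\<in>Basis. (L i \<bullet> k) * (M i \<bullet> l) * K k l)"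
    by (subst K, subst sum.swap, rule sum.cong[OF refl], rule sum.swap)
  also have "\<dots> = (\<Sum>k\<in>Basis. \<Sum>l\<in>Basis. (k \<bullet> l) * K k l)"
    by (simp add: sum_distrib_right[symmetric] dual)
  also have "\<dots> = (\<Sum>k\<in>Basis. K k k)"
    by (intro sum.cong refl) (simp add: inner_Basis if_distrib[of "\<lambda>x. x * _"] cong: if_cong)
  finally show ?thesis .
qed

text \<open>Since \<open>c\<close> is nonzero and \<open>b\<close> nondegenerate, \<open>L\<close>
  is invertible. If \<open>?M\<close> is the transpose of its inverse, then
  \<open>L (sharp b i)\<close> is \<open>c\<close> times \<open>sharp b' (?M i)\<close>, and the
  vectors \<open>L i\<close> and \<open>?M i\<close> are dual frames, in which the trace may be
  computed.\<close>

lemma bilinear_trace_pullback: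
  fixes L :: "'a::euclidean_space \<Rightarrow> 'a"
  assumes b: "metric_form b" and b': "metric_form b'" and L: "linear L"
    and eq: "\<And>u v. b' (L u) (L v) = c * b u v" and "c \<noteq> 0" and s': "bilinear s'"
  shows "bilinear_trace b (\<lambda>u v. s' (L u) (L v)) = c * bilinear_trace b' s'"
proof -
  have "inj L"
  proof (rule linear_injective_0[OF L, THEN iffD2], intro allI impI)
    fix u assume "L u = 0"
    then have "b u v = 0" for v
      using eq[of u v] linear_0[OF metric_form_linear(2)[OF b']] \<open>c \<noteq> 0\<close> by simp
    then show "u = 0" using b unfolding metric_form_def by blast
  qed
  then obtain N where N: "linear N" "\<And>x. N (L x) = x" "\<And>x. L (N x) = x"
    using linear_injective_isomorphism[OF L] by blast
  let ?M = "adjoint N"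
  have M: "linear ?M" by (rule adjoint_linear[OF N(1)])
  have sh: "L (sharp b i) = c *\<^sub>R sharp b' (?M i)" for i
  proof (rule metric_form_cancel[OF b'])
    fix v
    have "b' (L (sharp b i)) v = c * (i \<bullet> N v)"
      using eq[of "sharp b i" "N v"] sharp_left[OF b] by (simp add: N)
    also have "\<dots> = b' (c *\<^sub>R sharp b' (?M i)) v"
      by (simp add: linear_scale[OF metric_form_linear(2)[OF b']] sharp_left[OF b']
          adjoint_clauses[OF N(1)])
    finally show "b' (L (sharp b i)) v = b' (c *\<^sub>R sharp b' (?M i)) v" .
  qed
  have lin: "linear (s' u)" "linear (\<lambda>u. s' u v)" for u v
    using s' unfolding bilinear_def by (metis eta_contract_eq)+
  have K: "bilinear (\<lambda>u v. s' u (sharp b' v))"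
    unfolding bilinear_def
    using lin linear_compose[OF linear_sharp[OF b'], unfolded o_def] by blast
  have dual: "(\<Sum>i\<in>Basis. (L i \<bullet> k) * (?M i \<bullet> l)) = k \<bullet> l" for k l
  proof -
    have "(\<Sum>i\<in>Basis. (L i \<bullet> k) * (?M i \<bullet> l)) = (\<Sum>i\<in>Basis. (adjoint L k \<bullet> i) * (N l \<bullet> i))"
      by (intro sum.cong refl) (simp add: adjoint_clauses[OF N(1)] adjoint_clauses[OF L] inner_commute)
    also have "\<dots> = adjoint L k \<bullet> N l"
      by (rule euclidean_inner[symmetric])
    also have "\<dots> = k \<bullet> l" by (simp add: adjoint_clauses[OF L] N inner_commute)
    finally show ?thesis .
  qed
  have "bilinear_trace b (\<lambda>u v. s' (L u) (L v)) = (\<Sum>i\<in>Basis. s' (L i) (L (sharp b i)))"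
    by (rule bilinear_trace_sharp) (use linear_compose[OF L lin(1)] in \<open>simp add: o_def\<close>)
  also have "\<dots> = c * (\<Sum>i\<in>Basis. s' (L i) (sharp b' (?M i)))"
    by (simp add: sh linear_scale[OF lin(1)] sum_distrib_left)
  also have "\<dots> = c * (\<Sum>i\<in>Basis. s' i (sharp b' i))"
    using sum_bilinear_dual[OF K L M dual] by simp
  finally show ?thesis by (simp add: bilinear_trace_sharp lin)
qed

section \<open>Smooth metrics on open sets\<close>

definition smooth_metric :: "'e::euclidean_space set \<Rightarrow> ('e \<Rightarrow> 'e \<Rightarrow> 'e \<Rightarrow> real) \<Rightarrow> bool" where
  "smooth_metric U \<gamma> \<longleftrightarrow> open U \<and> (\<forall>x\<in>U. metric_form (\<gamma> x)) \<and> (\<forall>u v. smooth_on U (\<lambda>x. \<gamma> x u v))"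

lemma smooth_metricD:
  assumes "smooth_metric U \<gamma>"
  shows "open U" "x \<in> U \<Longrightarrow> metric_form (\<gamma> x)" "smooth_on U (\<lambda>x. \<gamma> x u v)"
    "x \<in> U \<Longrightarrow> (\<lambda>x. \<gamma> x u v) differentiable (at x)"
  using assms smooth_on_differentiable unfolding smooth_metric_def by blast+

lemma metric_expand:
  assumes "metric_form b"
  shows "b u v = (\<Sum>i\<in>Basis. \<Sum>j\<in>Basis. (u \<bullet> i) * (v \<bullet> j) * b i j)"
  by (subst linear_real_Basis_sum[OF metric_form_linear(2)[OF assms]],
      subst linear_real_Basis_sum[OF metric_form_linear(1)[OF assms]])
    (simp add: sum_distrib_left mult.assoc)

text \<open>Since \<open>f\<close> vanishes at \<open>x\<close>, continuity of \<open>g\<close>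
  suffices for the product rule. This breaks a circle in differentiating the inverse metric, whose
  increments involve the inverse metric itself.\<close>

lemma has_derivative_mult_vanishing:
  fixes f g :: "'a::euclidean_space \<Rightarrow> real"
  assumes f: "(f has_derivative f') (at x)" "f x = 0" and g: "isCont g x"
  shows "((\<lambda>y. f y * g y) has_derivative (\<lambda>v. f' v * g x)) (at x)"
proof -
  have bl: "bounded_linear f'" using f(1) has_derivative_bounded_linear by blast
  then obtain K where K: "\<And>v. norm (f' v) \<le> norm v * K" using bounded_linear.bounded by blast
  have g0: "((\<lambda>y. g y - g x) \<longlongrightarrow> 0) (at x)"
    using g by (simp add: isCont_def LIM_zero)
  have *: "((\<lambda>y. (f y - f x - f' (y - x)) /\<^sub>R norm (y - x)) \<longlongrightarrow> 0) (at x)"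
    using f(1) by (simp add: has_derivative_def)
  have 1: "((\<lambda>y. ((f y - f x - f' (y - x)) /\<^sub>R norm (y - x)) * g y) \<longlongrightarrow> 0) (at x)"
    using tendsto_mult[OF * g[unfolded isCont_def]] by simp
  have 2: "((\<lambda>y. (f' (y - x) / norm (y - x)) * (g y - g x)) \<longlongrightarrow> 0) (at x)"
  proof (rule Lim_null_comparison)
    show "\<forall>\<^sub>F y in at x. norm ((f' (y - x) / norm (y - x)) * (g y - g x)) \<le> \<bar>K\<bar> * \<bar>g y - g x\<bar>"
    proof (rule always_eventually, rule allI)
      fix y
      have "\<bar>f' (y - x)\<bar> / norm (y - x) \<le> \<bar>K\<bar>"
      proof (cases "y = x")
        case False
        have "\<bar>f' (y - x)\<bar> \<le> norm (y - x) * K" using K[of "y - x"] by simp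
        also have "\<dots> \<le> norm (y - x) * \<bar>K\<bar>" by (simp add: mult_left_mono)
        finally show ?thesis using False by (simp add: divide_le_eq mult.commute)
      qed simp
      from mult_right_mono[OF this, of "\<bar>g y - g x\<bar>"]
      show "norm ((f' (y - x) / norm (y - x)) * (g y - g x)) \<le> \<bar>K\<bar> * \<bar>g y - g x\<bar>"
        by (simp add: abs_mult)
    qed
    show "((\<lambda>y. \<bar>K\<bar> * \<bar>g y - g x\<bar>) \<longlongrightarrow> 0) (at x)"
      using tendsto_mult_left[OF tendsto_rabs_zero[OF g0], of "\<bar>K\<bar>"] by simp
  qed
  have "((\<lambda>y. (f y * g y - f x * g x - f' (y - x) * g x) /\<^sub>R norm (y - x)) \<longlongrightarrow> 0) (at x)"
    using tendsto_add[OF 1 2] by (simp add: f(2) divide_inverse algebra_simps)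
  then show ?thesis
    using bl by (simp add: has_derivative_def bounded_linear_mult_const)
qed

text \<open>In terms of matrices this is B'^-1 = B^-1 - B^-1 (B' - B) B'^-1. It gives regularity of
  the inverse without determinants.\<close>

lemma sharp_difference:
  assumes x: "metric_form b" and y: "metric_form b'"
  shows "sharp b' w = sharp b w
    - (\<Sum>i\<in>Basis. \<Sum>k\<in>Basis. ((b' i k - b i k) * (sharp b' w \<bullet> i)) *\<^sub>R sharp b k)" (is "?S' = ?S - ?R")
proof (rule metric_form_cancel[OF x])
  fix v
  have "b ?R v = (\<Sum>i\<in>Basis. \<Sum>k\<in>Basis. (?S' \<bullet> i) * (v \<bullet> k) * (b' i k - b i k))"
    by (simp add: linear_sum[OF metric_form_linear(2)[OF x]] linear_scale[OF metric_form_linear(2)[OF x]]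
        sharp_left[OF x] inner_commute mult_ac)
  also have "\<dots> = b' ?S' v - b ?S' v"
    by (simp add: metric_expand[OF x, of ?S' v] metric_expand[OF y, of ?S' v] right_diff_distrib sum_subtractf)
  finally show "b ?S' v = b (?S - ?R) v"
    by (simp add: linear_diff[OF metric_form_linear(2)[OF x]] sharp_left[OF x] sharp_left[OF y])
qed

text \<open>By \<open>sharp_difference\<close>, \<open>S y\<close> differs from \<open>S x\<close>
  by at most \<open>\<epsilon> y\<close> times the norm of \<open>S y\<close>, where
  \<open>\<epsilon>\<close> tends to 0. Once \<open>\<epsilon> y\<close> is below 1/2 that norm can
  be absorbed, which bounds \<open>S\<close> near \<open>x\<close> and gives continuity.
  Differentiability follows because the factors \<open>e i k\<close> vanish at \<open>x\<close>, so
  that only continuity of \<open>S\<close> is needed.\<close>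

lemma
  assumes \<gamma>: "smooth_metric U \<gamma>" and x: "x \<in> U"
  shows isCont_sharp: "isCont (\<lambda>y. sharp (\<gamma> y) w) x"
    and has_derivative_sharp: "((\<lambda>y. sharp (\<gamma> y) w) has_derivative
      (\<lambda>v. - (\<Sum>i\<in>Basis. \<Sum>k\<in>Basis.
        (dird (\<lambda>y. \<gamma> y i k) x v * (sharp (\<gamma> x) w \<bullet> i)) *\<^sub>R sharp (\<gamma> x) k))) (at x)"
proof -
  define S where "S y = sharp (\<gamma> y) w" for y
  define e where "e i k y = \<gamma> y i k - \<gamma> x i k" for i k y
  define \<epsilon> where "\<epsilon> y = (\<Sum>i\<in>Basis. \<Sum>k\<in>Basis. \<bar>e i k y\<bar> * norm (sharp (\<gamma> x) k))" for y
  have S: "S y = S x - (\<Sum>i\<in>Basis. \<Sum>k\<in>Basis. (e i k y * (S y \<bullet> i)) *\<^sub>R sharp (\<gamma> x) k)" if "y \<in> U" for y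
    unfolding S_def e_def
    by (rule sharp_difference[OF smooth_metricD(2)[OF \<gamma> x] smooth_metricD(2)[OF \<gamma> that]])
  have cont: "isCont (\<lambda>y. \<gamma> y i k) x" for i k
    by (rule smooth_on_isCont[OF smooth_metricD(3)[OF \<gamma>] x])
  have e0: "((\<lambda>y. e i k y) \<longlongrightarrow> 0) (at x)" for i k
    unfolding e_def using cont[unfolded isCont_def] by (rule LIM_zero)
  have \<epsilon>0: "(\<epsilon> \<longlongrightarrow> 0) (at x)"
  proof -
    have "(\<epsilon> \<longlongrightarrow> (\<Sum>i\<in>(Basis::'a set). \<Sum>k\<in>(Basis::'a set). \<bar>0\<bar> * norm (sharp (\<gamma> x) k))) (at x)"
      unfolding \<epsilon>_def
      by (intro tendsto_sum tendsto_mult tendsto_rabs e0 tendsto_const)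
    then show ?thesis by simp
  qed
  have diff: "norm (S y - S x) \<le> \<epsilon> y * norm (S y)" if "y \<in> U" for y
  proof -
    have "norm (S y - S x)
        = norm (\<Sum>i\<in>Basis. \<Sum>k\<in>Basis. (e i k y * (S y \<bullet> i)) *\<^sub>R sharp (\<gamma> x) k)"
      by (subst S[OF that]) simp
    also have "\<dots> \<le> (\<Sum>i\<in>Basis. \<Sum>k\<in>Basis. norm ((e i k y * (S y \<bullet> i)) *\<^sub>R sharp (\<gamma> x) k))"
      by (intro order_trans[OF norm_sum] sum_mono norm_sum)
    also have "\<dots> \<le> (\<Sum>i\<in>Basis. \<Sum>k\<in>Basis. \<bar>e i k y\<bar> * norm (sharp (\<gamma> x) k) * norm (S y))"
    proof (intro sum_mono)
      fix i k :: 'a assume "i \<in> Basis"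
      have "\<bar>e i k y\<bar> * norm (sharp (\<gamma> x) k) * \<bar>S y \<bullet> i\<bar>
          \<le> \<bar>e i k y\<bar> * norm (sharp (\<gamma> x) k) * norm (S y)"
        by (intro mult_left_mono Basis_le_norm \<open>i \<in> Basis\<close>) auto
      then show "norm ((e i k y * (S y \<bullet> i)) *\<^sub>R sharp (\<gamma> x) k)
          \<le> \<bar>e i k y\<bar> * norm (sharp (\<gamma> x) k) * norm (S y)"
        by (simp add: abs_mult mult_ac)
    qed
    finally show ?thesis by (simp add: \<epsilon>_def sum_distrib_right)
  qed
  have "\<forall>\<^sub>F y in at x. y \<in> U"
    by (rule eventually_at_in_open'[OF smooth_metricD(1)[OF \<gamma>] x])
  moreover have "\<forall>\<^sub>F y in at x. \<epsilon> y < 1 / 2"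
    by (rule order_tendstoD(2)[OF \<epsilon>0]) simp
  ultimately have ev: "\<forall>\<^sub>F y in at x. norm (S y - S x) \<le> \<epsilon> y * (2 * norm (S x))"
  proof eventually_elim
    case (elim y)
    have "\<epsilon> y \<ge> 0" unfolding \<epsilon>_def by (intro sum_nonneg mult_nonneg_nonneg) auto
    have "\<epsilon> y * norm (S y) \<le> 1 / 2 * norm (S y)" using elim by (intro mult_right_mono) auto
    then have "norm (S y) \<le> 2 * norm (S x)"
      using diff[OF elim(1)] norm_triangle_sub[of "S y" "S x"] by linarith
    then have "\<epsilon> y * norm (S y) \<le> \<epsilon> y * (2 * norm (S x))"
      using \<open>\<epsilon> y \<ge> 0\<close> by (intro mult_left_mono)
    then show ?case using diff[OF elim(1)] by linarith
  qed
  have "(\<lambda>y. S y - S x) \<midarrow>x\<rightarrow> 0"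
    by (rule Lim_null_comparison[OF ev]) (use tendsto_mult_left_zero[OF \<epsilon>0] in simp)
  then show cS: "isCont (\<lambda>y. sharp (\<gamma> y) w) x"
    unfolding isCont_def S_def by (rule LIM_zero_cancel)
  have "((\<lambda>y. S x - (\<Sum>i\<in>Basis. \<Sum>k\<in>Basis. (e i k y * (S y \<bullet> i)) *\<^sub>R sharp (\<gamma> x) k)) has_derivative
      (\<lambda>v. 0 - (\<Sum>i\<in>Basis. \<Sum>k\<in>Basis. (dird (\<lambda>y. \<gamma> y i k) x v * (S x \<bullet> i)) *\<^sub>R sharp (\<gamma> x) k))) (at x)"
  proof (intro has_derivative_diff has_derivative_const has_derivative_sum has_derivative_scaleR_left
      has_derivative_mult_vanishing)
    fix i k :: 'a
    have "((\<lambda>y. \<gamma> y i k - \<gamma> x i k) has_derivative (\<lambda>v. dird (\<lambda>y. \<gamma> y i k) x v - 0)) (at x)"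
      by (intro has_derivative_diff has_derivative_const has_derivative_dird smooth_metricD(4)[OF \<gamma> x])
    then show "((\<lambda>y. e i k y) has_derivative dird (\<lambda>y. \<gamma> y i k) x) (at x)" by (simp add: e_def)
    show "e i k x = 0" by (simp add: e_def)
    show "isCont (\<lambda>y. S y \<bullet> i) x" using cS unfolding S_def by (intro isCont_inner) auto
  qed
  then show "((\<lambda>y. sharp (\<gamma> y) w) has_derivative
      (\<lambda>v. - (\<Sum>i\<in>Basis. \<Sum>k\<in>Basis.
        (dird (\<lambda>y. \<gamma> y i k) x v * (sharp (\<gamma> x) w \<bullet> i)) *\<^sub>R sharp (\<gamma> x) k))) (at x)"
    using has_derivative_cong_open[OF smooth_metricD(1)[OF \<gamma>] x S] by (simp add: S_def)
qed

text \<open>The derivative of \<open>sharp\<close> is a polynomial in derivatives of the metric and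
  in \<open>sharp\<close> itself, so each induction step gains one order.\<close>

lemma smooth_on_sharp:
  assumes \<gamma>: "smooth_metric U \<gamma>"
  shows "smooth_on U (\<lambda>x. sharp (\<gamma> x) w)"
proof -
  have "Ck_on k U (\<lambda>x. sharp (\<gamma> x) w)" for k w
  proof (induction k arbitrary: w)
    case 0
    show ?case using isCont_sharp[OF \<gamma>] by (simp add: continuous_at_imp_continuous_on)
  next
    case (Suc k)
    note op = smooth_metricD(1)[OF \<gamma>]
    show ?case
    proof (rule Ck_on_SucI[OF has_derivative_sharp[OF \<gamma>] op])
      fix v
      have "Ck_on k U (\<lambda>x. dird (\<lambda>y. \<gamma> y i j) x v)" for i j
        using smooth_on_dird[OF smooth_metricD(3)[OF \<gamma>]] unfolding smooth_on_def by blast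
      moreover have "Ck_on k U (\<lambda>x. sharp (\<gamma> x) w \<bullet> i)" for i
        by (rule Ck_on_linear_compose[OF op bounded_linear_inner_left Suc])
      ultimately have "Ck_on k U (\<lambda>x. \<Sum>i\<in>Basis. \<Sum>j\<in>Basis.
          (dird (\<lambda>y. \<gamma> y i j) x v * (sharp (\<gamma> x) w \<bullet> i)) *\<^sub>R sharp (\<gamma> x) j)"
        by (intro Ck_on_sum op Ck_on_bilinear[OF bounded_bilinear_scaleR]
            Ck_on_bilinear[OF bounded_bilinear_mult] Suc) auto
      then show "Ck_on k U (\<lambda>x. - (\<Sum>i\<in>Basis. \<Sum>j\<in>Basis.
          (dird (\<lambda>y. \<gamma> y i j) x v * (sharp (\<gamma> x) w \<bullet> i)) *\<^sub>R sharp (\<gamma> x) j))"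
        by (rule Ck_on_linear_compose[OF op bounded_linear_minus[OF bounded_linear_ident]])
    qed
  qed
  then show ?thesis by (simp add: smooth_on_def)
qed

lemma smooth_on_inv_metric:
  "smooth_metric U \<gamma> \<Longrightarrow> smooth_on U (\<lambda>x. inv_metric (\<gamma> x) k l)"
  unfolding inv_metric_def by (intro smooth_on_inner smooth_on_sharp smooth_metricD)

lemma smooth_on_christoffel:
  "smooth_metric U \<gamma> \<Longrightarrow> smooth_on U (\<lambda>x. christoffel \<gamma> x k i j)"
  unfolding christoffel_def divide_inverse
  by (intro smooth_on_mult smooth_on_sum smooth_on_add smooth_on_diff smooth_on_const
      smooth_on_dird smooth_on_inv_metric smooth_metricD finite_Basis)

lemma smooth_on_local_laplacian:
  "smooth_metric U \<gamma> \<Longrightarrow> smooth_on U f \<Longrightarrow> smooth_on U (local_laplacian \<gamma> f)"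
  unfolding local_laplacian_def bilinear_trace_def cov_deriv_def
  by (intro smooth_on_minus smooth_on_mult smooth_on_sum smooth_on_diff smooth_on_dird
      smooth_on_christoffel smooth_on_inv_metric smooth_metricD(1) finite_Basis)

section \<open>The Laplacian in coordinates\<close>

text \<open>Twice the Christoffel symbols of the first kind; \<open>chris_vec\<close> is twice those
  of the second kind, as a vector. They are linear in each vector argument, so that they can be
  evaluated on the Euler field and on images under a differential instead of basis vectors
  only.\<close>

definition chris1 :: "('e::euclidean_space \<Rightarrow> 'e \<Rightarrow> 'e \<Rightarrow> real) \<Rightarrow> 'e \<Rightarrow> 'e \<Rightarrow> 'e \<Rightarrow> 'e \<Rightarrow> real" where
  "chris1 \<gamma> x u v w = dird (\<lambda>y. \<gamma> y v w) x u + dird (\<lambda>y. \<gamma> y u w) x v - dird (\<lambda>y. \<gamma> y u v) x w"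

definition chris_vec :: "('e::euclidean_space \<Rightarrow> 'e \<Rightarrow> 'e \<Rightarrow> real) \<Rightarrow> 'e \<Rightarrow> 'e \<Rightarrow> 'e \<Rightarrow> 'e" where
  "chris_vec \<gamma> x u v = sharp (\<gamma> x) (\<Sum>l\<in>Basis. chris1 \<gamma> x u v l *\<^sub>R l)"

lemma linear_dird_metric:
  assumes \<gamma>: "smooth_metric U \<gamma>" and x: "x \<in> U"
  shows "linear (\<lambda>w. dird (\<lambda>y. \<gamma> y u v) x w)" "linear (\<lambda>u. dird (\<lambda>y. \<gamma> y u v) x w)"
    "linear (\<lambda>v. dird (\<lambda>y. \<gamma> y u v) x w)"
proof -
  note op = smooth_metricD(1)[OF \<gamma>] and d = has_derivative_dird[OF smooth_metricD(4)[OF \<gamma> x]]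
  note lin = metric_form_linear[OF smooth_metricD(2)[OF \<gamma>]]
  show "linear (\<lambda>w. dird (\<lambda>y. \<gamma> y u v) x w)"
    using linear_dird[OF smooth_metricD(4)[OF \<gamma> x]] by (simp add: eta_contract_eq)
  have add: "dird (\<lambda>y. \<gamma> y (a + b) v) x w = dird (\<lambda>y. \<gamma> y a v) x w + dird (\<lambda>y. \<gamma> y b v) x w" for a b v
  proof -
    have "dird (\<lambda>y. \<gamma> y (a + b) v) x = dird (\<lambda>y. \<gamma> y a v + \<gamma> y b v) x"
      by (rule dird_cong_open[OF op x]) (simp add: linear_add[OF lin(2)])
    then show ?thesis by (simp add: dird_eqI[OF has_derivative_add[OF d d]])
  qed
  have scale: "dird (\<lambda>y. \<gamma> y (r *\<^sub>R a) v) x w = r * dird (\<lambda>y. \<gamma> y a v) x w" for r a v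
  proof -
    have "dird (\<lambda>y. \<gamma> y (r *\<^sub>R a) v) x = dird (\<lambda>y. r * \<gamma> y a v) x"
      by (rule dird_cong_open[OF op x]) (simp add: linear_scale[OF lin(2)])
    then show ?thesis by (simp add: dird_eqI[OF has_derivative_mult_right[OF d]])
  qed
  show *: "linear (\<lambda>u. dird (\<lambda>y. \<gamma> y u v) x w)" for v
    by (rule linearI) (simp_all add: add scale)
  have "dird (\<lambda>y. \<gamma> y u v) x w = dird (\<lambda>y. \<gamma> y v u) x w" for v
    using dird_cong_open[OF op x, of "\<lambda>y. \<gamma> y u v" "\<lambda>y. \<gamma> y v u"]
      metric_form_sym[OF smooth_metricD(2)[OF \<gamma>]] by simp
  then show "linear (\<lambda>v. dird (\<lambda>y. \<gamma> y u v) x w)" using * by simp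
qed

lemma linear_chris1:
  assumes "smooth_metric U \<gamma>" "x \<in> U"
  shows "linear (\<lambda>u. chris1 \<gamma> x u v w)" "linear (\<lambda>v. chris1 \<gamma> x u v w)" "linear (chris1 \<gamma> x u v)"
  unfolding chris1_def[abs_def]
  by (intro linear_compose_add linear_compose_sub linear_dird_metric[OF assms])+

lemma chris_vec:
  assumes "smooth_metric U \<gamma>" "x \<in> U"
  shows "\<gamma> x (chris_vec \<gamma> x u v) w = chris1 \<gamma> x u v w"
  unfolding chris_vec_def sharp_left[OF smooth_metricD(2)[OF assms]]
  by (rule inner_sum_linear[OF linear_chris1(3)[OF assms]])

lemma linear_chris_vec:
  assumes "smooth_metric U \<gamma>" "x \<in> U"
  shows "linear (\<lambda>u. chris_vec \<gamma> x u v)" "linear (chris_vec \<gamma> x u)"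
  by (rule linearI; rule metric_form_cancel[OF smooth_metricD(2)[OF assms]];
      simp add: chris_vec[OF assms] linear_add[OF metric_form_linear(2)[OF smooth_metricD(2)[OF assms]]]
        linear_scale[OF metric_form_linear(2)[OF smooth_metricD(2)[OF assms]]]
        linear_add[OF linear_chris1(1)[OF assms]] linear_scale[OF linear_chris1(1)[OF assms]]
        linear_add[OF linear_chris1(2)[OF assms]] linear_scale[OF linear_chris1(2)[OF assms]])+

lemma cov_deriv_chris_vec:
  assumes \<gamma>: "smooth_metric U \<gamma>" and x: "x \<in> U" and \<alpha>: "linear (\<alpha> x)"
  shows "cov_deriv \<gamma> \<alpha> x i j = dird (\<lambda>y. \<alpha> y j) x i - \<alpha> x (chris_vec \<gamma> x i j) / 2"
proof -
  have c: "christoffel \<gamma> x k i j = (chris_vec \<gamma> x i j \<bullet> k) / 2" for k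
    unfolding christoffel_def chris1_def[symmetric] inv_metric_sum[OF linear_chris1(3)[OF \<gamma> x]]
    using chris_vec[OF \<gamma> x, of i j "sharp (\<gamma> x) k"] sharp_right[OF smooth_metricD(2)[OF \<gamma> x]]
    by (simp add: inner_commute)
  have "(\<Sum>k\<in>Basis. christoffel \<gamma> x k i j * \<alpha> x k) = \<alpha> x (chris_vec \<gamma> x i j) / 2"
    unfolding linear_real_Basis_sum[OF \<alpha>, of "chris_vec \<gamma> x i j"] sum_divide_distrib c by simp
  then show ?thesis unfolding cov_deriv_def by simp
qed

lemma cov_deriv_dird:
  assumes \<gamma>: "smooth_metric U \<gamma>" and x: "x \<in> U" and f: "smooth_on U f"
  shows "cov_deriv \<gamma> (dird f) x i j
    = dird (\<lambda>y. dird f y j) x i - dird f x (chris_vec \<gamma> x i j) / 2"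
  using cov_deriv_chris_vec[of U \<gamma> x "dird f"] \<gamma> x linear_dird[OF smooth_on_differentiable[OF f x]]
  by blast

lemma linear_dird_dird:
  assumes "open U" "x \<in> U" "smooth_on U f"
  shows "linear (\<lambda>u. dird (\<lambda>y. dird f y v) x u)" "linear (\<lambda>v. dird (\<lambda>y. dird f y v) x u)"
proof -
  note d = smooth_on_has_derivative[OF smooth_on_dird[OF assms(3)] assms(2)]
  note lin = linear_dird[OF smooth_on_differentiable[OF assms(3)]]
  show "linear (\<lambda>u. dird (\<lambda>y. dird f y v) x u)"
    using linear_dird[OF smooth_on_differentiable[OF smooth_on_dird[OF assms(3)] assms(2)]]
    by (simp add: eta_contract_eq)
  show "linear (\<lambda>v. dird (\<lambda>y. dird f y v) x u)"
  proof (rule linearI)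
    fix a b :: 'a and r :: real
    have "dird (\<lambda>y. dird f y (a + b)) x = dird (\<lambda>y. dird f y a + dird f y b) x"
      by (rule dird_cong_open[OF assms(1,2)]) (simp add: linear_add[OF lin])
    then show "dird (\<lambda>y. dird f y (a + b)) x u = dird (\<lambda>y. dird f y a) x u + dird (\<lambda>y. dird f y b) x u"
      by (simp add: dird_eqI[OF has_derivative_add[OF d d]])
    have "dird (\<lambda>y. dird f y (r *\<^sub>R a)) x = dird (\<lambda>y. r *\<^sub>R dird f y a) x"
      by (rule dird_cong_open[OF assms(1,2)]) (simp add: linear_scale[OF lin])
    then show "dird (\<lambda>y. dird f y (r *\<^sub>R a)) x u = r *\<^sub>R dird (\<lambda>y. dird f y a) x u"
      by (simp add: dird_eqI[OF has_derivative_scaleR_right[OF d]])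
  qed
qed

lemma bilinear_hessian:
  assumes \<gamma>: "smooth_metric U \<gamma>" and x: "x \<in> U" and f: "smooth_on U f"
  shows "bilinear (cov_deriv \<gamma> (dird f) x)"
proof -
  note d = linear_dird[OF smooth_on_differentiable[OF f x]]
  have *: "linear (\<lambda>i. dird f x (chris_vec \<gamma> x i j) / 2)" "linear (\<lambda>j. dird f x (chris_vec \<gamma> x i j) / 2)" for i j
    using linear_compose[OF linear_chris_vec(1)[OF \<gamma> x] d] linear_compose[OF linear_chris_vec(2)[OF \<gamma> x] d]
    by (auto simp: o_def linear_iff add_divide_distrib)
  show ?thesis
    unfolding bilinear_def cov_deriv_dird[OF \<gamma> x f]
    by (intro conjI allI linear_compose_sub linear_dird_dird[OF smooth_metricD(1)[OF \<gamma>] x f] *)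
qed

text \<open>The variable enters through the base point and through both arguments of the metric.
  Expansion in the standard basis turns this into a sum of products of scalar functions.\<close>

lemma has_derivative_metric_chain:
  assumes \<gamma>: "smooth_metric V \<gamma>" and U: "open U" "x \<in> U" "\<And>y. y \<in> U \<Longrightarrow> \<phi> y \<in> V"
    and \<phi>: "(\<phi> has_derivative \<phi>') (at x)"
    and a: "(a has_derivative a') (at x)" and b: "(b has_derivative b') (at x)"
  shows "((\<lambda>y. \<gamma> (\<phi> y) (a y) (b y)) has_derivative
    (\<lambda>w. dird (\<lambda>z. \<gamma> z (a x) (b x)) (\<phi> x) (\<phi>' w) + \<gamma> (\<phi> x) (a' w) (b x) + \<gamma> (\<phi> x) (a x) (b' w))) (at x)"
proof -
  have \<phi>x: "\<phi> x \<in> V" using U by blast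
  have exp: "\<gamma> z u v = (\<Sum>i\<in>Basis. \<Sum>j\<in>Basis. (u \<bullet> i) * (v \<bullet> j) * \<gamma> z i j)" if "z \<in> V" for z u v
    by (rule metric_expand[OF smooth_metricD(2)[OF \<gamma> that]])
  have dexp: "dird (\<lambda>z. \<gamma> z u v) (\<phi> x) w
      = (\<Sum>i\<in>Basis. \<Sum>j\<in>Basis. (u \<bullet> i) * (v \<bullet> j) * dird (\<lambda>z. \<gamma> z i j) (\<phi> x) w)" for u v w
    by (subst linear_real_Basis_sum[OF linear_dird_metric(2)[OF \<gamma> \<phi>x]],
        subst linear_real_Basis_sum[OF linear_dird_metric(3)[OF \<gamma> \<phi>x]])
      (simp add: sum_distrib_left mult.assoc)
  have c: "((\<lambda>y. \<gamma> (\<phi> y) i j) has_derivative (\<lambda>w. dird (\<lambda>z. \<gamma> z i j) (\<phi> x) (\<phi>' w))) (at x)" for i j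
    by (rule has_derivative_compose[OF \<phi>]) (rule has_derivative_dird[OF smooth_metricD(4)[OF \<gamma> \<phi>x]])
  have "((\<lambda>y. \<Sum>i\<in>Basis. \<Sum>j\<in>Basis. (a y \<bullet> i) * (b y \<bullet> j) * \<gamma> (\<phi> y) i j) has_derivative
    (\<lambda>w. \<Sum>i\<in>Basis. \<Sum>j\<in>Basis.
      ((a x \<bullet> i) * (b x \<bullet> j)) * dird (\<lambda>z. \<gamma> z i j) (\<phi> x) (\<phi>' w)
      + ((a x \<bullet> i) * (b' w \<bullet> j) + (a' w \<bullet> i) * (b x \<bullet> j)) * \<gamma> (\<phi> x) i j)) (at x)"
    by (intro has_derivative_sum has_derivative_mult c has_derivative_inner_left a b)
  moreover have "(\<lambda>w. \<Sum>i\<in>Basis. \<Sum>j\<in>Basis.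
      ((a x \<bullet> i) * (b x \<bullet> j)) * dird (\<lambda>z. \<gamma> z i j) (\<phi> x) (\<phi>' w)
      + ((a x \<bullet> i) * (b' w \<bullet> j) + (a' w \<bullet> i) * (b x \<bullet> j)) * \<gamma> (\<phi> x) i j)
    = (\<lambda>w. dird (\<lambda>z. \<gamma> z (a x) (b x)) (\<phi> x) (\<phi>' w) + \<gamma> (\<phi> x) (a' w) (b x) + \<gamma> (\<phi> x) (a x) (b' w))"
    unfolding dexp[of "a x" "b x"] exp[OF \<phi>x, of "a' _" "b x"] exp[OF \<phi>x, of "a x" "b' _"]
      sum.distrib[symmetric]
    by (intro ext sum.cong refl) (simp add: algebra_simps)
  moreover have "\<gamma> (\<phi> y) (a y) (b y)
      = (\<Sum>i\<in>Basis. \<Sum>j\<in>Basis. (a y \<bullet> i) * (b y \<bullet> j) * \<gamma> (\<phi> y) i j)" if "y \<in> U" for y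
    by (rule exp[OF U(3)[OF that]])
  ultimately show ?thesis
    using has_derivative_cong_open[OF U(1,2), of "\<lambda>y. \<gamma> (\<phi> y) (a y) (b y)"] by (simp only:)
qed

lemma dird_sym_vec:
  fixes \<phi> :: "'a::euclidean_space \<Rightarrow> 'b::euclidean_space"
  assumes "open S" "smooth_on S \<phi>" "x \<in> S"
  shows "dird (\<lambda>y. dird \<phi> y u) x v = dird (\<lambda>y. dird \<phi> y v) x u"
proof (rule euclidean_eqI)
  fix b :: 'b
  have 1: "dird (\<lambda>y. \<phi> y \<bullet> b) y w = dird \<phi> y w \<bullet> b" if "y \<in> S" for y w
    by (simp add: dird_eqI[OF has_derivative_inner_left[OF smooth_on_has_derivative[OF assms(2) that]]])
  have 2: "dird (\<lambda>y. dird \<phi> y w) x z \<bullet> b = dird (\<lambda>y. dird (\<lambda>y. \<phi> y \<bullet> b) y w) x z" for w z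
  proof -
    have "dird (\<lambda>y. dird (\<lambda>y. \<phi> y \<bullet> b) y w) x = dird (\<lambda>y. dird \<phi> y w \<bullet> b) x"
      by (rule dird_cong_open[OF assms(1,3)]) (rule 1)
    also have "\<dots> = (\<lambda>z. dird (\<lambda>y. dird \<phi> y w) x z \<bullet> b)"
      by (intro dird_eqI has_derivative_inner_left smooth_on_has_derivative[OF _ assms(3)]
          smooth_on_dird assms(2))
    finally show ?thesis by simp
  qed
  show "dird (\<lambda>y. dird \<phi> y u) x v \<bullet> b = dird (\<lambda>y. dird \<phi> y v) x u \<bullet> b"
    unfolding 2 by (rule dird_sym[OF assms(1) smooth_on_inner[OF assms(1,2)] assms(3)])
qed

text \<open>With \<open>c = 1\<close> this is the invariance of the Laplacian under changes of charts, with \<open>c = s\<^sup>2\<close> it is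
  its homogeneity under the dilation by \<open>s\<close>.\<close>

lemma local_laplacian_pullback:
  fixes \<phi> :: "'e::euclidean_space \<Rightarrow> 'e"
  assumes \<gamma>: "smooth_metric U \<gamma>" and \<gamma>': "smooth_metric V \<gamma>'"
    and \<phi>: "smooth_on U \<phi>" "\<And>y. y \<in> U \<Longrightarrow> \<phi> y \<in> V"
    and eq: "\<And>y u v. y \<in> U \<Longrightarrow> \<gamma>' (\<phi> y) (dird \<phi> y u) (dird \<phi> y v) = c * \<gamma> y u v" and "c \<noteq> 0"
    and f: "smooth_on V f" and x: "x \<in> U"
  shows "local_laplacian \<gamma> (\<lambda>y. f (\<phi> y)) x = c * local_laplacian \<gamma>' f (\<phi> x)"
proof -
  let ?L = "dird \<phi> x"
  define H where "H u v = dird (\<lambda>y. dird \<phi> y v) x u" for u v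
  note op = smooth_metricD(1)[OF \<gamma>] and op' = smooth_metricD(1)[OF \<gamma>']
  have \<phi>x: "\<phi> x \<in> V" using \<phi>(2) x by blast
  note mf = smooth_metricD(2)[OF \<gamma> x] and mf' = smooth_metricD(2)[OF \<gamma>' \<phi>x]
  have d\<phi>: "(\<phi> has_derivative dird \<phi> y) (at y)" if "y \<in> U" for y
    by (rule smooth_on_has_derivative[OF \<phi>(1) that])
  have L: "linear ?L" using linear_dird smooth_on_differentiable[OF \<phi>(1) x] by blast
  have dH: "((\<lambda>y. dird \<phi> y v) has_derivative (\<lambda>u. H u v)) (at x)" for v
    unfolding H_def using smooth_on_has_derivative[OF smooth_on_dird[OF \<phi>(1)] x] by (simp add: eta_contract_eq)
  have Hsym: "H u v = H v u" for u v
    unfolding H_def by (rule dird_sym_vec[OF op \<phi>(1) x])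
  \<comment> \<open>The derivative of the homothety condition \<open>eq\<close>, where
    \<open>H\<close> is the second derivative of \<open>\<phi>\<close>.\<close>
  have d\<gamma>: "c * dird (\<lambda>y. \<gamma> y u v) x w = dird (\<lambda>z. \<gamma>' z (?L u) (?L v)) (\<phi> x) (?L w)
      + \<gamma>' (\<phi> x) (H w u) (?L v) + \<gamma>' (\<phi> x) (?L u) (H w v)" for u v w
  proof -
    have "dird (\<lambda>y. c * \<gamma> y u v) x w = c * dird (\<lambda>y. \<gamma> y u v) x w"
      by (simp add: dird_eqI[OF has_derivative_mult_right[OF has_derivative_dird[OF smooth_metricD(4)[OF \<gamma> x]]]])
    moreover have "dird (\<lambda>y. c * \<gamma> y u v) x = dird (\<lambda>y. \<gamma>' (\<phi> y) (dird \<phi> y u) (dird \<phi> y v)) x"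
      by (rule dird_cong_open[OF op x]) (simp add: eq)
    ultimately show ?thesis
      by (simp add: dird_eqI[OF has_derivative_metric_chain[OF \<gamma>' op x \<phi>(2) d\<phi>[OF x] dH dH]])
  qed
  \<comment> \<open>Of the six terms that contain \<open>H\<close>, four cancel by its symmetry and
    the other two coincide.\<close>
  have chris: "c * chris1 \<gamma> x u v w = chris1 \<gamma>' (\<phi> x) (?L u) (?L v) (?L w) + 2 * \<gamma>' (\<phi> x) (H u v) (?L w)" for u v w
    unfolding chris1_def right_diff_distrib distrib_left d\<gamma>
    by (simp add: Hsym[of v u] Hsym[of w u] Hsym[of w v] metric_form_sym[OF mf', of "?L _"])
  have "inj ?L"
  proof (rule linear_injective_0[OF L, THEN iffD2], intro allI impI)
    fix u assume "?L u = 0"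
    then have "\<gamma> x u v = 0" for v
      using eq[OF x, of u v] linear_0[OF metric_form_linear(2)[OF mf']] \<open>c \<noteq> 0\<close> by simp
    then show "u = 0" using mf unfolding metric_form_def by blast
  qed
  then have surj: "surj ?L" using L linear_injective_imp_surjective by blast
  have vec: "?L (chris_vec \<gamma> x u v) = chris_vec \<gamma>' (\<phi> x) (?L u) (?L v) + 2 *\<^sub>R H u v" for u v
  proof (rule metric_form_cancel[OF mf'])
    fix z obtain w where z: "z = ?L w" using surj by blast
    show "\<gamma>' (\<phi> x) (?L (chris_vec \<gamma> x u v)) z = \<gamma>' (\<phi> x) (chris_vec \<gamma>' (\<phi> x) (?L u) (?L v) + 2 *\<^sub>R H u v) z"
      unfolding z eq[OF x] chris_vec[OF \<gamma> x] chris
      by (simp add: linear_add[OF metric_form_linear(2)[OF mf']] linear_scale[OF metric_form_linear(2)[OF mf']]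
          chris_vec[OF \<gamma>' \<phi>x])
  qed
  have sf: "smooth_on U (\<lambda>y. f (\<phi> y))"
    by (rule smooth_on_compose[OF op op' \<phi>(2) \<phi>(1) f])
  have df: "dird (\<lambda>y. f (\<phi> y)) y v = dird f (\<phi> y) (dird \<phi> y v)" if "y \<in> U" for y v
  proof -
    have "((\<lambda>y. f (\<phi> y)) has_derivative (\<lambda>v. dird f (\<phi> y) (dird \<phi> y v))) (at y)"
      by (rule has_derivative_compose[OF d\<phi>[OF that]])
        (rule smooth_on_has_derivative[OF f \<phi>(2)[OF that]])
    then show ?thesis by (simp add: dird_eqI)
  qed
  have lf: "linear (dird f (\<phi> y))" if "y \<in> U" for y
    using linear_dird smooth_on_differentiable[OF f \<phi>(2)[OF that]] by blast
  have ddf: "dird (\<lambda>y. dird (\<lambda>y. f (\<phi> y)) y v) x u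
      = dird (\<lambda>z. dird f z (?L v)) (\<phi> x) (?L u) + dird f (\<phi> x) (H u v)" for u v
  proof -
    have c: "((\<lambda>y. dird f (\<phi> y) b) has_derivative (\<lambda>w. dird (\<lambda>z. dird f z b) (\<phi> x) (?L w))) (at x)" for b
      by (rule has_derivative_compose[OF d\<phi>[OF x]])
        (rule smooth_on_has_derivative[OF smooth_on_dird[OF f] \<phi>x])
    have "((\<lambda>y. \<Sum>b\<in>Basis. (dird \<phi> y v \<bullet> b) * dird f (\<phi> y) b) has_derivative
      (\<lambda>w. \<Sum>b\<in>Basis. (?L v \<bullet> b) * dird (\<lambda>z. dird f z b) (\<phi> x) (?L w) + (H w v \<bullet> b) * dird f (\<phi> x) b)) (at x)"
      by (intro has_derivative_sum has_derivative_mult c has_derivative_inner_left dH)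
    moreover have "dird (\<lambda>y. f (\<phi> y)) y v = (\<Sum>b\<in>Basis. (dird \<phi> y v \<bullet> b) * dird f (\<phi> y) b)" if "y \<in> U" for y
      unfolding df[OF that] by (rule linear_real_Basis_sum[OF lf[OF that]])
    ultimately have "dird (\<lambda>y. dird (\<lambda>y. f (\<phi> y)) y v) x u
      = (\<Sum>b\<in>Basis. (?L v \<bullet> b) * dird (\<lambda>z. dird f z b) (\<phi> x) (?L u)) + (\<Sum>b\<in>Basis. (H u v \<bullet> b) * dird f (\<phi> x) b)"
      using dird_cong_open[OF op x, of "\<lambda>y. dird (\<lambda>y. f (\<phi> y)) y v"] by (simp add: dird_eqI sum.distrib)
    also have "\<dots> = dird (\<lambda>z. dird f z (?L v)) (\<phi> x) (?L u) + dird f (\<phi> x) (H u v)"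
      using linear_real_Basis_sum[OF lf[OF x], of "H u v"]
        linear_real_Basis_sum[OF linear_dird_dird(2)[OF op' \<phi>x f, where u = "?L u"], of "?L v"]
      by simp
    finally show ?thesis .
  qed
  \<comment> \<open>The term with \<open>H\<close> in the second derivative of the composition
    cancels against the inhomogeneous term of the Christoffel symbols, so the Hessian transforms as
    a tensor.\<close>
  have hess: "cov_deriv \<gamma> (dird (\<lambda>y. f (\<phi> y))) x u v = cov_deriv \<gamma>' (dird f) (\<phi> x) (?L u) (?L v)" for u v
    unfolding cov_deriv_dird[OF \<gamma> x sf] cov_deriv_dird[OF \<gamma>' \<phi>x f] ddf df[OF x] vec
    by (simp add: linear_add[OF lf[OF x]] linear_scale[OF lf[OF x]] add_divide_distrib)
  have "bilinear_trace (\<gamma> x) (\<lambda>u v. cov_deriv \<gamma>' (dird f) (\<phi> x) (?L u) (?L v))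
      = c * bilinear_trace (\<gamma>' (\<phi> x)) (cov_deriv \<gamma>' (dird f) (\<phi> x))"
    by (rule bilinear_trace_pullback[OF mf mf' L eq[OF x] \<open>c \<noteq> 0\<close> bilinear_hessian[OF \<gamma>' \<phi>x f]])
  then show ?thesis
    unfolding local_laplacian_def hess[abs_def, symmetric] by (simp add: hess[abs_def])
qed

lemma cov_deriv_cong:
  assumes "open U" "x \<in> U" "\<And>y v. y \<in> U \<Longrightarrow> \<alpha> y v = \<beta> y v"
  shows "cov_deriv \<gamma> \<alpha> x i j = cov_deriv \<gamma> \<beta> x i j"
  unfolding cov_deriv_def
  using dird_cong_open[OF assms(1,2), of "\<lambda>y. \<alpha> y j" "\<lambda>y. \<beta> y j"] assms(2,3) by simp

lemma local_laplacian_cong: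
  assumes "open U" "x \<in> U" "\<And>y. y \<in> U \<Longrightarrow> f y = h y"
  shows "local_laplacian \<gamma> f x = local_laplacian \<gamma> h x"
proof -
  have "dird f y v = dird h y v" if "y \<in> U" for y v
    using dird_cong_open[OF assms(1) that, of f h] assms(3) by simp
  then have "cov_deriv \<gamma> (dird f) x = cov_deriv \<gamma> (dird h) x"
    by (intro ext cov_deriv_cong[OF assms(1,2)])
  then show ?thesis by (simp add: local_laplacian_def)
qed

section \<open>The pairing of differentials and Leibniz rules for the Laplacian\<close>

definition local_pairing ::
    "('e::euclidean_space \<Rightarrow> 'e \<Rightarrow> 'e \<Rightarrow> real) \<Rightarrow> ('e \<Rightarrow> real) \<Rightarrow> ('e \<Rightarrow> real) \<Rightarrow> 'e \<Rightarrow> real" where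
  "local_pairing \<gamma> f h x = bilinear_trace (\<gamma> x) (\<lambda>u v. dird f x u * dird h x v)"

lemma local_pairing_sym: "metric_form (\<gamma> x) \<Longrightarrow> local_pairing \<gamma> f h x = local_pairing \<gamma> h f x"
  unfolding local_pairing_def
  by (subst bilinear_trace_flip[symmetric]) (auto simp: mult.commute)

lemma dird_mult:
  "f differentiable (at x) \<Longrightarrow> h differentiable (at x) \<Longrightarrow>
    dird (\<lambda>y. f y * h y :: real) x v = f x * dird h x v + dird f x v * h x"
  by (simp add: dird_eqI[OF has_derivative_mult[OF has_derivative_dird has_derivative_dird]])

lemma dird_add:
  "f differentiable (at x) \<Longrightarrow> h differentiable (at x) \<Longrightarrow>
    dird (\<lambda>y. f y + h y) x v = dird f x v + dird h x v"
  by (simp add: dird_eqI[OF has_derivative_add[OF has_derivative_dird has_derivative_dird]])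

lemma dird_ln:
  fixes f :: "'a::euclidean_space \<Rightarrow> real"
  assumes "f differentiable (at x)" "f x > 0"
  shows "dird (\<lambda>y. ln (f y)) x v = dird f x v * inverse (f x)"
proof -
  have "(ln has_derivative (\<lambda>v. v * inverse (f x))) (at (f x))"
    using DERIV_ln[OF assms(2)] by (simp add: has_field_derivative_def mult.commute[of _ "inverse (f x)"])
  from has_derivative_compose[OF has_derivative_dird[OF assms(1)] this]
  have "((\<lambda>y. ln (f y)) has_derivative (\<lambda>v. dird f x v * inverse (f x))) (at x)" .
  then show ?thesis by (simp add: dird_eqI)
qed

lemma dird_inverse:
  assumes "f differentiable (at x)" "f x \<noteq> (0::real)"
  shows "dird (\<lambda>y. inverse (f y)) x v = - dird f x v * inverse ((f x)\<^sup>2)"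
proof -
  have "((\<lambda>y. inverse (f y)) has_derivative (\<lambda>v. - dird f x v * inverse ((f x)\<^sup>2))) (at x)"
    using has_derivative_dird[OF assms(1)] assms(2)
    by (auto intro!: derivative_eq_intros simp: power2_eq_square mult_ac)
  then show ?thesis by (simp add: dird_eqI)
qed

lemma local_pairing_ln:
  assumes "f differentiable (at x)" "f x > 0"
  shows "local_pairing \<gamma> (\<lambda>y. ln (f y)) k x = local_pairing \<gamma> f k x / f x"
proof -
  have "local_pairing \<gamma> (\<lambda>y. ln (f y)) k x
      = bilinear_trace (\<gamma> x) (\<lambda>u v. inverse (f x) * (dird f x u * dird k x v))"
    unfolding local_pairing_def dird_ln[OF assms] by (simp add: mult_ac)
  then show ?thesis by (simp add: bilinear_trace_cmult local_pairing_def divide_inverse)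
qed

lemma cov_deriv_add:
  assumes "(\<lambda>y. \<alpha> y j) differentiable (at x)" "(\<lambda>y. \<beta> y j) differentiable (at x)"
  shows "cov_deriv \<gamma> (\<lambda>y v. \<alpha> y v + \<beta> y v) x i j = cov_deriv \<gamma> \<alpha> x i j + cov_deriv \<gamma> \<beta> x i j"
  unfolding cov_deriv_def by (simp add: dird_add assms distrib_left sum.distrib)

lemma cov_deriv_mult:
  assumes "f differentiable (at x)" "(\<lambda>y. \<alpha> y j) differentiable (at x)"
  shows "cov_deriv \<gamma> (\<lambda>y v. f y * \<alpha> y v) x i j = f x * cov_deriv \<gamma> \<alpha> x i j + dird f x i * \<alpha> x j"
  unfolding cov_deriv_def dird_mult[OF assms]
  by (simp add: right_diff_distrib sum_distrib_left mult_ac)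

context
  fixes U :: "'e::euclidean_space set" and \<gamma> and f h :: "'e \<Rightarrow> real" and x
  assumes \<gamma>: "smooth_metric U \<gamma>" and x: "x \<in> U" and f: "smooth_on U f" and h: "smooth_on U h"
begin

lemma local_laplacian_add:
  "local_laplacian \<gamma> (\<lambda>y. f y + h y) x = local_laplacian \<gamma> f x + local_laplacian \<gamma> h x"
proof -
  note op = smooth_metricD(1)[OF \<gamma>] and df = smooth_on_differentiable[OF f]
    and dh = smooth_on_differentiable[OF h]
  have "cov_deriv \<gamma> (dird (\<lambda>y. f y + h y)) x = (\<lambda>i j. cov_deriv \<gamma> (dird f) x i j + cov_deriv \<gamma> (dird h) x i j)"
  proof (intro ext)
    fix i j
    have "cov_deriv \<gamma> (dird (\<lambda>y. f y + h y)) x i j = cov_deriv \<gamma> (\<lambda>y v. dird f y v + dird h y v) x i j"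
      by (rule cov_deriv_cong[OF op x]) (rule dird_add[OF df dh])
    also have "\<dots> = cov_deriv \<gamma> (dird f) x i j + cov_deriv \<gamma> (dird h) x i j"
      by (rule cov_deriv_add; rule smooth_on_differentiable[OF smooth_on_dird x]; fact f h)
    finally show "cov_deriv \<gamma> (dird (\<lambda>y. f y + h y)) x i j
        = cov_deriv \<gamma> (dird f) x i j + cov_deriv \<gamma> (dird h) x i j" .
  qed
  then show ?thesis
    unfolding local_laplacian_def by (simp add: bilinear_trace_add)
qed

text \<open>The mixed terms in the Hessian of a product form a symmetric sum, whose trace is twice
  the pairing; the minus sign stems from the convention for the Laplacian.\<close>

lemma local_laplacian_mult:
  "local_laplacian \<gamma> (\<lambda>y. f y * h y) x
    = f x * local_laplacian \<gamma> h x + h x * local_laplacian \<gamma> f x - 2 * local_pairing \<gamma> f h x"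
proof -
  note op = smooth_metricD(1)[OF \<gamma>] and df = smooth_on_differentiable[OF f]
    and dh = smooth_on_differentiable[OF h]
  note ddf = smooth_on_differentiable[OF smooth_on_dird[OF f] x]
    and ddh = smooth_on_differentiable[OF smooth_on_dird[OF h] x]
  have m: "(\<lambda>y. f y * dird h y j) differentiable (at x)" "(\<lambda>y. h y * dird f y j) differentiable (at x)" for j
    by (intro differentiable_mult df dh ddf ddh x)+
  have "cov_deriv \<gamma> (dird (\<lambda>y. f y * h y)) x i j
      = cov_deriv \<gamma> (\<lambda>y v. f y * dird h y v + h y * dird f y v) x i j" for i j
    by (rule cov_deriv_cong[OF op x]) (simp add: dird_mult df dh)
  then have "cov_deriv \<gamma> (dird (\<lambda>y. f y * h y)) x
      = (\<lambda>i j. (f x * cov_deriv \<gamma> (dird h) x i j + h x * cov_deriv \<gamma> (dird f) x i j)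
        + (dird f x i * dird h x j + dird h x i * dird f x j))"
    by (intro ext) (simp add: cov_deriv_add[OF m] cov_deriv_mult[OF df[OF x] ddh] cov_deriv_mult[OF dh[OF x] ddf])
  moreover have "bilinear_trace (\<gamma> x) (\<lambda>u v. dird h x u * dird f x v) = local_pairing \<gamma> f h x"
    using local_pairing_sym[of \<gamma> x f h] smooth_metricD(2)[OF \<gamma> x] by (simp add: local_pairing_def)
  ultimately show ?thesis
    unfolding local_laplacian_def
    by (simp add: bilinear_trace_add bilinear_trace_cmult local_pairing_def[symmetric])
qed

text \<open>The derivative of 1/f contributes the square of the differential with a minus sign,
  which the sign convention of the Laplacian reverses.\<close>

lemma local_laplacian_ln:
  assumes pos: "\<And>y. y \<in> U \<Longrightarrow> f y > 0"
  shows "local_laplacian \<gamma> (\<lambda>y. ln (f y)) x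
    = local_laplacian \<gamma> f x / f x + local_pairing \<gamma> f f x / (f x)\<^sup>2"
proof -
  note op = smooth_metricD(1)[OF \<gamma>] and df = smooth_on_differentiable[OF f]
  note ddf = smooth_on_differentiable[OF smooth_on_dird[OF f] x]
  have pos': "y \<in> U \<Longrightarrow> f y \<noteq> 0" for y using pos by force
  have di: "(\<lambda>y. inverse (f y)) differentiable (at x)"
    by (rule smooth_on_differentiable[OF smooth_on_inverse[OF op f pos'] x])
  have "cov_deriv \<gamma> (dird (\<lambda>y. ln (f y))) x i j = cov_deriv \<gamma> (\<lambda>y v. inverse (f y) * dird f y v) x i j" for i j
    by (rule cov_deriv_cong[OF op x]) (simp add: dird_ln df pos)
  then have "cov_deriv \<gamma> (dird (\<lambda>y. ln (f y))) x
      = (\<lambda>i j. inverse (f x) * cov_deriv \<gamma> (dird f) x i j + (- inverse ((f x)\<^sup>2)) * (dird f x i * dird f x j))"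
    by (intro ext) (simp add: cov_deriv_mult[OF di ddf] dird_inverse[OF df[OF x] pos'[OF x]])
  then show ?thesis
    unfolding local_laplacian_def
    by (simp only: bilinear_trace_add bilinear_trace_cmult local_pairing_def[symmetric])
      (simp add: divide_inverse mult.commute)
qed

end

lemma local_laplacian_const: "local_laplacian \<gamma> (\<lambda>y. c) x = 0"
proof -
  have "dird (\<lambda>y::'a. d) = (\<lambda>y v. 0)" for d :: real
    by (rule ext, rule dird_eqI) simp
  then have "cov_deriv \<gamma> (dird (\<lambda>y. c)) x = (\<lambda>i j. 0)"
    unfolding cov_deriv_def by simp
  then show ?thesis by (simp add: local_laplacian_def bilinear_trace_def)
qed

section \<open>The homogeneous function associated with the Euler field\<close>

context
  fixes U :: "'e::euclidean_space set" and \<gamma> and T :: "'e \<Rightarrow> 'e"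
  assumes \<gamma>: "smooth_metric U \<gamma>" and T: "bounded_linear T"
    and normalized: "\<And>x i j. x \<in> U \<Longrightarrow> i \<in> Basis \<Longrightarrow> j \<in> Basis \<Longrightarrow>
      cov_deriv \<gamma> (\<lambda>x. \<gamma> x (T x)) x i j = \<gamma> x i j"
begin

text \<open>The Euler field is linear in the coordinates used, so \<open>T\<close> is its own
  derivative. The normalization is given on basis vectors; by linearity its second index may be
  contracted with the Euler field. There the Christoffel term cancels half of the derivative of the
  metric, and what remains is half the derivative of the norm.\<close>

lemma dird_norm_euler:
  assumes x: "x \<in> U"
  shows "dird (\<lambda>y. \<gamma> y (T y) (T y)) x u = 2 * \<gamma> x (T x) u"
proof -
  note op = smooth_metricD(1)[OF \<gamma>] and mf = smooth_metricD(2)[OF \<gamma> x]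
  have d1: "((\<lambda>y. \<gamma> y (T y) j) has_derivative (\<lambda>w. dird (\<lambda>z. \<gamma> z (T x) j) x w + \<gamma> x (T w) j)) (at x)" for j
    using has_derivative_metric_chain[OF \<gamma> op x _ has_derivative_ident
        bounded_linear_imp_has_derivative[OF T] has_derivative_const]
    by (simp add: linear_0[OF metric_form_linear(1)[OF mf]])
  have d2: "((\<lambda>y. \<gamma> y (T y) (T y)) has_derivative
      (\<lambda>w. dird (\<lambda>z. \<gamma> z (T x) (T x)) x w + \<gamma> x (T w) (T x) + \<gamma> x (T x) (T w))) (at x)"
    using has_derivative_metric_chain[OF \<gamma> op x _ has_derivative_ident
        bounded_linear_imp_has_derivative[OF T] bounded_linear_imp_has_derivative[OF T]] by simp
  have "dird (\<lambda>y. \<gamma> y (T y) (T y)) x i = 2 * \<gamma> x (T x) i" if i: "i \<in> Basis" for i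
  proof -
    have "dird (\<lambda>z. \<gamma> z (T x) j) x i + \<gamma> x (T i) j - chris1 \<gamma> x i j (T x) / 2 = \<gamma> x i j" if "j \<in> Basis" for j
      using normalized[OF x i that] chris_vec[OF \<gamma> x, of i j "T x"] metric_form_sym[OF mf]
      unfolding cov_deriv_chris_vec[of U \<gamma> x "\<lambda>x. \<gamma> x (T x)", OF \<gamma> x metric_form_linear(1)[OF mf]]
      by (simp add: dird_eqI[OF d1])
    moreover have "linear (\<lambda>j. dird (\<lambda>z. \<gamma> z (T x) j) x i + \<gamma> x (T i) j - chris1 \<gamma> x i j (T x) / 2)"
      using linear_chris1(2)[OF \<gamma> x, of i "T x"]
      by (intro linear_compose_add linear_compose_sub linear_dird_metric(3)[OF \<gamma> x] metric_form_linear(1)[OF mf])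
        (auto simp: linear_iff add_divide_distrib)
    ultimately have "dird (\<lambda>z. \<gamma> z (T x) (T x)) x i + \<gamma> x (T i) (T x) - chris1 \<gamma> x i (T x) (T x) / 2
        = \<gamma> x i (T x)"
      using linear_eq_on[OF _ metric_form_linear(1)[OF mf], of _ "T x" Basis i] by (simp add: span_Basis)
    moreover have "chris1 \<gamma> x i (T x) (T x) = dird (\<lambda>z. \<gamma> z (T x) (T x)) x i"
      by (simp add: chris1_def)
    ultimately show ?thesis
      by (simp add: dird_eqI[OF d2] metric_form_sym[OF mf, of "T x"])
  qed
  moreover have "linear (dird (\<lambda>y. \<gamma> y (T y) (T y)) x)"
    by (rule linear_dird) (use d2 in \<open>auto simp: differentiable_def\<close>)
  moreover have "linear (\<lambda>u. 2 * \<gamma> x (T x) u)"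
    using metric_form_linear(1)[OF mf, of "T x"] by (auto simp: linear_iff algebra_simps)
  ultimately show ?thesis
    using linear_eq_on[of "dird (\<lambda>y. \<gamma> y (T y) (T y)) x" "\<lambda>u. 2 * \<gamma> x (T x) u" u Basis]
    by (simp add: span_Basis)
qed

lemma local_pairing_norm_euler:
  assumes x: "x \<in> U" and h: "h differentiable (at x)"
  shows "local_pairing \<gamma> (\<lambda>y. \<gamma> y (T y) (T y)) h x = 2 * dird h x (T x)"
proof -
  have "local_pairing \<gamma> (\<lambda>y. \<gamma> y (T y) (T y)) h x = bilinear_trace (\<gamma> x) (\<lambda>u v. 2 * (\<gamma> x (T x) u * dird h x v))"
    unfolding local_pairing_def dird_norm_euler[OF x] by (simp add: mult.assoc)
  then show ?thesis
    by (simp add: bilinear_trace_cmult bilinear_trace_flat[OF smooth_metricD(2)[OF \<gamma> x] linear_dird[OF h]])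
qed

text \<open>The differential is twice the covector dual to the Euler field, so by the normalization
  the Hessian is twice the metric, and its trace is twice the dimension.\<close>

lemma local_laplacian_norm_euler:
  assumes x: "x \<in> U"
  shows "local_laplacian \<gamma> (\<lambda>y. \<gamma> y (T y) (T y)) x = - 2 * DIM('e)"
proof -
  note op = smooth_metricD(1)[OF \<gamma>] and mf = smooth_metricD(2)[OF \<gamma> x]
  have d: "(\<lambda>y. \<gamma> y (T y) j) differentiable (at x)" for j
    using has_derivative_metric_chain[OF \<gamma> op x _ has_derivative_ident
        bounded_linear_imp_has_derivative[OF T] has_derivative_const]
    unfolding differentiable_def by auto
  have "cov_deriv \<gamma> (dird (\<lambda>y. \<gamma> y (T y) (T y))) x i j = 2 * \<gamma> x i j" if "i \<in> Basis" "j \<in> Basis" for i j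
  proof -
    have "cov_deriv \<gamma> (dird (\<lambda>y. \<gamma> y (T y) (T y))) x i j = cov_deriv \<gamma> (\<lambda>y v. 2 * \<gamma> y (T y) v) x i j"
      by (rule cov_deriv_cong[OF op x]) (rule dird_norm_euler)
    also have "\<dots> = 2 * cov_deriv \<gamma> (\<lambda>y. \<gamma> y (T y)) x i j"
      using cov_deriv_mult[of "\<lambda>y. 2" x "\<lambda>y. \<gamma> y (T y)" j \<gamma> i] d dird_eqI[OF has_derivative_const, of "2::real" x]
      by simp
    finally show ?thesis using normalized[OF x that] by simp
  qed
  then have "bilinear_trace (\<gamma> x) (cov_deriv \<gamma> (dird (\<lambda>y. \<gamma> y (T y) (T y))) x)
      = bilinear_trace (\<gamma> x) (\<lambda>i j. 2 * \<gamma> x i j)"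
    by (intro bilinear_trace_cong)
  then show ?thesis
    unfolding local_laplacian_def by (simp add: bilinear_trace_cmult bilinear_trace_self[OF mf])
qed

end

section \<open>Smooth functions and the Laplacian on a manifold\<close>

locale atlas =
  fixes A :: "('a, 'e::euclidean_space) chart set"
  assumes smooth_atlas: "smooth_atlas A"
begin

lemma chart_inj: "C \<in> A \<Longrightarrow> inj_on (snd C) (fst C)"
  and chart_open: "C \<in> A \<Longrightarrow> open (snd C ` fst C)"
  and overlap_open: "C \<in> A \<Longrightarrow> D \<in> A \<Longrightarrow> open (chart_image C (fst D))"
  and transition_smooth: "C \<in> A \<Longrightarrow> D \<in> A \<Longrightarrow> smooth_on (chart_image C (fst D)) (snd D \<circ> chart_inv C)"
  using smooth_atlas unfolding smooth_atlas_def by auto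

lemma chart_inv_chart: "C \<in> A \<Longrightarrow> p \<in> fst C \<Longrightarrow> chart_inv C (snd C p) = p"
  unfolding chart_inv_def by (rule inv_into_f_f[OF chart_inj])

lemma chart_chart_inv: "x \<in> chart_image C W \<Longrightarrow> snd C (chart_inv C x) = x"
  unfolding chart_inv_def chart_image_def by (auto simp: f_inv_into_f)

lemma chart_inv_mem: "x \<in> chart_image C W \<Longrightarrow> chart_inv C x \<in> fst C \<inter> W"
  unfolding chart_inv_def chart_image_def by (auto simp: inv_into_into)

lemma chart_image_mem: "C \<in> A \<Longrightarrow> p \<in> fst C \<Longrightarrow> snd C p \<in> chart_image C W \<longleftrightarrow> p \<in> W"
  unfolding chart_image_def by (auto simp: chart_inv_chart)

lemma chart_image_Int: "chart_image C (S \<inter> T) = chart_image C S \<inter> chart_image C T"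
  unfolding chart_image_def by auto

lemma openin_iff:
  "openin (atlas_topology A) W \<longleftrightarrow> W \<subseteq> points A \<and> (\<forall>C\<in>A. open (chart_image C W))"
  unfolding openin_atlas_topology using chart_open by blast

lemma open_chart_image: "openin (atlas_topology A) W \<Longrightarrow> C \<in> A \<Longrightarrow> open (chart_image C W)"
  by (simp add: openin_iff)

lemma chart_at:
  assumes "p \<in> points A"
  shows "chart_at A p \<in> A" "p \<in> fst (chart_at A p)"
proof -
  have "\<exists>C. C \<in> A \<and> p \<in> fst C" using assms by (auto simp: points_def)
  from someI_ex[OF this] show "chart_at A p \<in> A" "p \<in> fst (chart_at A p)"
    unfolding chart_at_def by auto
qed

lemma chart_at_openin:
  assumes "openin (atlas_topology A) W" "p \<in> W"
  shows "chart_at A p \<in> A" "p \<in> fst (chart_at A p)" "snd (chart_at A p) p \<in> chart_image (chart_at A p) W"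
proof -
  have p: "p \<in> points A" using assms by (auto simp: openin_iff)
  show "chart_at A p \<in> A" "p \<in> fst (chart_at A p)" by (rule chart_at[OF p])+
  show "snd (chart_at A p) p \<in> chart_image (chart_at A p) W"
    using chart_image_mem[OF chart_at[OF p]] assms(2) by blast
qed

context
  fixes W assumes W: "openin (atlas_topology A) W"
begin

lemma smooth_fun_const: "smooth_fun A W (\<lambda>p. c)"
  unfolding smooth_fun_def o_def using open_chart_image[OF W] by (auto intro: smooth_on_intros)

lemma smooth_fun_add: "smooth_fun A W f \<Longrightarrow> smooth_fun A W h \<Longrightarrow> smooth_fun A W (\<lambda>p. f p + h p)"
  unfolding smooth_fun_def o_def using open_chart_image[OF W] by (auto intro: smooth_on_intros)

lemma smooth_fun_diff: "smooth_fun A W f \<Longrightarrow> smooth_fun A W h \<Longrightarrow> smooth_fun A W (\<lambda>p. f p - h p)"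
  unfolding smooth_fun_def o_def using open_chart_image[OF W] by (auto intro: smooth_on_intros)

lemma smooth_fun_mult: "smooth_fun A W f \<Longrightarrow> smooth_fun A W h \<Longrightarrow> smooth_fun A W (\<lambda>p. f p * h p)"
  unfolding smooth_fun_def o_def using open_chart_image[OF W] by (auto intro: smooth_on_intros)

lemma smooth_fun_inverse:
  assumes "smooth_fun A W f" "\<And>p. p \<in> W \<Longrightarrow> f p \<noteq> 0"
  shows "smooth_fun A W (\<lambda>p. inverse (f p))"
  unfolding smooth_fun_def o_def
proof
  fix C assume C: "C \<in> A"
  show "smooth_on (chart_image C W) (\<lambda>x. inverse (f (chart_inv C x)))"
  proof (rule smooth_on_inverse[OF open_chart_image[OF W C]])
    show "smooth_on (chart_image C W) (\<lambda>x. f (chart_inv C x))"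
      using assms(1) C unfolding smooth_fun_def o_def by blast
    show "f (chart_inv C x) \<noteq> 0" if "x \<in> chart_image C W" for x
      using chart_inv_mem[OF that] assms(2) by simp
  qed
qed

lemma smooth_fun_ln:
  assumes "smooth_fun A W f" "\<And>p. p \<in> W \<Longrightarrow> f p > 0"
  shows "smooth_fun A W (\<lambda>p. ln (f p))"
  unfolding smooth_fun_def o_def
proof
  fix C assume C: "C \<in> A"
  show "smooth_on (chart_image C W) (\<lambda>x. ln (f (chart_inv C x)))"
  proof (rule smooth_on_ln[OF open_chart_image[OF W C]])
    show "smooth_on (chart_image C W) (\<lambda>x. f (chart_inv C x))"
      using assms(1) C unfolding smooth_fun_def o_def by blast
    show "f (chart_inv C x) > 0" if "x \<in> chart_image C W" for x
      using chart_inv_mem[OF that] assms(2) by simp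
  qed
qed

lemma smooth_fun_cong:
  assumes "\<And>p. p \<in> W \<Longrightarrow> f p = h p"
  shows "smooth_fun A W f \<longleftrightarrow> smooth_fun A W h"
proof -
  have "smooth_on (chart_image C W) (f \<circ> chart_inv C) \<longleftrightarrow> smooth_on (chart_image C W) (h \<circ> chart_inv C)"
    if "C \<in> A" for C
    by (rule smooth_on_cong[OF open_chart_image[OF W that]]) (use chart_inv_mem[of _ C W] assms in force)
  then show ?thesis unfolding smooth_fun_def by blast
qed

lemma smooth_fun_differentiable:
  assumes "smooth_fun A W f" "p \<in> W"
  shows "(f \<circ> chart_inv (chart_at A p)) differentiable (at (snd (chart_at A p) p))"
  using assms chart_at_openin[OF W] smooth_on_differentiable unfolding smooth_fun_def by blast

text \<open>Provides the open sets on which logarithms and inverses of a function are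
  smooth.\<close>

lemma openin_superlevel:
  assumes "smooth_fun A W f"
  shows "openin (atlas_topology A) {p \<in> W. f p > 0}"
  unfolding openin_iff
proof (intro conjI ballI)
  show "{p \<in> W. f p > 0} \<subseteq> points A" using W by (auto simp: openin_iff)
  fix C assume C: "C \<in> A"
  let ?U = "chart_image C W"
  have "continuous_on ?U (f \<circ> chart_inv C)"
    using assms C smooth_on_continuous unfolding smooth_fun_def by blast
  then have "open (?U \<inter> (f \<circ> chart_inv C) -` {0<..})"
    by (rule continuous_open_preimage[OF _ open_chart_image[OF W C]]) simp
  moreover have "chart_image C {p \<in> W. f p > 0} = ?U \<inter> (f \<circ> chart_inv C) -` {0<..}"
    unfolding chart_image_def by auto
  ultimately show "open (chart_image C {p \<in> W. f p > 0})" by simp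
qed

end

lemma smooth_fun_subset: "smooth_fun A W f \<Longrightarrow> W' \<subseteq> W \<Longrightarrow> smooth_fun A W' f"
proof -
  assume *: "smooth_fun A W f" "W' \<subseteq> W"
  have "chart_image C W' \<subseteq> chart_image C W" for C using *(2) unfolding chart_image_def by blast
  then show ?thesis
    using *(1) smooth_on_subset[of "chart_image C W" "f \<circ> chart_inv C" "chart_image C W'" for C]
    unfolding smooth_fun_def by metis
qed

section \<open>The Laplacian of a metric in arbitrary charts\<close>

lemma tens2_at_transition:
  assumes "tens2_at A p b" "C \<in> A" "D \<in> A" "p \<in> fst C" "p \<in> fst D"
  shows "b D (dird (snd D \<circ> chart_inv C) (snd C p) u) (dird (snd D \<circ> chart_inv C) (snd C p) v) = b C u v"
  using assms unfolding tens2_at_def by (metis IntI)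

definition pairing ::
    "('a \<Rightarrow> ('a, 'e) tens2) \<Rightarrow> ('a \<Rightarrow> real) \<Rightarrow> ('a \<Rightarrow> real) \<Rightarrow> 'a \<Rightarrow> real" where
  "pairing g f h p = (let C = chart_at A p in
     local_pairing (in_chart g C) (f \<circ> chart_inv C) (h \<circ> chart_inv C) (snd C p))"

context
  fixes W g assumes W: "openin (atlas_topology A) W" and g: "pseudo_metric A W g"
begin

lemma smooth_metric_in_chart:
  assumes C: "C \<in> A"
  shows "smooth_metric (chart_image C W) (in_chart g C)"
  unfolding smooth_metric_def
proof (intro conjI ballI allI)
  show "open (chart_image C W)" by (rule open_chart_image[OF W C])
  show "smooth_on (chart_image C W) (\<lambda>x. in_chart g C x u v)" for u v
    using g C unfolding pseudo_metric_def sym_tensor_field_def by blast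
  fix x assume "x \<in> chart_image C W"
  from chart_inv_mem[OF this] have p: "chart_inv C x \<in> W \<inter> fst C" by simp
  have st: "sym_tensor_field A W g"
    and nd: "\<forall>C\<in>A. \<forall>p\<in>W \<inter> fst C. \<forall>u. (\<forall>v. g p C u v = 0) \<longrightarrow> u = 0"
    using g by (auto simp: pseudo_metric_def)
  from st have "\<forall>p\<in>W. tens2_at A p (g p) \<and> tens2_sym (g p)" by (simp add: sym_tensor_field_def)
  then have t: "tens2_at A (chart_inv C x) (g (chart_inv C x))" and sym: "tens2_sym (g (chart_inv C x))"
    using p by auto
  have "bilinear (g (chart_inv C x) C)"
    using t[unfolded tens2_at_def, THEN conjunct2, THEN conjunct1] p C by simp
  moreover have "\<forall>u v. g (chart_inv C x) C u v = g (chart_inv C x) C v u"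
    using sym unfolding tens2_sym_def by blast
  moreover have "\<forall>u. (\<forall>v. g (chart_inv C x) C u v = 0) \<longrightarrow> u = 0" using nd C p by blast
  moreover have "in_chart g C x = g (chart_inv C x) C" by (intro ext) (simp add: in_chart_def)
  ultimately show "metric_form (in_chart g C x)" unfolding metric_form_def by simp
qed

lemma tens2_at_metric: "p \<in> W \<Longrightarrow> tens2_at A p (g p)"
  using g unfolding pseudo_metric_def sym_tensor_field_def by blast

text \<open>Independence of the chart picked by \<open>chart_at\<close>: this is
  \<open>local_laplacian_pullback\<close> for the transition map with factor 1, on the part of the
  overlap that lies in \<open>W\<close>.\<close>

lemma laplacian_in_chart:
  assumes f: "smooth_fun A W f" and C: "C \<in> A" and p: "p \<in> W" "p \<in> fst C"
  shows "laplacian A g f p = local_laplacian (in_chart g C) (f \<circ> chart_inv C) (snd C p)"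
proof -
  define D where "D = chart_at A p"
  have D: "D \<in> A" "p \<in> fst D" using chart_at_openin[OF W p(1)] by (auto simp: D_def)
  define \<phi> where "\<phi> = snd D \<circ> chart_inv C"
  let ?U = "chart_image C (fst D \<inter> W)" and ?V = "chart_image D W"
  have U: "?U \<subseteq> chart_image C W" "?U \<subseteq> chart_image C (fst D)" by (auto simp: chart_image_def)
  have opU: "open ?U"
    using open_chart_image[OF W C] overlap_open[OF C D(1)] by (simp add: chart_image_Int open_Int)
  have smU: "smooth_metric ?U (in_chart g C)"
    using smooth_metric_in_chart[OF C] opU U(1) unfolding smooth_metric_def by (blast intro: smooth_on_subset)
  have pU: "snd C p \<in> ?U" using chart_image_mem[OF C p(2)] D p by blast
  have inv: "chart_inv D (\<phi> y) = chart_inv C y" if "y \<in> ?U" for y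
    unfolding \<phi>_def using chart_inv_mem[OF that] chart_inv_chart[OF D(1)] by simp
  have V: "\<phi> y \<in> ?V" if "y \<in> ?U" for y
    unfolding \<phi>_def using chart_inv_mem[OF that] chart_image_mem[OF D(1)] by simp
  have eq: "in_chart g D (\<phi> y) (dird \<phi> y u) (dird \<phi> y v) = 1 * in_chart g C y u v" if "y \<in> ?U" for y u v
    using chart_inv_mem[OF that] tens2_at_transition[OF tens2_at_metric C D(1), of "chart_inv C y" u v]
      inv[OF that] by (simp add: in_chart_def chart_chart_inv[OF that] \<phi>_def)
  have s\<phi>: "smooth_on ?U \<phi>" unfolding \<phi>_def by (rule smooth_on_subset[OF transition_smooth[OF C D(1)] U(2)])
  have sf: "smooth_on ?V (f \<circ> chart_inv D)" using f D(1) unfolding smooth_fun_def by blast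
  have "local_laplacian (in_chart g C) (\<lambda>y. (f \<circ> chart_inv D) (\<phi> y)) (snd C p)
      = 1 * local_laplacian (in_chart g D) (f \<circ> chart_inv D) (\<phi> (snd C p))"
    by (rule local_laplacian_pullback[OF smU smooth_metric_in_chart[OF D(1)] s\<phi> V eq one_neq_zero sf pU])
  moreover have "local_laplacian (in_chart g C) (\<lambda>y. (f \<circ> chart_inv D) (\<phi> y)) (snd C p)
      = local_laplacian (in_chart g C) (f \<circ> chart_inv C) (snd C p)"
    by (rule local_laplacian_cong[OF opU pU]) (simp add: inv)
  moreover have "\<phi> (snd C p) = snd D p" by (simp add: \<phi>_def chart_inv_chart[OF C p(2)])
  ultimately show ?thesis by (simp add: laplacian_def D_def[symmetric])
qed

lemma smooth_fun_laplacian: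
  assumes f: "smooth_fun A W f"
  shows "smooth_fun A W (laplacian A g f)"
  unfolding smooth_fun_def
proof
  fix C assume C: "C \<in> A"
  have "smooth_on (chart_image C W) (local_laplacian (in_chart g C) (f \<circ> chart_inv C))"
    using f C unfolding smooth_fun_def by (intro smooth_on_local_laplacian smooth_metric_in_chart) auto
  moreover have "local_laplacian (in_chart g C) (f \<circ> chart_inv C) x = (laplacian A g f \<circ> chart_inv C) x"
    if "x \<in> chart_image C W" for x
    using laplacian_in_chart[OF f C, of "chart_inv C x"] chart_inv_mem[OF that] chart_chart_inv[OF that]
    by simp
  ultimately show "smooth_on (chart_image C W) (laplacian A g f \<circ> chart_inv C)"
    using smooth_on_cong[OF open_chart_image[OF W C]] by blast
qed

context
  fixes p assumes p: "p \<in> W"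
begin

lemma laplacian_cong:
  assumes "\<And>q. q \<in> W \<Longrightarrow> f q = h q"
  shows "laplacian A g f p = laplacian A g h p"
  unfolding laplacian_def Let_def
proof (rule local_laplacian_cong[OF open_chart_image[OF W chart_at_openin(1)[OF W p]] chart_at_openin(3)[OF W p]])
  fix y assume "y \<in> chart_image (chart_at A p) W"
  from chart_inv_mem[OF this] show "(f \<circ> chart_inv (chart_at A p)) y = (h \<circ> chart_inv (chart_at A p)) y"
    using assms by simp
qed

lemma laplacian_const: "laplacian A g (\<lambda>q. c) p = 0"
  by (simp add: laplacian_def local_laplacian_const o_def)

lemma laplacian_add:
  assumes "smooth_fun A W f" "smooth_fun A W h"
  shows "laplacian A g (\<lambda>q. f q + h q) p = laplacian A g f p + laplacian A g h p"
  using local_laplacian_add[OF smooth_metric_in_chart[OF chart_at_openin(1)[OF W p]] chart_at_openin(3)[OF W p],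
      of "f \<circ> chart_inv (chart_at A p)" "h \<circ> chart_inv (chart_at A p)"] assms chart_at_openin(1)[OF W p]
  by (simp add: laplacian_def smooth_fun_def Let_def o_def)

lemma laplacian_mult:
  assumes "smooth_fun A W f" "smooth_fun A W h"
  shows "laplacian A g (\<lambda>q. f q * h q) p
    = f p * laplacian A g h p + h p * laplacian A g f p - 2 * pairing g f h p"
  using local_laplacian_mult[OF smooth_metric_in_chart[OF chart_at_openin(1)[OF W p]] chart_at_openin(3)[OF W p],
      of "f \<circ> chart_inv (chart_at A p)" "h \<circ> chart_inv (chart_at A p)"] assms chart_at_openin(1,2)[OF W p]
  by (simp add: laplacian_def smooth_fun_def Let_def o_def pairing_def chart_inv_chart)

lemma laplacian_ln:
  assumes "smooth_fun A W f" "\<And>q. q \<in> W \<Longrightarrow> f q > 0"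
  shows "laplacian A g (\<lambda>q. ln (f q)) p = laplacian A g f p / f p + pairing g f f p / (f p)\<^sup>2"
proof -
  have "(f \<circ> chart_inv (chart_at A p)) y > 0" if "y \<in> chart_image (chart_at A p) W" for y
    using chart_inv_mem[OF that] assms(2) by simp
  then show ?thesis
    using local_laplacian_ln[OF smooth_metric_in_chart[OF chart_at_openin(1)[OF W p]] chart_at_openin(3)[OF W p],
      of "f \<circ> chart_inv (chart_at A p)" "f \<circ> chart_inv (chart_at A p)"] assms chart_at_openin(1,2)[OF W p]
    by (simp add: laplacian_def smooth_fun_def Let_def o_def pairing_def chart_inv_chart)
qed

lemma pairing_sym: "pairing g f h p = pairing g h f p"
  unfolding pairing_def Let_def
  using smooth_metricD(2)[OF smooth_metric_in_chart[OF chart_at_openin(1)[OF W p]] chart_at_openin(3)[OF W p]]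
  by (rule local_pairing_sym)

lemma pairing_ln:
  assumes "smooth_fun A W f" "f p > 0"
  shows "pairing g (\<lambda>q. ln (f q)) k p = pairing g f k p / f p"
  using local_pairing_ln[OF smooth_fun_differentiable[OF W assms(1) p], of "in_chart g (chart_at A p)"]
    chart_at_openin(1,2)[OF W p] assms(2)
  by (simp add: pairing_def Let_def o_def chart_inv_chart)

end

end

end

section \<open>The atlases of the metric bundle and of the ambient space\<close>

lemma tens2_scale_scale: "tens2_scale a (tens2_scale b t) = tens2_scale (a * b) t"
  by (simp add: tens2_scale_def mult.assoc)

lemma smooth_atlasI:
  assumes "\<And>C. C \<in> A \<Longrightarrow> inj_on (snd C) (fst C)" "\<And>C. C \<in> A \<Longrightarrow> open (snd C ` fst C)"
    and "\<And>C D. C \<in> A \<Longrightarrow> D \<in> A \<Longrightarrow> open (chart_image C (fst D))"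
    and "\<And>C D. C \<in> A \<Longrightarrow> D \<in> A \<Longrightarrow> smooth_on (chart_image C (fst D)) (snd D \<circ> chart_inv C)"
  shows "smooth_atlas A"
  using assms unfolding smooth_atlas_def by blast

lemma chart_inv_eqI:
  assumes "inj_on (snd C) (fst C)" "p \<in> fst C" "snd C p = x"
  shows "chart_inv C x = p"
  using assms unfolding chart_inv_def by auto

locale conformal =
  fixes A :: "('a, 'e::euclidean_space) chart set" and cf :: "('a \<Rightarrow> ('a, 'e) tens2) set"
  assumes conformal: "conformal_manifold A cf"

sublocale conformal \<subseteq> base: atlas A
  using conformal by unfold_locales (simp add: conformal_manifold_def smooth_manifold_def)

context conformal
begin

abbreviation "MB \<equiv> metric_bundle A cf"
abbreviation "BA \<equiv> bundle_atlas A cf"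
abbreviation "M \<equiv> ambient_atlas A cf"

lemma openin_points: "openin (atlas_topology A) (points A)"
proof -
  have "chart_image C (points A) = snd C ` fst C" if "C \<in> A" for C
    using that by (auto simp: chart_image_def points_def base.chart_inv_chart[OF that])
  then show ?thesis using base.chart_open by (simp add: base.openin_iff)
qed

lemma conformalE:
  obtains g0 where "pseudo_metric A (points A) g0"
    "\<And>g. g \<in> cf \<longleftrightarrow> (\<exists>\<upsilon>. g = (\<lambda>p. tens2_scale (exp (2 * \<upsilon> p)) (g0 p)) \<and> smooth_fun A (points A) \<upsilon>)"
  using conformal unfolding conformal_manifold_def by auto

lemma cf_nonempty: "\<exists>g. g \<in> cf"
  using base.smooth_fun_const[OF openin_points, of 0] conformalE by metis

lemma cf_related:
  assumes "g \<in> cf" "g' \<in> cf"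
  shows "\<exists>\<upsilon>. smooth_fun A (points A) \<upsilon> \<and> (\<forall>p. g' p = tens2_scale (exp (2 * \<upsilon> p)) (g p))"
proof -
  obtain g0 where cf: "\<And>g. g \<in> cf \<longleftrightarrow>
      (\<exists>\<upsilon>. g = (\<lambda>p. tens2_scale (exp (2 * \<upsilon> p)) (g0 p)) \<and> smooth_fun A (points A) \<upsilon>)"
    by (rule conformalE) (rule that)
  from assms(1) obtain a where a: "smooth_fun A (points A) a" "g = (\<lambda>p. tens2_scale (exp (2 * a p)) (g0 p))"
    using cf by blast
  from assms(2) obtain b where b: "smooth_fun A (points A) b" "g' = (\<lambda>p. tens2_scale (exp (2 * b p)) (g0 p))"
    using cf by blast
  have "smooth_fun A (points A) (\<lambda>p. b p - a p)"
    by (rule base.smooth_fun_diff[OF openin_points b(1) a(1)])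
  moreover have "g' p = tens2_scale (exp (2 * (b p - a p))) (g p)" for p
    by (simp add: a(2) b(2) tens2_scale_scale exp_add[symmetric] right_diff_distrib)
  ultimately show ?thesis by (intro exI[of _ "\<lambda>p. b p - a p"] conjI allI)
qed

text \<open>The constant \<open>ln s\<close> may be added to a conformal exponent. This makes the
  metric bundle invariant under dilations.\<close>

lemma cf_scale:
  assumes "g \<in> cf" "s > 0"
  shows "(\<lambda>p. tens2_scale (s\<^sup>2) (g p)) \<in> cf"
proof -
  obtain g0 where cf: "\<And>g. g \<in> cf \<longleftrightarrow>
      (\<exists>\<upsilon>. g = (\<lambda>p. tens2_scale (exp (2 * \<upsilon> p)) (g0 p)) \<and> smooth_fun A (points A) \<upsilon>)"
    by (rule conformalE) (rule that)
  from assms(1) obtain a where a: "smooth_fun A (points A) a" "g = (\<lambda>p. tens2_scale (exp (2 * a p)) (g0 p))"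
    using cf by blast
  have "exp (2 * (a p + ln s)) = s\<^sup>2 * exp (2 * a p)" for p
    using assms(2) by (simp add: distrib_left exp_add exp_double[of "ln s"] power2_eq_square)
  then have "(\<lambda>p. tens2_scale (s\<^sup>2) (g p)) = (\<lambda>p. tens2_scale (exp (2 * (a p + ln s))) (g0 p))"
    by (simp add: a(2) tens2_scale_scale)
  moreover have "smooth_fun A (points A) (\<lambda>p. a p + ln s)"
    by (intro base.smooth_fun_add base.smooth_fun_const openin_points a(1))
  ultimately show ?thesis unfolding cf by (intro exI[of _ "\<lambda>p. a p + ln s"] conjI)
qed

text \<open>Nondegeneracy provides a nonzero component of the metric at \<open>p\<close>. Hence
  dilations act freely and the fibre coordinate is unique.\<close>

lemma tens2_scale_inj:
  assumes g: "g \<in> cf" and p: "p \<in> points A" and eq: "tens2_scale a (g p) = tens2_scale b (g p)"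
  shows "a = b"
proof -
  obtain g0 where g0: "pseudo_metric A (points A) g0" and cf: "\<And>g. g \<in> cf \<longleftrightarrow>
      (\<exists>\<upsilon>. g = (\<lambda>p. tens2_scale (exp (2 * \<upsilon> p)) (g0 p)) \<and> smooth_fun A (points A) \<upsilon>)"
    by (rule conformalE) (rule that)
  from g obtain c where c: "g = (\<lambda>p. tens2_scale (exp (2 * c p)) (g0 p))"
    using cf by blast
  obtain C where C: "C \<in> A" "p \<in> fst C" using p by (auto simp: points_def)
  obtain u :: 'e where u: "u \<noteq> 0" by (metis nonempty_Basis nonzero_Basis ex_in_conv)
  have "\<forall>C\<in>A. \<forall>p\<in>points A \<inter> fst C. \<forall>u. (\<forall>v. g0 p C u v = 0) \<longrightarrow> u = 0"
    using g0 by (simp add: pseudo_metric_def)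
  then obtain v where v: "g0 p C u v \<noteq> 0" using C p u by blast
  have "a * (exp (2 * c p) * g0 p C u v) = b * (exp (2 * c p) * g0 p C u v)"
    using fun_cong[OF fun_cong[OF fun_cong[OF eq, of C], of u], of v] by (simp add: c tens2_scale_def)
  then show ?thesis using v by simp
qed

text \<open>A single representative parametrizes the whole ray bundle, because the conformal factor
  of any other one is the square of exp \<upsilon>.\<close>

lemma metric_bundle_iff:
  assumes g: "g \<in> cf"
  shows "y \<in> MB \<longleftrightarrow> (\<exists>p\<in>points A. \<exists>s>0. y = (p, tens2_scale (s\<^sup>2) (g p)))"
proof
  assume "y \<in> MB"
  then obtain p g' where p: "p \<in> points A" "g' \<in> cf" "y = (p, g' p)" by (auto simp: metric_bundle_def)
  from cf_related[OF g p(2)] obtain \<upsilon> where "\<forall>p. g' p = tens2_scale (exp (2 * \<upsilon> p)) (g p)" by blast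
  then have "y = (p, tens2_scale ((exp (\<upsilon> p))\<^sup>2) (g p))" using p(3) by (simp add: exp_double)
  then show "\<exists>p\<in>points A. \<exists>s>0. y = (p, tens2_scale (s\<^sup>2) (g p))"
    using p(1) by (intro bexI[of _ p] exI[of _ "exp (\<upsilon> p)"]) auto
next
  assume "\<exists>p\<in>points A. \<exists>s>0. y = (p, tens2_scale (s\<^sup>2) (g p))"
  then obtain p s where p: "p \<in> points A" "s > 0" "y = (p, tens2_scale (s\<^sup>2) (g p))" by blast
  have "\<exists>q h. y = (q, h q) \<and> q \<in> points A \<and> h \<in> cf"
    using p cf_scale[OF g p(2)]
    by (intro exI[of _ p] exI[of _ "\<lambda>p. tens2_scale (s\<^sup>2) (g p)"] conjI) auto
  then show "y \<in> MB" unfolding metric_bundle_def mem_Collect_eq .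
qed

lemma metric_bundleI: "g \<in> cf \<Longrightarrow> p \<in> points A \<Longrightarrow> s > 0 \<Longrightarrow> (p, tens2_scale (s\<^sup>2) (g p)) \<in> MB"
  using metric_bundle_iff by blast

lemma fibre_coord_eq:
  assumes "g \<in> cf" "p \<in> points A" "s > 0"
  shows "fibre_coord g (p, tens2_scale (s\<^sup>2) (g p)) = s"
  unfolding fibre_coord_def
proof (rule the_equality)
  fix s' assume "s' > 0 \<and> snd (p, tens2_scale (s\<^sup>2) (g p)) = tens2_scale (s'\<^sup>2) (g (fst (p, tens2_scale (s\<^sup>2) (g p))))"
  then have "s' > 0" "s\<^sup>2 = s'\<^sup>2" using tens2_scale_inj[OF assms(1,2), of "s\<^sup>2" "s'\<^sup>2"] by auto
  then show "s' = s" using assms(3) by (simp add: power2_eq_iff_nonneg)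
qed (use assms in simp)

lemma fibre_coord:
  assumes "g \<in> cf" "y \<in> MB"
  shows "fibre_coord g y > 0" "(fst y, tens2_scale ((fibre_coord g y)\<^sup>2) (g (fst y))) = y" "fst y \<in> points A"
proof -
  obtain p s where "p \<in> points A" "s > 0" "y = (p, tens2_scale (s\<^sup>2) (g p))"
    using metric_bundle_iff[OF assms(1)] assms(2) by blast
  then show "fibre_coord g y > 0" "(fst y, tens2_scale ((fibre_coord g y)\<^sup>2) (g (fst y))) = y" "fst y \<in> points A"
    using fibre_coord_eq[OF assms(1)] by auto
qed

lemma dilation_MB:
  assumes "y \<in> MB" "s > 0"
  shows "dilation s y \<in> MB"
proof -
  obtain g where g: "g \<in> cf" using cf_nonempty by blast
  then obtain p u where p: "p \<in> points A" "u > 0" "y = (p, tens2_scale (u\<^sup>2) (g p))"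
    using metric_bundle_iff assms(1) by blast
  have "dilation s y = (p, tens2_scale ((s * u)\<^sup>2) (g p))"
    by (simp add: dilation_def p tens2_scale_scale power_mult_distrib)
  then show ?thesis using metric_bundleI[OF g p(1)] p(2) assms(2) by simp
qed

lemma fibre_coord_dilation:
  assumes "g \<in> cf" "y \<in> MB" "s > 0"
  shows "fibre_coord g (dilation s y) = s * fibre_coord g y"
proof -
  note f = fibre_coord[OF assms(1,2)]
  have "dilation s y = (fst y, tens2_scale ((s * fibre_coord g y)\<^sup>2) (g (fst y)))"
    using f(2) by (metis dilation_def power_mult_distrib snd_conv tens2_scale_scale)
  then show ?thesis using fibre_coord_eq[OF assms(1) f(3), of "s * fibre_coord g y"] f(1) assms(3) by simp
qed

lemma bundle_chart_inj:
  assumes "C \<in> A" "g \<in> cf"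
  shows "inj_on (snd (bundle_chart A cf C g)) (fst (bundle_chart A cf C g))"
proof (rule inj_onI)
  fix y y' assume y: "y \<in> fst (bundle_chart A cf C g)" and y': "y' \<in> fst (bundle_chart A cf C g)"
    and eq: "snd (bundle_chart A cf C g) y = snd (bundle_chart A cf C g) y'"
  have "snd C (fst y) = snd C (fst y')" "fibre_coord g y = fibre_coord g y'"
    using eq by (auto simp: bundle_chart_def)
  moreover then have "fst y = fst y'"
    using inj_onD[OF base.chart_inj[OF assms(1)]] y y' by (auto simp: bundle_chart_def)
  moreover have "y \<in> MB" "y' \<in> MB" using y y' by (auto simp: bundle_chart_def)
  ultimately show "y = y'"
    using fibre_coord(2)[OF assms(2), of y] fibre_coord(2)[OF assms(2), of y'] by metis
qed

lemma bundle_chart_inv: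
  assumes "C \<in> A" "g \<in> cf" "x \<in> snd C ` fst C" "s > 0"
  shows "(chart_inv C x, tens2_scale (s\<^sup>2) (g (chart_inv C x))) \<in> fst (bundle_chart A cf C g)"
    and "snd (bundle_chart A cf C g) (chart_inv C x, tens2_scale (s\<^sup>2) (g (chart_inv C x))) = (x, s)"
    and "chart_inv (bundle_chart A cf C g) (x, s) = (chart_inv C x, tens2_scale (s\<^sup>2) (g (chart_inv C x)))"
proof -
  have x: "chart_inv C x \<in> fst C" "snd C (chart_inv C x) = x"
    using assms(3) by (auto simp: base.chart_inv_chart[OF assms(1)])
  then have p: "chart_inv C x \<in> points A" using assms(1) by (auto simp: points_def)
  show 1: "(chart_inv C x, tens2_scale (s\<^sup>2) (g (chart_inv C x))) \<in> fst (bundle_chart A cf C g)"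
    using metric_bundleI[OF assms(2) p assms(4)] x by (simp add: bundle_chart_def)
  show 2: "snd (bundle_chart A cf C g) (chart_inv C x, tens2_scale (s\<^sup>2) (g (chart_inv C x))) = (x, s)"
    using fibre_coord_eq[OF assms(2) p assms(4)] x by (simp add: bundle_chart_def)
  show "chart_inv (bundle_chart A cf C g) (x, s) = (chart_inv C x, tens2_scale (s\<^sup>2) (g (chart_inv C x)))"
    by (rule chart_inv_eqI[OF bundle_chart_inj[OF assms(1,2)] 1 2])
qed

lemma bundle_chart_range:
  assumes "C \<in> A" "g \<in> cf"
  shows "snd (bundle_chart A cf C g) ` fst (bundle_chart A cf C g) = (snd C ` fst C) \<times> {0<..}"
proof
  show "snd (bundle_chart A cf C g) ` fst (bundle_chart A cf C g) \<subseteq> (snd C ` fst C) \<times> {0<..}"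
    using fibre_coord[OF assms(2)] by (auto simp: bundle_chart_def)
  show "(snd C ` fst C) \<times> {0<..} \<subseteq> snd (bundle_chart A cf C g) ` fst (bundle_chart A cf C g)"
  proof
    fix z assume "z \<in> (snd C ` fst C) \<times> {0::real<..}"
    then obtain x s where "z = (x, s)" "x \<in> snd C ` fst C" "s > 0" by auto
    then show "z \<in> snd (bundle_chart A cf C g) ` fst (bundle_chart A cf C g)"
      using bundle_chart_inv[OF assms, of x s] by (metis image_eqI)
  qed
qed

lemma bundle_chart_overlap:
  assumes "C \<in> A" "g \<in> cf" "D \<in> A" "g' \<in> cf"
  shows "chart_image (bundle_chart A cf C g) (fst (bundle_chart A cf D g')) = chart_image C (fst D) \<times> {0<..}"
proof -
  have "(x, s) \<in> chart_image (bundle_chart A cf C g) (fst (bundle_chart A cf D g'))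
      \<longleftrightarrow> (x, s) \<in> chart_image C (fst D) \<times> {0<..}" for x s
  proof (cases "x \<in> snd C ` fst C \<and> s > 0")
    case True
    note inv = bundle_chart_inv[OF assms(1,2), of x s]
    have "(x, s) \<in> snd (bundle_chart A cf C g) ` fst (bundle_chart A cf C g)"
      using True bundle_chart_range[OF assms(1,2)] by simp
    moreover have "chart_inv (bundle_chart A cf C g) (x, s) \<in> fst (bundle_chart A cf D g') \<longleftrightarrow> chart_inv C x \<in> fst D"
      using inv True by (simp add: bundle_chart_def)
    ultimately show ?thesis using True by (simp add: chart_image_def)
  next
    case False
    then show ?thesis using bundle_chart_range[OF assms(1,2)] by (auto simp: chart_image_def)
  qed
  then show ?thesis by auto
qed

text \<open>The transition map combines a transition of the base with multiplication of the fibre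
  coordinate by exp \<upsilon>, where exp (2 \<upsilon>) is the conformal factor between the two
  representatives and is smooth on the base.\<close>

lemma smooth_bundle_atlas: "smooth_atlas BA"
proof (rule smooth_atlasI)
  fix B assume "B \<in> BA"
  then obtain C g where C: "C \<in> A" "g \<in> cf" and B: "B = bundle_chart A cf C g"
    by (auto simp: bundle_atlas_def)
  show "inj_on (snd B) (fst B)" unfolding B by (rule bundle_chart_inj[OF C])
  show "open (snd B ` fst B)" unfolding B bundle_chart_range[OF C]
    using base.chart_open[OF C(1)] by (intro open_Times) auto
  fix B' assume "B' \<in> BA"
  then obtain D g' where D: "D \<in> A" "g' \<in> cf" and B': "B' = bundle_chart A cf D g'"
    by (auto simp: bundle_atlas_def)
  let ?U = "chart_image C (fst D) \<times> {0::real<..}"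
  have op: "open ?U" using base.overlap_open[OF C(1) D(1)] by (intro open_Times) auto
  then show "open (chart_image B (fst B'))" unfolding B B' bundle_chart_overlap[OF C D] .
  obtain \<upsilon> where \<upsilon>: "smooth_fun A (points A) \<upsilon>" "\<And>p. g p = tens2_scale (exp (2 * \<upsilon> p)) (g' p)"
    using cf_related[OF D(2) C(2)] by blast
  let ?t = "\<lambda>z. ((snd D \<circ> chart_inv C) (fst z), snd z * exp ((\<upsilon> \<circ> chart_inv C) (fst z)))"
  have "smooth_on ?U (\<lambda>z. (snd D \<circ> chart_inv C) (fst z))"
    by (rule smooth_on_compose[OF op base.overlap_open[OF C(1) D(1)] _ _ base.transition_smooth[OF C(1) D(1)]])
      (auto intro: smooth_on_bounded_linear[OF op bounded_linear_fst])
  moreover have "smooth_on ?U (\<lambda>z. (\<upsilon> \<circ> chart_inv C) (fst z))"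
  proof (rule smooth_on_compose[OF op base.overlap_open[OF C(1) D(1)]])
    have "chart_image C (fst D) \<subseteq> chart_image C (points A)"
      using D(1) by (auto simp: chart_image_def points_def)
    then show "smooth_on (chart_image C (fst D)) (\<upsilon> \<circ> chart_inv C)"
      using \<upsilon>(1) C(1) smooth_on_subset unfolding smooth_fun_def by blast
  qed (auto intro: smooth_on_bounded_linear[OF op bounded_linear_fst])
  ultimately have "smooth_on ?U ?t"
    by (intro smooth_on_intros op)
  moreover have "(snd B' \<circ> chart_inv B) z = ?t z" if z: "z \<in> ?U" for z
  proof -
    obtain x s where xs: "z = (x, s)" "x \<in> chart_image C (fst D)" "s > 0" using z by auto
    define p where "p = chart_inv C x"
    have p: "p \<in> fst C" "p \<in> fst D" "p \<in> points A"
      using base.chart_inv_mem[OF xs(2)] C(1) by (auto simp: points_def p_def)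
    have "chart_inv B z = (p, tens2_scale (s\<^sup>2) (g p))"
      unfolding xs(1) B p_def by (rule bundle_chart_inv(3)[OF C _ xs(3)]) (use xs(2) in \<open>simp add: chart_image_def\<close>)
    moreover have "tens2_scale (s\<^sup>2) (g p) = tens2_scale ((s * exp (\<upsilon> p))\<^sup>2) (g' p)"
      by (simp add: \<upsilon>(2) tens2_scale_scale power_mult_distrib exp_double)
    ultimately show ?thesis
      using fibre_coord_eq[OF D(2) p(3), of "s * exp (\<upsilon> p)"] xs
      by (simp add: B' bundle_chart_def p_def)
  qed
  ultimately show "smooth_on (chart_image B (fst B')) (snd B' \<circ> chart_inv B)"
    unfolding B B' bundle_chart_overlap[OF C D] using smooth_on_cong[OF op, of _ ?t] B B' by blast
qed

section \<open>Ambient charts as products of bundle charts with the interval\<close>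

definition achart :: "('a, 'e) bchart \<Rightarrow> ('a, 'e) achart" where
  "achart B = (fst B \<times> {-1<..<1}, \<lambda>q. (snd B (fst q), snd q))"

lemma ambient_atlas_eq: "M = achart ` BA"
  unfolding ambient_atlas_def achart_def[abs_def] by blast

lemma achart_inj: "inj_on (snd B) (fst B) \<Longrightarrow> inj_on (snd (achart B)) (fst (achart B))"
  by (auto simp: achart_def inj_on_def)

lemma achart_range: "snd (achart B) ` fst (achart B) = (snd B ` fst B) \<times> {-1<..<1}"
  by (force simp: achart_def)

lemma achart_inv:
  assumes "inj_on (snd B) (fst B)" "z \<in> snd B ` fst B" "r \<in> {-1<..<1}"
  shows "chart_inv (achart B) (z, r) = (chart_inv B z, r)"
proof (rule chart_inv_eqI[OF achart_inj[OF assms(1)]])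
  have "chart_inv B z \<in> fst B" "snd B (chart_inv B z) = z"
    using assms(2) by (auto simp: chart_inv_def f_inv_into_f inv_into_into)
  then show "(chart_inv B z, r) \<in> fst (achart B)" "snd (achart B) (chart_inv B z, r) = (z, r)"
    using assms(3) by (auto simp: achart_def)
qed

lemma achart_overlap:
  assumes "inj_on (snd B) (fst B)"
  shows "chart_image (achart B) (fst (achart B')) = chart_image B (fst B') \<times> {-1<..<1}"
proof -
  have "(z, r) \<in> chart_image (achart B) (fst (achart B')) \<longleftrightarrow> (z, r) \<in> chart_image B (fst B') \<times> {-1<..<1}" for z r
  proof (cases "z \<in> snd B ` fst B \<and> r \<in> {-1<..<1}")
    case True
    then have "(z, r) \<in> (snd B ` fst B) \<times> {-1<..<1}" by auto
    then show ?thesis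
      using achart_inv[OF assms, of z r] True unfolding chart_image_def achart_range by (simp add: achart_def)
  next
    case False
    then show ?thesis unfolding chart_image_def achart_range by auto
  qed
  then show ?thesis by auto
qed

lemma smooth_ambient_atlas: "smooth_atlas M"
proof (rule smooth_atlasI)
  interpret ba: atlas BA by unfold_locales (rule smooth_bundle_atlas)
  fix K assume "K \<in> M"
  then obtain B where B: "B \<in> BA" and K: "K = achart B" by (auto simp: ambient_atlas_eq)
  note inj = ba.chart_inj[OF B]
  show "inj_on (snd K) (fst K)" unfolding K by (rule achart_inj[OF inj])
  show "open (snd K ` fst K)" unfolding K achart_range
    using ba.chart_open[OF B] by (intro open_Times) auto
  fix K' assume "K' \<in> M"
  then obtain B' where B': "B' \<in> BA" and K': "K' = achart B'" by (auto simp: ambient_atlas_eq)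
  let ?U = "chart_image B (fst B') \<times> {-1<..<1::real}"
  have op: "open ?U" using ba.overlap_open[OF B B'] by (intro open_Times) auto
  then show "open (chart_image K (fst K'))" unfolding K K' achart_overlap[OF inj] .
  let ?t = "\<lambda>z. ((snd B' \<circ> chart_inv B) (fst z), snd z)"
  have "smooth_on ?U (\<lambda>z. (snd B' \<circ> chart_inv B) (fst z))"
    by (rule smooth_on_compose[OF op ba.overlap_open[OF B B'] _ _ ba.transition_smooth[OF B B']])
      (auto intro: smooth_on_bounded_linear[OF op bounded_linear_fst])
  then have "smooth_on ?U ?t" by (intro smooth_on_intros op)
  moreover have "(snd K' \<circ> chart_inv K) z = ?t z" if "z \<in> ?U" for z
    using that achart_inv[OF inj, of "fst z" "snd z"] by (auto simp: K K' achart_def chart_image_def)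
  ultimately show "smooth_on (chart_image K (fst K')) (snd K' \<circ> chart_inv K)"
    unfolding K K' achart_overlap[OF inj] using smooth_on_cong[OF op, of _ ?t] K K' by blast
qed

end

sublocale conformal \<subseteq> bdl: atlas "bundle_atlas A cf"
  by unfold_locales (rule smooth_bundle_atlas)

sublocale conformal \<subseteq> amb: atlas "ambient_atlas A cf"
  by unfold_locales (rule smooth_ambient_atlas)

context conformal
begin

lemma points_BA: "points BA = MB"
proof -
  have "y \<in> points BA" if y: "y \<in> MB" for y
  proof -
    obtain g where g: "g \<in> cf" using cf_nonempty by blast
    then have "fst y \<in> points A" using fibre_coord(3) y by blast
    then obtain C where "C \<in> A" "fst y \<in> fst C" by (auto simp: points_def)
    then have "bundle_chart A cf C g \<in> BA" unfolding bundle_atlas_def using g by blast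
    moreover have "y \<in> fst (bundle_chart A cf C g)"
      using \<open>fst y \<in> fst C\<close> y by (simp add: bundle_chart_def)
    ultimately show ?thesis by (auto simp: points_def)
  qed
  moreover have "points BA \<subseteq> MB" by (auto simp: points_def bundle_atlas_def bundle_chart_def)
  ultimately show ?thesis by blast
qed

lemma points_M: "points M = MB \<times> {-1<..<1}"
proof -
  have "points M = points BA \<times> {-1<..<1}" by (auto simp: points_def ambient_atlas_eq achart_def)
  then show ?thesis by (simp add: points_BA)
qed

lemma achart_M: "B \<in> BA \<Longrightarrow> achart B \<in> M"
  by (simp add: ambient_atlas_eq)

lemma M_cases: "K \<in> M \<Longrightarrow> (\<And>B. B \<in> BA \<Longrightarrow> K = achart B \<Longrightarrow> P) \<Longrightarrow> P"
  by (auto simp: ambient_atlas_eq)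

text \<open>In every ambient chart the dilation by \<open>s\<close> and the Euler field have the
  coordinate expressions \<open>lam s\<close> and \<open>Tvec\<close>, because the fibre coordinates
  of all representatives scale alike. Both expressions are linear in the point.\<close>

definition lam :: "real \<Rightarrow> ('e \<times> real) \<times> real \<Rightarrow> ('e \<times> real) \<times> real" where
  "lam s z = ((fst (fst z), s * snd (fst z)), snd z)"

definition Tvec :: "('e \<times> real) \<times> real \<Rightarrow> ('e \<times> real) \<times> real" where
  "Tvec z = ((0, snd (fst z)), 0)"

lemma bounded_linear_lam: "bounded_linear (lam s)"
  unfolding lam_def[abs_def]
  by (intro bounded_linear_Pair bounded_linear_const_mult bounded_linear_compose[OF bounded_linear_fst]
      bounded_linear_compose[OF bounded_linear_snd] bounded_linear_fst bounded_linear_snd)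

lemma bounded_linear_Tvec: "bounded_linear Tvec"
  unfolding Tvec_def[abs_def]
  by (intro bounded_linear_Pair bounded_linear_zero
      bounded_linear_compose[OF bounded_linear_snd bounded_linear_fst])

lemma dilation_chart:
  assumes "B \<in> BA" "y \<in> fst B" "s > 0"
  shows "dilation s y \<in> fst B" "snd B (dilation s y) = (fst (snd B y), s * snd (snd B y))"
    "snd (snd B y) > 0"
proof -
  obtain C g where C: "C \<in> A" "g \<in> cf" and B: "B = bundle_chart A cf C g"
    using assms(1) by (auto simp: bundle_atlas_def)
  have y: "y \<in> MB" "fst y \<in> fst C" using assms(2) by (auto simp: B bundle_chart_def)
  show "dilation s y \<in> fst B"
    using dilation_MB[OF y(1) assms(3)] y by (simp add: B bundle_chart_def) (simp add: dilation_def)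
  show "snd B (dilation s y) = (fst (snd B y), s * snd (snd B y))"
    using fibre_coord_dilation[OF C(2) y(1) assms(3)] by (simp add: B bundle_chart_def dilation_def)
  show "snd (snd B y) > 0" using fibre_coord(1)[OF C(2) y(1)] by (simp add: B bundle_chart_def)
qed

lemma ambient_dilation_chart:
  assumes "K \<in> M" "q \<in> fst K" "s > 0"
  shows "ambient_dilation s q \<in> fst K" "snd K (ambient_dilation s q) = lam s (snd K q)"
    "snd (fst (snd K q)) > 0"
  using assms dilation_chart
  by (auto elim!: M_cases simp: achart_def ambient_dilation_def lam_def)

lemma euler_field_chart:
  assumes "K \<in> M" "q \<in> fst K"
  shows "euler_field K q = Tvec (snd K q)"
proof -
  have "((\<lambda>s. lam s (snd K q)) has_vector_derivative Tvec (snd K q)) (at 1)"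
    unfolding lam_def Tvec_def by (auto intro!: derivative_eq_intros)
  then have "((\<lambda>s. snd K (ambient_dilation s q)) has_vector_derivative Tvec (snd K q)) (at 1)"
    by (rule has_vector_derivative_transform_within_open[of _ _ _ "{0<..}"])
      (use ambient_dilation_chart[OF assms] in auto)
  then show ?thesis unfolding euler_field_def by (rule vector_derivative_at)
qed

end

section \<open>Neighbourhoods of the metric bundle\<close>

context conformal
begin

abbreviation "nbhd \<equiv> ambient_nbhd A cf"
abbreviation "near \<equiv> near_bundle A cf"
abbreviation "sm \<equiv> smooth_near_bundle A cf"
abbreviation "AD \<equiv> ambient_density A cf"

lemma nbhd_open: "nbhd W \<Longrightarrow> openin (atlas_topology M) W"
  and nbhd_bundle: "nbhd W \<Longrightarrow> y \<in> MB \<Longrightarrow> (y, 0) \<in> W"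
  and nbhd_dilation: "nbhd W \<Longrightarrow> q \<in> W \<Longrightarrow> s > 0 \<Longrightarrow> ambient_dilation s q \<in> W"
  unfolding ambient_nbhd_def bundle_incl_def by (auto simp: image_subset_iff)

lemma nbhdI:
  assumes "openin (atlas_topology M) W" "\<And>y. y \<in> MB \<Longrightarrow> (y, 0) \<in> W"
    "\<And>q s. q \<in> W \<Longrightarrow> s > 0 \<Longrightarrow> ambient_dilation s q \<in> W"
  shows "nbhd W"
  using assms unfolding ambient_nbhd_def bundle_incl_def by auto

lemma nbhd_points: "nbhd W \<Longrightarrow> q \<in> W \<Longrightarrow> q \<in> points M"
  using nbhd_open amb.openin_iff by blast

lemma nbhd_fst: "nbhd W \<Longrightarrow> q \<in> W \<Longrightarrow> fst q \<in> MB"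
  using nbhd_points by (fastforce simp: points_M)

lemma nbhd_Int: "nbhd W \<Longrightarrow> nbhd W' \<Longrightarrow> nbhd (W \<inter> W')"
  by (intro nbhdI openin_Int) (auto simp: nbhd_open nbhd_bundle nbhd_dilation)

lemma nbhd_whole: "nbhd (points M)"
proof (rule nbhdI)
  have "chart_image K (points M) = snd K ` fst K" if "K \<in> M" for K
    using that by (auto simp: chart_image_def points_def amb.chart_inv_chart[OF that])
  then show "openin (atlas_topology M) (points M)" using amb.chart_open by (simp add: amb.openin_iff)
qed (auto simp: points_M ambient_dilation_def dilation_MB)

lemma near_mono: "near P \<Longrightarrow> (\<And>q. P q \<Longrightarrow> Q q) \<Longrightarrow> near Q"
  unfolding near_bundle_def by blast

lemma near_conj: "near P \<Longrightarrow> near Q \<Longrightarrow> near (\<lambda>q. P q \<and> Q q)"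
  unfolding near_bundle_def using nbhd_Int by (metis IntD1 IntD2)

lemma near_mp2: "near P \<Longrightarrow> near Q \<Longrightarrow> (\<And>q. P q \<Longrightarrow> Q q \<Longrightarrow> R q) \<Longrightarrow> near R"
  using near_mono[OF near_conj] by metis

lemma near_mp3: "near P \<Longrightarrow> near Q \<Longrightarrow> near R \<Longrightarrow> (\<And>q. P q \<Longrightarrow> Q q \<Longrightarrow> R q \<Longrightarrow> S q) \<Longrightarrow> near S"
  using near_mp2[OF near_conj] by metis

lemma near_points: "near (\<lambda>q. q \<in> points M)"
  unfolding near_bundle_def using nbhd_whole by blast

lemma near_always: "(\<And>q. P q) \<Longrightarrow> near P"
  using near_mono[OF near_points] by blast

lemma near_nbhd: "nbhd W \<Longrightarrow> (\<And>q. q \<in> W \<Longrightarrow> P q) \<Longrightarrow> near P"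
  unfolding near_bundle_def by blast

lemma near_on_bundle: "near P \<Longrightarrow> y \<in> MB \<Longrightarrow> P (y, 0)"
  unfolding near_bundle_def using nbhd_bundle by blast

lemma chart_image_star:
  assumes K: "K \<in> M" and W: "W \<subseteq> points M"
  shows "chart_image K {q \<in> W. \<forall>t\<in>{0..1}. (fst q, t * snd q) \<in> W}
    = {z. \<forall>t\<in>{0..1}. (fst z, t * snd z) \<in> chart_image K W}"
proof -
  obtain B where B: "B \<in> BA" "K = achart B" using K by (rule M_cases)
  have inv: "chart_inv K (z, r) = (chart_inv B z, r)" if "z \<in> snd B ` fst B" "r \<in> {-1<..<1}" for z r
    unfolding B(2) by (rule achart_inv[OF bdl.chart_inj[OF B(1)] that])
  have "(z, r) \<in> chart_image K {q \<in> W. \<forall>t\<in>{0..1}. (fst q, t * snd q) \<in> W}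
    \<longleftrightarrow> (z, r) \<in> {z. \<forall>t\<in>{0..1}. (fst z, t * snd z) \<in> chart_image K W}" for z r
  proof (cases "z \<in> snd B ` fst B \<and> r \<in> {-1<..<1}")
    case True
    then have t: "t * r \<in> {-1<..<1}" if "t \<in> {0..1}" for t
    proof -
      have "\<bar>t * r\<bar> \<le> 1 * \<bar>r\<bar>" unfolding abs_mult by (rule mult_right_mono) (use that in auto)
      then show ?thesis using True by (auto simp: abs_if split: if_splits)
    qed
    have one: "(chart_inv B z, r) \<in> W" if "\<forall>t\<in>{0..1}. (chart_inv B z, t * r) \<in> W"
      using bspec[OF that, of 1] by simp
    have "(z, t * r) \<in> chart_image K W \<longleftrightarrow> (chart_inv B z, t * r) \<in> W" if "t \<in> {0..1}" for t
      using True t[OF that] inv[of z "t * r"] unfolding chart_image_def B(2) achart_range by simp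
    moreover have "(z, r) \<in> chart_image K {q \<in> W. \<forall>t\<in>{0..1}. (fst q, t * snd q) \<in> W}
      \<longleftrightarrow> (\<forall>t\<in>{0..1}. (chart_inv B z, t * r) \<in> W)"
      using True inv[of z r] one unfolding chart_image_def B(2) achart_range by auto
    ultimately show ?thesis by simp
  next
    case False
    then have "(z, r) \<notin> snd K ` fst K" unfolding B(2) achart_range by auto
    then have "(z, 1 * r) \<notin> chart_image K W" "(z, r) \<notin> chart_image K {q \<in> W. \<forall>t\<in>{0..1}. (fst q, t * snd q) \<in> W}"
      unfolding chart_image_def by simp_all
    moreover have "(1::real) \<in> {0..1}" by simp
    ultimately show ?thesis by (metis (mono_tags, lifting) fst_conv mem_Collect_eq snd_conv)
  qed
  then show ?thesis by auto
qed

text \<open>Hadamard's lemma integrates along the fibres down to r = 0, which requires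
  neighbourhoods that are star-shaped in r. The largest such subset of \<open>W\<close> is open by
  \<open>open_star_core\<close>, and it is dilation invariant because dilations fix r.\<close>

lemma nbhd_star:
  assumes "nbhd W"
  obtains W' where "nbhd W'" "W' \<subseteq> W" "\<forall>y r t. (y, r) \<in> W' \<longrightarrow> t \<in> {0..1} \<longrightarrow> (y, t * r) \<in> W'"
proof
  let ?W' = "{q \<in> W. \<forall>t\<in>{0..1}. (fst q, t * snd q) \<in> W}"
  note W = nbhd_open[OF assms]
  show "nbhd ?W'"
  proof (rule nbhdI)
    have "W \<subseteq> points M" using W by (simp add: amb.openin_iff)
    then have "open (chart_image K ?W')" if "K \<in> M" for K
      using open_star_core[OF amb.open_chart_image[OF W that]] chart_image_star[OF that, of W] by simp
    then show "openin (atlas_topology M) ?W'" using W unfolding amb.openin_iff by auto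
  next
    fix q s assume "q \<in> ?W'" "(s::real) > 0"
    then show "ambient_dilation s q \<in> ?W'"
      using nbhd_dilation[OF assms, of "(fst q, _)" s] nbhd_dilation[OF assms, of q s]
      by (auto simp: ambient_dilation_def)
  qed (auto simp: nbhd_bundle[OF assms])
  show "?W' \<subseteq> W" by auto
  show "\<forall>y r t. (y, r) \<in> ?W' \<longrightarrow> t \<in> {0..1} \<longrightarrow> (y, t * r) \<in> ?W'"
  proof (intro allI impI)
    fix y r t assume yr: "(y, r) \<in> ?W'" and t: "t \<in> {0..1::real}"
    have "(y, t' * (t * r)) \<in> W" if "t' \<in> {0..1}" for t'
    proof -
      have "t' * t \<in> {0..1}" using t that by (auto intro: mult_le_one)
      then show ?thesis using yr by (simp add: mult.assoc[symmetric])
    qed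
    then show "(y, t * r) \<in> ?W'" using yr t by auto
  qed
qed

section \<open>Smooth functions and densities near the metric bundle\<close>

lemma nearE:
  assumes "near P"
  obtains W where "nbhd W" "\<forall>q\<in>W. P q"
  using assms unfolding near_bundle_def by blast

lemma smE:
  assumes "sm f" "near P"
  obtains W where "nbhd W" "smooth_fun M W f" "\<forall>q\<in>W. P q"
proof -
  obtain W1 where 1: "nbhd W1" "smooth_fun M W1 f" using assms(1) unfolding smooth_near_bundle_def by blast
  obtain W2 where 2: "nbhd W2" "\<forall>q\<in>W2. P q" by (rule nearE[OF assms(2)])
  show thesis
    by (rule that[OF nbhd_Int[OF 1(1) 2(1)] amb.smooth_fun_subset[OF 1(2)]]) (use 2 in auto)
qed

lemma smI: "nbhd W \<Longrightarrow> smooth_fun M W f \<Longrightarrow> sm f"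
  unfolding smooth_near_bundle_def by blast

lemma sm2E:
  assumes "sm f" "sm h" "near P"
  obtains W where "nbhd W" "smooth_fun M W f" "smooth_fun M W h" "\<forall>q\<in>W. P q"
proof -
  obtain W1 where 1: "nbhd W1" "smooth_fun M W1 f" "\<forall>q\<in>W1. P q" by (rule smE[OF assms(1,3)])
  obtain W2 where 2: "nbhd W2" "smooth_fun M W2 h" using assms(2) unfolding smooth_near_bundle_def by blast
  show thesis
    by (rule that[OF nbhd_Int[OF 1(1) 2(1)] amb.smooth_fun_subset[OF 1(2)] amb.smooth_fun_subset[OF 2(2)]])
      (use 1 in auto)
qed

lemma sm_map2:
  assumes "sm f" "sm h"
    and "\<And>W. openin (atlas_topology M) W \<Longrightarrow> smooth_fun M W f \<Longrightarrow> smooth_fun M W h \<Longrightarrow> smooth_fun M W k"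
  shows "sm k"
proof -
  obtain W where "nbhd W" "smooth_fun M W f" "smooth_fun M W h" by (rule sm2E[OF assms(1,2) near_points])
  then show ?thesis using assms(3)[OF nbhd_open] by (intro smI)
qed

lemma sm_cong:
  assumes "sm f" "near (\<lambda>q. f q = h q)"
  shows "sm h"
proof -
  obtain W where W: "nbhd W" "smooth_fun M W f" "\<forall>q\<in>W. f q = h q" by (rule smE[OF assms])
  then show ?thesis using amb.smooth_fun_cong[OF nbhd_open[OF W(1)], of f h] smI by blast
qed

lemma sm_const: "sm (\<lambda>q. c)"
  by (rule smI[OF nbhd_whole amb.smooth_fun_const[OF nbhd_open[OF nbhd_whole]]])

lemma sm_add: "sm f \<Longrightarrow> sm h \<Longrightarrow> sm (\<lambda>q. f q + h q)"
  by (erule (1) sm_map2) (rule amb.smooth_fun_add)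

lemma sm_diff: "sm f \<Longrightarrow> sm h \<Longrightarrow> sm (\<lambda>q. f q - h q)"
  by (erule (1) sm_map2) (rule amb.smooth_fun_diff)

lemma sm_mult: "sm f \<Longrightarrow> sm h \<Longrightarrow> sm (\<lambda>q. f q * h q)"
  by (erule (1) sm_map2) (rule amb.smooth_fun_mult)

lemma sm_cmult: "sm f \<Longrightarrow> sm (\<lambda>q. c * f q)"
  using sm_mult[OF sm_const] .

lemma sm_power: "sm f \<Longrightarrow> sm (\<lambda>q. f q ^ k)"
  by (induction k) (auto simp: sm_const sm_mult)

lemma sm_ln:
  assumes "sm f" "near (\<lambda>q. f q > 0)"
  shows "sm (\<lambda>q. ln (f q))"
proof -
  obtain W where W: "nbhd W" "smooth_fun M W f" "\<forall>q\<in>W. f q > 0" by (rule smE[OF assms])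
  then show ?thesis using amb.smooth_fun_ln[OF nbhd_open[OF W(1)] W(2)] smI by blast
qed

text \<open>Properties near the bundle become eventual properties of r on every fibre, so germs
  along the bundle can be compared through limits as r tends to 0.\<close>

lemma near_fibre:
  assumes "near P" "y \<in> MB"
  shows "\<forall>\<^sub>F r in nhds 0. P (y, r)"
proof -
  obtain W where W: "nbhd W" "\<And>q. q \<in> W \<Longrightarrow> P q" using assms(1) unfolding near_bundle_def by blast
  have yW: "(y, 0) \<in> W" by (rule nbhd_bundle[OF W(1) assms(2)])
  obtain K where K: "K \<in> M" "(y, 0) \<in> fst K" using nbhd_points[OF W(1) yW] by (auto simp: points_def)
  obtain B where B: "B \<in> BA" "K = achart B" using K(1) by (rule M_cases)
  have y: "y \<in> fst B" using K(2) by (simp add: B(2) achart_def)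
  let ?U = "chart_image K W"
  have "open ((\<lambda>r. (snd B y, r)) -` ?U)"
    by (intro open_vimage amb.open_chart_image[OF nbhd_open[OF W(1)] K(1)] continuous_intros)
  moreover have "0 \<in> (\<lambda>r. (snd B y, r)) -` ?U"
    using amb.chart_image_mem[OF K, of W] yW by (simp add: B(2) achart_def)
  moreover have "P (y, r)" if "r \<in> (\<lambda>r. (snd B y, r)) -` ?U" for r
  proof -
    have "(snd B y, r) \<in> ?U" using that by simp
    then have "r \<in> {-1<..<1}" "chart_inv K (snd B y, r) \<in> W"
      unfolding chart_image_def B(2) achart_range by auto
    moreover from this have "chart_inv K (snd B y, r) = (y, r)"
      using achart_inv[OF bdl.chart_inj[OF B(1)], of "snd B y" r] y bdl.chart_inv_chart[OF B(1) y] by (simp add: B(2))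
    ultimately show ?thesis using W(2) by simp
  qed
  ultimately show ?thesis unfolding eventually_nhds by blast
qed

lemma fibre_chart:
  assumes "nbhd W" "y \<in> MB"
  obtains B where "B \<in> BA" "y \<in> fst B" "snd B y = fst (snd (achart B) (y, 0))"
    "(snd B y, 0) \<in> chart_image (achart B) W"
    "\<forall>r\<in>{-1<..<1}. chart_inv (achart B) (snd B y, r) = (y, r)"
proof -
  have yW: "(y, 0) \<in> W" by (rule nbhd_bundle[OF assms])
  obtain K where K: "K \<in> M" "(y, 0) \<in> fst K" using nbhd_points[OF assms(1) yW] by (auto simp: points_def)
  obtain B where B: "B \<in> BA" "K = achart B" using K(1) by (rule M_cases)
  have y: "y \<in> fst B" using K(2) by (simp add: B(2) achart_def)
  show thesis
  proof (rule that[OF B(1) y])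
    show "snd B y = fst (snd (achart B) (y, 0))" by (simp add: achart_def)
    show "(snd B y, 0) \<in> chart_image (achart B) W"
      using amb.chart_image_mem[OF K, of W] yW by (simp add: B(2) achart_def)
    show "\<forall>r\<in>{-1<..<1}. chart_inv (achart B) (snd B y, r) = (y, r)"
      using achart_inv[OF bdl.chart_inj[OF B(1)], of "snd B y"] y bdl.chart_inv_chart[OF B(1) y] by simp
  qed
qed

lemma sm_fibre_tendsto:
  assumes "sm f" "y \<in> MB"
  shows "((\<lambda>r. f (y, r)) \<longlongrightarrow> f (y, 0)) (at 0)"
proof -
  obtain W where W: "nbhd W" "smooth_fun M W f" using assms(1) unfolding smooth_near_bundle_def by blast
  obtain B where B: "B \<in> BA" "(snd B y, 0) \<in> chart_image (achart B) W"
    "\<forall>r\<in>{-1<..<1}. chart_inv (achart B) (snd B y, r) = (y, r)"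
    by (rule fibre_chart[OF W(1) assms(2)]) (rule that)
  have B3: "chart_inv (achart B) (snd B y, r) = (y, r)" if "r \<in> {-1<..<1}" for r
    using B(3) that by blast
  have "smooth_on (chart_image (achart B) W) (f \<circ> chart_inv (achart B))"
    using W(2) achart_M[OF B(1)] by (simp add: smooth_fun_def)
  then have "isCont (f \<circ> chart_inv (achart B)) (snd B y, 0)" using B(2) by (rule smooth_on_isCont)
  moreover have "isCont (\<lambda>r. (snd B y, r)) (0::real)" by (intro continuous_intros)
  ultimately have "isCont (\<lambda>r. (f \<circ> chart_inv (achart B)) (snd B y, r)) 0"
    by (rule isCont_o2[rotated])
  then have "((\<lambda>r. (f \<circ> chart_inv (achart B)) (snd B y, r)) \<longlongrightarrow> f (y, 0)) (at 0)"
    using B3[of 0] by (simp add: isCont_def)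
  moreover have "\<forall>\<^sub>F r in at 0. r \<in> {-1<..<1::real}"
    by (rule eventually_at_in_open') auto
  then have "\<forall>\<^sub>F r in at 0. (f \<circ> chart_inv (achart B)) (snd B y, r) = f (y, r)"
    by eventually_elim (simp add: B3)
  ultimately show ?thesis by (rule Lim_transform_eventually)
qed

lemma near_fibre_at: "near P \<Longrightarrow> y \<in> MB \<Longrightarrow> \<forall>\<^sub>F r in at 0. P (y, r)"
  by (drule (1) near_fibre) (simp add: eventually_nhds_conv_at)

text \<open>Off the bundle the factor can be divided out; on the bundle, equality follows by
  continuity in r.\<close>

lemma near_cancel_snd:
  assumes "sm a" "sm b" "near (\<lambda>q. snd q * a q = snd q * b q)"
  shows "near (\<lambda>q. a q = b q)"
proof -
  have "a (y, 0) = b (y, 0)" if y: "y \<in> MB" for y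
  proof -
    have "\<forall>\<^sub>F r in at 0. r \<noteq> (0::real)" by (simp add: eventually_at_filter)
    with near_fibre_at[OF assms(3) y] have "\<forall>\<^sub>F r in at 0. a (y, r) = b (y, r)"
      by eventually_elim simp
    then have "((\<lambda>r. b (y, r)) \<longlongrightarrow> a (y, 0)) (at 0)"
      by (rule Lim_transform_eventually[OF sm_fibre_tendsto[OF assms(1) y]])
    then show ?thesis using sm_fibre_tendsto[OF assms(2) y] by (rule tendsto_unique[rotated]) simp
  qed
  then have on: "a q = b q" if "q \<in> points M" "snd q = 0" for q
    using that by (cases q) (auto simp: points_M)
  show ?thesis
  proof (rule near_mp2[OF assms(3) near_points])
    fix q assume "snd q * a q = snd q * b q" "q \<in> points M"
    then show "a q = b q" using on[of q] by (cases "snd q = 0") auto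
  qed
qed

lemma hadamard:
  assumes "sm f" "\<And>y. y \<in> MB \<Longrightarrow> f (y, 0) = 0"
  obtains h where "sm h" "near (\<lambda>q. f q = snd q * h q)"
proof -
  obtain W0 where W0: "nbhd W0" "smooth_fun M W0 f" using assms(1) unfolding smooth_near_bundle_def by blast
  obtain W where W: "nbhd W" "W \<subseteq> W0" "\<forall>y r t. (y, r) \<in> W \<longrightarrow> t \<in> {0..1} \<longrightarrow> (y, t * r) \<in> W"
    by (rule nbhd_star[OF W0(1)])
  have f: "smooth_fun M W f" by (rule amb.smooth_fun_subset[OF W0(2) W(2)])
  \<comment> \<open>All ambient charts share the coordinate r, so the derivative along a fibre gives
    a value on the bundle that refers to no chart.\<close>
  define h where "h q = (if snd q = 0 then vector_derivative (\<lambda>r. f (fst q, r)) (at 0) else f q / snd q)" for q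
  have "smooth_fun M W h" unfolding smooth_fun_def
  proof
    fix K assume K: "K \<in> M"
    obtain B where B: "B \<in> BA" "K = achart B" using K by (rule M_cases)
    let ?U = "chart_image K W" and ?F = "f \<circ> chart_inv K"
    note op = amb.open_chart_image[OF nbhd_open[OF W(1)] K]
    have sF: "smooth_on ?U ?F" using f K by (simp add: smooth_fun_def)
    have rng: "z \<in> snd B ` fst B" "r \<in> {-1<..<1}" if "(z, r) \<in> ?U" for z r
      using that unfolding chart_image_def B(2) achart_range by auto
    have inv: "chart_inv K (z, r) = (chart_inv B z, r)" if "z \<in> snd B ` fst B" "r \<in> {-1<..<1}" for z r
      unfolding B(2) by (rule achart_inv[OF bdl.chart_inj[OF B(1)] that])
    have star: "(z, t * r) \<in> ?U" if zr: "(z, r) \<in> ?U" and t: "t \<in> {0..1}" for z r t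
    proof -
      have "{q \<in> W. \<forall>t\<in>{0..1}. (fst q, t * snd q) \<in> W} = W" using W(3) by auto
      then have "chart_image K W = {z. \<forall>t\<in>{0..1}. (fst z, t * snd z) \<in> chart_image K W}"
        using chart_image_star[OF K, of W] nbhd_points[OF W(1)] by (simp add: subsetI)
      then have "\<forall>t\<in>{0..1}. (fst (z, r), t * snd (z, r)) \<in> chart_image K W" using zr by blast
      then show ?thesis using t by simp
    qed
    have zero: "?F (z, 0) = 0" if "(z, 0) \<in> ?U" for z
    proof -
      have "chart_inv K (z, 0) \<in> W" using amb.chart_inv_mem[OF that] by blast
      then show ?thesis using inv[OF rng[OF that]] nbhd_fst[OF W(1)] assms(2) by fastforce
    qed
    have "smooth_on ?U (\<lambda>(z, r). if r = 0 then dird ?F (z, 0) (0, 1) else ?F (z, r) / r)"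
      by (rule smooth_on_divide_snd[OF op sF zero star])
    moreover have "(\<lambda>(z, r). if r = 0 then dird ?F (z, 0) (0, 1) else ?F (z, r) / r) x = (h \<circ> chart_inv K) x"
      if x: "x \<in> ?U" for x
    proof -
      obtain z r where zr: "x = (z, r)" by fastforce
      note rg = rng[OF x[unfolded zr]]
      show ?thesis
      proof (cases "r = 0")
        case False
        then show ?thesis using inv[OF rg] by (simp add: zr h_def)
      next
        case True
        have "?F differentiable (at ((z, 0) + 0 *\<^sub>R (0, 1)))"
          using smooth_on_differentiable[OF sF x] by (simp add: zr True)
        from has_derivative_along_line[OF this]
        have "((\<lambda>s. ?F (z, s)) has_vector_derivative dird ?F (z, 0) (0, 1)) (at 0)" by simp
        then have "((\<lambda>s. f (chart_inv B z, s)) has_vector_derivative dird ?F (z, 0) (0, 1)) (at 0)"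
          by (rule has_vector_derivative_transform_within_open[of _ _ _ "{-1<..<1}"]) (auto simp: inv rg)
        then show ?thesis using inv[OF rg] by (simp add: zr True h_def vector_derivative_at)
      qed
    qed
    ultimately show "smooth_on ?U (h \<circ> chart_inv K)" using smooth_on_cong[OF op] by blast
  qed
  then have "sm h" by (rule smI[OF W(1)])
  moreover have "near (\<lambda>q. f q = snd q * h q)"
  proof (rule near_mono[OF near_points])
    fix q assume "q \<in> points M"
    then have "fst q \<in> MB" by (auto simp: points_M)
    then show "f q = snd q * h q" using assms(2)[of "fst q"] by (cases q) (auto simp: h_def)
  qed
  ultimately show thesis by (rule that)
qed

section \<open>Algebra of ambient densities\<close>

lemma ADE: "AD w f \<Longrightarrow> sm f" "AD w f \<Longrightarrow> near (\<lambda>q. \<forall>s>0. f (ambient_dilation s q) = s powi w * f q)"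
  unfolding ambient_density_def by auto

lemma AD_cong:
  assumes "AD w f" "near (\<lambda>q. f q = h q)"
  shows "AD w h"
proof -
  obtain W where W: "nbhd W" "\<And>q. q \<in> W \<Longrightarrow> f q = h q \<and> (\<forall>s>0. f (ambient_dilation s q) = s powi w * f q)"
    using near_conj[OF assms(2) ADE(2)[OF assms(1)]] unfolding near_bundle_def by blast
  have "near (\<lambda>q. \<forall>s>0. h (ambient_dilation s q) = s powi w * h q)"
    by (rule near_nbhd[OF W(1)]) (metis W nbhd_dilation)
  then show ?thesis using sm_cong[OF ADE(1)[OF assms(1)] assms(2)] by (simp add: ambient_density_def)
qed

lemma ADI: "sm f \<Longrightarrow> near (\<lambda>q. \<forall>s>0. f (ambient_dilation s q) = s powi w * f q) \<Longrightarrow> AD w f"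
  unfolding ambient_density_def by blast

lemma AD_add:
  assumes "AD w f" "AD w h"
  shows "AD w (\<lambda>q. f q + h q)"
proof (rule ADI[OF sm_add[OF ADE(1)[OF assms(1)] ADE(1)[OF assms(2)]]])
  show "near (\<lambda>q. \<forall>s>0. f (ambient_dilation s q) + h (ambient_dilation s q) = s powi w * (f q + h q))"
    using ADE(2)[OF assms(1)] ADE(2)[OF assms(2)] by (rule near_mp2) (simp add: distrib_left)
qed

lemma AD_mult:
  assumes "AD w f" "AD w' h"
  shows "AD (w + w') (\<lambda>q. f q * h q)"
proof (rule ADI[OF sm_mult[OF ADE(1)[OF assms(1)] ADE(1)[OF assms(2)]]])
  show "near (\<lambda>q. \<forall>s>0. f (ambient_dilation s q) * h (ambient_dilation s q) = s powi (w + w') * (f q * h q))"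
    using ADE(2)[OF assms(1)] ADE(2)[OF assms(2)] by (rule near_mp2) (simp add: power_int_add)
qed

lemma AD_const: "AD 0 (\<lambda>q. c)"
  by (simp add: ambient_density_def sm_const near_always)

lemma AD_zero: "AD w (\<lambda>q. 0)"
  by (simp add: ambient_density_def sm_const near_always)

lemma AD_cmult: "AD w f \<Longrightarrow> AD w (\<lambda>q. c * f q)"
  using AD_mult[OF AD_const, of w f c] by simp

lemma AD_diff: "AD w f \<Longrightarrow> AD w h \<Longrightarrow> AD w (\<lambda>q. f q - h q)"
  using AD_add[OF _ AD_cmult[of w h "-1"]] by simp

lemma AD_sum: "finite I \<Longrightarrow> (\<And>i. i \<in> I \<Longrightarrow> AD w (f i)) \<Longrightarrow> AD w (\<lambda>q. \<Sum>i\<in>I. f i q)"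
  by (induction I rule: finite_induct) (auto simp: AD_zero AD_add)

lemma AD_power: "AD w f \<Longrightarrow> AD (int k * w) (\<lambda>q. f q ^ k)"
proof (induction k)
  case (Suc k)
  then show ?case using AD_mult[OF Suc.prems Suc.IH[OF Suc.prems]] by (simp add: algebra_simps)
qed (simp add: AD_const)

text \<open>The set where the square of \<open>f\<close> is positive is open, contains the bundle,
  and is dilation invariant by homogeneity, hence is an admissible neighbourhood. Squaring avoids a
  distinction of signs.\<close>

lemma AD_nonzero:
  assumes "AD w f" "\<And>y. y \<in> MB \<Longrightarrow> f (y, 0) \<noteq> 0"
  shows "near (\<lambda>q. f q \<noteq> 0)" "AD (- w) (\<lambda>q. inverse (f q))"
proof -
  obtain W where W: "nbhd W" "smooth_fun M W f" "\<forall>q\<in>W. \<forall>s>0. f (ambient_dilation s q) = s powi w * f q"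
    by (rule smE[OF ADE[OF assms(1)]])
  let ?W' = "{q \<in> W. f q * f q > 0}"
  have W': "nbhd ?W'"
  proof (rule nbhdI)
    show "openin (atlas_topology M) ?W'"
      by (intro amb.openin_superlevel amb.smooth_fun_mult nbhd_open W)
    show "(y, 0) \<in> ?W'" if "y \<in> MB" for y
      using nbhd_bundle[OF W(1) that] assms(2)[OF that] by (auto simp: zero_less_mult_iff)
    show "ambient_dilation s q \<in> ?W'" if "q \<in> ?W'" "s > 0" for q s
    proof -
      have "f (ambient_dilation s q) * f (ambient_dilation s q) = (s powi w * s powi w) * (f q * f q)"
        using W(3) that by simp
      moreover have "s powi w > 0" using that(2) by (rule zero_less_power_int)
      ultimately show ?thesis using nbhd_dilation[OF W(1), of q s] that by simp
    qed
  qed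
  then show nz: "near (\<lambda>q. f q \<noteq> 0)" by (rule near_nbhd) auto
  have "smooth_fun M ?W' (\<lambda>q. inverse (f q))"
    by (rule amb.smooth_fun_inverse[OF nbhd_open[OF W'] amb.smooth_fun_subset[OF W(2)]]) auto
  moreover have "near (\<lambda>q. \<forall>s>0. inverse (f (ambient_dilation s q)) = s powi (- w) * inverse (f q))"
    by (rule near_mono[OF ADE(2)[OF assms(1)]]) (simp add: power_int_minus inverse_mult_distrib)
  ultimately show "AD (- w) (\<lambda>q. inverse (f q))"
    using smI[OF W'] by (simp add: ambient_density_def)
qed

section \<open>Densities on the bundle and their extensions to the ambient space\<close>

lemma smooth_fun_chart_M:
  assumes "\<And>B. B \<in> BA \<Longrightarrow> smooth_on (chart_image (achart B) W) (\<lambda>z. f (chart_inv B (fst z), snd z))"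
    and W: "openin (atlas_topology M) W"
  shows "smooth_fun M W f"
  unfolding smooth_fun_def
proof
  fix K assume K: "K \<in> M"
  obtain B where B: "B \<in> BA" "K = achart B" using K by (rule M_cases)
  show "smooth_on (chart_image K W) (f \<circ> chart_inv K)"
    using assms(1)[OF B(1), folded B(2)] amb.open_chart_image[OF W K]
  proof (rule smooth_on_transform)
    fix z assume that: "z \<in> chart_image K W"
    have "z \<in> snd B ` fst B \<times> {-1<..<1}" using that unfolding chart_image_def B(2) achart_range by blast
    then show "f (chart_inv B (fst z), snd z) = (f \<circ> chart_inv K) z"
      using achart_inv[OF bdl.chart_inj[OF B(1)], of "fst z" "snd z"] by (auto simp: B(2))
  qed
qed

lemma bundle_image_whole: "B \<in> BA \<Longrightarrow> chart_image B MB = snd B ` fst B"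
  unfolding points_BA[symmetric] by (auto simp: chart_image_def points_def bdl.chart_inv_chart)

text \<open>Extension constant in r; dilations fix r, so the weight is kept.\<close>

lemma AD_fst:
  assumes "density A cf w a"
  shows "AD w (\<lambda>q. a (fst q))"
proof -
  have "smooth_fun M (points M) (\<lambda>q. a (fst q))"
  proof (rule smooth_fun_chart_M[OF _ nbhd_open[OF nbhd_whole]])
    fix B assume B: "B \<in> BA"
    note op = amb.open_chart_image[OF nbhd_open[OF nbhd_whole] achart_M[OF B]]
    have "smooth_on (chart_image (achart B) (points M)) (\<lambda>z. (a \<circ> chart_inv B) (fst z))"
    proof (rule smooth_on_compose[OF op, where T = "chart_image B MB"])
      show "open (chart_image B MB)" using bundle_image_whole[OF B] bdl.chart_open[OF B] by simp
      show "fst z \<in> chart_image B MB" if "z \<in> chart_image (achart B) (points M)" for z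
      proof -
        have "z \<in> snd B ` fst B \<times> {-1<..<1}" using that unfolding chart_image_def achart_range by blast
        then show ?thesis by (auto simp: bundle_image_whole[OF B])
      qed
      show "smooth_on (chart_image B MB) (a \<circ> chart_inv B)"
        using assms B by (simp add: density_def smooth_fun_def)
    qed (rule smooth_on_bounded_linear[OF op bounded_linear_fst])
    then show "smooth_on (chart_image (achart B) (points M)) (\<lambda>z. a (fst (chart_inv B (fst z), snd z)))" by simp
  qed
  then have "sm (\<lambda>q. a (fst q))" by (rule smI[OF nbhd_whole])
  moreover have "near (\<lambda>q. \<forall>s>0. a (fst (ambient_dilation s q)) = s powi w * a (fst q))"
    by (rule near_mono[OF near_points]) (use assms in \<open>auto simp: density_def ambient_dilation_def points_M\<close>)
  ultimately show ?thesis by (simp add: ambient_density_def)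
qed

lemma AD_snd: "AD 0 snd"
proof -
  have "smooth_fun M (points M) snd"
  proof (rule smooth_fun_chart_M[OF _ nbhd_open[OF nbhd_whole]])
    fix B assume B: "B \<in> BA"
    show "smooth_on (chart_image (achart B) (points M)) (\<lambda>z. snd (chart_inv B (fst z), snd z))"
      using smooth_on_bounded_linear[OF amb.open_chart_image[OF nbhd_open[OF nbhd_whole] achart_M[OF B]] bounded_linear_snd]
      by simp
  qed
  then have "sm snd" by (rule smI[OF nbhd_whole])
  then show ?thesis by (simp add: ambient_density_def near_always ambient_dilation_def)
qed

lemma density_restrict:
  assumes "AD w f"
  shows "density A cf w (\<lambda>y. f (y, 0))"
  unfolding density_def
proof (intro conjI ballI allI impI)
  obtain W where W: "nbhd W" "smooth_fun M W f" using ADE(1)[OF assms] unfolding smooth_near_bundle_def by blast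
  show "smooth_fun BA MB (\<lambda>y. f (y, 0))" unfolding smooth_fun_def
  proof
    fix B assume B: "B \<in> BA"
    let ?U = "chart_image B MB"
    have op: "open ?U" using bundle_image_whole[OF B] bdl.chart_open[OF B] by simp
    have inv: "chart_inv (achart B) (z, 0) = (chart_inv B z, 0)" if "z \<in> ?U" for z
      using achart_inv[OF bdl.chart_inj[OF B], of z 0] that bundle_image_whole[OF B] by simp
    have "smooth_on ?U (\<lambda>z. (f \<circ> chart_inv (achart B)) (z, 0))"
    proof (rule smooth_on_compose[OF op amb.open_chart_image[OF nbhd_open[OF W(1)] achart_M[OF B]]])
      show "(z, 0) \<in> chart_image (achart B) W" if "z \<in> ?U" for z
        using inv[OF that] nbhd_bundle[OF W(1)] bdl.chart_inv_mem[OF that] that bundle_image_whole[OF B]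
        unfolding chart_image_def achart_range by auto
      show "smooth_on ?U (\<lambda>z. (z, 0::real))" by (intro smooth_on_intros op)
      show "smooth_on (chart_image (achart B) W) (f \<circ> chart_inv (achart B))"
        using W(2) achart_M[OF B] by (simp add: smooth_fun_def)
    qed
    moreover have "(f \<circ> chart_inv (achart B)) (z, 0) = ((\<lambda>y. f (y, 0)) \<circ> chart_inv B) z" if "z \<in> ?U" for z
      using inv[OF that] by simp
    ultimately show "smooth_on ?U ((\<lambda>y. f (y, 0)) \<circ> chart_inv B)" by (rule smooth_on_transform[OF _ op])
  qed
  show "f (dilation s y, 0) = s powi w * f (y, 0)" if "y \<in> MB" "s > 0" for y s
    using near_on_bundle[OF ADE(2)[OF assms] that(1)] that(2) by (simp add: ambient_dilation_def)
qed

text \<open>Off the bundle the quotient inherits homogeneity because dilations fix r; on the bundle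
  homogeneity follows in the limit r to 0.\<close>

lemma AD_hadamard:
  assumes f: "AD w f" "\<And>y. y \<in> MB \<Longrightarrow> f (y, 0) = 0"
  obtains h where "AD w h" "near (\<lambda>q. f q = snd q * h q)"
proof -
  obtain h where h: "sm h" "near (\<lambda>q. f q = snd q * h q)" by (rule hadamard[OF ADE(1)[OF f(1)] f(2)])
  obtain W where W: "nbhd W" "\<And>q. q \<in> W \<Longrightarrow> f q = snd q * h q \<and> (\<forall>s>0. f (ambient_dilation s q) = s powi w * f q)"
    using near_conj[OF h(2) ADE(2)[OF f(1)]] unfolding near_bundle_def by blast
  have off: "h (ambient_dilation s q) = s powi w * h q" if "q \<in> W" "s > 0" "snd q \<noteq> 0" for q s
  proof -
    have "snd q * h (ambient_dilation s q) = f (ambient_dilation s q)"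
      using W(2)[OF nbhd_dilation[OF W(1) that(1,2)]] by (simp add: ambient_dilation_def)
    also have "\<dots> = snd q * (s powi w * h q)" using W(2)[OF that(1)] that(2) by simp
    finally show ?thesis using that(3) by simp
  qed
  have "h (ambient_dilation s q) = s powi w * h q" if q: "q \<in> W" and s: "s > 0" for q s
  proof (cases "snd q = 0")
    case True
    obtain y where y: "q = (y, 0)" "y \<in> MB" using True nbhd_fst[OF W(1) q] by (cases q) auto
    have "\<forall>\<^sub>F r in at 0. (y, r) \<in> W"
      by (rule near_fibre_at[OF near_nbhd[OF W(1)] y(2)])
    moreover have "\<forall>\<^sub>F r in at 0. r \<noteq> (0::real)" by (simp add: eventually_at_filter)
    ultimately have "\<forall>\<^sub>F r in at 0. s powi w * h (y, r) = h (dilation s y, r)"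
    proof eventually_elim
      case (elim r)
      then show ?case using off[of "(y, r)" s] s by (simp add: ambient_dilation_def)
    qed
    moreover have "((\<lambda>r. s powi w * h (y, r)) \<longlongrightarrow> s powi w * h (y, 0)) (at 0)"
      by (intro tendsto_intros sm_fibre_tendsto[OF h(1) y(2)])
    ultimately have "((\<lambda>r. h (dilation s y, r)) \<longlongrightarrow> s powi w * h (y, 0)) (at 0)"
      by (rule Lim_transform_eventually[rotated])
    with sm_fibre_tendsto[OF h(1) dilation_MB[OF y(2) s]] have "h (dilation s y, 0) = s powi w * h (y, 0)"
      by (rule tendsto_unique[rotated]) simp
    then show ?thesis by (simp add: y ambient_dilation_def)
  qed (use off q s in blast)
  then have "near (\<lambda>q. \<forall>s>0. h (ambient_dilation s q) = s powi w * h q)"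
    by (intro near_nbhd[OF W(1)]) blast
  then show thesis using that h by (auto simp: ambient_density_def)
qed

end

section \<open>The ambient metric\<close>

locale ambient = conformal A cf for A :: "('a, 'e::euclidean_space) chart set" and cf +
  fixes gt :: "('a, 'e) afield"
  assumes ambient: "ambient_metric A cf gt"
begin

text \<open>One neighbourhood on which all conditions on \<open>gt\<close> hold simultaneously is
  fixed once and for all; later ones are intersected with it.\<close>

definition "W0 = (SOME W. nbhd W \<and> pseudo_metric M W gt \<and>
     (\<forall>C\<in>BA. \<forall>y\<in>fst C. pullback M bundle_incl gt y C = tautological A y C) \<and>
     (\<forall>s>0. \<forall>C\<in>M. \<forall>q\<in>W \<inter> fst C.
        pullback M (ambient_dilation s) gt q C = tens2_scale (s\<^sup>2) (gt q) C) \<and>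
     ricci_condition A cf W gt \<and>
     (\<forall>C\<in>M. \<forall>q\<in>W \<inter> fst C. euler_normalized_at gt C q))"

lemma W0: "nbhd W0" "pseudo_metric M W0 gt"
  "\<And>B y. B \<in> BA \<Longrightarrow> y \<in> fst B \<Longrightarrow> pullback M bundle_incl gt y B = tautological A y B"
  "\<And>s K q. s > 0 \<Longrightarrow> K \<in> M \<Longrightarrow> q \<in> W0 \<Longrightarrow> q \<in> fst K \<Longrightarrow>
    pullback M (ambient_dilation s) gt q K = tens2_scale (s\<^sup>2) (gt q) K"
  "\<And>K q. K \<in> M \<Longrightarrow> q \<in> W0 \<Longrightarrow> q \<in> fst K \<Longrightarrow> euler_normalized_at gt K q"
  using someI_ex[OF ambient[unfolded ambient_metric_def], folded W0_def] by simp_all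

abbreviation "rt \<equiv> rho_tilde A cf gt"
abbreviation "lap \<equiv> ambient_laplacian A cf gt"

lemma metric_nbhd:
  assumes "openin (atlas_topology M) W" "W \<subseteq> W0"
  shows "pseudo_metric M W gt"
proof -
  have st: "sym_tensor_field M W0 gt" and nd: "\<forall>C\<in>M. \<forall>p\<in>W0 \<inter> fst C. \<forall>u. (\<forall>v. gt p C u v = 0) \<longrightarrow> u = 0"
    using W0(2) by (auto simp: pseudo_metric_def)
  have sub: "chart_image K W \<subseteq> chart_image K W0" for K using assms(2) by (auto simp: chart_image_def)
  have "smooth_on (chart_image K W0) (\<lambda>x. in_chart gt K x u v)" if "K \<in> M" for K u v
    using st that unfolding sym_tensor_field_def by blast
  then have "smooth_on (chart_image K W) (\<lambda>x. in_chart gt K x u v)" if "K \<in> M" for K u v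
    by (rule smooth_on_subset[OF _ sub]) (rule that)
  then have "sym_tensor_field M W gt"
    using st assms(2) unfolding sym_tensor_field_def by auto
  moreover have "\<forall>C\<in>M. \<forall>p\<in>W \<inter> fst C. \<forall>u. (\<forall>v. gt p C u v = 0) \<longrightarrow> u = 0"
    using nd assms(2) by auto
  ultimately show ?thesis by (simp add: pseudo_metric_def)
qed

lemmas smooth_metric_W0 = amb.smooth_metric_in_chart[OF nbhd_open[OF W0(1)] W0(2)]

lemma in_chart_eq: "in_chart gt K x = gt (chart_inv K x) K"
  by (intro ext) (simp add: in_chart_def)

lemma lam_line: "lam s z = (z - Tvec z) + s *\<^sub>R Tvec z"
  by (cases z, cases "fst z") (simp add: lam_def Tvec_def algebra_simps)

text \<open>In a chart the dilation orbit is an affine line with direction \<open>Tvec\<close>, so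
  the derivative along the orbit is an ordinary directional derivative.\<close>

lemma has_derivative_along_dilation:
  assumes K: "K \<in> M" "q \<in> fst K" and f: "(f \<circ> chart_inv K) differentiable (at (snd K q))"
  shows "((\<lambda>s. f (ambient_dilation s q)) has_vector_derivative
    dird (f \<circ> chart_inv K) (snd K q) (Tvec (snd K q))) (at 1)"
proof -
  let ?z = "snd K q"
  have "(f \<circ> chart_inv K) differentiable (at ((?z - Tvec ?z) + 1 *\<^sub>R Tvec ?z))" using f by simp
  then have "((\<lambda>s. (f \<circ> chart_inv K) ((?z - Tvec ?z) + s *\<^sub>R Tvec ?z)) has_vector_derivative
      dird (f \<circ> chart_inv K) ((?z - Tvec ?z) + 1 *\<^sub>R Tvec ?z) (Tvec ?z)) (at 1)"
    by (rule has_derivative_along_line)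
  then have "((\<lambda>s. (f \<circ> chart_inv K) (lam s ?z)) has_vector_derivative
      dird (f \<circ> chart_inv K) ?z (Tvec ?z)) (at 1)"
    by (simp add: lam_line)
  then show ?thesis
  proof (rule has_vector_derivative_transform_within_open[of _ _ _ "{0<..}"])
    fix s :: real assume "s \<in> {0<..}"
    then have "ambient_dilation s q \<in> fst K" "snd K (ambient_dilation s q) = lam s ?z"
      using ambient_dilation_chart[OF K, of s] by simp_all
    then show "(f \<circ> chart_inv K) (lam s ?z) = f (ambient_dilation s q)"
      using amb.chart_inv_chart[OF K(1), of "ambient_dilation s q"] by simp
  qed auto
qed

lemma transition_differentiable:
  assumes "K \<in> M" "D \<in> M" "q \<in> fst K" "q \<in> fst D"
  shows "(snd D \<circ> chart_inv K) differentiable (at (snd K q))"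
  by (rule smooth_on_differentiable[OF amb.transition_smooth[OF assms(1,2)]])
    (use amb.chart_image_mem[OF assms(1,3)] assms(4) in blast)

lemma Tvec_transition:
  assumes "K \<in> M" "D \<in> M" "q \<in> fst K" "q \<in> fst D"
  shows "dird (snd D \<circ> chart_inv K) (snd K q) (Tvec (snd K q)) = Tvec (snd D q)"
  using euler_field_chart[OF assms(2,4)]
    vector_derivative_at[OF has_derivative_along_dilation[OF assms(1,3) transition_differentiable[OF assms]]]
  by (simp add: euler_field_def)

lemma rt_chart:
  assumes "K \<in> M" "q \<in> fst K" "q \<in> W0"
  shows "rt q = gt q K (Tvec (snd K q)) (Tvec (snd K q))"
proof -
  note D = amb.chart_at_openin[OF nbhd_open[OF W0(1)] assms(3)]
  note t = amb.tens2_at_metric[OF nbhd_open[OF W0(1)] W0(2) assms(3)]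
  show ?thesis
    using amb.tens2_at_transition[OF t assms(1) D(1) assms(2) D(2), of "Tvec (snd K q)" "Tvec (snd K q)"]
    by (simp add: rho_tilde_def Let_def euler_field_chart[OF D(1,2)] Tvec_transition[OF assms(1) D(1) assms(2) D(2)])
qed

text \<open>The pullback condition involves the chart chosen at the image point. The chain rule and
  the tensor law bring it back to \<open>K\<close>, which contains both points and in which the
  dilation is its own differential.\<close>

lemma metric_dilation:
  assumes K: "K \<in> M" "q \<in> fst K" and q: "q \<in> W0" and s: "s > 0"
  shows "gt (ambient_dilation s q) K (lam s u) (lam s v) = s\<^sup>2 * gt q K u v"
proof -
  let ?q = "ambient_dilation s q"
  have q': "?q \<in> W0" by (rule nbhd_dilation[OF W0(1) q s])
  note K' = ambient_dilation_chart[OF K s]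
  define D where "D = chart_at M ?q"
  have D: "D \<in> M" "?q \<in> fst D"
    unfolding D_def using amb.chart_at_openin[OF nbhd_open[OF W0(1)] q'] by auto
  note t = amb.tens2_at_metric[OF nbhd_open[OF W0(1)] W0(2) q']
  let ?\<tau> = "snd D \<circ> chart_inv K"
  have L: "dird (snd D \<circ> ambient_dilation s \<circ> chart_inv K) (snd K q) u = dird ?\<tau> (snd K ?q) (lam s u)" for u
  proof -
    let ?U = "chart_image K (points M)"
    have qU: "snd K q \<in> ?U" using amb.chart_image_mem[OF K] K by (auto simp: points_def)
    have "(snd D \<circ> ambient_dilation s \<circ> chart_inv K) z = ?\<tau> (lam s z)" if "z \<in> ?U" for z
    proof -
      have z: "chart_inv K z \<in> fst K" "snd K (chart_inv K z) = z"
        using amb.chart_inv_mem[OF that] amb.chart_chart_inv[OF that] by auto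
      have "chart_inv K (lam s z) = ambient_dilation s (chart_inv K z)"
        using ambient_dilation_chart[OF K(1) z(1) s] amb.chart_inv_chart[OF K(1)] z(2) by metis
      then show ?thesis by simp
    qed
    then have "dird (snd D \<circ> ambient_dilation s \<circ> chart_inv K) (snd K q) = dird (\<lambda>z. ?\<tau> (lam s z)) (snd K q)"
      by (rule dird_cong_open[OF amb.open_chart_image[OF nbhd_open[OF nbhd_whole] K(1)] qU])
    also have "\<dots> = (\<lambda>u. dird ?\<tau> (lam s (snd K q)) (lam s u))"
    proof (rule dird_eqI)
      have "(?\<tau> has_derivative dird ?\<tau> (lam s (snd K q))) (at (lam s (snd K q)))"
        using has_derivative_dird[OF transition_differentiable[OF K(1) D(1) K'(1) D(2)]] K'(2) by simp
      then show "((\<lambda>z. ?\<tau> (lam s z)) has_derivative (\<lambda>u. dird ?\<tau> (lam s (snd K q)) (lam s u))) (at (snd K q))"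
        by (rule has_derivative_compose[OF bounded_linear_imp_has_derivative[OF bounded_linear_lam]])
    qed
    finally show ?thesis using K'(2) by simp
  qed
  have "s\<^sup>2 * gt q K u v = pullback M (ambient_dilation s) gt q K u v"
    using W0(4)[OF s K(1) q K(2)] by (simp add: tens2_scale_def)
  also have "\<dots> = gt ?q D (dird ?\<tau> (snd K ?q) (lam s u)) (dird ?\<tau> (snd K ?q) (lam s v))"
    by (simp add: pullback_def Let_def D_def[symmetric] L)
  also have "\<dots> = gt ?q K (lam s u) (lam s v)"
    by (rule amb.tens2_at_transition[OF t K(1) D(1) K'(1) D(2)])
  finally show ?thesis by simp
qed

lemma Tvec_lam: "Tvec (lam s z) = lam s (Tvec z)"
  by (simp add: Tvec_def lam_def)

lemma rt_dilation:
  assumes q: "q \<in> W0" and s: "s > 0"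
  shows "rt (ambient_dilation s q) = s\<^sup>2 * rt q"
proof -
  obtain K where K: "K \<in> M" "q \<in> fst K" using amb.chart_at_openin[OF nbhd_open[OF W0(1)] q] by blast
  note K' = ambient_dilation_chart[OF K s]
  show ?thesis
    unfolding rt_chart[OF K q] rt_chart[OF K(1) K'(1) nbhd_dilation[OF W0(1) q s]] K'(2) Tvec_lam
    by (rule metric_dilation[OF K q s])
qed

lemma rt_in_chart:
  assumes "K \<in> M" "x \<in> chart_image K W0"
  shows "(rt \<circ> chart_inv K) x = in_chart gt K x (Tvec x) (Tvec x)"
  using rt_chart[OF assms(1), of "chart_inv K x"] amb.chart_inv_mem[OF assms(2)] amb.chart_chart_inv[OF assms(2)]
  by (simp add: in_chart_def)

lemma smooth_fun_rt: "smooth_fun M W0 rt"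
  unfolding smooth_fun_def
proof
  fix K assume K: "K \<in> M"
  let ?U = "chart_image K W0"
  note sm = smooth_metric_W0[OF K]
  note op = smooth_metricD(1)[OF sm]
  have "smooth_on ?U (\<lambda>x. \<Sum>i\<in>Basis. \<Sum>j\<in>Basis. (Tvec x \<bullet> i) * (Tvec x \<bullet> j) * in_chart gt K x i j)"
    by (intro smooth_on_sum smooth_on_mult smooth_on_inner op finite_Basis
        smooth_on_bounded_linear[OF op bounded_linear_Tvec] smooth_metricD(3)[OF sm])
  then show "smooth_on ?U (rt \<circ> chart_inv K)"
    by (rule smooth_on_transform[OF _ op])
      (simp only: rt_in_chart[OF K] metric_expand[OF smooth_metricD(2)[OF sm], symmetric])
qed

lemma AD_rt: "AD 2 rt"
proof (rule ADI)
  show "sm rt" by (rule smI[OF W0(1) smooth_fun_rt])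
  show "near (\<lambda>q. \<forall>s>0. rt (ambient_dilation s q) = s powi 2 * rt q)"
    by (rule near_nbhd[OF W0(1)]) (simp add: rt_dilation)
qed

lemma cf_bilinear:
  assumes "y \<in> MB" "C \<in> A" "fst y \<in> fst C"
  shows "bilinear (snd y C)"
proof -
  obtain p g where p: "p \<in> points A" "g \<in> cf" "y = (p, g p)" using assms(1) by (auto simp: metric_bundle_def)
  obtain g0 where g0: "pseudo_metric A (points A) g0" and cf: "\<And>g. g \<in> cf \<longleftrightarrow>
      (\<exists>\<upsilon>. g = (\<lambda>p. tens2_scale (exp (2 * \<upsilon> p)) (g0 p)) \<and> smooth_fun A (points A) \<upsilon>)"
    by (rule conformalE) (rule that)
  obtain c where c: "g = (\<lambda>p. tens2_scale (exp (2 * c p)) (g0 p))" using cf p(2) by blast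
  have "tens2_at A p (g0 p)" using g0 p(1) by (simp add: pseudo_metric_def sym_tensor_field_def)
  then have "bilinear (g0 p C)"
    using assms(2,3) p(3) by (simp add: tens2_at_def)
  then have "bilinear (\<lambda>u v. exp (2 * c p) * g0 p C u v)"
    unfolding bilinear_def
    using linear_compose_scale_right[of "\<lambda>u. g0 p C u v" "exp (2 * c p)" for v]
      linear_compose_scale_right[of "\<lambda>v. g0 p C u v" "exp (2 * c p)" for u] by simp
  then show ?thesis by (simp add: p(3) c tens2_scale_def)
qed

text \<open>On the bundle the Euler field is tangent to the fibres of the projection to the base,
  hence null for the tautological tensor, which is a pullback along this projection.\<close>

lemma rt_bundle:
  assumes y: "y \<in> MB"
  shows "rt (y, 0) = 0"
proof -
  have yW: "(y, 0) \<in> W0" by (rule nbhd_bundle[OF W0(1) y])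
  define D where "D = chart_at M (y, 0)"
  have D: "D \<in> M" "(y, 0) \<in> fst D"
    unfolding D_def using amb.chart_at_openin[OF nbhd_open[OF W0(1)] yW] by auto
  obtain B where B: "B \<in> BA" "D = achart B" using D(1) by (rule M_cases)
  have yB: "y \<in> fst B" using D(2) by (simp add: B(2) achart_def)
  let ?U = "chart_image B MB"
  have op: "open ?U" using bundle_image_whole[OF B(1)] bdl.chart_open[OF B(1)] by simp
  have yU: "snd B y \<in> ?U" using yB y bdl.chart_image_mem[OF B(1)] by blast
  let ?u = "(0, snd (snd B y)) :: 'e \<times> real"
  have incl: "dird (snd D \<circ> bundle_incl \<circ> chart_inv B) (snd B y) u = (u, 0)" for u
  proof -
    have "dird (snd D \<circ> bundle_incl \<circ> chart_inv B) (snd B y) = dird (\<lambda>z. (z, 0)) (snd B y)"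
      by (rule dird_cong_open[OF op yU]) (simp add: bundle_incl_def B(2) achart_def bdl.chart_chart_inv)
    also have "\<dots> = (\<lambda>u. (u, 0))" by (rule dird_eqI) (auto intro!: derivative_eq_intros)
    finally show ?thesis by simp
  qed
  have "rt (y, 0) = gt (y, 0) D (?u, 0) (?u, 0)"
    unfolding rt_chart[OF D yW] by (simp add: B(2) achart_def Tvec_def)
  also have "\<dots> = pullback M bundle_incl gt y B ?u ?u"
    by (simp add: pullback_def Let_def bundle_incl_def[of y] D_def[symmetric] incl)
  also have "\<dots> = tautological A y B ?u ?u" by (simp add: W0(3)[OF B(1) yB])
  also have "\<dots> = 0"
  proof -
    obtain C g where C: "C \<in> A" "g \<in> cf" and BC: "B = bundle_chart A cf C g"
      using B(1) by (auto simp: bundle_atlas_def)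
    have yC: "fst y \<in> fst C" using yB by (simp add: BC bundle_chart_def)
    define E where "E = chart_at A (fst y)"
    have E: "E \<in> A" "fst y \<in> fst E"
      unfolding E_def using base.chart_at[of "fst y"] C(1) yC by (auto simp: points_def)
    let ?V = "chart_image C (fst E) \<times> {0::real<..}"
    have opV: "open ?V" by (intro open_Times base.overlap_open C(1) E(1)) auto
    have x: "snd C (fst y) \<in> chart_image C (fst E)" using base.chart_image_mem[OF C(1) yC] E(2) by blast
    have yV: "snd B y \<in> ?V"
      using x fibre_coord(1)[OF C(2) y] by (simp add: BC bundle_chart_def)
    have "dird (snd E \<circ> fst \<circ> chart_inv B) (snd B y) = dird (\<lambda>z. (snd E \<circ> chart_inv C) (fst z)) (snd B y)"
    proof (rule dird_cong_open[OF opV yV])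
      fix z assume "z \<in> ?V"
      then show "(snd E \<circ> fst \<circ> chart_inv B) z = (snd E \<circ> chart_inv C) (fst z)"
        using bundle_chart_inv(3)[OF C, of "fst z" "snd z"] by (auto simp: BC chart_image_def)
    qed
    also have "\<dots> = (\<lambda>u. dird (snd E \<circ> chart_inv C) (fst (snd B y)) (fst u))"
    proof (rule dird_eqI)
      have "fst (snd B y) = snd C (fst y)" by (simp add: BC bundle_chart_def)
      then have d: "(snd E \<circ> chart_inv C has_derivative dird (snd E \<circ> chart_inv C) (fst (snd B y))) (at (fst (snd B y)))"
        using smooth_on_has_derivative[OF base.transition_smooth[OF C(1) E(1)] x] by simp
      show "((\<lambda>z. (snd E \<circ> chart_inv C) (fst z)) has_derivative
          (\<lambda>u. dird (snd E \<circ> chart_inv C) (fst (snd B y)) (fst u))) (at (snd B y))"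
        by (rule has_derivative_compose[OF bounded_linear_imp_has_derivative[OF bounded_linear_fst] d])
    qed
    finally have "dird (snd E \<circ> fst \<circ> chart_inv B) (snd B y) ?u = dird (snd E \<circ> chart_inv C) (fst (snd B y)) 0"
      by simp
    moreover have "fst (snd B y) = snd C (fst y)" by (simp add: BC bundle_chart_def)
    moreover have "dird (snd E \<circ> chart_inv C) (snd C (fst y)) 0 = 0"
      by (rule linear_0[OF linear_dird[OF smooth_on_differentiable[OF base.transition_smooth[OF C(1) E(1)] x]]])
    ultimately have "dird (snd E \<circ> fst \<circ> chart_inv B) (snd B y) ?u = 0" by simp
    then have "tautological A y B ?u ?u = snd y E 0 0"
      by (simp add: tautological_def pullback_def Let_def E_def[symmetric])
    then show ?thesis using bilinear_lzero[OF cf_bilinear[OF y E]] by simp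
  qed
  finally show ?thesis .
qed

lemma normalized_in_chart:
  assumes K: "K \<in> M" and x: "x \<in> chart_image K W0" and "i \<in> Basis" "j \<in> Basis"
  shows "cov_deriv (in_chart gt K) (\<lambda>x. in_chart gt K x (Tvec x)) x i j = in_chart gt K x i j"
proof -
  have q: "chart_inv K x \<in> fst K" "chart_inv K x \<in> W0" "snd K (chart_inv K x) = x"
    using amb.chart_inv_mem[OF x] amb.chart_chart_inv[OF x] by auto
  have "cov_deriv (in_chart gt K) (\<lambda>x. in_chart gt K x (Tvec x)) x i j
      = cov_deriv (in_chart gt K) (\<lambda>x. in_chart gt K x (euler_field K (chart_inv K x))) x i j"
  proof (rule cov_deriv_cong[OF smooth_metricD(1)[OF smooth_metric_W0[OF K]] x])
    fix y v assume y: "y \<in> chart_image K W0"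
    then have "euler_field K (chart_inv K y) = Tvec y"
      using euler_field_chart[OF K, of "chart_inv K y"] amb.chart_inv_mem[OF y] amb.chart_chart_inv[OF y] by simp
    then show "in_chart gt K y (Tvec y) v = in_chart gt K y (euler_field K (chart_inv K y)) v" by simp
  qed
  also have "\<dots> = in_chart gt K x i j"
    using W0(5)[OF K q(2,1)] assms(3,4) by (simp add: euler_normalized_at_def q(3) in_chart_def)
  finally show ?thesis .
qed

lemma dird_rt:
  assumes K: "K \<in> M" and x: "x \<in> chart_image K W0"
  shows "dird (rt \<circ> chart_inv K) x u = 2 * in_chart gt K x (Tvec x) u"
proof -
  note sm = smooth_metric_W0[OF K]
  have "dird (rt \<circ> chart_inv K) x = dird (\<lambda>x. in_chart gt K x (Tvec x) (Tvec x)) x"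
    by (rule dird_cong_open[OF smooth_metricD(1)[OF sm] x]) (rule rt_in_chart[OF K])
  then show ?thesis
    using dird_norm_euler[OF sm bounded_linear_Tvec normalized_in_chart[OF K] x] by simp
qed

text \<open>The quotient of \<open>\<rho>\<^sub>~\<close> by the coordinate of \<open>(-1, 1)\<close> does not vanish on \<open>\<G>\<close> because \<open>d\<rho>\<^sub>~\<close> is
  twice the dual of \<open>T \<noteq> 0\<close>.\<close>

lemma rt_factor:
  obtains v where "AD 2 v" "near (\<lambda>q. rt q = snd q * v q)" "near (\<lambda>q. v q \<noteq> 0)"
proof -
  obtain v where v: "AD 2 v" "near (\<lambda>q. rt q = snd q * v q)" by (rule AD_hadamard[OF AD_rt rt_bundle])
  have "v (y, 0) \<noteq> 0" if y: "y \<in> MB" for y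
  proof
    assume v0: "v (y, 0) = 0"
    obtain B where B: "B \<in> BA" "y \<in> fst B" "snd B y = fst (snd (achart B) (y, 0))"
      "(snd B y, 0) \<in> chart_image (achart B) W0"
      "\<forall>r\<in>{-1<..<1}. chart_inv (achart B) (snd B y, r) = (y, r)"
      by (rule fibre_chart[OF W0(1) y]) (rule that)
    let ?K = "achart B" and ?z = "snd B y"
    let ?F = "rt \<circ> chart_inv ?K"
    note K = achart_M[OF B(1)]
    have x0: "(?z, 0) \<in> chart_image ?K W0" by (rule B(4))
    have sF: "smooth_on (chart_image ?K W0) ?F" using smooth_fun_rt K by (simp add: smooth_fun_def)
    have d: "?F differentiable (at (?z, 0))" by (rule smooth_on_differentiable[OF sF x0])
    \<comment> \<open>The derivative of \<open>rt\<close> in the direction of r is the limit of rt /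
      r, that is, the value of \<open>v\<close>.\<close>
    have vert: "dird ?F (?z, 0) (0, 1) = 0"
    proof -
      have "?F differentiable (at ((?z, 0) + 0 *\<^sub>R (0, 1)))" using d by simp
      from has_derivative_along_line[OF this]
      have 1: "((\<lambda>s. ?F (?z, s)) has_vector_derivative dird ?F (?z, 0) (0, 1)) (at 0)" by simp
      have "\<forall>\<^sub>F r in nhds 0. rt (y, r) = r * v (y, r)" using near_fibre[OF v(2) y] by simp
      moreover have "\<forall>\<^sub>F r in nhds 0. r \<in> {-1<..<1::real}" by (rule eventually_nhds_in_open) auto
      ultimately have ev: "\<forall>\<^sub>F r in nhds 0. ?F (?z, r) = r * v (y, r)"
        by eventually_elim (simp add: B(5))
      have 0: "?F (?z, 0) = 0" using B(5) rt_bundle[OF y] by simp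
      have "((\<lambda>r. (?F (?z, r) - ?F (?z, 0)) / (r - 0)) \<longlongrightarrow> dird ?F (?z, 0) (0, 1)) (at 0)"
        using 1 unfolding has_real_derivative_iff_has_vector_derivative[symmetric] has_field_derivative_iff
        by simp
      moreover have "\<forall>\<^sub>F r in at 0. (?F (?z, r) - ?F (?z, 0)) / (r - 0) = v (y, r)"
        using ev unfolding eventually_at_filter by eventually_elim (simp only: 0, simp)
      ultimately have "((\<lambda>r. v (y, r)) \<longlongrightarrow> dird ?F (?z, 0) (0, 1)) (at 0)"
        by (rule Lim_transform_eventually)
      with sm_fibre_tendsto[OF ADE(1)[OF v(1)] y] have "v (y, 0) = dird ?F (?z, 0) (0, 1)"
        by (rule tendsto_unique[rotated]) simp
      then show ?thesis using v0 by simp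
    qed
    \<comment> \<open>In directions tangent to the bundle the derivative vanishes because
      \<open>rt\<close> is 0 there.\<close>
    have hor: "dird ?F (?z, 0) (a, 0) = 0" for a
    proof -
      have "?F differentiable (at ((?z, 0) + 0 *\<^sub>R (a, 0)))" using d by simp
      from has_derivative_along_line[OF this]
      have 1: "((\<lambda>s. ?F (?z + s *\<^sub>R a, 0)) has_vector_derivative dird ?F (?z, 0) (a, 0)) (at 0)" by simp
      let ?V = "(\<lambda>s. (?z + s *\<^sub>R a, 0::real)) -` chart_image ?K W0"
      have "open ?V"
        by (intro open_vimage amb.open_chart_image[OF nbhd_open[OF W0(1)] K] continuous_intros)
      moreover have "0 \<in> ?V" using x0 by simp
      moreover have "?F (?z + s *\<^sub>R a, 0) = 0" if "s \<in> ?V" for s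
      proof -
        have m: "(?z + s *\<^sub>R a, 0) \<in> chart_image ?K W0" using that by simp
        then have "?z + s *\<^sub>R a \<in> snd B ` fst B" unfolding chart_image_def achart_range by auto
        then have e: "chart_inv ?K (?z + s *\<^sub>R a, 0) = (chart_inv B (?z + s *\<^sub>R a), 0)"
          by (rule achart_inv[OF bdl.chart_inj[OF B(1)]]) simp
        have "chart_inv ?K (?z + s *\<^sub>R a, 0) \<in> W0" using amb.chart_inv_mem[OF m] by blast
        from nbhd_fst[OF W0(1) this] show ?thesis using rt_bundle e by simp
      qed
      ultimately have "((\<lambda>s. 0) has_vector_derivative dird ?F (?z, 0) (a, 0)) (at 0)"
        by (rule has_vector_derivative_transform_within_open[OF 1])
      then show ?thesis using vector_derivative_at vector_derivative_const_at by metis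
    qed
    have "dird ?F (?z, 0) u = 0" for u
    proof -
      have "dird ?F (?z, 0) ((fst u, 0) + snd u *\<^sub>R (0, 1)) = 0"
        unfolding linear_add[OF linear_dird[OF d]] linear_scale[OF linear_dird[OF d]] hor vert by simp
      then show ?thesis by simp
    qed
    then have "in_chart gt ?K (?z, 0) (Tvec (?z, 0)) u = 0" for u
      using dird_rt[OF K x0, of u] by simp
    then have "Tvec (?z, 0) = 0"
      using smooth_metricD(2)[OF smooth_metric_W0[OF K] x0] unfolding metric_form_def by blast
    moreover have "snd (snd B y) > 0" using dilation_chart(3)[OF B(1,2), of 1] by simp
    ultimately show False by (simp add: Tvec_def zero_prod_def)
  qed
  then show thesis using that[OF v] AD_nonzero(1)[OF v(1)] by blast
qed

section \<open>Division by the defining function\<close>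

lemma near_rt_nonzero: "near (\<lambda>q. snd q \<noteq> 0 \<longrightarrow> rt q \<noteq> 0)"
proof -
  obtain v where "AD 2 v" "near (\<lambda>q. rt q = snd q * v q)" "near (\<lambda>q. v q \<noteq> 0)" by (rule rt_factor)
  from near_mp2[OF this(2,3)] show ?thesis by simp
qed

text \<open>Converts powers of r, in which formal series are written, into powers of
  \<open>rt\<close>, for which the Laplacian is known. The weight -2 balances the weights 0 of r and
  2 of \<open>rt\<close>.\<close>

lemma snd_factor:
  obtains u where "AD (-2) u" "near (\<lambda>q. snd q = rt q * u q)" "near (\<lambda>q. u q \<noteq> 0)"
proof -
  obtain v where v: "AD 2 v" "near (\<lambda>q. rt q = snd q * v q)" "near (\<lambda>q. v q \<noteq> 0)" by (rule rt_factor)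
  have "AD (-2) (\<lambda>q. inverse (v q))"
    using AD_nonzero(2)[OF v(1)] near_on_bundle[OF v(3)] by simp
  moreover have "near (\<lambda>q. snd q = rt q * inverse (v q))" by (rule near_mp2[OF v(2,3)]) simp
  moreover have "near (\<lambda>q. inverse (v q) \<noteq> 0)" by (rule near_mono[OF v(3)]) simp
  ultimately show thesis by (rule that)
qed

lemma near_cancel_rt:
  assumes "sm a" "sm b" "near (\<lambda>q. rt q * a q = rt q * b q)"
  shows "near (\<lambda>q. a q = b q)"
proof -
  have "near (\<lambda>q. snd q * a q = snd q * b q)"
    using assms(3) near_rt_nonzero by (rule near_mp2) auto
  then show ?thesis by (rule near_cancel_snd[OF assms(1,2)])
qed

lemma near_cancel_rt_power:
  assumes "sm a" "sm b"
  shows "near (\<lambda>q. rt q ^ k * a q = rt q ^ k * b q) \<Longrightarrow> near (\<lambda>q. a q = b q)"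
proof (induction k)
  case (Suc k)
  have "near (\<lambda>q. rt q * (rt q ^ k * a q) = rt q * (rt q ^ k * b q))"
    using Suc.prems by (simp only: power_Suc mult.assoc)
  then have "near (\<lambda>q. rt q ^ k * a q = rt q ^ k * b q)"
    by (rule near_cancel_rt[rotated 2]) (intro sm_mult sm_power ADE(1)[OF AD_rt] assms)+
  then show ?case by (rule Suc.IH)
qed simp

lemma AD_divide_rt:
  assumes "AD w f" "\<And>y. y \<in> MB \<Longrightarrow> f (y, 0) = 0"
  obtains h where "AD (w - 2) h" "near (\<lambda>q. f q = rt q * h q)"
proof -
  obtain h where h: "AD w h" "near (\<lambda>q. f q = snd q * h q)" by (rule AD_hadamard[OF assms])
  obtain u where u: "AD (-2) u" "near (\<lambda>q. snd q = rt q * u q)" by (rule snd_factor)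
  have "AD (w - 2) (\<lambda>q. u q * h q)" using AD_mult[OF u(1) h(1)] by (simp add: add.commute)
  moreover have "near (\<lambda>q. f q = rt q * (u q * h q))" by (rule near_mp2[OF h(2) u(2)]) (simp add: mult.assoc)
  ultimately show thesis by (rule that)
qed

lemma sm_divide_rt:
  assumes "sm f" "\<And>y. y \<in> MB \<Longrightarrow> f (y, 0) = 0"
  obtains h where "sm h" "near (\<lambda>q. f q = rt q * h q)"
proof -
  obtain h where h: "sm h" "near (\<lambda>q. f q = snd q * h q)" by (rule hadamard[OF assms])
  obtain u where u: "AD (-2) u" "near (\<lambda>q. snd q = rt q * u q)" by (rule snd_factor)
  have "sm (\<lambda>q. u q * h q)" by (rule sm_mult[OF ADE(1)[OF u(1)] h(1)])
  moreover have "near (\<lambda>q. f q = rt q * (u q * h q))" by (rule near_mp2[OF h(2) u(2)]) (simp add: mult.assoc)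
  ultimately show thesis by (rule that)
qed

section \<open>The ambient Laplacian\<close>

lemma lapE:
  assumes "sm f" "sm h" "near P"
  obtains W where "nbhd W" "openin (atlas_topology M) W" "pseudo_metric M W gt" "W \<subseteq> W0"
    "smooth_fun M W f" "smooth_fun M W h" "\<forall>q\<in>W. P q"
proof -
  obtain W where W: "nbhd W" "smooth_fun M W f" "smooth_fun M W h" "\<forall>q\<in>W. P q" by (rule sm2E[OF assms])
  show thesis
  proof (rule that[of "W \<inter> W0"])
    show 1: "nbhd (W \<inter> W0)" by (rule nbhd_Int[OF W(1) W0(1)])
    show 2: "openin (atlas_topology M) (W \<inter> W0)" by (rule nbhd_open[OF 1])
    show "pseudo_metric M (W \<inter> W0) gt" by (rule metric_nbhd[OF 2]) simp
    show "smooth_fun M (W \<inter> W0) f" "smooth_fun M (W \<inter> W0) h"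
      using W(2,3) amb.smooth_fun_subset by blast+
  qed (use W(4) in auto)
qed

lemma lap_cong:
  assumes "near (\<lambda>q. f q = h q)"
  shows "near (\<lambda>q. lap f q = lap h q)"
proof -
  obtain W where W: "nbhd W" "openin (atlas_topology M) W" "pseudo_metric M W gt" "\<forall>q\<in>W. f q = h q"
    by (rule lapE[OF sm_const sm_const assms]) (rule that)
  show ?thesis
    by (rule near_nbhd[OF W(1)]) (rule amb.laplacian_cong[OF W(2,3)], use W(4) in auto)
qed

lemma sm_lap:
  assumes "sm f"
  shows "sm (lap f)"
proof -
  obtain W where W: "nbhd W" "openin (atlas_topology M) W" "pseudo_metric M W gt" "smooth_fun M W f"
    by (rule lapE[OF assms sm_const near_points]) (rule that)
  then show ?thesis using smI[OF W(1) amb.smooth_fun_laplacian[OF W(2,3,4)]] by simp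
qed

lemma lap_add:
  assumes "sm f" "sm h"
  shows "near (\<lambda>q. lap (\<lambda>q. f q + h q) q = lap f q + lap h q)"
proof -
  obtain W where W: "nbhd W" "openin (atlas_topology M) W" "pseudo_metric M W gt" "smooth_fun M W f" "smooth_fun M W h"
    by (rule lapE[OF assms near_points]) (rule that)
  show ?thesis
    by (rule near_nbhd[OF W(1)]) (rule amb.laplacian_add[OF W(2,3) _ W(4,5)])
qed

lemma pairing_const: "amb.pairing gt (\<lambda>q. c) h q = 0"
proof -
  have "dird (\<lambda>y. c) x u = 0" for x u :: "('e \<times> real) \<times> real"
    by (simp add: dird_eqI[OF has_derivative_const])
  then show ?thesis
    by (simp add: amb.pairing_def Let_def local_pairing_def o_def bilinear_trace_def)
qed

lemma laplacian_cmult: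
  assumes "openin (atlas_topology M) W" "pseudo_metric M W gt" "smooth_fun M W f" "q \<in> W"
  shows "lap (\<lambda>q. c * f q) q = c * lap f q"
  using amb.laplacian_mult[OF assms(1,2,4) amb.smooth_fun_const[OF assms(1)] assms(3)]
    amb.laplacian_const[OF assms(1,2,4)]
  by (simp add: pairing_const)

lemma lap_cmult:
  assumes "sm f"
  shows "near (\<lambda>q. lap (\<lambda>q. c * f q) q = c * lap f q)"
proof -
  obtain W where W: "nbhd W" "openin (atlas_topology M) W" "pseudo_metric M W gt" "smooth_fun M W f"
    by (rule lapE[OF assms sm_const near_points]) (rule that)
  show ?thesis
    by (rule near_nbhd[OF W(1)]) (rule laplacian_cmult[OF W(2,3,4)])
qed

lemma lap_dilation:
  assumes W: "nbhd W" "W \<subseteq> W0" "smooth_fun M W f" and q: "q \<in> W" and s: "s > 0"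
  shows "lap (\<lambda>q. f (ambient_dilation s q)) q = s\<^sup>2 * lap f (ambient_dilation s q)"
proof -
  note op = nbhd_open[OF W(1)]
  note pm = metric_nbhd[OF op W(2)]
  define K where "K = chart_at M q"
  have K: "K \<in> M" "q \<in> fst K" "snd K q \<in> chart_image K W"
    unfolding K_def using amb.chart_at_openin[OF op q] by auto
  let ?U = "chart_image K W"
  note K' = ambient_dilation_chart[OF K(1,2) s]
  note smU = amb.smooth_metric_in_chart[OF op pm K(1)]
  have inv: "chart_inv K z \<in> fst K" "snd K (chart_inv K z) = z" "chart_inv K z \<in> W" if "z \<in> ?U" for z
    using amb.chart_inv_mem[OF that] amb.chart_chart_inv[OF that] by auto
  have lam: "chart_inv K (lam s z) = ambient_dilation s (chart_inv K z)" if "z \<in> ?U" for z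
    using ambient_dilation_chart[OF K(1) inv(1)[OF that] s] amb.chart_inv_chart[OF K(1)] inv(2)[OF that] by metis
  have lamU: "lam s z \<in> ?U" if "z \<in> ?U" for z
    using amb.chart_image_mem[OF K(1) ambient_dilation_chart(1)[OF K(1) inv(1)[OF that] s], of W]
      nbhd_dilation[OF W(1) inv(3)[OF that] s] ambient_dilation_chart(2)[OF K(1) inv(1)[OF that] s]
      inv(2)[OF that] by simp
  have dlam: "dird (lam s) z u = lam s u" for z u
    by (simp add: dird_eqI[OF bounded_linear_imp_has_derivative[OF bounded_linear_lam]])
  have eq: "in_chart gt K (lam s z) (dird (lam s) z u) (dird (lam s) z v) = s\<^sup>2 * in_chart gt K z u v"
    if "z \<in> ?U" for z u v
    unfolding dlam in_chart_eq lam[OF that]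
    by (rule metric_dilation[OF K(1) inv(1)[OF that] _ s]) (use inv(3)[OF that] W(2) in auto)
  have sf: "smooth_on ?U (f \<circ> chart_inv K)" using W(3) K(1) by (simp add: smooth_fun_def)
  have "s\<^sup>2 \<noteq> 0" using s by simp
  from local_laplacian_pullback[OF smU smU smooth_on_bounded_linear[OF smooth_metricD(1)[OF smU] bounded_linear_lam] lamU eq this sf K(3)]
  have "local_laplacian (in_chart gt K) (\<lambda>z. (f \<circ> chart_inv K) (lam s z)) (snd K q)
      = s\<^sup>2 * local_laplacian (in_chart gt K) (f \<circ> chart_inv K) (lam s (snd K q))" .
  moreover have "local_laplacian (in_chart gt K) (\<lambda>z. (f \<circ> chart_inv K) (lam s z)) (snd K q)
      = lap (\<lambda>q. f (ambient_dilation s q)) q"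
    unfolding laplacian_def Let_def K_def[symmetric]
    by (rule local_laplacian_cong[OF smooth_metricD(1)[OF smU] K(3)]) (simp add: lam)
  moreover have "local_laplacian (in_chart gt K) (f \<circ> chart_inv K) (lam s (snd K q)) = lap f (ambient_dilation s q)"
    using amb.laplacian_in_chart[OF op pm W(3) K(1) nbhd_dilation[OF W(1) q s] K'(1)] K'(2) by simp
  ultimately show ?thesis by simp
qed

text \<open>Dilation by \<open>s\<close> multiplies the metric by the square of \<open>s\<close> and
  thus divides the Laplacian by it.\<close>

lemma AD_lap:
  assumes "AD w f"
  shows "AD (w - 2) (lap f)"
proof (rule ADI[OF sm_lap[OF ADE(1)[OF assms]]])
  obtain W where W: "nbhd W" "openin (atlas_topology M) W" "pseudo_metric M W gt" "W \<subseteq> W0" "smooth_fun M W f"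
    "\<forall>q\<in>W. \<forall>s>0. f (ambient_dilation s q) = s powi w * f q"
    by (rule lapE[OF ADE(1)[OF assms] sm_const ADE(2)[OF assms]]) (rule that)
  show "near (\<lambda>q. \<forall>s>0. lap f (ambient_dilation s q) = s powi (w - 2) * lap f q)"
  proof (rule near_nbhd[OF W(1)], intro allI impI)
    fix q s assume q: "q \<in> W" and s: "(s::real) > 0"
    have "s\<^sup>2 * lap f (ambient_dilation s q) = lap (\<lambda>q. s powi w * f q) q"
      unfolding lap_dilation[OF W(1,4,5) q s, symmetric]
      by (rule amb.laplacian_cong[OF W(2,3) q]) (use W(6) s in simp)
    also have "\<dots> = s powi w * lap f q" by (rule laplacian_cmult[OF W(2,3,5) q])
    finally show "lap f (ambient_dilation s q) = s powi (w - 2) * lap f q"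
      using s by (simp add: power_int_diff field_simps)
  qed
qed

text \<open>The constant counts the ambient dimension n + 2.\<close>

lemma lap_rt:
  assumes q: "q \<in> W0"
  shows "lap rt q = - 2 * (real DIM('e) + 2)"
proof -
  define K where "K = chart_at M q"
  have K: "K \<in> M" "q \<in> fst K" "snd K q \<in> chart_image K W0"
    unfolding K_def using amb.chart_at_openin[OF nbhd_open[OF W0(1)] q] by auto
  note sm = smooth_metric_W0[OF K(1)]
  have "lap rt q = local_laplacian (in_chart gt K) (\<lambda>x. in_chart gt K x (Tvec x) (Tvec x)) (snd K q)"
    unfolding laplacian_def Let_def K_def[symmetric]
    by (rule local_laplacian_cong[OF smooth_metricD(1)[OF sm] K(3)]) (rule rt_in_chart[OF K(1)])
  then show ?thesis
    using local_laplacian_norm_euler[OF sm bounded_linear_Tvec normalized_in_chart[OF K(1)] K(3)] by simp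
qed

text \<open>The differential of \<open>rt\<close> is twice the dual of the Euler field, so the
  pairing is twice the derivative along dilations. For a density of weight w that derivative is w
  times the function.\<close>

lemma pairing_rt:
  assumes W: "openin (atlas_topology M) W" "W \<subseteq> W0" "smooth_fun M W f" and q: "q \<in> W"
    and d: "((\<lambda>s. f (ambient_dilation s q)) has_vector_derivative d) (at 1)"
  shows "amb.pairing gt rt f q = 2 * d"
proof -
  have q0: "q \<in> W0" using q W(2) by blast
  define K where "K = chart_at M q"
  have K: "K \<in> M" "q \<in> fst K" "snd K q \<in> chart_image K W0"
    unfolding K_def using amb.chart_at_openin[OF nbhd_open[OF W0(1)] q0] by auto
  note sm = smooth_metric_W0[OF K(1)]
  have df: "(f \<circ> chart_inv K) differentiable (at (snd K q))"
    unfolding K_def by (rule amb.smooth_fun_differentiable[OF W(1,3) q])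
  have "amb.pairing gt rt f q = local_pairing (in_chart gt K) (rt \<circ> chart_inv K) (f \<circ> chart_inv K) (snd K q)"
    by (simp add: amb.pairing_def Let_def K_def)
  also have "\<dots> = local_pairing (in_chart gt K) (\<lambda>x. in_chart gt K x (Tvec x) (Tvec x)) (f \<circ> chart_inv K) (snd K q)"
  proof -
    have "dird (rt \<circ> chart_inv K) (snd K q) = dird (\<lambda>x. in_chart gt K x (Tvec x) (Tvec x)) (snd K q)"
      by (rule dird_cong_open[OF smooth_metricD(1)[OF sm] K(3)]) (rule rt_in_chart[OF K(1)])
    then show ?thesis by (simp add: local_pairing_def)
  qed
  also have "\<dots> = 2 * dird (f \<circ> chart_inv K) (snd K q) (Tvec (snd K q))"
    by (rule local_pairing_norm_euler[OF sm bounded_linear_Tvec normalized_in_chart[OF K(1)] K(3) df])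
  also have "dird (f \<circ> chart_inv K) (snd K q) (Tvec (snd K q)) = d"
    by (rule vector_derivative_unique_at[OF has_derivative_along_dilation[OF K(1,2) df] d])
  finally show ?thesis .
qed

text \<open>Leibniz rule, with -2 (n + 2) for the Laplacian of \<open>rt\<close> and 2 w f for the
  pairing of the differentials, the latter by Euler's identity.\<close>

lemma lap_rt_mult:
  assumes "AD w f"
  shows "near (\<lambda>q. lap (\<lambda>q. rt q * f q) q = rt q * lap f q - 2 * (real DIM('e) + 2 + 2 * of_int w) * f q)"
proof -
  obtain W where W: "nbhd W" "openin (atlas_topology M) W" "pseudo_metric M W gt" "W \<subseteq> W0"
    "smooth_fun M W f" "smooth_fun M W rt"
    "\<forall>q\<in>W. \<forall>s>0. f (ambient_dilation s q) = s powi w * f q"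
    by (rule lapE[OF ADE(1)[OF assms] ADE(1)[OF AD_rt] ADE(2)[OF assms]]) (rule that)
  show ?thesis
  proof (rule near_nbhd[OF W(1)])
    fix q assume q: "q \<in> W"
    have "((\<lambda>s. s powi w * f q) has_vector_derivative of_int w * f q) (at 1)"
      unfolding has_real_derivative_iff_has_vector_derivative[symmetric]
      by (auto intro!: derivative_eq_intros)
    then have "((\<lambda>s. f (ambient_dilation s q)) has_vector_derivative of_int w * f q) (at 1)"
      by (rule has_vector_derivative_transform_within_open[of _ _ _ "{0<..}"]) (use W(7) q in auto)
    from pairing_rt[OF W(2,4,5) q this]
    have p: "amb.pairing gt rt f q = 2 * (of_int w * f q)" .
    have l: "lap rt q = - 2 * (real DIM('e) + 2)" using lap_rt q W(4) by blast
    show "lap (\<lambda>q. rt q * f q) q = rt q * lap f q - 2 * (real DIM('e) + 2 + 2 * of_int w) * f q"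
      unfolding amb.laplacian_mult[OF W(2,3) q W(6,5)] l p by (simp add: algebra_simps)
  qed
qed

text \<open>Each induction step applies \<open>lap_rt_mult\<close> to \<open>rt ^ k * f\<close>,
  whose weight is 2 k + w; the factors n + 2 + 2 (2 j + w) for j < k add up to k (2 k + n + 2 w).
  For k = 0 the truncated exponent k - 1 is harmless, as its coefficient is 0.\<close>

lemma lap_rt_power:
  assumes f: "AD w f"
  shows "near (\<lambda>q. lap (\<lambda>q. rt q ^ k * f q) q
    = rt q ^ k * lap f q - 2 * real k * (2 * real k + real DIM('e) + 2 * of_int w) * rt q ^ (k - 1) * f q)"
proof (induction k)
  case 0
  show ?case by (rule near_always) simp
next
  case (Suc k)
  have "AD (int k * 2 + w) (\<lambda>q. rt q ^ k * f q)" by (rule AD_mult[OF AD_power[OF AD_rt] f])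
  from lap_rt_mult[OF this] Suc show ?case
  proof (rule near_mp2)
    fix q
    assume 1: "lap (\<lambda>q. rt q * (rt q ^ k * f q)) q = rt q * lap (\<lambda>q. rt q ^ k * f q) q
        - 2 * (real DIM('e) + 2 + 2 * of_int (int k * 2 + w)) * (rt q ^ k * f q)"
      and 2: "lap (\<lambda>q. rt q ^ k * f q) q
        = rt q ^ k * lap f q - 2 * real k * (2 * real k + real DIM('e) + 2 * of_int w) * rt q ^ (k - 1) * f q"
    have "rt q * (2 * real k * (2 * real k + real DIM('e) + 2 * of_int w) * rt q ^ (k - 1) * f q)
        = 2 * real k * (2 * real k + real DIM('e) + 2 * of_int w) * rt q ^ k * f q"
      by (cases k) (simp_all add: algebra_simps)
    then show "lap (\<lambda>q. rt q ^ Suc k * f q) q = rt q ^ Suc k * lap f q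
        - 2 * real (Suc k) * (2 * real (Suc k) + real DIM('e) + 2 * of_int w) * rt q ^ (Suc k - 1) * f q"
      using 1 unfolding 2 by (simp add: algebra_simps)
  qed
qed

text \<open>By the Leibniz rule for \<open>\<Delta> (f h)\<close> this is \<open>\<langle>df, dh\<rangle>\<close>.\<close>

definition bracket :: "(('a, 'e) apoint \<Rightarrow> real) \<Rightarrow> (('a, 'e) apoint \<Rightarrow> real) \<Rightarrow> ('a, 'e) apoint \<Rightarrow> real" where
  "bracket f h q = (f q * lap h q + h q * lap f q - lap (\<lambda>q. f q * h q) q) / 2"

lemma AD_bracket:
  assumes "AD w f" "AD w' h"
  shows "AD (w + w' - 2) (bracket f h)"
proof -
  have "AD (w + w' - 2) (\<lambda>q. (1 / 2) * (f q * lap h q + h q * lap f q - lap (\<lambda>q. f q * h q) q))"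
    using AD_mult[OF assms(1) AD_lap[OF assms(2)]] AD_mult[OF assms(2) AD_lap[OF assms(1)]]
      AD_lap[OF AD_mult[OF assms]]
    by (intro AD_cmult AD_add AD_diff) (simp_all add: algebra_simps)
  then show ?thesis by (simp add: bracket_def[abs_def])
qed

lemma pairing_bracket:
  assumes "openin (atlas_topology M) W" "pseudo_metric M W gt" "q \<in> W" "smooth_fun M W f" "smooth_fun M W h"
  shows "amb.pairing gt f h q = bracket f h q"
  using amb.laplacian_mult[OF assms] by (simp add: bracket_def)

lemma lap_ln:
  assumes "sm f" "near (\<lambda>q. f q > 0)"
  shows "near (\<lambda>q. lap (\<lambda>q. ln (f q)) q = lap f q / f q + bracket f f q / (f q)\<^sup>2)"
proof -
  obtain W where W: "nbhd W" "openin (atlas_topology M) W" "pseudo_metric M W gt" "smooth_fun M W f" "\<forall>q\<in>W. f q > 0"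
    by (rule lapE[OF assms(1) sm_const assms(2)]) (rule that)
  show ?thesis
  proof (rule near_nbhd[OF W(1)])
    fix q assume q: "q \<in> W"
    show "lap (\<lambda>q. ln (f q)) q = lap f q / f q + bracket f f q / (f q)\<^sup>2"
      using amb.laplacian_ln[OF W(2,3) q W(4)] pairing_bracket[OF W(2,3) q W(4,4)] W(5) by simp
  qed
qed

text \<open>The logarithm is smooth only where h > 0, which is not a neighbourhood of the bundle.
  The rules are therefore applied on this open subset, and \<open>F\<close> is carried along because
  additivity, too, has to be used there.\<close>

lemma lap_add_mult_ln:
  assumes "sm F" "sm f" "sm h"
  shows "near (\<lambda>q. h q > 0 \<longrightarrow> lap (\<lambda>q. F q + f q * ln (h q)) q
    = lap F q + (f q * (lap h q / h q + bracket h h q / (h q)\<^sup>2) + ln (h q) * lap f q - 2 * (bracket h f q / h q)))"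
proof -
  obtain W1 where W1: "nbhd W1" "smooth_fun M W1 F" using assms(1) unfolding smooth_near_bundle_def by blast
  obtain W where W: "nbhd W" "openin (atlas_topology M) W" "pseudo_metric M W gt" "W \<subseteq> W0" "smooth_fun M W f" "smooth_fun M W h"
    "\<forall>q\<in>W. q \<in> W1"
    by (rule lapE[OF assms(2,3) near_nbhd[OF W1(1)]]) (assumption | rule that)+
  let ?W = "{q \<in> W. h q > 0}"
  have op: "openin (atlas_topology M) ?W" by (rule amb.openin_superlevel[OF W(2,6)])
  have pm: "pseudo_metric M ?W gt" using W(4) by (intro metric_nbhd[OF op]) auto
  have sF: "smooth_fun M ?W F" by (rule amb.smooth_fun_subset[OF W1(2)]) (use W(7) in auto)
  have sf: "smooth_fun M ?W f" and sh: "smooth_fun M ?W h"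
    by (rule amb.smooth_fun_subset[OF W(5)], blast, rule amb.smooth_fun_subset[OF W(6)], blast)
  have pos: "\<And>q. q \<in> ?W \<Longrightarrow> h q > 0" by simp
  have sl: "smooth_fun M ?W (\<lambda>q. ln (h q))" by (rule amb.smooth_fun_ln[OF op sh pos])
  show ?thesis
  proof (rule near_nbhd[OF W(1)], rule impI)
    fix q assume "q \<in> W" "h q > 0"
    then have q: "q \<in> ?W" by simp
    have "amb.pairing gt f (\<lambda>q. ln (h q)) q = bracket h f q / h q"
      using amb.pairing_sym[OF op pm q, of f "\<lambda>q. ln (h q)"] amb.pairing_ln[OF op pm q sh pos[OF q], of f]
        pairing_bracket[OF op pm q sh sf] by simp
    then show "lap (\<lambda>q. F q + f q * ln (h q)) q
      = lap F q + (f q * (lap h q / h q + bracket h h q / (h q)\<^sup>2) + ln (h q) * lap f q - 2 * (bracket h f q / h q))"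
      using amb.laplacian_add[OF op pm q sF amb.smooth_fun_mult[OF op sf sl]]
        amb.laplacian_mult[OF op pm q sf sl] amb.laplacian_ln[OF op pm q sh pos]
        pairing_bracket[OF op pm q sh sh] by simp
  qed
qed

end

text \<open>The bound ln z <= z at z = 1 / sqrt x gives - x ln x <= 2 sqrt x.\<close>

lemma tendsto_x_ln_x: "((\<lambda>x::real. x * ln x) \<longlongrightarrow> 0) (at_right 0)"
proof (rule Lim_null_comparison)
  have "\<forall>\<^sub>F x in at_right 0. x \<in> {0<..<1::real}"
    by (rule eventually_at_right_real) simp
  then show "\<forall>\<^sub>F x in at_right 0. norm (x * ln x) \<le> 2 * sqrt x"
  proof eventually_elim
    case (elim x)
    have "ln (1 / sqrt x) \<le> 1 / sqrt x" using elim by (intro ln_bound) auto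
    moreover have "ln (1 / sqrt x) = - ln x / 2" using elim by (simp add: ln_div ln_sqrt)
    ultimately have "- ln x \<le> 2 / sqrt x" by simp
    then have "x * (- ln x) \<le> x * (2 / sqrt x)" using elim by (intro mult_left_mono) auto
    moreover have "x * (2 / sqrt x) = 2 * sqrt x"
      using elim real_sqrt_mult_self[of x] by (simp add: field_simps)
    moreover have "norm (x * ln x) = x * (- ln x)"
      using elim by (simp add: abs_mult)
    ultimately show ?case by simp
  qed
  show "((\<lambda>x. 2 * sqrt x) \<longlongrightarrow> 0) (at_right 0)"
    by (auto intro!: tendsto_eq_intros)
qed

section \<open>Vanishing orders along the metric bundle\<close>

context ambient
begin

abbreviation "Orho \<equiv> O_rho A cf gt"

lemma OrhoI: "sm h \<Longrightarrow> near (\<lambda>q. f q = rt q ^ k * h q) \<Longrightarrow> Orho k f"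
  unfolding O_rho_def by blast

lemma OrhoE:
  assumes "Orho k f"
  obtains h where "sm h" "near (\<lambda>q. f q = rt q ^ k * h q)"
  using assms unfolding O_rho_def by blast

lemma sm_rt: "sm rt"
  by (rule ADE(1)[OF AD_rt])

lemma Orho_cong:
  assumes "Orho k f" "near (\<lambda>q. f q = g q)"
  shows "Orho k g"
proof -
  obtain h where h: "sm h" "near (\<lambda>q. f q = rt q ^ k * h q)" by (rule OrhoE[OF assms(1)])
  show ?thesis by (rule OrhoI[OF h(1) near_mp2[OF h(2) assms(2)]]) simp
qed

lemma Orho_0: "sm f \<Longrightarrow> Orho 0 f"
  by (rule OrhoI) (auto intro: near_always)

lemma Orho_add:
  assumes "Orho k f" "Orho k g"
  shows "Orho k (\<lambda>q. f q + g q)"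
proof -
  obtain h where h: "sm h" "near (\<lambda>q. f q = rt q ^ k * h q)" by (rule OrhoE[OF assms(1)])
  obtain h' where h': "sm h'" "near (\<lambda>q. g q = rt q ^ k * h' q)" by (rule OrhoE[OF assms(2)])
  show ?thesis
    by (rule OrhoI[OF sm_add[OF h(1) h'(1)] near_mp2[OF h(2) h'(2)]]) (simp add: distrib_left)
qed

lemma Orho_mult:
  assumes "Orho k f" "Orho l g"
  shows "Orho (k + l) (\<lambda>q. f q * g q)"
proof -
  obtain h where h: "sm h" "near (\<lambda>q. f q = rt q ^ k * h q)" by (rule OrhoE[OF assms(1)])
  obtain h' where h': "sm h'" "near (\<lambda>q. g q = rt q ^ l * h' q)" by (rule OrhoE[OF assms(2)])
  show ?thesis
    by (rule OrhoI[OF sm_mult[OF h(1) h'(1)] near_mp2[OF h(2) h'(2)]]) (simp add: power_add)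
qed

lemma Orho_cmult: "Orho k f \<Longrightarrow> Orho k (\<lambda>q. c * f q)"
  using Orho_mult[OF Orho_0[OF sm_const]] by simp

lemma Orho_diff: "Orho k f \<Longrightarrow> Orho k g \<Longrightarrow> Orho k (\<lambda>q. f q - g q)"
  using Orho_add[OF _ Orho_cmult[of k g "-1"]] by simp

lemma Orho_rt_power: "Orho k (\<lambda>q. rt q ^ k)"
  by (rule OrhoI[OF sm_const[of 1]]) (auto intro: near_always)

lemma Orho_rt_mult: "sm h \<Longrightarrow> Orho k (\<lambda>q. rt q ^ k * h q)"
  by (rule OrhoI) (auto intro: near_always)

lemma Orho_sm:
  assumes "Orho k f"
  shows "sm f"
proof -
  obtain h where h: "sm h" "near (\<lambda>q. f q = rt q ^ k * h q)" by (rule OrhoE[OF assms])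
  show ?thesis by (rule sm_cong[OF sm_mult[OF sm_power[OF sm_rt, of k] h(1)] near_mono[OF h(2)]]) simp
qed

lemma Orho_mono:
  assumes "Orho k f" "l \<le> k"
  shows "Orho l f"
proof -
  obtain h where h: "sm h" "near (\<lambda>q. f q = rt q ^ k * h q)" by (rule OrhoE[OF assms(1)])
  show ?thesis
  proof (rule OrhoI[OF sm_mult[OF sm_power[OF sm_rt, of "k - l"] h(1)] near_mono[OF h(2)]])
    fix q assume "f q = rt q ^ k * h q"
    then show "f q = rt q ^ l * (rt q ^ (k - l) * h q)"
      using assms(2) by (simp add: mult.assoc[symmetric] power_add[symmetric])
  qed
qed

lemma Orho_zero_bundle:
  assumes "Orho k f" "k > 0" "y \<in> MB"
  shows "f (y, 0) = 0"
proof -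
  obtain h where h: "sm h" "near (\<lambda>q. f q = rt q ^ k * h q)" by (rule OrhoE[OF assms(1)])
  show ?thesis using near_on_bundle[OF h(2) assms(3)] rt_bundle[OF assms(3)] assms(2) by simp
qed

lemma Orho_cancel:
  assumes "sm f" "Orho (k + l) (\<lambda>q. rt q ^ k * f q)"
  shows "Orho l f"
proof -
  obtain h where h: "sm h" "near (\<lambda>q. rt q ^ k * f q = rt q ^ (k + l) * h q)" by (rule OrhoE[OF assms(2)])
  have "near (\<lambda>q. rt q ^ k * f q = rt q ^ k * (rt q ^ l * h q))"
    by (rule near_mono[OF h(2)]) (simp add: power_add mult.assoc)
  then show ?thesis
    by (rule OrhoI[OF h(1) near_cancel_rt_power[OF assms(1) sm_mult[OF sm_power[OF sm_rt] h(1)]]])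
qed

lemma Orho_1I: "sm f \<Longrightarrow> (\<And>y. y \<in> MB \<Longrightarrow> f (y, 0) = 0) \<Longrightarrow> Orho 1 f"
  by (rule sm_divide_rt[of f], assumption, blast) (rule OrhoI, auto)

text \<open>For a density the cofactor of \<open>rt ^ k\<close> can be chosen as a density, by
  dividing one factor at a time; its weight is what \<open>lap_rt_power\<close> needs.\<close>

lemma AD_Orho:
  "AD w f \<Longrightarrow> Orho k f \<Longrightarrow> \<exists>h. AD (w - 2 * int k) h \<and> near (\<lambda>q. f q = rt q ^ k * h q)"
proof (induction k arbitrary: w f)
  case 0
  then show ?case by (intro exI[of _ f]) (auto intro: near_always)
next
  case (Suc k)
  obtain f1 where f1: "AD (w - 2) f1" "near (\<lambda>q. f q = rt q * f1 q)"
    by (rule AD_divide_rt[OF Suc.prems(1) Orho_zero_bundle[OF Suc.prems(2)]]) auto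
  have "Orho (1 + k) (\<lambda>q. rt q ^ 1 * f1 q)"
    using Orho_cong[OF Suc.prems(2) f1(2)] by simp
  then have "Orho k f1" by (rule Orho_cancel[OF ADE(1)[OF f1(1)]])
  from Suc.IH[OF f1(1) this] obtain h where h: "AD (w - 2 - 2 * int k) h" "near (\<lambda>q. f1 q = rt q ^ k * h q)"
    by blast
  have "near (\<lambda>q. f q = rt q ^ Suc k * h q)" by (rule near_mp2[OF f1(2) h(2)]) simp
  moreover have "AD (w - 2 * int (Suc k)) h" using h(1) by (simp add: algebra_simps)
  ultimately show ?case by blast
qed

lemma Orho_SucI:
  assumes "AD w h" "\<And>y. y \<in> MB \<Longrightarrow> h (y, 0) = 0"
  shows "Orho (Suc k) (\<lambda>q. rt q ^ k * h q)"
  using Orho_mult[OF Orho_rt_power Orho_1I[OF ADE(1)[OF assms(1)] assms(2)], of k] by simp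

section \<open>Iterated Laplacians\<close>

lemma AD_iter: "AD w f \<Longrightarrow> AD (w - 2 * int j) ((lap ^^ j) f)"
proof (induction j)
  case (Suc j)
  then show ?case using AD_lap[OF Suc.IH[OF Suc.prems]] by (simp add: algebra_simps)
qed simp

lemma sm_iter: "sm f \<Longrightarrow> sm ((lap ^^ j) f)"
  by (induction j) (auto intro: sm_lap)

lemma iter_cong: "near (\<lambda>q. f q = h q) \<Longrightarrow> near (\<lambda>q. (lap ^^ j) f q = (lap ^^ j) h q)"
proof (induction j)
  case (Suc j)
  then show ?case using lap_cong[OF Suc.IH[OF Suc.prems]] by simp
qed simp

lemma iter_add:
  assumes "sm f" "sm h"
  shows "near (\<lambda>q. (lap ^^ j) (\<lambda>q. f q + h q) q = (lap ^^ j) f q + (lap ^^ j) h q)"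
proof (induction j)
  case (Suc j)
  show ?case
    using near_mp2[OF lap_cong[OF Suc] lap_add[OF sm_iter[OF assms(1)] sm_iter[OF assms(2)]]] by simp
qed (simp add: near_always)

lemma lap_diff:
  assumes "sm f" "sm h"
  shows "near (\<lambda>q. lap (\<lambda>q. f q - h q) q = lap f q - lap h q)"
proof -
  have "near (\<lambda>q. lap (\<lambda>q. f q + (- 1) * h q) q = lap f q + lap (\<lambda>q. (- 1) * h q) q)"
    by (rule lap_add[OF assms(1) sm_cmult[OF assms(2)]])
  from near_mp2[OF this lap_cmult[OF assms(2), of "-1"]] show ?thesis by simp
qed

text \<open>Only one order is lost although the operator has order two: the differential of
  \<open>rt\<close> has squared norm 4 \<open>rt\<close>, so the bundle is a null hypersurface, and
  differentiating a power of \<open>rt\<close> twice lowers the exponent by one only.\<close>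

lemma Orho_lap:
  assumes "AD w f" "Orho (Suc k) f"
  shows "Orho k (lap f)"
proof -
  obtain h where h: "AD (w - 2 * int (Suc k)) h" "near (\<lambda>q. f q = rt q ^ Suc k * h q)"
    using AD_Orho[OF assms] by blast
  let ?c = "2 * real (Suc k) * (2 * real (Suc k) + real DIM('e) + 2 * of_int (w - 2 * int (Suc k)))"
  have "near (\<lambda>q. lap f q = rt q ^ k * (rt q * lap h q - ?c * h q))"
    by (rule near_mp2[OF lap_cong[OF h(2)] lap_rt_power[OF h(1), of "Suc k"]])
      (simp add: right_diff_distrib mult_ac)
  moreover have "sm (\<lambda>q. rt q * lap h q - ?c * h q)"
    by (intro sm_diff sm_mult sm_cmult sm_rt sm_lap ADE(1)[OF h(1)])
  ultimately show ?thesis by (intro OrhoI)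
qed

lemma Orho_iter:
  "AD w f \<Longrightarrow> Orho (j + k) f \<Longrightarrow> Orho k ((lap ^^ j) f)"
proof (induction j arbitrary: k)
  case (Suc j)
  have "Orho (Suc k) ((lap ^^ j) f)" by (rule Suc.IH) (use Suc.prems in simp_all)
  from Orho_lap[OF AD_iter[OF Suc.prems(1)] this] show ?case by simp
qed simp

text \<open>The coefficient \<open>2 (j + 1) (n - 2 (j + 1))\<close> vanishes for \<open>j + 1 = n / 2\<close>; this is why
  \<open>\<Delta>\<^sup>n\<^sup>/\<^sup>2\<close> acts on densities of weight \<open>0\<close> on \<open>\<G>\<close>.\<close>

lemma iter_rt_mult:
  assumes f: "AD (-2) f"
  shows "near (\<lambda>q. (lap ^^ Suc j) (\<lambda>q. rt q * f q) q = rt q * (lap ^^ Suc j) f q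
    - 2 * real (Suc j) * (real DIM('e) - 2 * real (Suc j)) * (lap ^^ j) f q)"
proof (induction j)
  case 0
  show ?case using lap_rt_mult[OF f] by simp
next
  case (Suc j)
  let ?c = "2 * real (Suc j) * (real DIM('e) - 2 * real (Suc j))"
  let ?g = "(lap ^^ Suc j) f"
  have g: "AD (-2 - 2 * int (Suc j)) ?g" by (rule AD_iter[OF f])
  have g': "AD (-2 - 2 * int j) ((lap ^^ j) f)" by (rule AD_iter[OF f])
  have "near (\<lambda>q. lap ((lap ^^ Suc j) (\<lambda>q. rt q * f q)) q = lap (\<lambda>q. rt q * ?g q - ?c * (lap ^^ j) f q) q)"
    by (rule lap_cong[OF Suc])
  moreover have "near (\<lambda>q. lap (\<lambda>q. rt q * ?g q - ?c * (lap ^^ j) f q) q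
      = lap (\<lambda>q. rt q * ?g q) q - lap (\<lambda>q. ?c * (lap ^^ j) f q) q)"
    by (rule lap_diff[OF sm_mult[OF sm_rt ADE(1)[OF g]] sm_cmult[OF ADE(1)[OF g']]])
  moreover have "near (\<lambda>q. lap (\<lambda>q. rt q * ?g q) q - lap (\<lambda>q. ?c * (lap ^^ j) f q) q
      = (rt q * lap ?g q - 2 * (real DIM('e) + 2 + 2 * of_int (-2 - 2 * int (Suc j))) * ?g q) - ?c * ?g q)"
    by (rule near_mp2[OF lap_rt_mult[OF g] lap_cmult[OF ADE(1)[OF g'], of ?c]]) simp
  ultimately show ?case
    by (rule near_mp3) (simp add: algebra_simps)
qed

text \<open>For weight -n, \<open>lap_rt_power\<close> lowers the exponent i by one and produces the
  factor 2 i (n - 2 i). Its other term keeps the exponent, which the remaining Laplacians cannot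
  exhaust, so that it vanishes on the bundle.\<close>

lemma iter_rt_power_bundle:
  "AD (- int DIM('e)) f \<Longrightarrow> y \<in> MB \<Longrightarrow>
    (lap ^^ k) (\<lambda>q. rt q ^ k * f q) (y, 0)
      = (\<Prod>i=1..k. 2 * real i * (real DIM('e) - 2 * real i)) * f (y, 0)"
proof (induction k arbitrary: f)
  case (Suc k)
  let ?c = "2 * real (Suc k) * (real DIM('e) - 2 * real (Suc k))"
  note f = Suc.prems(1)
  have "near (\<lambda>q. lap (\<lambda>q. rt q ^ Suc k * f q) q = rt q ^ Suc k * lap f q + rt q ^ k * (?c * f q))"
    by (rule near_mono[OF lap_rt_power[OF f, of "Suc k"]]) (simp add: algebra_simps)
  from iter_cong[OF this, of k]
  have 1: "near (\<lambda>q. (lap ^^ k) (lap (\<lambda>q. rt q ^ Suc k * f q)) q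
      = (lap ^^ k) (\<lambda>q. rt q ^ Suc k * lap f q + rt q ^ k * (?c * f q)) q)" .
  note cf' = AD_cmult[OF f, of ?c]
  have lf: "AD (- int DIM('e) - 2) (lap f)" by (rule AD_lap[OF f])
  have 2: "near (\<lambda>q. (lap ^^ k) (\<lambda>q. rt q ^ Suc k * lap f q + rt q ^ k * (?c * f q)) q
      = (lap ^^ k) (\<lambda>q. rt q ^ Suc k * lap f q) q + (lap ^^ k) (\<lambda>q. rt q ^ k * (?c * f q)) q)"
    by (rule iter_add; intro sm_mult sm_power sm_rt ADE(1)[OF lf] ADE(1)[OF cf'])
  have "Orho 1 ((lap ^^ k) (\<lambda>q. rt q ^ Suc k * lap f q))"
    using Orho_iter[OF AD_mult[OF AD_power[OF AD_rt, of "Suc k"] lf], of k 1] Orho_rt_mult[OF ADE(1)[OF lf], of "Suc k"]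
    by simp
  then have 3: "(lap ^^ k) (\<lambda>q. rt q ^ Suc k * lap f q) (y, 0) = 0"
    by (rule Orho_zero_bundle) (use Suc.prems in simp_all)
  have "(lap ^^ Suc k) (\<lambda>q. rt q ^ Suc k * f q) (y, 0) = (lap ^^ k) (\<lambda>q. rt q ^ k * (?c * f q)) (y, 0)"
    using near_on_bundle[OF 1 Suc.prems(2)] near_on_bundle[OF 2 Suc.prems(2)] 3
    by (simp only: funpow_Suc_right o_apply)
  also have "\<dots> = (\<Prod>i=1..k. 2 * real i * (real DIM('e) - 2 * real i)) * (?c * f (y, 0))"
    by (rule Suc.IH[OF cf' Suc.prems(2)])
  also have "\<dots> = (\<Prod>i=1..Suc k. 2 * real i * (real DIM('e) - 2 * real i)) * f (y, 0)"
    unfolding prod.cl_ivl_Suc by (simp del: of_nat_Suc)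
  finally show ?case .
qed simp

section \<open>Truncations of formal power series\<close>

lemma AD_term: "density A cf w b \<Longrightarrow> AD w (\<lambda>q. b (fst q) * snd q ^ k)"
  using AD_mult[OF AD_fst AD_power[OF AD_snd, of k]] by simp

lemma AD_truncation: "formal_density A cf w a \<Longrightarrow> AD w (truncation a N)"
  unfolding truncation_def[abs_def] formal_density_def by (intro AD_sum AD_term) auto

lemma Orho_snd_power: "Orho k (\<lambda>q. snd q ^ k)"
proof -
  obtain u where u: "AD (-2) u" "near (\<lambda>q. snd q = rt q * u q)" by (rule snd_factor)
  show ?thesis
    by (rule OrhoI[OF sm_power[OF ADE(1)[OF u(1)], of k]], rule near_mono[OF u(2)]) (simp add: power_mult_distrib)
qed

lemma Orho_truncation_tail:
  assumes a: "formal_density A cf w a" and "j \<le> N"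
  shows "Orho j (\<lambda>q. truncation a N q - truncation a j q)"
proof -
  have "truncation a N q - truncation a j q = snd q ^ j * (\<Sum>k\<in>{j<..N}. a k (fst q) * snd q ^ (k - j))" for q
  proof -
    have "{..N} = {..j} \<union> {j<..N}" using assms(2) by auto
    then have "truncation a N q = truncation a j q + (\<Sum>k\<in>{j<..N}. a k (fst q) * snd q ^ k)"
      unfolding truncation_def by (simp only:) (subst sum.union_disjoint, auto)
    moreover have "(\<Sum>k\<in>{j<..N}. a k (fst q) * snd q ^ k) = snd q ^ j * (\<Sum>k\<in>{j<..N}. a k (fst q) * snd q ^ (k - j))"
      unfolding sum_distrib_left
    proof (rule sum.cong[OF refl])
      fix k assume "k \<in> {j<..N}"
      then have "snd q ^ k = snd q ^ j * snd q ^ (k - j)" by (simp add: power_add[symmetric])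
      then show "a k (fst q) * snd q ^ k = snd q ^ j * (a k (fst q) * snd q ^ (k - j))" by simp
    qed
    ultimately show ?thesis by simp
  qed
  moreover have "sm (\<lambda>q. \<Sum>k\<in>{j<..N}. a k (fst q) * snd q ^ (k - j))"
    by (rule ADE(1)[OF AD_sum[of _ w]]) (use a in \<open>auto intro: AD_term simp: formal_density_def\<close>)
  ultimately show ?thesis using Orho_mult[OF Orho_snd_power Orho_0, of _ j] by simp
qed

text \<open>Converts vanishing order back into vanishing coefficients: after division by
  \<open>r ^ k\<close>, the lower coefficients being 0, the limit r to 0 isolates
  \<open>a k y\<close> on one side and gives 0 on the other. The bound on \<open>K\<close> ensures
  that all coefficients in question occur in the truncation.\<close>

lemma truncation_Orho_coeff:
  assumes "Orho K (truncation a N)" "K \<le> Suc N" "y \<in> MB"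
  shows "k < K \<Longrightarrow> a k y = 0"
proof (induction k rule: less_induct)
  case (less k)
  obtain h where h: "sm h" "near (\<lambda>q. truncation a N q = rt q ^ K * h q)" by (rule OrhoE[OF assms(1)])
  obtain v where v: "AD 2 v" "near (\<lambda>q. rt q = snd q * v q)" by (rule rt_factor)
  let ?h = "\<lambda>q. v q ^ K * h q"
  have "near (\<lambda>q. truncation a N q = snd q ^ K * ?h q)"
    by (rule near_mp2[OF h(2) v(2)]) (simp add: power_mult_distrib)
  from near_fibre_at[OF this assms(3)]
  have ev: "\<forall>\<^sub>F r in at 0. truncation a N (y, r) = r ^ K * ?h (y, r)" by simp
  have "k \<le> N" using less.prems assms(2) by simp
  have t: "truncation a N (y, r) = r ^ k * (\<Sum>j\<in>{k..N}. a j y * r ^ (j - k))" for r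
  proof -
    have "truncation a N (y, r) = (\<Sum>j\<in>{k..N}. a j y * r ^ j)"
      unfolding truncation_def by (rule sum.mono_neutral_cong_right) (use less.IH less.prems in auto)
    also have "\<dots> = r ^ k * (\<Sum>j\<in>{k..N}. a j y * r ^ (j - k))"
      unfolding sum_distrib_left
    proof (rule sum.cong[OF refl])
      fix j assume "j \<in> {k..N}"
      then have "r ^ j = r ^ k * r ^ (j - k)" by (simp add: power_add[symmetric])
      then show "a j y * r ^ j = r ^ k * (a j y * r ^ (j - k))" by simp
    qed
    finally show ?thesis .
  qed
  have "\<forall>\<^sub>F r in at 0. r \<noteq> (0::real)" by (simp add: eventually_at_filter)
  with ev have "\<forall>\<^sub>F r in at 0. r ^ (K - k) * ?h (y, r) = (\<Sum>j\<in>{k..N}. a j y * r ^ (j - k))"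
  proof eventually_elim
    case (elim r)
    have K: "r ^ K = r ^ k * r ^ (K - k)" using less.prems by (simp add: power_add[symmetric])
    have "r ^ k * (r ^ (K - k) * ?h (y, r)) = truncation a N (y, r)"
      unfolding elim(1) K by (simp only: mult.assoc)
    also have "\<dots> = r ^ k * (\<Sum>j\<in>{k..N}. a j y * r ^ (j - k))" by (rule t)
    finally have e: "r ^ k * (r ^ (K - k) * ?h (y, r)) = r ^ k * (\<Sum>j\<in>{k..N}. a j y * r ^ (j - k))" .
    have "r ^ k \<noteq> 0" using elim(2) by simp
    from mult_left_cancel[THEN iffD1, OF this e] show ?case .
  qed
  moreover have "((\<lambda>r. r ^ (K - k) * ?h (y, r)) \<longlongrightarrow> 0 ^ (K - k) * ?h (y, 0)) (at 0)"
    by (intro tendsto_intros sm_fibre_tendsto[OF ADE(1)[OF v(1)] assms(3)] sm_fibre_tendsto[OF h(1) assms(3)])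
  ultimately have "((\<lambda>r. \<Sum>j\<in>{k..N}. a j y * r ^ (j - k)) \<longlongrightarrow> 0 ^ (K - k) * ?h (y, 0)) (at 0)"
    by (rule Lim_transform_eventually[rotated])
  moreover have "((\<lambda>r. \<Sum>j\<in>{k..N}. a j y * r ^ (j - k)) \<longlongrightarrow> (\<Sum>j\<in>{k..N}. a j y * 0 ^ (j - k))) (at 0)"
    by (intro tendsto_intros)
  ultimately have "0 ^ (K - k) * ?h (y, 0) = (\<Sum>j\<in>{k..N}. a j y * 0 ^ (j - k))"
    by (rule tendsto_unique[rotated]) simp
  moreover have "(\<Sum>j\<in>{k..N}. a j y * 0 ^ (j - k)) = a k y"
  proof -
    have "(\<Sum>j\<in>{k..N}. a j y * 0 ^ (j - k)) = (\<Sum>j\<in>{k}. a j y * 0 ^ (j - k))"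
      by (rule sum.mono_neutral_right) (use \<open>k \<le> N\<close> in auto)
    then show ?thesis by simp
  qed
  moreover have "(0::real) ^ (K - k) = 0" using less.prems by simp
  ultimately show ?case by simp
qed

text \<open>The step in solving \<Delta>a = - S order by order. Adding a term of order k + 1 changes
  the error of order k by \<open>- ?c\<close> times its leading coefficient, so the error can be
  removed whenever the indicial factor n + 2 w - 2 (k + 1) is nonzero.\<close>

lemma series_step:
  assumes a: "formal_density A cf w a" and \<psi>: "AD (w - 2 - 2 * int k) \<psi>"
    and S: "near (\<lambda>q. S q + lap (truncation a k) q = rt q ^ k * \<psi> q)"
    and c: "real DIM('e) + 2 * of_int w - 2 * real (Suc k) \<noteq> 0"
  obtains b \<psi>' where "density A cf w b" "AD (w - 2 - 2 * int (Suc k)) \<psi>'"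
    "near (\<lambda>q. S q + lap (truncation (a(Suc k := b)) (Suc k)) q = rt q ^ Suc k * \<psi>' q)"
proof -
  obtain u where u: "AD (-2) u" "near (\<lambda>q. snd q = rt q * u q)" "near (\<lambda>q. u q \<noteq> 0)" by (rule snd_factor)
  let ?c = "2 * real (Suc k) * (real DIM('e) + 2 * of_int w - 2 * real (Suc k))"
  have c0: "?c \<noteq> 0" using c by simp
  have iu: "AD 2 (\<lambda>q. inverse (u q))" using AD_nonzero(2)[OF u(1)] near_on_bundle[OF u(3)] by simp
  \<comment> \<open>The power of \<open>inverse u\<close> compensates for rewriting the power of r
    as one of \<open>rt\<close>, so that \<open>?c * U\<close> equals \<open>\<psi>\<close> on the
    bundle.\<close>
  define b where "b y = (1 / ?c) * (\<psi> (y, 0) * inverse (u (y, 0)) ^ Suc k)" for y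
  have "AD w (\<lambda>q. (1 / ?c) * (\<psi> q * inverse (u q) ^ Suc k))"
    using AD_cmult[OF AD_mult[OF \<psi> AD_power[OF iu, of "Suc k"]], of "1 / ?c"] by (simp add: algebra_simps)
  from density_restrict[OF this] have b: "density A cf w b" by (simp add: b_def[abs_def])
  define U where "U q = u q ^ Suc k * b (fst q)" for q
  have U: "AD (w - 2 * int (Suc k)) U"
    using AD_mult[OF AD_power[OF u(1), of "Suc k"] AD_fst[OF b]] by (simp add: U_def[abs_def] algebra_simps)
  have bU: "near (\<lambda>q. b (fst q) * snd q ^ Suc k = rt q ^ Suc k * U q)"
    by (rule near_mono[OF u(2)]) (simp add: U_def power_mult_distrib del: power_Suc)
  have \<psi>U: "AD (w - 2 - 2 * int k) (\<lambda>q. \<psi> q - ?c * U q)"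
    by (rule AD_diff[OF \<psi> AD_cmult]) (use U in \<open>simp add: algebra_simps\<close>)
  have z: "\<psi> (y, 0) - ?c * U (y, 0) = 0" if y: "y \<in> MB" for y
  proof -
    have "u (y, 0) ^ Suc k * inverse (u (y, 0)) ^ Suc k = 1"
      using near_on_bundle[OF u(3) y] by (simp only: power_mult_distrib[symmetric]) simp
    moreover have "U (y, 0) = (1 / ?c) * \<psi> (y, 0) * (u (y, 0) ^ Suc k * inverse (u (y, 0)) ^ Suc k)"
      by (simp only: U_def b_def fst_conv mult_ac)
    ultimately have "U (y, 0) = (1 / ?c) * \<psi> (y, 0)" by simp
    then show ?thesis using c0 by simp
  qed
  obtain h where h: "AD (w - 2 - 2 * int k - 2) h" "near (\<lambda>q. \<psi> q - ?c * U q = rt q * h q)"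
    by (rule AD_divide_rt[OF \<psi>U z])
  have trunc: "truncation (a(Suc k := b)) (Suc k) = (\<lambda>q. truncation a k q + b (fst q) * snd q ^ Suc k)"
    by (rule ext) (simp add: truncation_def)
  have "near (\<lambda>q. lap (truncation (a(Suc k := b)) (Suc k)) q
      = lap (truncation a k) q + lap (\<lambda>q. b (fst q) * snd q ^ Suc k) q)"
    unfolding trunc by (rule lap_add[OF ADE(1)[OF AD_truncation[OF a]] ADE(1)[OF AD_term[OF b]]])
  moreover have "near (\<lambda>q. lap (\<lambda>q. b (fst q) * snd q ^ Suc k) q = rt q ^ Suc k * lap U q - ?c * rt q ^ k * U q)"
    by (rule near_mp2[OF lap_cong[OF bU] lap_rt_power[OF U, of "Suc k"]]) (simp add: algebra_simps)
  ultimately have "near (\<lambda>q. lap (truncation (a(Suc k := b)) (Suc k)) q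
      = lap (truncation a k) q + (rt q ^ Suc k * lap U q - ?c * rt q ^ k * U q))"
    by (rule near_mp2) simp
  with S h(2) have "near (\<lambda>q. S q + lap (truncation (a(Suc k := b)) (Suc k)) q = rt q ^ Suc k * (h q + lap U q))"
  proof (rule near_mp3)
    fix q assume 1: "S q + lap (truncation a k) q = rt q ^ k * \<psi> q" and 2: "\<psi> q - ?c * U q = rt q * h q"
      and 3: "lap (truncation (a(Suc k := b)) (Suc k)) q
        = lap (truncation a k) q + (rt q ^ Suc k * lap U q - ?c * rt q ^ k * U q)"
    have "S q + lap (truncation (a(Suc k := b)) (Suc k)) q
        = (S q + lap (truncation a k) q) + rt q ^ Suc k * lap U q - ?c * rt q ^ k * U q"
      unfolding 3 by simp
    also have "\<dots> = rt q ^ k * (\<psi> q - ?c * U q) + rt q ^ Suc k * lap U q"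
      unfolding 1 by (simp only: right_diff_distrib mult_ac)
    also have "\<dots> = rt q ^ Suc k * (h q + lap U q)"
      unfolding 2 by (simp add: algebra_simps)
    finally show "S q + lap (truncation (a(Suc k := b)) (Suc k)) q = rt q ^ Suc k * (h q + lap U q)" .
  qed
  moreover have "AD (w - 2 - 2 * int (Suc k)) (\<lambda>q. h q + lap U q)"
    using h(1) AD_lap[OF U] by (intro AD_add) (simp_all add: algebra_simps)
  ultimately show thesis using that[OF b] by blast
qed

lemma truncation_cong: "(\<And>k. k \<le> N \<Longrightarrow> a k = b k) \<Longrightarrow> truncation a N = truncation b N"
  unfolding truncation_def by (intro ext sum.cong) auto

text \<open>The source \<open>S\<close> may depend on the truncation order, since it will contain a
  truncation of \<eta>; a change by O(rho^k) at stage k spoils nothing achieved before. From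
  \<open>j0\<close> on, no indicial factor vanishes.\<close>

lemma series_exists:
  assumes a0: "formal_density A cf w a0"
    and init: "Orho j0 (\<lambda>q. S j0 q + lap (truncation a0 j0) q)"
    and S: "\<And>k. AD (w - 2) (S k)" "\<And>k. k \<ge> j0 \<Longrightarrow> Orho k (\<lambda>q. S (Suc k) q - S k q)"
    and c: "\<And>k. k \<ge> j0 \<Longrightarrow> real DIM('e) + 2 * of_int w - 2 * real (Suc k) \<noteq> 0"
  obtains a where "formal_density A cf w a" "\<forall>k\<le>j0. a k = a0 k"
    "\<forall>N\<ge>j0. Orho N (\<lambda>q. S N q + lap (truncation a N) q)"
proof -
  \<comment> \<open>\<open>?P\<close> says that the equation holds to order j0 + i, and
    \<open>?Q\<close> that coefficients up to j0 + i are not changed any more.\<close>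
  let ?P = "\<lambda>i a. formal_density A cf w a \<and> (\<forall>k\<le>j0. a k = a0 k) \<and>
    Orho (j0 + i) (\<lambda>q. S (j0 + i) q + lap (truncation a (j0 + i)) q)"
  let ?Q = "\<lambda>i a b. \<forall>k\<le>j0 + i. b k = (a k :: ('a, 'e) bpoint \<Rightarrow> real)"
  have "\<exists>f. \<forall>i. ?P i (f i) \<and> ?Q i (f i) (f (Suc i))"
  proof (rule dependent_nat_choice)
    show "\<exists>a. ?P 0 a" using a0 init by (intro exI[of _ a0]) simp
  next
    fix a i assume P: "?P i a"
    let ?k = "j0 + i"
    have a: "formal_density A cf w a" using P by blast
    have sl: "AD (w - 2) (\<lambda>q. S (Suc ?k) q + lap (truncation a ?k) q)"
      by (intro AD_add S AD_lap AD_truncation a)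
    have "Orho ?k (\<lambda>q. S ?k q + lap (truncation a ?k) q)" using P by blast
    from Orho_add[OF this S(2)[of ?k]]
    have "Orho ?k (\<lambda>q. (S ?k q + lap (truncation a ?k) q) + (S (Suc ?k) q - S ?k q))" by simp
    then have "Orho ?k (\<lambda>q. S (Suc ?k) q + lap (truncation a ?k) q)"
      by (rule Orho_cong) (rule near_always, simp)
    from AD_Orho[OF sl this] obtain \<psi> where \<psi>: "AD (w - 2 - 2 * int ?k) \<psi>"
      "near (\<lambda>q. S (Suc ?k) q + lap (truncation a ?k) q = rt q ^ ?k * \<psi> q)" by blast
    obtain b \<psi>' where b: "density A cf w b" "AD (w - 2 - 2 * int (Suc ?k)) \<psi>'"
      "near (\<lambda>q. S (Suc ?k) q + lap (truncation (a(Suc ?k := b)) (Suc ?k)) q = rt q ^ Suc ?k * \<psi>' q)"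
      using series_step[OF a \<psi> c[of ?k]] by auto
    have "?P (Suc i) (a(Suc ?k := b))"
    proof (intro conjI)
      show "formal_density A cf w (a(Suc ?k := b))" using a b(1) by (simp add: formal_density_def)
      show "\<forall>k\<le>j0. (a(Suc ?k := b)) k = a0 k" using P by simp
      show "Orho (j0 + Suc i) (\<lambda>q. S (j0 + Suc i) q + lap (truncation (a(Suc ?k := b)) (j0 + Suc i)) q)"
        using OrhoI[OF ADE(1)[OF b(2)] b(3)] by simp
    qed
    moreover have "?Q i a (a(Suc ?k := b))" by simp
    ultimately show "\<exists>b. ?P (Suc i) b \<and> ?Q i a b" by blast
  qed
  then obtain f where f: "\<And>i. ?P i (f i)" "\<And>i. ?Q i (f i) (f (Suc i))" by blast
  have stab: "f (i + d) k = f i k" if "k \<le> j0 + i" for i d k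
    using that f(2) by (induction d) auto
  \<comment> \<open>The diagonal of the sequence: the k-th coefficient is final from stage k - j0
    on, which is stage 0 if k <= j0.\<close>
  define a where "a k = f (k - j0) k" for k
  have trunc: "truncation a N = truncation (f (N - j0)) N" if "N \<ge> j0" for N
  proof (rule truncation_cong)
    fix k assume "k \<le> N"
    then have "f ((k - j0) + (N - j0 - (k - j0))) k = f (k - j0) k" by (intro stab) simp
    then show "a k = f (N - j0) k" using \<open>k \<le> N\<close> that by (simp add: a_def)
  qed
  show thesis
  proof (rule that)
    show "formal_density A cf w a" using f(1) by (simp add: formal_density_def a_def)
    show "\<forall>k\<le>j0. a k = a0 k" using f(1)[of 0] by (simp add: a_def)
    show "\<forall>N\<ge>j0. Orho N (\<lambda>q. S N q + lap (truncation a N) q)"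
    proof (intro allI impI)
      fix N assume "j0 \<le> N"
      then show "Orho N (\<lambda>q. S N q + lap (truncation a N) q)"
        using f(1)[of "N - j0"] trunc[of N] by simp
    qed
  qed
qed

end

section \<open>Functions with a logarithmic term\<close>

text \<open>The algebra behind \<open>lap_log_term\<close>: R, C, P and h stand for
  \<open>rt\<close>, \<open>t2inv\<close>, \<open>rt ^ (m - 1)\<close> and \<open>H\<close>, k for
  m, and names starting with L for Laplacians. The divisions by R cancel, so the terms singular in
  rho combine to a smooth function.\<close>

lemma log_term_identity:
  fixes R C h P LC LCC LCH LH k :: real
  assumes "R \<noteq> 0" "C \<noteq> 0"
  shows "h * (R * P) * ((R * LC - 2 * (2 * k - 2) * C) / (R * C)
      + (R * C * (R * LC - 2 * (2 * k - 2) * C) + R * C * (R * LC - 2 * (2 * k - 2) * C)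
          - (R\<^sup>2 * LCC - 4 * (2 * k - 4) * R * (C * C))) / 2 / (R * C)\<^sup>2)
    - 2 * ((R * C * (R * P * LH) + h * (R * P) * (R * LC - 2 * (2 * k - 2) * C)
          - (R * (R * P) * LCH + 4 * (k + 1) * (R * P) * (C * h))) / 2 / (R * C))
    = P * (4 * k * h + R * (h * (LC * inverse C + (C * LC + C * LC - LCC) / 2 * (inverse C)\<^sup>2)
        - 2 * ((C * LH + h * LC - LCH) / 2 * inverse C)))"
  using assms by (simp add: field_simps power2_eq_square)

context ambient
begin

text \<open>Dividing by log rho and letting rho tend to 0 shows that \<open>\<beta>\<close> vanishes
  on the bundle. Then the logarithmic term behaves like rho log rho, so \<open>\<alpha>\<close>
  vanishes there as well. Both are divisible by \<open>rt\<close>, the relation persists for the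
  quotients, and induction on the order applies.\<close>

lemma Orho_all_log:
  assumes t: "AD 1 t" "near (\<lambda>q. t q > 0)"
  shows "sm \<alpha> \<Longrightarrow> sm \<beta> \<Longrightarrow> near (\<lambda>q. rho A cf gt t q > 0 \<longrightarrow> \<alpha> q + \<beta> q * ln (rho A cf gt t q) = 0) \<Longrightarrow>
    Orho K \<alpha> \<and> Orho K \<beta>"
proof (induction K arbitrary: \<alpha> \<beta>)
  case 0
  then show ?case using Orho_0 by blast
next
  case (Suc K)
  let ?\<rho> = "rho A cf gt t"
  note s\<alpha> = Suc.prems(1) and s\<beta> = Suc.prems(2)
  obtain v where v: "AD 2 v" "near (\<lambda>q. rt q = snd q * v q)" "near (\<lambda>q. v q \<noteq> 0)" by (rule rt_factor)
  have bdry: "\<exists>F. F \<noteq> bot \<and> (\<forall>f. sm f \<longrightarrow> ((\<lambda>r. f (y, r)) \<longlongrightarrow> f (y, 0)) F) \<and>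
      filterlim (\<lambda>r. ?\<rho> (y, r)) (at_right 0) F \<and> (\<forall>P. near P \<longrightarrow> eventually (\<lambda>r. P (y, r)) F)"
    if y: "y \<in> MB" for y
  proof -
    \<comment> \<open>The sign of \<open>v\<close> decides on which side of the bundle rho is
      positive along this fibre; the filter \<open>F\<close> describes r tending to 0 from that
      side.\<close>
    define \<sigma> where "\<sigma> = sgn (v (y, 0))"
    have v0: "v (y, 0) \<noteq> 0" by (rule near_on_bundle[OF v(3) y])
    then have \<sigma>: "\<sigma> \<noteq> 0" "\<sigma> * v (y, 0) > 0" by (auto simp: \<sigma>_def sgn_if)
    define F where "F = filtermap (\<lambda>x. \<sigma> * x) (at_right (0::real))"
    have le: "F \<le> at 0"
    proof -
      have "((\<lambda>x. \<sigma> * x) \<longlongrightarrow> 0) (at_right (0::real))" by (auto intro!: tendsto_eq_intros)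
      moreover have "\<forall>\<^sub>F x in at_right (0::real). \<sigma> * x \<noteq> 0"
        using eventually_at_right_less[of 0] by eventually_elim (use \<sigma>(1) in simp)
      ultimately have "filterlim (\<lambda>x. \<sigma> * x) (at 0) (at_right (0::real))" by (simp add: filterlim_at)
      then show ?thesis by (simp add: F_def filterlim_def)
    qed
    have ev: "eventually (\<lambda>r. P (y, r)) F" if "near P" for P
      using near_fibre_at[OF that y] le by (rule filter_leD[rotated])
    have lim: "((\<lambda>r. f (y, r)) \<longlongrightarrow> f (y, 0)) F" if "sm f" for f
      by (rule filterlim_mono[OF sm_fibre_tendsto[OF that y] order_refl le])
    have t0: "t (y, 0) > 0" by (rule near_on_bundle[OF t(2) y])
    have rlim: "filterlim (\<lambda>r. ?\<rho> (y, r)) (at_right 0) F"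
      unfolding filterlim_at
    proof
      have "((\<lambda>r. rt (y, r) / (2 * (t (y, r))\<^sup>2)) \<longlongrightarrow> rt (y, 0) / (2 * (t (y, 0))\<^sup>2)) F"
        by (intro tendsto_intros lim sm_rt ADE(1)[OF t(1)]) (use t0 in simp)
      then show "((\<lambda>r. ?\<rho> (y, r)) \<longlongrightarrow> 0) F" by (simp add: rho_def rt_bundle[OF y])
      have "\<forall>\<^sub>F r in F. \<sigma> * r > 0"
        unfolding F_def eventually_filtermap using eventually_at_right_less[of 0]
        by eventually_elim (use \<sigma>(1) in \<open>auto simp: zero_less_mult_iff mult.assoc[symmetric] \<sigma>_def sgn_if split: if_splits\<close>)
      moreover have "\<forall>\<^sub>F r in F. \<sigma> * v (y, r) > 0"
        by (rule order_tendstoD(1)[OF tendsto_mult_left[OF lim[OF ADE(1)[OF v(1)]]] \<sigma>(2)])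
      moreover note ev[OF v(2)] ev[OF t(2)]
      ultimately have "\<forall>\<^sub>F r in F. ?\<rho> (y, r) > 0"
      proof eventually_elim
        case (elim r)
        have "rt (y, r) = r * v (y, r)" using elim(3) by simp
        moreover have "(\<sigma> * r) * (\<sigma> * v (y, r)) > 0" using elim(1,2) by (rule mult_pos_pos)
        moreover have "\<sigma> * \<sigma> = 1" using v0 by (simp add: \<sigma>_def sgn_if)
        moreover have "(\<sigma> * r) * (\<sigma> * v (y, r)) = (\<sigma> * \<sigma>) * (r * v (y, r))" by (simp only: mult_ac)
        ultimately have "rt (y, r) > 0" by simp
        then show ?case using elim(4) by (simp add: rho_def)
      qed
      then show "\<forall>\<^sub>F r in F. ?\<rho> (y, r) \<in> {0<..} \<and> ?\<rho> (y, r) \<noteq> 0" by eventually_elim simp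
    qed
    have "F \<noteq> bot" by (simp add: F_def filtermap_bot_iff)
    then show ?thesis by (intro exI[of _ F] conjI allI impI rlim ev lim)
  qed
  have \<beta>0: "\<beta> (y, 0) = 0" if y: "y \<in> MB" for y
  proof -
    obtain F where F: "F \<noteq> bot" "\<And>f. sm f \<Longrightarrow> ((\<lambda>r. f (y, r)) \<longlongrightarrow> f (y, 0)) F"
      "filterlim (\<lambda>r. ?\<rho> (y, r)) (at_right 0) F" "\<And>P. near P \<Longrightarrow> eventually (\<lambda>r. P (y, r)) F"
      using bdry[OF y] by blast
    have lnF: "filterlim (\<lambda>r. ln (?\<rho> (y, r))) at_bot F" by (rule filterlim_compose[OF ln_at_0 F(3)])
    have "filterlim (\<lambda>r. ln (?\<rho> (y, r))) at_infinity F"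
      by (rule filterlim_mono[OF lnF at_bot_le_at_infinity order_refl])
    then have *: "((\<lambda>r. - \<alpha> (y, r) / ln (?\<rho> (y, r))) \<longlongrightarrow> 0) F"
      by (rule tendsto_divide_0[OF tendsto_minus[OF F(2)[OF s\<alpha>]]])
    have "\<forall>\<^sub>F r in F. ?\<rho> (y, r) > 0" using F(3) by (simp add: filterlim_at eventually_conj_iff)
    moreover have "\<forall>\<^sub>F r in F. ln (?\<rho> (y, r)) < 0" using lnF by (auto simp: filterlim_at_bot_dense)
    moreover note F(4)[OF Suc.prems(3)]
    ultimately have "\<forall>\<^sub>F r in F. - \<alpha> (y, r) / ln (?\<rho> (y, r)) = \<beta> (y, r)"
      by eventually_elim (simp add: field_simps)
    with * have "((\<lambda>r. \<beta> (y, r)) \<longlongrightarrow> 0) F" by (rule Lim_transform_eventually)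
    then show ?thesis using F(2)[OF s\<beta>] F(1) tendsto_unique by blast
  qed
  obtain \<beta>' where \<beta>': "sm \<beta>'" "near (\<lambda>q. \<beta> q = rt q * \<beta>' q)" by (rule sm_divide_rt[OF s\<beta> \<beta>0])
  have \<alpha>0: "\<alpha> (y, 0) = 0" if y: "y \<in> MB" for y
  proof -
    obtain F where F: "F \<noteq> bot" "\<And>f. sm f \<Longrightarrow> ((\<lambda>r. f (y, r)) \<longlongrightarrow> f (y, 0)) F"
      "filterlim (\<lambda>r. ?\<rho> (y, r)) (at_right 0) F" "\<And>P. near P \<Longrightarrow> eventually (\<lambda>r. P (y, r)) F"
      using bdry[OF y] by blast
    have "((\<lambda>r. - (\<beta>' (y, r) * (2 * (t (y, r))\<^sup>2)) * (?\<rho> (y, r) * ln (?\<rho> (y, r)))) \<longlongrightarrow>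
        - (\<beta>' (y, 0) * (2 * (t (y, 0))\<^sup>2)) * 0) F"
      by (intro tendsto_mult tendsto_minus tendsto_power tendsto_const F(2) \<beta>'(1) ADE(1)[OF t(1)]
          filterlim_compose[OF tendsto_x_ln_x F(3)])
    moreover have "\<forall>\<^sub>F r in F. ?\<rho> (y, r) > 0" using F(3) by (simp add: filterlim_at eventually_conj_iff)
    then have "\<forall>\<^sub>F r in F. - (\<beta>' (y, r) * (2 * (t (y, r))\<^sup>2)) * (?\<rho> (y, r) * ln (?\<rho> (y, r))) = \<alpha> (y, r)"
      using F(4)[OF Suc.prems(3)] F(4)[OF \<beta>'(2)] F(4)[OF t(2)]
    proof eventually_elim
      case (elim r)
      have "rt (y, r) = 2 * (t (y, r))\<^sup>2 * ?\<rho> (y, r)" using elim(4) by (simp add: rho_def)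
      then have "\<beta> (y, r) = (\<beta>' (y, r) * (2 * (t (y, r))\<^sup>2)) * ?\<rho> (y, r)" using elim(3) by (simp add: mult_ac)
      then show ?case using elim(1,2) by (simp add: algebra_simps)
    qed
    ultimately have "((\<lambda>r. \<alpha> (y, r)) \<longlongrightarrow> - (\<beta>' (y, 0) * (2 * (t (y, 0))\<^sup>2)) * 0) F"
      by (rule Lim_transform_eventually)
    then show ?thesis using F(2)[OF s\<alpha>] F(1) tendsto_unique by fastforce
  qed
  obtain \<alpha>' where \<alpha>': "sm \<alpha>'" "near (\<lambda>q. \<alpha> q = rt q * \<alpha>' q)" by (rule sm_divide_rt[OF s\<alpha> \<alpha>0])
  have "near (\<lambda>q. ?\<rho> q > 0 \<longrightarrow> \<alpha>' q + \<beta>' q * ln (?\<rho> q) = 0)"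
    using near_conj[OF Suc.prems(3) t(2)] \<alpha>'(2) \<beta>'(2)
  proof (rule near_mp3, intro impI)
    fix q assume *: "(?\<rho> q > 0 \<longrightarrow> \<alpha> q + \<beta> q * ln (?\<rho> q) = 0) \<and> t q > 0" "\<alpha> q = rt q * \<alpha>' q" "\<beta> q = rt q * \<beta>' q"
      "?\<rho> q > 0"
    then have "rt q \<noteq> 0" by (auto simp: rho_def)
    moreover have "rt q * (\<alpha>' q + \<beta>' q * ln (?\<rho> q)) = 0" using * by (simp add: algebra_simps)
    ultimately show "\<alpha>' q + \<beta>' q * ln (?\<rho> q) = 0" by simp
  qed
  from Suc.IH[OF \<alpha>'(1) \<beta>'(1) this] have "Orho K \<alpha>'" "Orho K \<beta>'" by auto
  then have "Orho (1 + K) (\<lambda>q. rt q ^ 1 * \<alpha>' q)" "Orho (1 + K) (\<lambda>q. rt q ^ 1 * \<beta>' q)"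
    using Orho_mult[OF Orho_rt_power[of 1], of K] by blast+
  then show ?case
    using Orho_cong[of "Suc K" "\<lambda>q. rt q * \<alpha>' q" \<alpha>] Orho_cong[of "Suc K" "\<lambda>q. rt q * \<beta>' q" \<beta>]
      near_mono[OF \<alpha>'(2)] near_mono[OF \<beta>'(2)] by simp
qed

end

locale even_ambient = ambient A cf gt for A :: "('a, 'e::euclidean_space) chart set" and cf gt +
  fixes m :: nat
  assumes dim: "DIM('e) = 2 * m" and m2: "m \<ge> 2"

section \<open>The Laplacian of the logarithmic term in a fixed scale\<close>

locale scaled_ambient = even_ambient A cf gt m for A :: "('a, 'e::euclidean_space) chart set" and cf gt m +
  fixes t :: "('a, 'e) apoint \<Rightarrow> real"
  assumes t: "AD 1 t" "near (\<lambda>q. t q > 0)"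
begin

definition t2inv :: "('a, 'e) apoint \<Rightarrow> real" where
  "t2inv q = inverse (2 * (t q)\<^sup>2)"

lemma rho_eq: "rho A cf gt t = (\<lambda>q. rt q * t2inv q)"
  by (rule ext) (simp only: rho_def t2inv_def divide_inverse)

lemma t_bundle: "y \<in> MB \<Longrightarrow> t (y, 0) > 0"
  by (rule near_on_bundle[OF t(2)])

lemma AD_t2inv: "AD (-2) t2inv"
proof -
  have "AD 2 (\<lambda>q. 2 * (t q)\<^sup>2)" using AD_cmult[OF AD_power[OF t(1), of 2], of 2] by simp
  moreover have "2 * (t (y, 0))\<^sup>2 \<noteq> 0" if "y \<in> MB" for y using t_bundle[OF that] by simp
  ultimately show ?thesis unfolding t2inv_def[abs_def] by (rule AD_nonzero(2))
qed

lemma near_t2inv: "near (\<lambda>q. t2inv q > 0)"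
  by (rule near_mono[OF t(2)]) (simp add: t2inv_def)

lemma AD_inverse_t2inv: "AD 2 (\<lambda>q. inverse (t2inv q))"
  using AD_nonzero(2)[OF AD_t2inv] near_on_bundle[OF near_t2inv] by force

lemma sm_ln_t: "sm (\<lambda>q. ln (t q))"
  by (rule sm_ln[OF ADE(1)[OF t(1)] t(2)])

abbreviation "lapln \<equiv> lap (\<lambda>q. ln (t q))"

text \<open>The function log t is not a density, as dilations add constants to it; its Laplacian is
  one, as the explicit formula shows.\<close>

lemma AD_lap_ln_t: "AD (-2) lapln"
proof -
  have it: "AD (-1) (\<lambda>q. inverse (t q))" using AD_nonzero(2)[OF t(1)] t_bundle by force
  have "AD (-2) (\<lambda>q. lap t q * inverse (t q) + bracket t t q * (inverse (t q))\<^sup>2)"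
    using AD_mult[OF AD_lap[OF t(1)] it] AD_mult[OF AD_bracket[OF t(1) t(1)] AD_power[OF it, of 2]]
    by (intro AD_add) simp_all
  moreover have "near (\<lambda>q. lap t q * inverse (t q) + bracket t t q * (inverse (t q))\<^sup>2 = lapln q)"
    by (rule near_mono[OF lap_ln[OF ADE(1)[OF t(1)] t(2)]]) (simp add: divide_inverse power_inverse)
  ultimately show ?thesis by (rule AD_cong)
qed

text \<open>With c for \<open>t2inv\<close> this is H \<Delta>(log c) - 2 <d log c, dH>, written so
  that it is visibly a density.\<close>

definition Bt :: "(('a, 'e) apoint \<Rightarrow> real) \<Rightarrow> ('a, 'e) apoint \<Rightarrow> real" where
  "Bt H q = H q * (lap t2inv q * inverse (t2inv q) + bracket t2inv t2inv q * (inverse (t2inv q))\<^sup>2)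
    - 2 * (bracket t2inv H q * inverse (t2inv q))"

lemma AD_Bt:
  assumes "AD w H"
  shows "AD (w - 2) (Bt H)"
proof -
  note c = AD_t2inv and ic = AD_inverse_t2inv
  have 1: "AD (-2) (\<lambda>q. lap t2inv q * inverse (t2inv q) + bracket t2inv t2inv q * (inverse (t2inv q))\<^sup>2)"
    using AD_mult[OF AD_lap[OF c] ic] AD_mult[OF AD_bracket[OF c c] AD_power[OF ic, of 2]]
    by (intro AD_add) simp_all
  show ?thesis
    using AD_mult[OF assms 1] AD_mult[OF AD_bracket[OF c assms] ic]
    unfolding Bt_def[abs_def] by (intro AD_diff AD_cmult) (simp_all add: algebra_simps)
qed

text \<open>The part of the Laplacian of \<open>H * rt ^ m * log rho\<close> without a logarithm. Of
  the coefficient 4 m, log \<open>rt\<close> contributes - 4 m through its own Laplacian, and log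
  \<open>t2inv\<close> contributes 8 m through its pairing with the differential of
  \<open>rt ^ m\<close>, because \<open>t2inv\<close> has weight -2.\<close>

definition smooth_part :: "(('a, 'e) apoint \<Rightarrow> real) \<Rightarrow> ('a, 'e) apoint \<Rightarrow> real" where
  "smooth_part H q = rt q ^ (m - 1) * (4 * real m * H q + rt q * Bt H q)"

lemma AD_smooth_part:
  assumes "AD (- 2 * int m) H"
  shows "AD (-2) (smooth_part H)"
proof -
  have "AD (- 2 * int m) (\<lambda>q. 4 * real m * H q + rt q * Bt H q)"
    using AD_mult[OF AD_rt AD_Bt[OF assms]] by (intro AD_add AD_cmult assms) simp
  from AD_mult[OF AD_power[OF AD_rt, of "m - 1"] this] show ?thesis
    using m2 by (simp add: smooth_part_def[abs_def] of_nat_diff algebra_simps)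
qed

text \<open>Since \<open>\<eta> \<rho>\<^sub>~\<^sup>m\<close> has weight \<open>0\<close>, the Laplacian of \<open>\<eta> \<rho>\<^sub>~\<^sup>m log \<rho>\<close> has the logarithmic coefficient
  \<open>\<rho>\<^sub>~\<^sup>m \<Delta>\<eta>\<close>, while its smooth part starts with \<open>2 n \<eta> \<rho>\<^sub>~\<^sup>m\<^sup>-\<^sup>1\<close>.\<close>

lemma lap_log_term:
  assumes H: "AD (- 2 * int m) H" and F: "sm F"
  shows "near (\<lambda>q. rho A cf gt t q > 0 \<longrightarrow>
    lap (\<lambda>q. F q + H q * rt q ^ m * ln (rho A cf gt t q)) q
      = lap F q + smooth_part H q + (rt q ^ m * lap H q) * ln (rho A cf gt t q))"
proof -
  let ?c = t2inv and ?\<rho> = "\<lambda>q. rt q * t2inv q" and ?f = "\<lambda>q. H q * rt q ^ m"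
  note c = AD_t2inv
  have s\<rho>: "sm ?\<rho>" by (rule sm_mult[OF sm_rt ADE(1)[OF c]])
  have sf: "sm ?f" by (rule sm_mult[OF ADE(1)[OF H] sm_power[OF sm_rt]])
  note main = lap_add_mult_ln[OF F sf s\<rho>]
  have dimr: "real DIM('e) = 2 * real m" by (simp add: dim)
  have A1: "near (\<lambda>q. lap ?\<rho> q = rt q * lap ?c q - 2 * (2 * real m - 2) * ?c q)"
    using lap_rt_mult[OF c] by (simp add: dimr)
  have "near (\<lambda>q. lap (\<lambda>q. ?\<rho> q * ?\<rho> q) q = lap (\<lambda>q. rt q ^ 2 * (?c q * ?c q)) q)"
    by (rule lap_cong[OF near_always]) (simp add: power2_eq_square mult_ac)
  moreover have "near (\<lambda>q. lap (\<lambda>q. rt q ^ 2 * (?c q * ?c q)) q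
      = rt q ^ 2 * lap (\<lambda>q. ?c q * ?c q) q - 4 * (2 * real m - 4) * rt q * (?c q * ?c q))"
    using lap_rt_power[OF AD_mult[OF c c], of 2] by (simp add: dimr)
  ultimately have A2: "near (\<lambda>q. lap (\<lambda>q. ?\<rho> q * ?\<rho> q) q
      = rt q ^ 2 * lap (\<lambda>q. ?c q * ?c q) q - 4 * (2 * real m - 4) * rt q * (?c q * ?c q))"
    by (rule near_mp2) simp
  have "near (\<lambda>q. lap (\<lambda>q. ?\<rho> q * ?f q) q = lap (\<lambda>q. rt q ^ Suc m * (?c q * H q)) q)"
    by (rule lap_cong[OF near_always]) (simp add: mult_ac)
  moreover have "near (\<lambda>q. lap (\<lambda>q. rt q ^ Suc m * (?c q * H q)) q
      = rt q ^ Suc m * lap (\<lambda>q. ?c q * H q) q + 4 * (real m + 1) * rt q ^ m * (?c q * H q))"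
    by (rule near_mono[OF lap_rt_power[OF AD_mult[OF c H], of "Suc m"]]) (simp add: dimr algebra_simps)
  ultimately have A3: "near (\<lambda>q. lap (\<lambda>q. ?\<rho> q * ?f q) q
      = rt q ^ Suc m * lap (\<lambda>q. ?c q * H q) q + 4 * (real m + 1) * rt q ^ m * (?c q * H q))"
    by (rule near_mp2) simp
  have "near (\<lambda>q. lap ?f q = lap (\<lambda>q. rt q ^ m * H q) q)"
    by (rule lap_cong[OF near_always]) (simp add: mult.commute)
  moreover have "near (\<lambda>q. lap (\<lambda>q. rt q ^ m * H q) q = rt q ^ m * lap H q)"
    using lap_rt_power[OF H, of m] by (simp add: dimr)
  ultimately have A4: "near (\<lambda>q. lap ?f q = rt q ^ m * lap H q)" by (rule near_mp2) simp
  have "near (\<lambda>q. ?c q > 0 \<and> lap ?\<rho> q = rt q * lap ?c q - 2 * (2 * real m - 2) * ?c q \<and>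
      lap (\<lambda>q. ?\<rho> q * ?\<rho> q) q = rt q ^ 2 * lap (\<lambda>q. ?c q * ?c q) q - 4 * (2 * real m - 4) * rt q * (?c q * ?c q) \<and>
      lap (\<lambda>q. ?\<rho> q * ?f q) q = rt q ^ Suc m * lap (\<lambda>q. ?c q * H q) q + 4 * (real m + 1) * rt q ^ m * (?c q * H q) \<and>
      lap ?f q = rt q ^ m * lap H q)"
    by (intro near_conj near_t2inv A1 A2 A3 A4)
  with main show ?thesis
    unfolding rho_eq
  proof (rule near_mp2, intro impI)
    fix q
    assume M: "0 < ?\<rho> q \<longrightarrow> lap (\<lambda>q. F q + ?f q * ln (?\<rho> q)) q
        = lap F q + (?f q * (lap ?\<rho> q / ?\<rho> q + bracket ?\<rho> ?\<rho> q / (?\<rho> q)\<^sup>2) + ln (?\<rho> q) * lap ?f q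
          - 2 * (bracket ?\<rho> ?f q / ?\<rho> q))"
      and A: "?c q > 0 \<and> lap ?\<rho> q = rt q * lap ?c q - 2 * (2 * real m - 2) * ?c q \<and>
      lap (\<lambda>q. ?\<rho> q * ?\<rho> q) q = rt q ^ 2 * lap (\<lambda>q. ?c q * ?c q) q - 4 * (2 * real m - 4) * rt q * (?c q * ?c q) \<and>
      lap (\<lambda>q. ?\<rho> q * ?f q) q = rt q ^ Suc m * lap (\<lambda>q. ?c q * H q) q + 4 * (real m + 1) * rt q ^ m * (?c q * H q) \<and>
      lap ?f q = rt q ^ m * lap H q"
      and pos: "0 < ?\<rho> q"
    have C: "?c q \<noteq> 0" and R: "rt q \<noteq> 0" using A pos by auto
    have pw: "rt q ^ m = rt q * rt q ^ (m - 1)" using m2 by (simp add: power_eq_if)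
    have b1: "bracket ?\<rho> ?\<rho> q = (?\<rho> q * lap ?\<rho> q + ?\<rho> q * lap ?\<rho> q - lap (\<lambda>q. ?\<rho> q * ?\<rho> q) q) / 2"
      and b2: "bracket ?\<rho> ?f q = (?\<rho> q * lap ?f q + ?f q * lap ?\<rho> q - lap (\<lambda>q. ?\<rho> q * ?f q) q) / 2"
      by (simp_all only: bracket_def)
    have "?f q * (lap ?\<rho> q / ?\<rho> q + bracket ?\<rho> ?\<rho> q / (?\<rho> q)\<^sup>2) - 2 * (bracket ?\<rho> ?f q / ?\<rho> q) = smooth_part H q"
      unfolding b1 b2 smooth_part_def Bt_def bracket_def[of t2inv]
      using log_term_identity[OF R C, where h = "H q" and P = "rt q ^ (m - 1)" and LC = "lap ?c q" and k = "real m"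
          and LCC = "lap (\<lambda>q. ?c q * ?c q) q" and LH = "lap H q" and LCH = "lap (\<lambda>q. ?c q * H q) q"] A
      by (simp only: pw power_Suc)
    then show "lap (\<lambda>q. F q + H q * rt q ^ m * ln (?\<rho> q)) q
        = lap F q + smooth_part H q + (rt q ^ m * lap H q) * ln (?\<rho> q)"
      using M pos A by (simp add: algebra_simps)
  qed
qed

end

section \<open>Loss and gain of vanishing order\<close>

context ambient
begin

lemma bracket_diff:
  assumes "sm f" "sm h" "sm h'"
  shows "near (\<lambda>q. bracket f h' q - bracket f h q = bracket f (\<lambda>q. h' q - h q) q)"
proof -
  have eq: "(\<lambda>q. f q * (h' q - h q)) = (\<lambda>q. f q * h' q - f q * h q)"
    by (simp add: right_diff_distrib)
  show ?thesis
    using lap_diff[OF sm_mult[OF assms(1,3)] sm_mult[OF assms(1,2)]] lap_diff[OF assms(3,2)]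
  proof (rule near_mp2)
    fix q
    assume 1: "lap (\<lambda>q. f q * h' q - f q * h q) q = lap (\<lambda>q. f q * h' q) q - lap (\<lambda>q. f q * h q) q"
      and 2: "lap (\<lambda>q. h' q - h q) q = lap h' q - lap h q"
    show "bracket f h' q - bracket f h q = bracket f (\<lambda>q. h' q - h q) q"
      unfolding bracket_def eq 1 2 by (simp add: field_simps)
  qed
qed

lemma Orho_bracket:
  assumes f: "AD w f" and d: "AD w' d" "Orho (Suc k) d"
  shows "Orho k (bracket f d)"
proof -
  have fd: "Orho (Suc k) (\<lambda>q. f q * d q)" using Orho_mult[OF Orho_0[OF ADE(1)[OF f]] d(2)] by simp
  have "Orho k (\<lambda>q. f q * lap d q)" using Orho_mult[OF Orho_0[OF ADE(1)[OF f]] Orho_lap[OF d]] by simp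
  moreover have "Orho k (\<lambda>q. d q * lap f q)"
    using Orho_mult[OF Orho_mono[OF d(2), of k] Orho_0[OF sm_lap[OF ADE(1)[OF f]]]] by simp
  moreover have "Orho k (lap (\<lambda>q. f q * d q))" by (rule Orho_lap[OF AD_mult[OF f d(1)] fd])
  ultimately have "Orho k (\<lambda>q. (1 / 2) * (f q * lap d q + d q * lap f q - lap (\<lambda>q. f q * d q) q))"
    by (intro Orho_cmult Orho_diff Orho_add)
  then show ?thesis by (simp add: bracket_def[abs_def])
qed

lemma density_zero: "density A cf w (\<lambda>y. 0)"
  using density_restrict[OF AD_zero] .

lemma truncation_bundle: "truncation a N (y, 0) = a 0 y"
proof -
  have "truncation a N (y, 0) = (\<Sum>k\<in>{0}. a k y * 0 ^ k)"
    unfolding truncation_def by (rule sum.mono_neutral_cong_right) auto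
  then show ?thesis by simp
qed

lemma truncation_diff: "truncation a N q - truncation b N q = truncation (\<lambda>k y. a k y - b k y) N q"
  by (simp add: truncation_def sum_subtractf[symmetric] left_diff_distrib)

text \<open>If f = rt^k p, then the term of order k - 1 in its Laplacian is p times a multiple of
  the indicial factor. Where that factor is nonzero, p has to vanish on the bundle.\<close>

lemma Orho_gain:
  assumes f: "AD w f" "Orho k f" and l: "Orho k (lap f)" and "k > 0"
    and c: "real DIM('e) + 2 * of_int w - 2 * real k \<noteq> 0"
  shows "Orho (Suc k) f"
proof -
  obtain p where p: "AD (w - 2 * int k) p" "near (\<lambda>q. f q = rt q ^ k * p q)"
    using AD_Orho[OF f] by blast
  obtain j where j: "k = Suc j" using \<open>k > 0\<close> by (cases k) auto
  let ?c = "2 * real k * (real DIM('e) + 2 * of_int w - 2 * real k)"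
  have "near (\<lambda>q. rt q ^ k * lap p q - lap f q = rt q ^ j * (?c * p q))"
    by (rule near_mp2[OF lap_cong[OF p(2)] lap_rt_power[OF p(1), of k]]) (simp add: j algebra_simps)
  moreover have "Orho k (\<lambda>q. rt q ^ k * lap p q - lap f q)"
    by (intro Orho_diff Orho_rt_mult sm_lap ADE(1)[OF p(1)] l)
  ultimately have "Orho (j + 1) (\<lambda>q. rt q ^ j * (?c * p q))" using Orho_cong j by simp
  then have "Orho 1 (\<lambda>q. ?c * p q)" by (rule Orho_cancel[OF sm_cmult[OF ADE(1)[OF p(1)]]])
  from Orho_cmult[OF this, of "1 / ?c"] have "Orho 1 p" using c \<open>k > 0\<close> by simp
  from Orho_mult[OF Orho_rt_power this, of k] have "Orho (Suc k) (\<lambda>q. rt q ^ k * p q)" by simp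
  then show ?thesis by (rule Orho_cong) (rule near_mono[OF p(2)], simp)
qed

end

context scaled_ambient
begin

text \<open>\<open>Bt\<close> is linear and of first order, so it loses at most one order. This
  controls how the source changes when one more coefficient of \<eta> is included.\<close>

lemma Orho_Bt_diff:
  assumes H: "AD w H" "AD w H'" and d: "Orho (Suc k) (\<lambda>q. H' q - H q)"
  shows "Orho k (\<lambda>q. Bt H' q - Bt H q)"
proof -
  note c = AD_t2inv and ic = AD_inverse_t2inv
  let ?s = "\<lambda>q. lap t2inv q * inverse (t2inv q) + bracket t2inv t2inv q * (inverse (t2inv q))\<^sup>2"
  have s: "sm ?s"
    by (intro sm_add sm_mult sm_power sm_lap ADE(1)[OF c] ADE(1)[OF ic] ADE(1)[OF AD_bracket[OF c c]])
  have 1: "Orho k (\<lambda>q. (H' q - H q) * ?s q)"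
    using Orho_mult[OF Orho_mono[OF d, of k] Orho_0[OF s]] by simp
  have 2: "Orho k (\<lambda>q. 2 * (bracket t2inv (\<lambda>q. H' q - H q) q * inverse (t2inv q)))"
    using Orho_cmult[OF Orho_mult[OF Orho_bracket[OF c AD_diff[OF H(2,1)] d] Orho_0[OF ADE(1)[OF ic]]], of 2] by simp
  show ?thesis
  proof (rule Orho_cong[OF Orho_diff[OF 1 2]],
      rule near_mono[OF bracket_diff[OF ADE(1)[OF c] ADE(1)[OF H(1)] ADE(1)[OF H(2)]]])
    fix q assume *: "bracket t2inv H' q - bracket t2inv H q = bracket t2inv (\<lambda>q. H' q - H q) q"
    show "(H' q - H q) * ?s q - 2 * (bracket t2inv (\<lambda>q. H' q - H q) q * inverse (t2inv q)) = Bt H' q - Bt H q"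
      unfolding *[symmetric] Bt_def by (simp add: left_diff_distrib right_diff_distrib)
  qed
qed

lemma Orho_smooth_part_diff:
  assumes H: "AD w H" "AD w H'" and d: "Orho (Suc k) (\<lambda>q. H' q - H q)"
  shows "Orho k (\<lambda>q. smooth_part H' q - smooth_part H q)"
proof -
  have "Orho k (\<lambda>q. 4 * real m * (H' q - H q) + rt q * (Bt H' q - Bt H q))"
    using Orho_mult[OF Orho_0[OF sm_rt] Orho_Bt_diff[OF assms]]
    by (intro Orho_add Orho_cmult Orho_mono[OF d]) simp_all
  from Orho_mult[OF Orho_0[OF sm_power[OF sm_rt, of "m - 1"]] this] show ?thesis
    by (simp add: smooth_part_def algebra_simps)
qed

section \<open>The truncated ansatz and the two components of its Laplacian\<close>

abbreviation "ansatz \<phi> \<eta> N \<equiv> log_ansatz A cf gt t (truncation \<phi> N) (truncation \<eta> N)"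

definition smooth_lap :: "('a, 'e) formal \<Rightarrow> ('a, 'e) formal \<Rightarrow> nat \<Rightarrow> ('a, 'e) apoint \<Rightarrow> real" where
  "smooth_lap \<phi> \<eta> N q = lapln q + lap (truncation \<phi> N) q + smooth_part (truncation \<eta> N) q"

lemma AD_eta: "formal_density A cf (- int DIM('e)) \<eta> \<Longrightarrow> AD (- 2 * int m) (truncation \<eta> N)"
  using AD_truncation[of "- int DIM('e)" \<eta> N] by (simp add: dim)

lemma sm_smooth_lap:
  assumes "formal_density A cf 0 \<phi>" "formal_density A cf (- int DIM('e)) \<eta>"
  shows "sm (smooth_lap \<phi> \<eta> N)"
  unfolding smooth_lap_def[abs_def]
  by (intro sm_add ADE(1)[OF AD_lap_ln_t] sm_lap ADE(1)[OF AD_truncation[OF assms(1)]]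
      ADE(1)[OF AD_smooth_part] AD_eta[OF assms(2)])

lemma lap_ansatz:
  assumes "formal_density A cf 0 \<phi>" "formal_density A cf (- int DIM('e)) \<eta>"
  shows "near (\<lambda>q. rho A cf gt t q > 0 \<longrightarrow> lap (ansatz \<phi> \<eta> N) q
    = smooth_lap \<phi> \<eta> N q + (rt q ^ m * lap (truncation \<eta> N) q) * ln (rho A cf gt t q))"
proof -
  have s\<phi>: "sm (truncation \<phi> N)" by (rule ADE(1)[OF AD_truncation[OF assms(1)]])
  have e: "ansatz \<phi> \<eta> N = (\<lambda>q. (ln (t q) + truncation \<phi> N q) + truncation \<eta> N q * rt q ^ m * ln (rho A cf gt t q))"
    by (rule ext) (simp add: log_ansatz_def dim)
  show ?thesis
    unfolding e
    by (rule near_mp2[OF lap_log_term[OF AD_eta[OF assms(2)] sm_add[OF sm_ln_t s\<phi>]] lap_add[OF sm_ln_t s\<phi>]])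
      (simp add: smooth_lap_def)
qed

text \<open>In the definition, a and b are arbitrary. \<open>Orho_all_log\<close>, applied to their
  differences from the components in \<open>lap_ansatz\<close>, identifies them to all
  orders.\<close>

lemma formally_harmonic_iff:
  assumes "formal_density A cf 0 \<phi>" "formal_density A cf (- int DIM('e)) \<eta>"
  shows "formally_harmonic A cf gt t \<phi> \<eta> \<longleftrightarrow> (\<forall>K. \<exists>N0. \<forall>N\<ge>N0.
    Orho K (smooth_lap \<phi> \<eta> N) \<and> Orho K (\<lambda>q. rt q ^ m * lap (truncation \<eta> N) q))"
proof -
  have X: "sm (\<lambda>q. rt q ^ m * lap (truncation \<eta> N) q)" for N
    by (intro sm_mult sm_power sm_rt sm_lap ADE(1)[OF AD_eta[OF assms(2)]])
  have "(\<exists>a b. Orho K a \<and> Orho K b \<and> near (\<lambda>q. rho A cf gt t q > 0 \<longrightarrow>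
      lap (ansatz \<phi> \<eta> N) q = a q + b q * ln (rho A cf gt t q)))
    \<longleftrightarrow> Orho K (smooth_lap \<phi> \<eta> N) \<and> Orho K (\<lambda>q. rt q ^ m * lap (truncation \<eta> N) q)" for K N
  proof
    assume "\<exists>a b. Orho K a \<and> Orho K b \<and> near (\<lambda>q. rho A cf gt t q > 0 \<longrightarrow>
      lap (ansatz \<phi> \<eta> N) q = a q + b q * ln (rho A cf gt t q))"
    then obtain a b where ab: "Orho K a" "Orho K b" "near (\<lambda>q. rho A cf gt t q > 0 \<longrightarrow>
      lap (ansatz \<phi> \<eta> N) q = a q + b q * ln (rho A cf gt t q))" by blast
    let ?\<alpha> = "\<lambda>q. smooth_lap \<phi> \<eta> N q - a q" and ?\<beta> = "\<lambda>q. rt q ^ m * lap (truncation \<eta> N) q - b q"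
    have "near (\<lambda>q. rho A cf gt t q > 0 \<longrightarrow> ?\<alpha> q + ?\<beta> q * ln (rho A cf gt t q) = 0)"
      by (rule near_mp2[OF lap_ansatz[OF assms, of N] ab(3)]) (auto simp: algebra_simps)
    from Orho_all_log[OF t sm_diff[OF sm_smooth_lap[OF assms] Orho_sm[OF ab(1)]]
        sm_diff[OF X Orho_sm[OF ab(2)]] this, of K]
    have "Orho K ?\<alpha>" "Orho K ?\<beta>" by auto
    from Orho_add[OF this(1) ab(1)] Orho_add[OF this(2) ab(2)]
    show "Orho K (smooth_lap \<phi> \<eta> N) \<and> Orho K (\<lambda>q. rt q ^ m * lap (truncation \<eta> N) q)" by simp
  qed (use lap_ansatz[OF assms] in blast)
  then show ?thesis unfolding formally_harmonic_def by simp
qed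

lemma smooth_part_leading:
  assumes "AD (- 2 * int m) H"
  shows "Orho m (\<lambda>q. smooth_part H q - 4 * real m * (rt q ^ (m - 1) * H q))"
proof -
  have "Orho m (\<lambda>q. rt q ^ m * Bt H q)" by (rule Orho_rt_mult[OF ADE(1)[OF AD_Bt[OF assms]]])
  moreover have "rt q ^ m = rt q ^ (m - 1) * rt q" for q using m2 by (simp add: power_eq_if)
  ultimately show ?thesis by (simp add: smooth_part_def algebra_simps)
qed

text \<open>Modulo rho^m the logarithmic term enters the smooth part only through its leading term,
  which suffices for uniqueness and for the Q-curvature. In the logarithmic coefficient the factor
  \<open>rt ^ m\<close> is cancelled, whence the order \<open>m + K\<close> in the proof.\<close>

lemma
  assumes sol: "formal_log_solution A cf gt t \<phi> \<eta>"
  shows solution_smooth: "\<exists>N0. \<forall>N\<ge>N0. Orho m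
      (\<lambda>q. lapln q + lap (truncation \<phi> N) q + 4 * real m * (rt q ^ (m - 1) * truncation \<eta> N q))"
    and solution_log: "\<exists>N0. \<forall>N\<ge>N0. Orho K (lap (truncation \<eta> N))"
proof -
  have fd: "formal_density A cf 0 \<phi>" "formal_density A cf (- int DIM('e)) \<eta>"
    and fh: "formally_harmonic A cf gt t \<phi> \<eta>" using sol by (auto simp: formal_log_solution_def)
  note fh = fh[unfolded formally_harmonic_iff[OF fd]]
  obtain N0 where N0: "\<And>N. N \<ge> N0 \<Longrightarrow> Orho m (smooth_lap \<phi> \<eta> N)" using fh by blast
  have "Orho m (\<lambda>q. lapln q + lap (truncation \<phi> N) q + 4 * real m * (rt q ^ (m - 1) * truncation \<eta> N q))"
    if "N \<ge> N0" for N
    by (rule Orho_cong[OF Orho_diff[OF N0[OF that] smooth_part_leading[OF AD_eta[OF fd(2), of N]]]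
          near_always]) (simp add: smooth_lap_def)
  then show "\<exists>N0. \<forall>N\<ge>N0. Orho m
      (\<lambda>q. lapln q + lap (truncation \<phi> N) q + 4 * real m * (rt q ^ (m - 1) * truncation \<eta> N q))" by blast
  obtain N1 where N1: "\<And>N. N \<ge> N1 \<Longrightarrow> Orho (m + K) (\<lambda>q. rt q ^ m * lap (truncation \<eta> N) q)" using fh by blast
  have "Orho K (lap (truncation \<eta> N))" if "N \<ge> N1" for N
    by (rule Orho_cancel[OF sm_lap[OF ADE(1)[OF AD_eta[OF fd(2)]]] N1[OF that]])
  then show "\<exists>N0. \<forall>N\<ge>N0. Orho K (lap (truncation \<eta> N))" by blast
qed

section \<open>Existence\<close>

text \<open>The indicial factor n - 2 (k + 1) of weight 0 is nonzero while k + 1 < m. The condition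
  on \<open>a 0\<close> expresses \<phi> = O(rho) and survives because only higher coefficients are
  altered.\<close>

lemma solution_below_critical_order:
  "k \<le> m - 1 \<Longrightarrow> \<exists>a. formal_density A cf 0 a \<and> a 0 = (\<lambda>y. 0) \<and>
    Orho k (\<lambda>q. lapln q + lap (truncation a k) q)"
proof (induction k)
  case 0
  have "formal_density A cf 0 (\<lambda>k y. 0)" by (simp add: formal_density_def density_zero)
  moreover from this have "Orho 0 (\<lambda>q. lapln q + lap (truncation (\<lambda>k y. 0) 0) q)"
    by (intro Orho_0 sm_add sm_lap ADE(1)[OF AD_lap_ln_t] ADE(1)[OF AD_truncation])
  ultimately show ?case by blast
next
  case (Suc k)
  then obtain a where a: "formal_density A cf 0 a" "a 0 = (\<lambda>y. 0)"
    "Orho k (\<lambda>q. lapln q + lap (truncation a k) q)" by auto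
  have "AD (0 - 2) (\<lambda>q. lapln q + lap (truncation a k) q)"
    using AD_add[OF AD_lap_ln_t] AD_lap[OF AD_truncation[OF a(1)], of k] by simp
  from AD_Orho[OF this a(3)] obtain \<psi> where \<psi>: "AD (0 - 2 - 2 * int k) \<psi>"
    "near (\<lambda>q. lapln q + lap (truncation a k) q = rt q ^ k * \<psi> q)" by blast
  have c: "real DIM('e) + 2 * of_int 0 - 2 * real (Suc k) \<noteq> 0" using Suc.prems m2 by (simp add: dim)
  obtain b \<psi>' where b: "density A cf 0 b" "AD (0 - 2 - 2 * int (Suc k)) \<psi>'"
    "near (\<lambda>q. lapln q + lap (truncation (a(Suc k := b)) (Suc k)) q = rt q ^ Suc k * \<psi>' q)"
    by (rule series_step[OF a(1) \<psi> c])
  show ?case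
  proof (intro exI conjI)
    show "formal_density A cf 0 (a(Suc k := b))" using a(1) b(1) by (simp add: formal_density_def)
    show "(a(Suc k := b)) 0 = (\<lambda>y. 0)" using a(2) by simp
    show "Orho (Suc k) (\<lambda>q. lapln q + lap (truncation (a(Suc k := b)) (Suc k)) q)"
      by (rule OrhoI[OF ADE(1)[OF b(2)] b(3)])
  qed
qed

lemma solution_exists: "\<exists>\<phi> \<eta>. formal_log_solution A cf gt t \<phi> \<eta>"
proof -
  obtain a where a: "formal_density A cf 0 a" "a 0 = (\<lambda>y. 0)"
    "Orho (m - 1) (\<lambda>q. lapln q + lap (truncation a (m - 1)) q)"
    using solution_below_critical_order[of "m - 1"] by auto
  have "AD (0 - 2) (\<lambda>q. lapln q + lap (truncation a (m - 1)) q)"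
    using AD_add[OF AD_lap_ln_t] AD_lap[OF AD_truncation[OF a(1)], of "m - 1"] by simp
  from AD_Orho[OF this a(3)] obtain \<psi> where \<psi>0: "AD (0 - 2 - 2 * int (m - 1)) \<psi>"
    "near (\<lambda>q. lapln q + lap (truncation a (m - 1)) q = rt q ^ (m - 1) * \<psi> q)" by blast
  have \<psi>: "AD (- 2 * int m) \<psi>" using \<psi>0(1) m2 by (simp add: of_nat_diff)
  \<comment> \<open>The error of order m - 1 is out of reach of \<phi>; the leading term 4 m \<eta>
    of the logarithmic part has to cancel it.\<close>
  define \<eta>0 where "\<eta>0 y = - (1 / (4 * real m)) * \<psi> (y, 0)" for y
  have \<eta>0: "density A cf (- 2 * int m) \<eta>0"
    using density_restrict[OF AD_cmult[OF \<psi>, of "- (1 / (4 * real m))"]] by (simp add: \<eta>0_def[abs_def])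
  let ?e = "\<lambda>k::nat. if k = 0 then \<eta>0 else (\<lambda>y. 0)"
  have e: "formal_density A cf (- 2 * int m) ?e" using \<eta>0 by (simp add: formal_density_def density_zero)
  \<comment> \<open>For weight -n the indicial factor is - n - 2 (k + 1), which is always
    negative.\<close>
  have c\<eta>: "real DIM('e) + 2 * of_int (- 2 * int m) - 2 * real (Suc k) \<noteq> 0" for k by (simp add: dim)
  have init\<eta>: "Orho 0 (\<lambda>q. (\<lambda>_ _. 0) 0 q + lap (truncation ?e 0) q)"
    by (intro Orho_0 sm_add sm_const sm_lap ADE(1)[OF AD_truncation[OF e]])
  have d\<eta>: "Orho k (\<lambda>q. (\<lambda>_ _. 0) (Suc k) q - (\<lambda>_ _. 0) k q)" for k :: nat
    using Orho_rt_mult[OF sm_const[of 0], of k] by simp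
  obtain \<eta> where \<eta>0': "formal_density A cf (- 2 * int m) \<eta>" "\<forall>k\<le>0. \<eta> k = ?e k"
    "\<forall>N\<ge>0. Orho N (\<lambda>q. (\<lambda>_ _. 0) N q + lap (truncation \<eta> N) q)"
    by (rule series_exists[OF e init\<eta> AD_zero d\<eta> c\<eta>])
  then have \<eta>: "formal_density A cf (- 2 * int m) \<eta>" "\<eta> 0 = \<eta>0" "\<And>N. Orho N (lap (truncation \<eta> N))"
    by simp_all
  have \<eta>': "formal_density A cf (- int DIM('e)) \<eta>" using \<eta>(1) by (simp add: dim)
  let ?S = "\<lambda>N q. lapln q + smooth_part (truncation \<eta> N) q"
  \<comment> \<open>The coefficient of order m is free, as its indicial factor is 0; the choice here
    is 0.\<close>
  let ?a = "a(m := (\<lambda>y. 0))"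
  have a': "formal_density A cf 0 ?a" using a(1) by (simp add: formal_density_def density_zero)
  have ta: "truncation ?a m = truncation a (m - 1)"
  proof
    fix q
    have "truncation ?a m q = truncation ?a (m - 1) q + ?a m (fst q) * snd q ^ m"
      using m2 by (cases m) (simp_all add: truncation_def)
    also have "truncation ?a (m - 1) = truncation a (m - 1)" by (rule truncation_cong) (use m2 in auto)
    finally show "truncation ?a m q = truncation a (m - 1) q"
      by (simp only: fun_upd_same mult_zero_left add_0_right)
  qed
  have init: "Orho m (\<lambda>q. ?S m q + lap (truncation ?a m) q)"
  proof -
    let ?H = "truncation \<eta> m"
    have z: "AD (- 2 * int m) (\<lambda>q. \<psi> q + 4 * real m * ?H q)"
      by (intro AD_add AD_cmult \<psi> AD_eta[OF \<eta>'])
    have "\<psi> (y, 0) + 4 * real m * ?H (y, 0) = 0" for y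
      using \<eta>(2) m2 by (simp add: truncation_bundle \<eta>0_def)
    from Orho_SucI[OF z this, of "m - 1"] have "Orho m (\<lambda>q. rt q ^ (m - 1) * (\<psi> q + 4 * real m * ?H q))"
      using m2 by simp
    from Orho_add[OF this smooth_part_leading[OF AD_eta[OF \<eta>'], of m]] show ?thesis
      by (rule Orho_cong) (rule near_mono[OF \<psi>0(2)], simp add: ta algebra_simps)
  qed
  have S: "AD (0 - 2) (?S N)" for N
    using AD_add[OF AD_lap_ln_t AD_smooth_part[OF AD_eta[OF \<eta>']]] by simp
  have dS: "Orho k (\<lambda>q. ?S (Suc k) q - ?S k q)" for k
  proof -
    have "truncation \<eta> (Suc k) q - truncation \<eta> k q = \<eta> (Suc k) (fst q) * snd q ^ Suc k" for q
      by (simp add: truncation_def)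
    moreover have "sm (\<lambda>q. \<eta> (Suc k) (fst q))"
      using \<eta>(1) by (intro ADE(1)[OF AD_fst[where w = "- 2 * int m"]]) (simp add: formal_density_def)
    ultimately have "Orho (Suc k) (\<lambda>q. truncation \<eta> (Suc k) q - truncation \<eta> k q)"
      using Orho_mult[OF Orho_0 Orho_snd_power, of _ "Suc k"] by simp
    from Orho_smooth_part_diff[OF AD_eta[OF \<eta>'] AD_eta[OF \<eta>'] this] show ?thesis by simp
  qed
  \<comment> \<open>Beyond the critical order the factors n - 2 (k + 1) are negative, so the
    construction of \<phi> meets no further obstruction.\<close>
  have c: "real DIM('e) + 2 * of_int 0 - 2 * real (Suc k) \<noteq> 0" if "k \<ge> m" for k
    using that by (simp add: dim)
  obtain \<phi> where \<phi>: "formal_density A cf 0 \<phi>" "\<forall>k\<le>m. \<phi> k = ?a k"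
    "\<forall>N\<ge>m. Orho N (\<lambda>q. ?S N q + lap (truncation \<phi> N) q)"
    by (rule series_exists[OF a' init S dS c])
  have "formally_harmonic A cf gt t \<phi> \<eta>"
    unfolding formally_harmonic_iff[OF \<phi>(1) \<eta>']
  proof (intro allI exI impI conjI)
    fix K N assume N: "max K m \<le> N"
    have "Orho N (\<lambda>q. ?S N q + lap (truncation \<phi> N) q)" using \<phi>(3) N by simp
    then have "Orho K (\<lambda>q. ?S N q + lap (truncation \<phi> N) q)" by (rule Orho_mono) (use N in simp)
    then show "Orho K (smooth_lap \<phi> \<eta> N)"
      by (rule Orho_cong[OF _ near_always]) (simp add: smooth_lap_def)
    have "Orho K (lap (truncation \<eta> N))" by (rule Orho_mono[OF \<eta>(3)]) (use N in simp)
    from Orho_mult[OF Orho_0[OF sm_power[OF sm_rt]] this]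
    show "Orho K (\<lambda>q. rt q ^ m * lap (truncation \<eta> N) q)" by simp
  qed
  moreover have "\<phi> 0 = (\<lambda>y. 0)" using \<phi>(2) a(2) m2 by simp
  ultimately have "formal_log_solution A cf gt t \<phi> \<eta>"
    using \<phi>(1) \<eta>' by (simp add: formal_log_solution_def formal_O_def)
  then show ?thesis by blast
qed

section \<open>The logarithmic coefficient and the Q-curvature\<close>

lemma solution_Q_curvature:
  assumes sol: "formal_log_solution A cf gt t \<phi> \<eta>" and y: "y \<in> MB"
  shows "(lap ^^ m) (\<lambda>q. ln (t q)) (y, 0)
    = - (4 * real m * (\<Prod>i=1..m - 1. 2 * real i * (2 * real m - 2 * real i))) * \<eta> 0 y"
proof -
  have fd: "formal_density A cf 0 \<phi>" "formal_O A cf 1 \<phi>" "formal_density A cf (- int DIM('e)) \<eta>"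
    using sol by (auto simp: formal_log_solution_def)
  obtain N where N: "Orho m (\<lambda>q. lapln q + lap (truncation \<phi> N) q + 4 * real m * (rt q ^ (m - 1) * truncation \<eta> N q))"
    using solution_smooth[OF sol] by blast
  let ?\<Phi> = "truncation \<phi> N" and ?H = "truncation \<eta> N"
  let ?G = "\<lambda>q. lapln q + lap ?\<Phi> q"
  note \<Phi> = AD_truncation[OF fd(1), of N] and H = AD_eta[OF fd(3), of N]
  have G: "AD (-2) ?G" using AD_add[OF AD_lap_ln_t] AD_lap[OF \<Phi>] by simp
  have "Orho (m - 1) (\<lambda>q. (?G q + 4 * real m * (rt q ^ (m - 1) * ?H q)) - 4 * real m * (rt q ^ (m - 1) * ?H q))"
    by (intro Orho_diff Orho_mono[OF N] Orho_cmult Orho_rt_mult ADE(1)[OF H]) simp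
  then have "Orho (m - 1) ?G" by simp
  from AD_Orho[OF G this] obtain Z where Z0: "AD (-2 - 2 * int (m - 1)) Z" "near (\<lambda>q. ?G q = rt q ^ (m - 1) * Z q)"
    by blast
  have Z: "AD (- int DIM('e)) Z" using Z0(1) m2 by (simp add: of_nat_diff dim)
  have "Orho m (\<lambda>q. rt q ^ (m - 1) * (Z q + 4 * real m * ?H q))"
    by (rule Orho_cong[OF N near_mono[OF Z0(2)]]) (simp add: algebra_simps)
  then have "Orho ((m - 1) + 1) (\<lambda>q. rt q ^ (m - 1) * (Z q + 4 * real m * ?H q))" using m2 by simp
  then have "Orho 1 (\<lambda>q. Z q + 4 * real m * ?H q)"
    by (rule Orho_cancel[rotated]) (intro sm_add sm_cmult ADE(1)[OF Z] ADE(1)[OF H])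
  \<comment> \<open>Comparison at order m - 1: on the bundle the leading coefficient
    \<open>Z\<close> of the Laplacian of log t + \<phi> is balanced by the logarithmic term.\<close>
  from Orho_zero_bundle[OF this _ y] have Zy: "Z (y, 0) = - 4 * real m * \<eta> 0 y"
    by (simp add: truncation_bundle)
  have "Orho 1 ?\<Phi>"
    using fd(2) by (intro Orho_1I ADE(1)[OF \<Phi>]) (simp add: truncation_bundle formal_O_def)
  from AD_Orho[OF \<Phi> this] obtain f where f: "AD (-2) f" "near (\<lambda>q. ?\<Phi> q = rt q * f q)" by auto
  have "(lap ^^ Suc (m - 1)) ?\<Phi> (y, 0) = (lap ^^ Suc (m - 1)) (\<lambda>q. rt q * f q) (y, 0)"
    by (rule near_on_bundle[OF iter_cong[OF f(2)] y])
  \<comment> \<open>In \<open>iter_rt_mult\<close> with j + 1 = m, one term contains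
    \<open>rt\<close>, which vanishes on the bundle, and the other has the factor n - 2 m =
    0.\<close>
  also have "\<dots> = 0"
    using near_on_bundle[OF iter_rt_mult[OF f(1), of "m - 1"] y] rt_bundle[OF y] m2 by (simp add: dim of_nat_diff)
  finally have "(lap ^^ (m - 1)) (lap ?\<Phi>) (y, 0) = 0" by (simp only: funpow_Suc_right o_apply)
  moreover have "(lap ^^ (m - 1)) ?G (y, 0) = (lap ^^ (m - 1)) lapln (y, 0) + (lap ^^ (m - 1)) (lap ?\<Phi>) (y, 0)"
    by (rule near_on_bundle[OF iter_add[OF ADE(1)[OF AD_lap_ln_t] sm_lap[OF ADE(1)[OF \<Phi>]]] y])
  moreover have "(lap ^^ (m - 1)) ?G (y, 0) = (lap ^^ (m - 1)) (\<lambda>q. rt q ^ (m - 1) * Z q) (y, 0)"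
    by (rule near_on_bundle[OF iter_cong[OF Z0(2)] y])
  moreover have "(lap ^^ (m - 1)) (\<lambda>q. rt q ^ (m - 1) * Z q) (y, 0)
      = (\<Prod>i=1..m - 1. 2 * real i * (2 * real m - 2 * real i)) * Z (y, 0)"
    using iter_rt_power_bundle[OF Z y, of "m - 1"] by (simp add: dim)
  ultimately have "(lap ^^ (m - 1)) lapln (y, 0)
      = (\<Prod>i=1..m - 1. 2 * real i * (2 * real m - 2 * real i)) * Z (y, 0)" by simp
  moreover have "(lap ^^ m) (\<lambda>q. ln (t q)) = (lap ^^ (m - 1)) lapln"
  proof -
    have "lap ^^ m = lap ^^ Suc (m - 1)" using m2 by simp
    then show ?thesis by (simp only: funpow_Suc_right o_apply)
  qed
  ultimately show ?thesis by (simp add: Zy)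
qed

end

section \<open>Uniqueness\<close>

context even_ambient
begin

text \<open>The constants \<open>ln s\<close> that keep log t and log t' from being densities cancel
  in the difference.\<close>

lemma AD_ln_diff:
  assumes t: "AD 1 t" "near (\<lambda>q. t q > 0)" and t': "AD 1 t'" "near (\<lambda>q. t' q > 0)"
  shows "AD 0 (\<lambda>q. ln (t q) - ln (t' q))"
proof (rule ADI)
  show "sm (\<lambda>q. ln (t q) - ln (t' q))"
    by (intro sm_diff sm_ln t t' ADE(1)[OF t(1)] ADE(1)[OF t'(1)])
  have "near (\<lambda>q. (\<forall>s>0. t (ambient_dilation s q) = s powi 1 * t q) \<and> (\<forall>s>0. t' (ambient_dilation s q) = s powi 1 * t' q))"
    by (rule near_conj[OF ADE(2)[OF t(1)] ADE(2)[OF t'(1)]])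
  with near_conj[OF t(2) t'(2)]
  show "near (\<lambda>q. \<forall>s>0. ln (t (ambient_dilation s q)) - ln (t' (ambient_dilation s q)) = s powi 0 * (ln (t q) - ln (t' q)))"
    by (rule near_mp2) (simp add: ln_mult)
qed

text \<open>Two scales with the same restriction to the bundle are compared at once: equal scales
  give uniqueness, different ones give independence of the extension of t. The difference of the two
  functions log t + \<phi> is a density of weight 0 although neither of them is.\<close>

lemma solution_unique:
  assumes t: "AD 1 t" "near (\<lambda>q. t q > 0)" and t': "AD 1 t'" "near (\<lambda>q. t' q > 0)"
    and tt': "\<And>y. y \<in> MB \<Longrightarrow> t (y, 0) = t' (y, 0)"
    and sol: "formal_log_solution A cf gt t \<phi> \<eta>" and sol': "formal_log_solution A cf gt t' \<phi>' \<eta>'"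
  shows "\<exists>N0. \<forall>N\<ge>N0. Orho m (\<lambda>q. (ln (t q) + truncation \<phi> N q) - (ln (t' q) + truncation \<phi>' N q)) \<and>
    Orho K (\<lambda>q. truncation \<eta> N q - truncation \<eta>' N q)"
proof -
  interpret s: scaled_ambient A cf gt m t by unfold_locales (fact t)+
  interpret s': scaled_ambient A cf gt m t' by unfold_locales (fact t')+
  have fd: "formal_density A cf 0 \<phi>" "formal_O A cf 1 \<phi>" "formal_density A cf (- int DIM('e)) \<eta>"
    "formal_density A cf 0 \<phi>'" "formal_O A cf 1 \<phi>'" "formal_density A cf (- int DIM('e)) \<eta>'"
    using sol sol' by (auto simp: formal_log_solution_def)
  obtain N1 where N1: "\<And>N. N \<ge> N1 \<Longrightarrow> Orho m (\<lambda>q. lap (\<lambda>q. ln (t q)) q + lap (truncation \<phi> N) q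
      + 4 * real m * (rt q ^ (m - 1) * truncation \<eta> N q))" using s.solution_smooth[OF sol] by blast
  obtain N2 where N2: "\<And>N. N \<ge> N2 \<Longrightarrow> Orho m (\<lambda>q. lap (\<lambda>q. ln (t' q)) q + lap (truncation \<phi>' N) q
      + 4 * real m * (rt q ^ (m - 1) * truncation \<eta>' N q))" using s'.solution_smooth[OF sol'] by blast
  obtain N3 where N3: "\<And>N. N \<ge> N3 \<Longrightarrow> Orho K (lap (truncation \<eta> N))" using s.solution_log[OF sol] by blast
  obtain N4 where N4: "\<And>N. N \<ge> N4 \<Longrightarrow> Orho K (lap (truncation \<eta>' N))" using s'.solution_log[OF sol'] by blast
  show ?thesis
  proof (intro exI[of _ "max (max N1 N2) (max N3 N4)"] allI impI)
    fix N assume N: "max (max N1 N2) (max N3 N4) \<le> N"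
    let ?F = "\<lambda>q. ln (t q) + truncation \<phi> N q" and ?F' = "\<lambda>q. ln (t' q) + truncation \<phi>' N q"
    let ?P = "\<lambda>q. ?F q - ?F' q" and ?D = "\<lambda>q. truncation \<eta> N q - truncation \<eta>' N q"
    have D: "AD (- 2 * int m) ?D" by (intro AD_diff s.AD_eta fd)
    have s\<Phi>: "sm (truncation \<phi> N)" "sm (truncation \<phi>' N)" by (rule ADE(1)[OF AD_truncation], fact fd)+
    have P: "AD 0 ?P"
      by (rule AD_cong[OF AD_add[OF AD_ln_diff[OF t t'] AD_diff[OF AD_truncation[OF fd(1), of N] AD_truncation[OF fd(4), of N]]] near_always])
        simp
    have P1: "Orho 1 ?P"
      by (rule Orho_1I[OF ADE(1)[OF P]]) (use fd(2,5) tt' in \<open>simp add: truncation_bundle formal_O_def\<close>)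
    have lapP: "near (\<lambda>q. lap ?P q = (lap (\<lambda>q. ln (t q)) q + lap (truncation \<phi> N) q)
        - (lap (\<lambda>q. ln (t' q)) q + lap (truncation \<phi>' N) q))"
      by (rule near_mp3[OF lap_diff[OF sm_add[OF s.sm_ln_t s\<Phi>(1)] sm_add[OF s'.sm_ln_t s\<Phi>(2)]]
            lap_add[OF s.sm_ln_t s\<Phi>(1)] lap_add[OF s'.sm_ln_t s\<Phi>(2)]]) simp
    have eq: "Orho m (\<lambda>q. lap ?P q + rt q ^ (m - 1) * (4 * real m * ?D q))"
    proof (rule Orho_cong[OF Orho_diff[OF N1 N2]])
      show "near (\<lambda>q. lap (\<lambda>q. ln (t q)) q + lap (truncation \<phi> N) q + 4 * real m * (rt q ^ (m - 1) * truncation \<eta> N q)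
          - (lap (\<lambda>q. ln (t' q)) q + lap (truncation \<phi>' N) q + 4 * real m * (rt q ^ (m - 1) * truncation \<eta>' N q))
          = lap ?P q + rt q ^ (m - 1) * (4 * real m * ?D q))"
        by (rule near_mono[OF lapP]) (simp add: algebra_simps)
    qed (use N in auto)
    have sD: "sm (\<lambda>q. 4 * real m * ?D q)" by (rule sm_cmult[OF ADE(1)[OF D]])
    have "Orho (m - 1) (\<lambda>q. (lap ?P q + rt q ^ (m - 1) * (4 * real m * ?D q)) - rt q ^ (m - 1) * (4 * real m * ?D q))"
      by (intro Orho_diff Orho_mono[OF eq] Orho_rt_mult sD) simp
    then have l: "Orho (m - 1) (lap ?P)" by simp
    \<comment> \<open>As the Laplacian of \<open>?P\<close> is O(rho^(m-1)), the order of
      \<open>?P\<close> can be raised while the indicial factor of weight 0 is nonzero, that is, up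
      to m.\<close>
    have Pk: "Orho (Suc k) ?P" if "Suc k \<le> m" for k
      using that
    proof (induction k)
      case (Suc k)
      then have "Orho (Suc k) ?P" by simp
      then show ?case
        by (rule Orho_gain[OF P _ Orho_mono[OF l]]) (use Suc.prems in \<open>auto simp: dim\<close>)
    qed (use P1 in simp)
    have Pm: "Orho m ?P" using Pk[of "m - 1"] m2 by simp
    \<comment> \<open>At order m the factor vanishes: \<open>rt ^ m * p\<close> produces no term of
      order m - 1. This leaves the logarithmic term alone and forces \<open>?D\<close> to vanish on
      the bundle.\<close>
    obtain p where p: "AD (0 - 2 * int m) p" "near (\<lambda>q. ?P q = rt q ^ m * p q)" using AD_Orho[OF P Pm] by blast
    have "near (\<lambda>q. lap ?P q = rt q ^ m * lap p q)"
      by (rule near_mp2[OF lap_cong[OF p(2)] lap_rt_power[OF p(1), of m]]) (simp add: dim)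
    then have "Orho m (lap ?P)" by (rule OrhoI[OF sm_lap[OF ADE(1)[OF p(1)]]])
    from Orho_diff[OF eq this] have "Orho ((m - 1) + 1) (\<lambda>q. rt q ^ (m - 1) * (4 * real m * ?D q))"
      using m2 by simp
    from Orho_cmult[OF Orho_cancel[OF sD this], of "1 / (4 * real m)"] have D1: "Orho 1 ?D" using m2 by simp
    have "Orho K (\<lambda>q. lap (truncation \<eta> N) q - lap (truncation \<eta>' N) q)"
      using N by (intro Orho_diff N3 N4) auto
    then have lD: "Orho K (lap ?D)"
      by (rule Orho_cong[OF _ near_mono[OF lap_diff[OF ADE(1)[OF s.AD_eta[OF fd(3)]] ADE(1)[OF s.AD_eta[OF fd(6)]]]]])
        (rule sym)
    \<comment> \<open>No indicial factor of weight -n vanishes, so the vanishing of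
      \<open>?D\<close> on the bundle propagates to every order to which its Laplacian
      vanishes.\<close>
    have Dk: "Orho (Suc k) ?D" if "Suc k \<le> Suc K" for k
      using that
    proof (induction k)
      case (Suc k)
      then have "Orho (Suc k) ?D" by simp
      then show ?case
        by (rule Orho_gain[OF D _ Orho_mono[OF lD]]) (use Suc.prems m2 in \<open>auto simp: dim\<close>)
    qed (use D1 in simp)
    have "Orho K ?D" by (rule Orho_mono[OF Dk[of K]]) simp_all
    with Pm show "Orho m ?P \<and> Orho K ?D" by blast
  qed
qed

lemma solution_eta_unique:
  assumes t: "AD 1 t" "near (\<lambda>q. t q > 0)" and t': "AD 1 t'" "near (\<lambda>q. t' q > 0)"
    and tt': "\<And>y. y \<in> MB \<Longrightarrow> t (y, 0) = t' (y, 0)"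
    and sol: "formal_log_solution A cf gt t \<phi> \<eta>" and sol': "formal_log_solution A cf gt t' \<phi>' \<eta>'"
  shows "formal_O A cf K (\<lambda>k y. \<eta> k y - \<eta>' k y)"
proof -
  obtain N0 where N0: "\<And>N. N \<ge> N0 \<Longrightarrow> Orho K (\<lambda>q. truncation \<eta> N q - truncation \<eta>' N q)"
    using solution_unique[OF assms, of K] by blast
  have "Orho K (truncation (\<lambda>k y. \<eta> k y - \<eta>' k y) (max N0 K))"
    using N0[of "max N0 K"] unfolding truncation_diff by simp
  from truncation_Orho_coeff[OF this] show ?thesis by (simp add: formal_O_def)
qed

lemma solution_phi_unique:
  assumes t: "AD 1 t" "near (\<lambda>q. t q > 0)"
    and sol: "formal_log_solution A cf gt t \<phi> \<eta>" and sol': "formal_log_solution A cf gt t \<phi>' \<eta>'"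
  shows "formal_O A cf m (\<lambda>k y. \<phi> k y - \<phi>' k y)"
proof -
  obtain N0 where N0: "\<And>N. N \<ge> N0 \<Longrightarrow>
      Orho m (\<lambda>q. (ln (t q) + truncation \<phi> N q) - (ln (t q) + truncation \<phi>' N q))"
    using solution_unique[OF t t refl sol sol', of 0] by blast
  have "Orho m (truncation (\<lambda>k y. \<phi> k y - \<phi>' k y) (max N0 m))"
    by (rule Orho_cong[OF N0[of "max N0 m"] near_always]) (simp_all add: truncation_diff[symmetric])
  from truncation_Orho_coeff[OF this] show ?thesis by (simp add: formal_O_def)
qed

text \<open>Another extension of t changes \<phi>, so the object attached to g is the sum log t +
  \<phi> modulo rho^m. The tails beyond order m are O(rho^m), hence truncations of order m
  suffice.\<close>

lemma solution_scale_independent: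
  assumes t: "AD 1 t" "near (\<lambda>q. t q > 0)" and t': "AD 1 t'" "near (\<lambda>q. t' q > 0)"
    and tt': "\<And>y. y \<in> MB \<Longrightarrow> t (y, 0) = t' (y, 0)"
    and sol: "formal_log_solution A cf gt t \<phi> \<eta>" and sol': "formal_log_solution A cf gt t' \<phi>' \<eta>'"
  shows "Orho m (\<lambda>q. (ln (t q) + truncation \<phi> m q) - (ln (t' q) + truncation \<phi>' m q))"
proof -
  have fd: "formal_density A cf 0 \<phi>" "formal_density A cf 0 \<phi>'"
    using sol sol' by (auto simp: formal_log_solution_def)
  obtain N where N: "N \<ge> m" "Orho m (\<lambda>q. (ln (t q) + truncation \<phi> N q) - (ln (t' q) + truncation \<phi>' N q))"
    using solution_unique[OF assms, of 0] by (meson max.cobounded1 max.cobounded2)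
  show ?thesis
    by (rule Orho_cong[OF Orho_add[OF Orho_diff[OF N(2) Orho_truncation_tail[OF fd(1) N(1)]]
            Orho_truncation_tail[OF fd(2) N(1)]] near_always]) simp
qed

end

lemma critical_product_nonzero: "(\<Prod>i=1..m - 1. 2 * real i * (2 * real m - 2 * real i)) \<noteq> 0"
  by (auto simp: prod_zero_iff)

theorem theorem2p4:
  assumes "DIM('e::euclidean_space) = n" and "n \<ge> 4" and "even n"
  shows "\<exists>c::real. c \<noteq> 0 \<and>
    (\<forall>(A :: ('a, 'e) chart set) cf gt g.
       conformal_manifold A cf \<and> ambient_metric A cf gt \<and> g \<in> cf \<longrightarrow>
       (\<forall>t. scale_function A cf g t \<longrightarrow>
          (\<exists>\<phi> \<eta>. formal_log_solution A cf gt t \<phi> \<eta>) \<and>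
          (\<forall>\<phi> \<eta> \<phi>' \<eta>'. formal_log_solution A cf gt t \<phi> \<eta> \<and> formal_log_solution A cf gt t \<phi>' \<eta>' \<longrightarrow>
             formal_O A cf (n div 2) (\<lambda>k y. \<phi> k y - \<phi>' k y) \<and>
             (\<forall>K. formal_O A cf K (\<lambda>k y. \<eta> k y - \<eta>' k y))) \<and>
          (\<forall>\<phi> \<eta>. formal_log_solution A cf gt t \<phi> \<eta> \<longrightarrow>
             (\<forall>p\<in>points A. \<eta> 0 (p, g p) = c * Q_curvature A cf gt g t p))) \<and>
       (\<forall>t t' \<phi> \<eta> \<phi>' \<eta>'.
          scale_function A cf g t \<and> scale_function A cf g t' \<and>
          formal_log_solution A cf gt t \<phi> \<eta> \<and> formal_log_solution A cf gt t' \<phi>' \<eta>' \<longrightarrow>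
          O_rho A cf gt (n div 2)
            (\<lambda>q. (ln (t q) + truncation \<phi> (n div 2) q) - (ln (t' q) + truncation \<phi>' (n div 2) q)) \<and>
          (\<forall>K. formal_O A cf K (\<lambda>k y. \<eta> k y - \<eta>' k y))))"
proof -
  define m where "m = n div 2"
  have m: "n div 2 = m" "DIM('e) = 2 * m" "m \<ge> 2" using assms by (auto simp: m_def)
  \<comment> \<open>By \<open>solution_Q_curvature\<close> the Q-curvature is C times \<eta> along
    g. C depends on n only, so one constant serves all manifolds.\<close>
  define C where "C = 4 * real m * (\<Prod>i=1..m - 1. 2 * real i * (2 * real m - 2 * real i))"
  have C: "C \<noteq> 0" using critical_product_nonzero[of m] m(3) by (simp add: C_def)
  show ?thesis unfolding m(1)
  proof (intro exI[of _ "1 / C"] conjI[of "1 / C \<noteq> 0"] allI impI)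
    show "1 / C \<noteq> 0" using C by simp
    fix A :: "('a, 'e) chart set" and cf gt g
    assume *: "conformal_manifold A cf \<and> ambient_metric A cf gt \<and> g \<in> cf"
    then interpret even_ambient A cf gt m
      by unfold_locales (use m in auto)
    have g: "g \<in> cf" using * by blast
    have scale: "AD 1 t" "near (\<lambda>q. t q > 0)" if "scale_function A cf g t" for t
      using that by (auto simp: scale_function_def)
    \<comment> \<open>Every point of the bundle is g scaled by the square of some u > 0, so all
      scale functions for g agree there.\<close>
    have eq: "t (y, 0) = t' (y, 0)"
      if t: "scale_function A cf g t" "scale_function A cf g t'" and y: "y \<in> MB" for t t' y
    proof -
      obtain p u where "p \<in> points A" "u > 0" "y = (p, tens2_scale (u\<^sup>2) (g p))"
        using metric_bundle_iff[OF g] y by blast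
      then show ?thesis using t by (simp add: scale_function_def bundle_incl_def)
    qed
    have Q: "\<eta> 0 (p, g p) = 1 / C * Q_curvature A cf gt g t p"
      if t: "scale_function A cf g t" and sol: "formal_log_solution A cf gt t \<phi> \<eta>" and p: "p \<in> points A" for t \<phi> \<eta> p
    proof -
      interpret s: scaled_ambient A cf gt m t by unfold_locales (fact scale[OF t])+
      have "(p, g p) \<in> MB" using p g by (auto simp: metric_bundle_def)
      from s.solution_Q_curvature[OF sol this] show ?thesis
        using C by (simp add: Q_curvature_def m(2) bundle_incl_def C_def)
    qed
    have ex: "\<exists>\<phi> \<eta>. formal_log_solution A cf gt t \<phi> \<eta>" if "scale_function A cf g t" for t
    proof -
      interpret s: scaled_ambient A cf gt m t by unfold_locales (fact scale[OF that])+
      show ?thesis by (rule s.solution_exists)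
    qed
    show "(\<forall>t. scale_function A cf g t \<longrightarrow>
          (\<exists>\<phi> \<eta>. formal_log_solution A cf gt t \<phi> \<eta>) \<and>
          (\<forall>\<phi> \<eta> \<phi>' \<eta>'. formal_log_solution A cf gt t \<phi> \<eta> \<and> formal_log_solution A cf gt t \<phi>' \<eta>' \<longrightarrow>
             formal_O A cf m (\<lambda>k y. \<phi> k y - \<phi>' k y) \<and>
             (\<forall>K. formal_O A cf K (\<lambda>k y. \<eta> k y - \<eta>' k y))) \<and>
          (\<forall>\<phi> \<eta>. formal_log_solution A cf gt t \<phi> \<eta> \<longrightarrow>
             (\<forall>p\<in>points A. \<eta> 0 (p, g p) = 1 / C * Q_curvature A cf gt g t p))) \<and>
       (\<forall>t t' \<phi> \<eta> \<phi>' \<eta>'.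
          scale_function A cf g t \<and> scale_function A cf g t' \<and>
          formal_log_solution A cf gt t \<phi> \<eta> \<and> formal_log_solution A cf gt t' \<phi>' \<eta>' \<longrightarrow>
          O_rho A cf gt m
            (\<lambda>q. (ln (t q) + truncation \<phi> m q) - (ln (t' q) + truncation \<phi>' m q)) \<and>
          (\<forall>K. formal_O A cf K (\<lambda>k y. \<eta> k y - \<eta>' k y)))"
    proof (intro conjI allI impI ballI; (elim conjE)?)
      fix t assume t: "scale_function A cf g t"
      show "\<exists>\<phi> \<eta>. formal_log_solution A cf gt t \<phi> \<eta>" by (rule ex[OF t])
      fix \<phi> \<eta> assume sol: "formal_log_solution A cf gt t \<phi> \<eta>"
      show "\<eta> 0 (p, g p) = 1 / C * Q_curvature A cf gt g t p" if "p \<in> points A" for p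
        by (rule Q[OF t sol that])
      fix \<phi>' \<eta>' assume sol': "formal_log_solution A cf gt t \<phi>' \<eta>'"
      show "formal_O A cf m (\<lambda>k y. \<phi> k y - \<phi>' k y)"
        by (rule solution_phi_unique[OF scale[OF t] sol sol'])
      show "formal_O A cf K (\<lambda>k y. \<eta> k y - \<eta>' k y)" for K
        by (rule solution_eta_unique[OF scale[OF t] scale[OF t] refl sol sol'])
    next
      fix t t' \<phi> \<eta> \<phi>' \<eta>'
      assume t: "scale_function A cf g t" and t': "scale_function A cf g t'"
        and sol: "formal_log_solution A cf gt t \<phi> \<eta>" and sol': "formal_log_solution A cf gt t' \<phi>' \<eta>'"
      show "O_rho A cf gt m (\<lambda>q. (ln (t q) + truncation \<phi> m q) - (ln (t' q) + truncation \<phi>' m q))"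
        by (rule solution_scale_independent[OF scale[OF t] scale[OF t'] eq[OF t t'] sol sol'])
      show "formal_O A cf K (\<lambda>k y. \<eta> k y - \<eta>' k y)" for K
        by (rule solution_eta_unique[OF scale[OF t] scale[OF t'] eq[OF t t'] sol sol'])
    qed
  qed
qed

end
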